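(* Let $(R,\mathfrak m)$ be a Noetherian local domain of dimension $d$. Then $R$ is catenary if and only if $\operatorname{Ann}_R(0:_{H^d_{\mathfrak m}(R)}\mathfrak p)=\mathfrak p$ for all prime ideals $\mathfrak p$ of $R$ with $\mathfrak p\supseteq\operatorname{Ann}_R H^d_{\mathfrak m}(R)$.
   Context: $H^d_{\mathfrak m}(R)$ is the $d$-th local cohomology module of $R$ with support in $\mathfrak m$ (an Artinian $R$-module). For an $R$-module $A$ and an ideal $I$, $0:_A I=\{a\in A: Ia=0\}$. $R$ is catenary if for any prime ideals $\mathfrak p\subset\mathfrak q$ of $R$, all saturated chains of prime ideals from $\mathfrak p$ to $\mathfrak q$ have the same length. *)

theory Defs
  imports "HOL-Algebra.Module" "HOL-Algebra.Ideal_Product" "HOL-Algebra.Ring_Divisibility"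
    "HOL-Library.Extended_Nat"
begin

section \<open>Local rings, Krull dimension, catenary rings\<close>

definition local_ring :: "('a, 'r) ring_scheme \<Rightarrow> 'a set \<Rightarrow> bool"
  where "local_ring R \<mm> \<longleftrightarrow>
    cring R \<and> maximalideal \<mm> R \<and> (\<forall>\<nn>. maximalideal \<nn> R \<longrightarrow> \<nn> = \<mm>)"

definition prime_chain :: "('a, 'r) ring_scheme \<Rightarrow> nat \<Rightarrow> (nat \<Rightarrow> 'a set) \<Rightarrow> bool"
  where "prime_chain R n P \<longleftrightarrow>
    (\<forall>i\<le>n. primeideal (P i) R) \<and> (\<forall>i<n. P i \<subset> P (Suc i))"

definition krull_dim :: "('a, 'r) ring_scheme \<Rightarrow> enat"
  where "krull_dim R = Sup {enat n | n. \<exists>P. prime_chain R n P}"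

definition saturated_prime_chain ::
  "('a, 'r) ring_scheme \<Rightarrow> 'a set \<Rightarrow> 'a set \<Rightarrow> nat \<Rightarrow> (nat \<Rightarrow> 'a set) \<Rightarrow> bool"
  where "saturated_prime_chain R \<pp> \<qq> n P \<longleftrightarrow>
    prime_chain R n P \<and> P 0 = \<pp> \<and> P n = \<qq> \<and>
    (\<forall>i<n. \<nexists>Q. primeideal Q R \<and> P i \<subset> Q \<and> Q \<subset> P (Suc i))"

definition catenary :: "('a, 'r) ring_scheme \<Rightarrow> bool"
  where "catenary R \<longleftrightarrow>
    (\<forall>\<pp> \<qq>. primeideal \<pp> R \<longrightarrow> primeideal \<qq> R \<longrightarrow> \<pp> \<subset> \<qq> \<longrightarrow>
      (\<forall>m n P Q. saturated_prime_chain R \<pp> \<qq> m P \<longrightarrow>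
        saturated_prime_chain R \<pp> \<qq> n Q \<longrightarrow> m = n))"


section \<open>Modules\<close>

text \<open>The record type of modules extends that of rings; the fields \<open>mult\<close> and \<open>one\<close> of
  a module carry no information and are never used below.\<close>

definition regular_module :: "('a, 'r) ring_scheme \<Rightarrow> ('a, 'a) module"
  where "regular_module R =
    \<lparr>carrier = carrier R, monoid.mult = monoid.mult R, one = one R, ring.zero = ring.zero R, add = add R,
     smult = monoid.mult R\<rparr>"

definition module_hom ::
  "('a, 'r) ring_scheme \<Rightarrow> ('a, 'b) module \<Rightarrow> ('a, 'c) module \<Rightarrow> ('b \<Rightarrow> 'c) set"
  where "module_hom R M N =
    {h \<in> carrier M \<rightarrow> carrier N.
      (\<forall>x\<in>carrier M. \<forall>y\<in>carrier M. h (x \<oplus>\<^bsub>M\<^esub> y) = h x \<oplus>\<^bsub>N\<^esub> h y) \<and>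
      (\<forall>r\<in>carrier R. \<forall>x\<in>carrier M. h (r \<odot>\<^bsub>M\<^esub> x) = r \<odot>\<^bsub>N\<^esub> h x)}"

definition quotient_module :: "('a, 'b) module \<Rightarrow> 'b set \<Rightarrow> ('a, 'b set) module"
  where "quotient_module M N =
    \<lparr>carrier = a_rcosets\<^bsub>M\<^esub> N, monoid.mult = undefined, one = undefined, ring.zero = N, add = set_add M,
     smult = (\<lambda>r X. \<Union>x\<in>X. N +>\<^bsub>M\<^esub> (r \<odot>\<^bsub>M\<^esub> x))\<rparr>"

definition annihilator :: "('a, 'r) ring_scheme \<Rightarrow> ('a, 'b) module \<Rightarrow> 'b set \<Rightarrow> 'a set"
  where "annihilator R M X = {r \<in> carrier R. \<forall>x\<in>X. r \<odot>\<^bsub>M\<^esub> x = \<zero>\<^bsub>M\<^esub>}"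

text \<open>The submodule \<open>0 :\<^sub>M I\<close>.\<close>

definition zero_colon :: "('a, 'b) module \<Rightarrow> 'a set \<Rightarrow> 'b set"
  where "zero_colon M I = {x \<in> carrier M. \<forall>a\<in>I. a \<odot>\<^bsub>M\<^esub> x = \<zero>\<^bsub>M\<^esub>}"


section \<open>Injective resolutions and local cohomology\<close>

text \<open>A definition cannot quantify over types, so the lifting property is required for
  test modules whose elements have the type of the elements of \<open>R\<close>. This is the usual
  notion: the ideals of \<open>R\<close> and \<open>R\<close> itself are among these modules, so Baer's criterion
  gives the lifting property for modules over every type.\<close>

definition injective_module :: "('a, 'r) ring_scheme \<Rightarrow> ('a, 'b) module \<Rightarrow> bool"
  where "injective_module R E \<longleftrightarrow> module R E \<and>
    (\<forall>(M :: ('a, 'a) module) (N :: ('a, 'a) module) i f.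
      module R M \<longrightarrow> module R N \<longrightarrow>
      i \<in> module_hom R M N \<longrightarrow> inj_on i (carrier M) \<longrightarrow> f \<in> module_hom R M E \<longrightarrow>
      (\<exists>g\<in>module_hom R N E. \<forall>x\<in>carrier M. g (i x) = f x))"

text \<open>Exactness of \<open>0 \<rightarrow> M \<rightarrow> I 0 \<rightarrow> I 1 \<rightarrow> \<dots>\<close>, with augmentation \<open>\<epsilon>\<close>
  and differentials \<open>\<delta>\<close>.\<close>

definition injective_resolution ::
  "('a, 'r) ring_scheme \<Rightarrow> ('a, 'c) module \<Rightarrow> ('c \<Rightarrow> 'b) \<Rightarrow>
    (nat \<Rightarrow> ('a, 'b) module) \<Rightarrow> (nat \<Rightarrow> 'b \<Rightarrow> 'b) \<Rightarrow> bool"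
  where "injective_resolution R M \<epsilon> I \<delta> \<longleftrightarrow>
    (\<forall>i. injective_module R (I i)) \<and>
    \<epsilon> \<in> module_hom R M (I 0) \<and> inj_on \<epsilon> (carrier M) \<and>
    (\<forall>i. \<delta> i \<in> module_hom R (I i) (I (Suc i))) \<and>
    a_kernel (I 0) (I 1) (\<delta> 0) = \<epsilon> ` carrier M \<and>
    (\<forall>i. a_kernel (I (Suc i)) (I (Suc (Suc i))) (\<delta> (Suc i)) = \<delta> i ` carrier (I i))"

primrec ideal_power :: "('a, 'r) ring_scheme \<Rightarrow> 'a set \<Rightarrow> nat \<Rightarrow> 'a set"
  where
    "ideal_power R \<aa> 0 = carrier R"
  | "ideal_power R \<aa> (Suc n) = ideal_prod R \<aa> (ideal_power R \<aa> n)"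

text \<open>The \<open>\<aa>\<close>-torsion functor \<open>\<Gamma>\<^sub>\<aa>\<close>; on morphisms it is restriction.\<close>

definition torsion_module ::
  "('a, 'r) ring_scheme \<Rightarrow> 'a set \<Rightarrow> ('a, 'b) module \<Rightarrow> ('a, 'b) module"
  where "torsion_module R \<aa> M = M\<lparr>carrier := \<Union>n. zero_colon M (ideal_power R \<aa> n)\<rparr>"

definition cohomology_module ::
  "(nat \<Rightarrow> ('a, 'b) module) \<Rightarrow> (nat \<Rightarrow> 'b \<Rightarrow> 'b) \<Rightarrow> nat \<Rightarrow> ('a, 'b set) module"
  where "cohomology_module C \<delta> i =
    quotient_module ((C i)\<lparr>carrier := a_kernel (C i) (C (Suc i)) (\<delta> i)\<rparr>)
      (case i of 0 \<Rightarrow> {\<zero>\<^bsub>C 0\<^esub>} | Suc j \<Rightarrow> \<delta> j ` carrier (C j))"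

text \<open>\<open>H\<^sup>i\<^sub>\<aa>(M)\<close>, the \<open>i\<close>-th right derived functor of \<open>\<Gamma>\<^sub>\<aa>\<close> at \<open>M\<close>, computed from an injective
  resolution \<open>(I, \<delta>)\<close> of \<open>M\<close>. Up to isomorphism it does not depend on the resolution.\<close>

definition local_cohomology ::
  "('a, 'r) ring_scheme \<Rightarrow> 'a set \<Rightarrow> (nat \<Rightarrow> ('a, 'b) module) \<Rightarrow> (nat \<Rightarrow> 'b \<Rightarrow> 'b) \<Rightarrow>
    nat \<Rightarrow> ('a, 'b set) module"
  where "local_cohomology R \<aa> I \<delta> i = cohomology_module (\<lambda>j. torsion_module R \<aa> (I j)) \<delta> i"

end

(* The numerical input is Ratliff's theorem: R is catenary iff ht p + dim R/p = d for every prime p.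
   Its hard direction rests on the existence of infinitely many primes strictly between p and Q
   whenever there is one q that is adjacent to both, and on Krull's height theorem.

   Write H for the top local cohomology.  For a system of parameters z_1, ..., z_d there are classes
   in H playing the role of the fractions 1/(z_1^K1 ... z_d^Kd), whose annihilators are, up to bounded
   exponents, the ideals (z_1^K1, ..., z_d^Kd).  If the z_i are adapted to a chain of primes of length d
   through p, a multiple of such a class by an element outside p is killed by a power of p, and an
   element u outside p with u (0 :_H p) = 0 would contradict Krull's intersection theorem along the
   chain.  Hence Ann (0 :_H p) = p when ht p + dim R/p = d, and Ann H = 0 from p = 0.

   Conversely, let ht p + dim R/p < d and let x generate an ideal over which p is minimal.  Then x and
   some u in p belong to a sequence of d elements with m-primary ideal such that t u lies in the
   radical of (x) for some t outside p.  The classes killed by x lift to the top Koszul cohomology of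
   powers of x.  Without the torsion condition at u that cohomology vanishes, since only d - 1
   elements are left, and since a power of t u kills it in every degree, a power of t turns bounding
   chains into u-torsion ones.  So a power of t kills 0 :_H p, and Ann (0 :_H p) is not p.

   All cohomology is computed by Koszul complexes on the given injective resolution. *)

theory Submission
  imports Defs "HOL-Library.Function_Algebras" "HOL-Computational_Algebra.Polynomial"
begin

section \<open>Ideals and primes of commutative rings\<close>

text \<open>No localization, quotient ring or direct limit is formed. The ring under study is the
  quotient of one commutative ring type by \<open>I0\<close>, its ideals are those above
  \<open>I0\<close>, and a statement at a prime \<open>q\<close> is one that holds up to a factor
  \<open>s\<close> outside \<open>q\<close>. Cohomology is likewise a pair of submodules, boundaries
  inside cycles. Torsion for the maximal ideal is torsion for each element of a finite set
  \<open>W\<close>. Such conditions can be imposed or removed one element at a time, and traded for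
  Koszul factors. In each exchange injectivity enters as the surjectivity of \<open>E\<close> onto
  its localization at \<open>z\<close>: a chain can be divided by a power of \<open>z\<close> up to
  \<open>z\<close>-torsion. The bounded exponents come from the Artinian property of the mixed
  cohomologies, where some elements are Koszul factors and others torsion conditions: the images of
  the powers of \<open>z\<close> become stationary there. The bound at the i-th parameter must
  depend only on the exponents before it, since the intersection theorem lets the i-th exponent grow
  while everything else stays fixed.\<close>

definition is_ideal :: "'f::comm_ring_1 set \<Rightarrow> bool" where
  "is_ideal J \<longleftrightarrow> 0 \<in> J \<and> (\<forall>a\<in>J. \<forall>b\<in>J. a + b \<in> J) \<and> (\<forall>r. \<forall>a\<in>J. r * a \<in> J)"

definition is_prime :: "'f::comm_ring_1 set \<Rightarrow> bool" where
  "is_prime P \<longleftrightarrow> is_ideal P \<and> 1 \<notin> P \<and> (\<forall>a b. a * b \<in> P \<longrightarrow> a \<in> P \<or> b \<in> P)"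

text \<open>The ideal \<open>J + (x)\<close>. Ideals grow by one generator at a time, as noetherian
  induction requires.\<close>

definition adj :: "'f::comm_ring_1 set \<Rightarrow> 'f \<Rightarrow> 'f set" where
  "adj J x = {a + r * x | a r. a \<in> J}"

definition min_prime :: "'f::comm_ring_1 set \<Rightarrow> 'f set \<Rightarrow> bool" where
  "min_prime J P \<longleftrightarrow> is_prime P \<and> J \<subseteq> P \<and> (\<forall>Q. is_prime Q \<longrightarrow> J \<subseteq> Q \<longrightarrow> Q \<subseteq> P \<longrightarrow> Q = P)"

definition gen :: "'f::comm_ring_1 set \<Rightarrow> 'f set" where
  "gen S = \<Inter>{J. is_ideal J \<and> S \<subseteq> J}"

lemma idealD:
  assumes "is_ideal J"
  shows "0 \<in> J" "a \<in> J \<Longrightarrow> b \<in> J \<Longrightarrow> a + b \<in> J" "a \<in> J \<Longrightarrow> r * a \<in> J" "a \<in> J \<Longrightarrow> a * r \<in> J"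
    "a \<in> J \<Longrightarrow> - a \<in> J" "a \<in> J \<Longrightarrow> b \<in> J \<Longrightarrow> a - b \<in> J"
proof -
  show *: "0 \<in> J" "a \<in> J \<Longrightarrow> b \<in> J \<Longrightarrow> a + b \<in> J" "a \<in> J \<Longrightarrow> r * a \<in> J" for a b r
    using assms by (auto simp: is_ideal_def)
  show "a \<in> J \<Longrightarrow> a * r \<in> J" using *(3)[of a r] by (simp add: mult.commute)
  show **: "a \<in> J \<Longrightarrow> - a \<in> J" for a using *(3)[of a "-1"] by simp
  show "a \<in> J \<Longrightarrow> b \<in> J \<Longrightarrow> a - b \<in> J" using *(2)[of a "-b"] **[of b] by simp
qed

lemma primeD:
  assumes "is_prime P"
  shows "is_ideal P" "1 \<notin> P" "a * b \<in> P \<longleftrightarrow> a \<in> P \<or> b \<in> P"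
proof -
  show P: "is_ideal P" "1 \<notin> P" using assms by (auto simp: is_prime_def)
  show "a * b \<in> P \<longleftrightarrow> a \<in> P \<or> b \<in> P"
    using assms idealD(3,4)[OF P(1)] by (auto simp: is_prime_def)
qed

lemma prime_power: "is_prime P \<Longrightarrow> a ^ n \<in> P \<longleftrightarrow> n > 0 \<and> a \<in> P"
  by (induction n) (auto simp: primeD)

lemma prime_prod: "is_prime P \<Longrightarrow> finite A \<Longrightarrow> prod f A \<in> P \<longleftrightarrow> (\<exists>x\<in>A. f x \<in> P)"
  by (rotate_tac 1, induction A rule: finite_induct) (auto simp: primeD)

lemma ideal_add_cancel: "is_ideal J \<Longrightarrow> a \<in> J \<Longrightarrow> a + b \<in> J \<longleftrightarrow> b \<in> J"
  using idealD(2,6)[of J] by (metis add_diff_cancel_left')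

lemma ideal_diff_cancel: "is_ideal J \<Longrightarrow> a - b \<in> J \<Longrightarrow> a \<in> J \<longleftrightarrow> b \<in> J"
  using idealD(2,6)[of J] by (metis add_diff_cancel diff_add_cancel minus_diff_eq idealD(5))

lemma ideal_adj: assumes "is_ideal J" shows "is_ideal (adj J x)"
proof -
  have "0 \<in> adj J x" unfolding adj_def using idealD(1)[OF assms]
    by (intro CollectI exI[of _ 0]) simp
  moreover have "a + b \<in> adj J x" if ab: "a \<in> adj J x" "b \<in> adj J x" for a b
  proof -
    obtain u r v s where "a = u + r * x" "b = v + s * x" "u \<in> J" "v \<in> J" using ab unfolding adj_def by blast
    then have "a + b = (u + v) + (r + s) * x" "u + v \<in> J"
      by (simp_all add: algebra_simps idealD(2)[OF assms])
    then show ?thesis unfolding adj_def by blast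
  qed
  moreover have "r * a \<in> adj J x" if a: "a \<in> adj J x" for a r
  proof -
    obtain u s where "a = u + s * x" "u \<in> J" using a unfolding adj_def by blast
    then have "r * a = r * u + (r * s) * x" by (simp add: algebra_simps)
    moreover have "r * u \<in> J" using idealD(3)[OF assms] \<open>u \<in> J\<close> .
    ultimately show ?thesis unfolding adj_def by blast
  qed
  ultimately show ?thesis unfolding is_ideal_def by blast
qed

lemma adj_sub: "J \<subseteq> adj J x"
proof
  fix a assume "a \<in> J"
  then show "a \<in> adj J x" unfolding adj_def by (intro CollectI exI[of _ a] exI[of _ 0]) simp
qed

lemma adj_mem: "is_ideal J \<Longrightarrow> x \<in> adj J x"
  unfolding adj_def using idealD(1)[of J] by (intro CollectI exI[of _ 0] exI[of _ 1]) simp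

lemma adj_multI: "is_ideal J \<Longrightarrow> r * x \<in> adj J x"
  by (simp add: adj_mem ideal_adj idealD)

lemma adj_le: assumes "is_ideal J" "is_ideal K" shows "adj J x \<subseteq> K \<longleftrightarrow> J \<subseteq> K \<and> x \<in> K"
proof
  show "J \<subseteq> K \<and> x \<in> K" if "adj J x \<subseteq> K"
    using that adj_sub[of J x] adj_mem[OF \<open>is_ideal J\<close>, of x] by blast
  show "adj J x \<subseteq> K" if "J \<subseteq> K \<and> x \<in> K"
    using that idealD(2,3)[OF \<open>is_ideal K\<close>] unfolding adj_def by blast
qed

lemma adj_mono: "J \<subseteq> K \<Longrightarrow> adj J x \<subseteq> adj K x"
  unfolding adj_def by blast

lemma adjE: assumes "a \<in> adj J x" obtains j r where "j \<in> J" "a = j + r * x"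
  using assms unfolding adj_def by blast

lemma ideal_gen: "is_ideal (gen S)"
  unfolding gen_def is_ideal_def by auto

lemma gen_le: "is_ideal K \<Longrightarrow> gen S \<subseteq> K \<longleftrightarrow> S \<subseteq> K"
  unfolding gen_def by blast

lemma gen_sub: "S \<subseteq> gen S" unfolding gen_def by blast

lemma gen_insert: "gen (insert x S) = adj (gen S) x"
proof
  show "gen (insert x S) \<subseteq> adj (gen S) x"
    unfolding gen_le[OF ideal_adj[OF ideal_gen]]
    using adj_sub[of "gen S" x] adj_mem[OF ideal_gen, of x S] gen_sub[of S] by auto
  show "adj (gen S) x \<subseteq> gen (insert x S)"
    unfolding adj_le[OF ideal_gen ideal_gen] using gen_sub[of "insert x S"] gen_le[OF ideal_gen, of S "insert x S"] by blast
qed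

lemma gen_ideal: "is_ideal J \<Longrightarrow> gen J = J"
  using gen_le gen_sub by blast

lemma ideal_colon: "is_ideal J \<Longrightarrow> is_ideal {a. x * a \<in> J}"
  unfolding is_ideal_def by (auto simp: distrib_left mult.left_commute)

text \<open>The contraction of \<open>J\<close> from the localization at \<open>q\<close>; it stands
  in for the localized ideal.\<close>

lemma ideal_sat:
  assumes "is_ideal J" "is_prime q" shows "is_ideal {a. \<exists>s. s \<notin> q \<and> s * a \<in> J}"
proof -
  have "\<exists>s. s \<notin> q \<and> s * (a + b) \<in> J" if "s \<notin> q" "s * a \<in> J" "t \<notin> q" "t * b \<in> J" for a b s t
  proof -
    have "s * t * (a + b) = t * (s * a) + s * (t * b)" by (simp add: algebra_simps)
    then show ?thesis using that idealD[OF assms(1)] primeD(3)[OF assms(2)] by metis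
  qed
  moreover have "\<exists>t. t \<notin> q \<and> t * (r * a) \<in> J" if "s \<notin> q" "s * a \<in> J" for r s a
    using that idealD(3)[OF assms(1)] by (metis mult.left_commute)
  moreover have "\<exists>s. s \<notin> q \<and> s * 0 \<in> J"
    using idealD(1)[OF assms(1)] primeD(2)[OF assms(2)] by (intro exI[of _ 1]) simp
  ultimately show ?thesis unfolding is_ideal_def by blast
qed

text \<open>Serves the noetherian inductions: a proper ideal \<open>J\<close> that is not prime
  contains some \<open>a * b\<close> with neither factor in \<open>J\<close>, and facts about the
  larger ideals \<open>J + (a)\<close> and \<open>J + (b)\<close> multiply to a fact about
  \<open>J\<close>.\<close>

lemma colon_prod_adj:
  assumes "is_ideal J" "x \<in> adj J a" "y \<in> adj J b" "a * b \<in> J" shows "x * y \<in> J"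
proof -
  obtain u r v s where "x = u + r * a" "y = v + s * b" "u \<in> J" "v \<in> J"
    using assms(2,3) unfolding adj_def by blast
  then have "x * y = u * y + (r * a) * v + (r * s) * (a * b)" by (simp add: algebra_simps)
  then show ?thesis using \<open>u \<in> J\<close> \<open>v \<in> J\<close> assms(4) idealD[OF assms(1)] by metis
qed

lemma not_prime_split:
  assumes "is_ideal J" "1 \<notin> J" "\<not> is_prime J"
  obtains a b where "a \<notin> J" "b \<notin> J" "a * b \<in> J"
  using assms unfolding is_prime_def by blast

lemma prime_adj_split:
  assumes "is_ideal J" "is_prime P" "J \<subseteq> P" "a * b \<in> J"
  shows "adj J a \<subseteq> P \<or> adj J b \<subseteq> P"
proof -
  have "a \<in> P \<or> b \<in> P" using assms primeD(3) by blast
  then show ?thesis using adj_le[OF assms(1) primeD(1)[OF assms(2)]] assms(3) by blast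
qed

lemma prime_avoidance:
  assumes "finite PP" "\<And>P. P \<in> PP \<Longrightarrow> is_prime P" "is_ideal J" "\<And>P. P \<in> PP \<Longrightarrow> \<not> J \<subseteq> P"
  shows "\<exists>x\<in>J. \<forall>P\<in>PP. x \<notin> P"
  using assms
proof (induction "card PP" arbitrary: PP)
  case 0
  then show ?case using idealD(1)[of J] by auto
next
  case (Suc n)
  from Suc.hyps(2) obtain P where P: "P \<in> PP" by fastforce
  define QQ where "QQ = PP - {P}"
  have PPe: "PP = insert P QQ" "P \<notin> QQ" "finite QQ" "card QQ = n"
    using P Suc unfolding QQ_def by auto
  show ?case
  proof (cases "\<exists>Q\<in>QQ. Q \<subseteq> P")
    case True
    then obtain Q where Q: "Q \<in> QQ" "Q \<subseteq> P" by blast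
    have "\<exists>x\<in>J. \<forall>P\<in>PP - {Q}. x \<notin> P"
      by (rule Suc.hyps(1)) (use Suc Q PPe in auto)
    then show ?thesis using Q PPe by blast
  next
    case False
    obtain x where x: "x \<in> J" "\<forall>Q\<in>QQ. x \<notin> Q"
      using Suc.hyps(1)[of QQ] Suc.prems PPe by (metis insertCI)
    have "\<forall>Q\<in>QQ. \<exists>y. y \<in> Q \<and> y \<notin> P" using False by blast
    then obtain f where f: "\<And>Q. Q \<in> QQ \<Longrightarrow> f Q \<in> Q \<and> f Q \<notin> P" by metis
    obtain j where j: "j \<in> J" "j \<notin> P" using Suc.prems P by blast
    define y where "y = j * prod f QQ"
    have Pp: "is_prime P" using Suc.prems P by blast
    have y1: "y \<notin> P" unfolding y_def using primeD(3)[OF Pp] prime_prod[OF Pp PPe(3)] f j by blast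
    have y2: "y \<in> Q" if "Q \<in> QQ" for Q
      proof -
      have "is_prime Q" using Suc.prems(2) PPe(1) that by blast
      then show ?thesis
        unfolding y_def using prime_prod[OF _ PPe(3), of Q f] f[OF that] that primeD(3)[of Q] by blast
    qed
    have y3: "y \<in> J" unfolding y_def using idealD(4)[OF Suc.prems(3)] j by blast
    show ?thesis
    proof (cases "x \<in> P")
      case True
      then show ?thesis
        using x y1 y2 y3 PPe Suc.prems ideal_add_cancel[OF primeD(1)] idealD(2)[OF Suc.prems(3)]
        by (metis (no_types, lifting) add.commute insert_iff)
    next
      case False
      then show ?thesis using x PPe by blast
    qed
  qed
qed

text \<open>The noetherian ring is the quotient by \<open>I0\<close>; its ideals are the ideals that contain \<open>I0\<close>.\<close>

locale noeth =
  fixes I0 :: "'f::comm_ring_1 set"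
  assumes ideal_I0: "is_ideal I0"
    and max_ideal_ex: "\<And>C. C \<noteq> {} \<Longrightarrow> (\<And>J. J \<in> C \<Longrightarrow> is_ideal J \<and> I0 \<subseteq> J) \<Longrightarrow> \<exists>M\<in>C. \<forall>J\<in>C. M \<subseteq> J \<longrightarrow> J = M"
begin

section \<open>Noetherian induction and the primes above an ideal\<close>

lemma noeth_induct [consumes 2, case_names step]:
  assumes "is_ideal J" "I0 \<subseteq> J"
    and "\<And>J. is_ideal J \<Longrightarrow> I0 \<subseteq> J \<Longrightarrow> (\<And>K. is_ideal K \<Longrightarrow> J \<subset> K \<Longrightarrow> Q K) \<Longrightarrow> Q J"
  shows "Q J"
proof (rule ccontr)
  assume "\<not> Q J"
  then obtain M where "M \<in> {J. is_ideal J \<and> I0 \<subseteq> J \<and> \<not> Q J}"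
     "\<forall>J\<in>{J. is_ideal J \<and> I0 \<subseteq> J \<and> \<not> Q J}. M \<subseteq> J \<longrightarrow> J = M"
    using max_ideal_ex[of "{J. is_ideal J \<and> I0 \<subseteq> J \<and> \<not> Q J}"] assms(1,2) by blast
  then show False using assms(3)[of M] by blast
qed

lemma acc_seq:
  assumes "\<And>n::nat. is_ideal (L n)" "I0 \<subseteq> L 0" "\<And>n. L n \<subseteq> L (Suc n)"
  shows "\<exists>k. \<forall>n\<ge>k. L n = L k"
proof -
  have mono: "L m \<subseteq> L n" if "m \<le> n" for m n using lift_Suc_mono_le[of L] assms(3) that by blast
  have "\<exists>M\<in>range L. \<forall>J\<in>range L. M \<subseteq> J \<longrightarrow> J = M"
  proof (rule max_ideal_ex)
    show "is_ideal J \<and> I0 \<subseteq> J" if "J \<in> range L" for J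
      using that assms(1,2) mono[of 0] by blast
  qed simp
  then obtain k where "\<forall>J\<in>range L. L k \<subseteq> J \<longrightarrow> J = L k" by blast
  then show ?thesis using mono by blast
qed

text \<open>If \<open>J\<close> is not prime, \<open>J + (a)\<close> and \<open>J + (b)\<close>
  cannot both meet \<open>S\<close>, because the product of two such elements would lie in
  \<open>J\<close> and in \<open>S\<close>. So one of the larger ideals can be used.\<close>

lemma prime_disjoint_ex:
  assumes "is_ideal J" "I0 \<subseteq> J" "1 \<in> S" "\<And>s t. s \<in> S \<Longrightarrow> t \<in> S \<Longrightarrow> s * t \<in> S" "J \<inter> S = {}"
  shows "\<exists>P. is_prime P \<and> J \<subseteq> P \<and> P \<inter> S = {}"
  using assms(1,2,5)
proof (induction rule: noeth_induct)
  case (step J)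
  show ?case
  proof (cases "is_prime J")
    case False
    then obtain a b where ab: "a \<notin> J" "b \<notin> J" "a * b \<in> J"
      using not_prime_split[OF step(1)] step(4) assms(3) by (metis disjoint_iff)
    have adj: "is_ideal (adj J a)" "is_ideal (adj J b)" "J \<subset> adj J a" "J \<subset> adj J b"
      using ideal_adj[OF step(1)] adj_sub[of J] adj_mem[OF step(1)] ab by blast+
    have "\<not> (\<exists>x\<in>adj J a \<inter> S. \<exists>y\<in>adj J b \<inter> S. True)"
      using colon_prod_adj[OF step(1) _ _ ab(3)] assms(4) step(4) by blast
    then have "adj J a \<inter> S = {} \<or> adj J b \<inter> S = {}" by blast
    then show ?thesis using step(3)[OF adj(1,3)] step(3)[OF adj(2,4)] adj(3,4) by blast
  qed (use step in blast)
qed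

lemma radical_mem:
  assumes "is_ideal J" "I0 \<subseteq> J" "\<And>P. is_prime P \<Longrightarrow> J \<subseteq> P \<Longrightarrow> a \<in> P"
  shows "\<exists>n. a ^ n \<in> J"
proof (rule ccontr)
  assume *: "\<not> ?thesis"
  have "\<exists>P. is_prime P \<and> J \<subseteq> P \<and> P \<inter> range (\<lambda>n::nat. a ^ n) = {}"
  proof (rule prime_disjoint_ex[OF assms(1,2)])
    show "1 \<in> range (\<lambda>n::nat. a ^ n)" by (rule range_eqI[of _ _ 0]) simp
    show "s * t \<in> range (\<lambda>n::nat. a ^ n)" if "s \<in> range (\<lambda>n::nat. a ^ n)" "t \<in> range (\<lambda>n::nat. a ^ n)" for s t
    proof -
      obtain n m where "s = a ^ n" "t = a ^ m" using \<open>s \<in> _\<close> \<open>t \<in> _\<close> by blast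
      then have "s * t = a ^ (n + m)" by (simp add: power_add)
      then show ?thesis by blast
    qed
    show "J \<inter> range (\<lambda>n::nat. a ^ n) = {}" using * by blast
  qed
  then obtain P where P: "is_prime P" "J \<subseteq> P" "P \<inter> range (\<lambda>n::nat. a ^ n) = {}" by blast
  have "a ^ 1 \<in> range (\<lambda>n::nat. a ^ n)" by blast
  then show False using P assms(3)[OF P(1,2)] by auto
qed

text \<open>Localized at \<open>q\<close>, every element of \<open>q\<close> is nilpotent modulo
  \<open>J\<close>. A prime over \<open>J\<close> disjoint from all \<open>s * a ^ n\<close> lies
  inside \<open>q\<close> (take \<open>n = 0\<close>), equals \<open>q\<close> by minimality, and
  yet omits \<open>a\<close>.\<close>

lemma min_prime_power:
  assumes "is_ideal J" "I0 \<subseteq> J" "min_prime J q" "a \<in> q"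
  shows "\<exists>s n. s \<notin> q \<and> s * a ^ n \<in> J"
proof (rule ccontr)
  assume *: "\<not> ?thesis"
  have q: "is_prime q" using assms(3) by (simp add: min_prime_def)
  let ?S = "{s * a ^ n | s n. s \<notin> q}"
  have "\<exists>P. is_prime P \<and> J \<subseteq> P \<and> P \<inter> ?S = {}"
  proof (rule prime_disjoint_ex[OF assms(1,2)])
    show "1 \<in> ?S" using primeD(2)[OF q] by (intro CollectI exI[of _ 1] exI[of _ 0]) simp
    show "s * t \<in> ?S" if st: "s \<in> ?S" "t \<in> ?S" for s t
    proof -
      obtain s' n t' m where "s = s' * a ^ n" "t = t' * a ^ m" "s' \<notin> q" "t' \<notin> q" using st by blast
      then have "s * t = (s' * t') * a ^ (n + m)" "s' * t' \<notin> q"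
        by (simp_all add: power_add mult_ac primeD(3)[OF q])
      then show ?thesis by blast
    qed
    show "J \<inter> ?S = {}" using * by blast
  qed
  then obtain P where P: "is_prime P" "J \<subseteq> P" "P \<inter> ?S = {}" by blast
  have "P \<subseteq> q"
  proof
    fix s assume s: "s \<in> P"
    show "s \<in> q"
    proof (rule ccontr)
      assume "s \<notin> q"
      then have "s * a ^ 0 \<in> ?S" by blast
      then show False using P(3) s by auto
    qed
  qed
  then have "a \<in> P" using assms(3,4) P by (auto simp: min_prime_def)
  moreover have "1 * a ^ 1 \<in> ?S" using primeD(2)[OF q] by blast
  ultimately show False using P(3) by auto
qed

text \<open>A prime over \<open>J\<close> lies over \<open>J + (a)\<close> or over
  \<open>J + (b)\<close>, so the families found for the two larger ideals can be united. The members
  of \<open>SS\<close> need not be minimal, but every minimal prime is among them.\<close>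

lemma finite_primes_below:
  assumes "is_ideal J" "I0 \<subseteq> J"
  shows "\<exists>SS. finite SS \<and> (\<forall>P\<in>SS. is_prime P \<and> J \<subseteq> P) \<and> (\<forall>P. is_prime P \<longrightarrow> J \<subseteq> P \<longrightarrow> (\<exists>Q\<in>SS. Q \<subseteq> P))"
  using assms
proof (induction rule: noeth_induct)
  case (step J)
  consider "1 \<in> J" | "is_prime J" | "1 \<notin> J" "\<not> is_prime J" by blast
  then show ?case
  proof cases
    case 1
    then show ?thesis using primeD(2) by (intro exI[of _ "{}"]) blast
  next
    case 2
    then show ?thesis by (intro exI[of _ "{J}"]) auto
  next
    case 3
    then obtain a b where ab: "a \<notin> J" "b \<notin> J" "a * b \<in> J"
      using not_prime_split[OF step(1)] by metis
    have adj: "is_ideal (adj J a)" "is_ideal (adj J b)" "J \<subset> adj J a" "J \<subset> adj J b"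
      using ideal_adj[OF step(1)] adj_sub[of J] adj_mem[OF step(1)] ab by blast+
    obtain A where A: "finite A" "\<forall>P\<in>A. is_prime P \<and> adj J a \<subseteq> P" "\<forall>P. is_prime P \<longrightarrow> adj J a \<subseteq> P \<longrightarrow> (\<exists>Q\<in>A. Q \<subseteq> P)"
      using step(3)[OF adj(1,3)] by blast
    obtain B where B: "finite B" "\<forall>P\<in>B. is_prime P \<and> adj J b \<subseteq> P" "\<forall>P. is_prime P \<longrightarrow> adj J b \<subseteq> P \<longrightarrow> (\<exists>Q\<in>B. Q \<subseteq> P)"
      using step(3)[OF adj(2,4)] by blast
    have "finite (A \<union> B)" using A(1) B(1) by blast
    moreover have "\<forall>P\<in>A \<union> B. is_prime P \<and> J \<subseteq> P"
      using A(2) B(2) adj(3,4) by (meson UnE order_trans psubset_imp_subset)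
    moreover have "\<forall>P. is_prime P \<longrightarrow> J \<subseteq> P \<longrightarrow> (\<exists>Q\<in>A \<union> B. Q \<subseteq> P)"
      using A(3) B(3) prime_adj_split[OF step(1) _ _ ab(3)] by (meson UnI1 UnI2)
    ultimately show ?thesis by blast
  qed
qed

lemma finite_min_primes:
  assumes "is_ideal J" "I0 \<subseteq> J" shows "finite {P. min_prime J P}"
proof -
  obtain SS where SS: "finite SS" "\<forall>P\<in>SS. is_prime P \<and> J \<subseteq> P" "\<forall>P. is_prime P \<longrightarrow> J \<subseteq> P \<longrightarrow> (\<exists>Q\<in>SS. Q \<subseteq> P)"
    using finite_primes_below[OF assms] by blast
  have "{P. min_prime J P} \<subseteq> SS"
  proof
    fix P assume "P \<in> {P. min_prime J P}"
    then have P: "is_prime P" "J \<subseteq> P" "\<And>Q. is_prime Q \<Longrightarrow> J \<subseteq> Q \<Longrightarrow> Q \<subseteq> P \<Longrightarrow> Q = P"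
      by (auto simp: min_prime_def)
    obtain Q where "Q \<in> SS" "Q \<subseteq> P" using SS(3) P(1,2) by blast
    then show "P \<in> SS" using P(3)[of Q] SS(2) by blast
  qed
  then show ?thesis using SS(1) finite_subset by blast
qed

lemma min_prime_below:
  assumes "is_ideal J" "I0 \<subseteq> J" "is_prime P" "J \<subseteq> P"
  shows "\<exists>Q. min_prime J Q \<and> Q \<subseteq> P"
proof -
  obtain SS where SS: "finite SS" "\<forall>P\<in>SS. is_prime P \<and> J \<subseteq> P" "\<forall>P. is_prime P \<longrightarrow> J \<subseteq> P \<longrightarrow> (\<exists>Q\<in>SS. Q \<subseteq> P)"
    using finite_primes_below[OF assms(1,2)] by blast
  have "finite {Q\<in>SS. Q \<subseteq> P}" "{Q\<in>SS. Q \<subseteq> P} \<noteq> {}" using SS assms by auto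
  then obtain Q where Q: "Q \<in> SS" "Q \<subseteq> P" "\<forall>Q'\<in>{Q\<in>SS. Q \<subseteq> P}. Q' \<subseteq> Q \<longrightarrow> Q = Q'"
    using finite_has_minimal[of "{Q\<in>SS. Q \<subseteq> P}"] by auto
  have "min_prime J Q"
    unfolding min_prime_def
  proof (intro conjI allI impI)
    fix Q' assume "is_prime Q'" "J \<subseteq> Q'" "Q' \<subseteq> Q"
    then obtain Q'' where "Q'' \<in> SS" "Q'' \<subseteq> Q'" using SS by blast
    then show "Q' = Q" using Q \<open>Q' \<subseteq> Q\<close> by blast
  qed (use SS Q in auto)
  then show ?thesis using Q by blast
qed

lemma dcc_saturated:
  assumes "is_ideal J" "I0 \<subseteq> J" "is_prime q"
    and "\<And>P. is_prime P \<Longrightarrow> J \<subseteq> P \<Longrightarrow> P \<subseteq> q \<Longrightarrow> P = q"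
    and "\<And>n::nat. is_ideal (L n)" "\<And>n. J \<subseteq> L n" "\<And>n. L (Suc n) \<subseteq> L n"
    and "\<And>n s a. s \<notin> q \<Longrightarrow> s * a \<in> L n \<Longrightarrow> a \<in> L n"
  shows "\<exists>k. \<forall>n\<ge>k. L n = L k"
  using assms(1,2,4-)
proof (induction arbitrary: L rule: noeth_induct)
  case (step J)
  note mono = lift_Suc_antimono_le[of L, OF step(7)]
  have full: "L n = UNIV" if "\<not> L n \<subseteq> q" for n
  proof -
    obtain s where "s \<in> L n" "s \<notin> q" using \<open>\<not> L n \<subseteq> q\<close> by blast
    then have "1 \<in> L n" using step(8)[of s 1 n] by simp
    then show ?thesis using idealD(3)[OF step(5)[of n]] by (metis UNIV_eq_I mult.right_neutral)
  qed
  show ?case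
  proof (cases "J \<subseteq> q")
    case False
    then have "\<not> L n \<subseteq> q" for n using step(6)[of n] by blast
    then show ?thesis using full by metis
  next
    case Jq: True
    show ?thesis
    proof (cases "is_prime J")
      case True
      then have "J = q" using step(4)[OF True] Jq by blast
      then have *: "L n = q \<or> L n = UNIV" for n using full[of n] step(6)[of n] by blast
      show ?thesis
      proof (cases "\<forall>n. L n = UNIV")
        case False
        then obtain k where k: "L k = q" using * by blast
        have "L n = q" if "n \<ge> k" for n
          using *[of n] mono[OF that] k primeD(2)[OF \<open>is_prime q\<close>] by blast
        then show ?thesis using k by metis
      qed metis
    next
      case False
      have "1 \<notin> J" using Jq primeD(2)[OF assms(3)] by blast
      then obtain a b where ab: "a \<notin> J" "b \<notin> J" "a * b \<in> J"
        using not_prime_split[OF step(1)] False by metis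
      have adj: "is_ideal (adj J a)" "J \<subset> adj J a"
        using ideal_adj[OF step(1)] adj_sub[of J] adj_mem[OF step(1)] ab by blast+
      have col: "is_ideal {x. a * x \<in> J}" "J \<subset> {x. a * x \<in> J}"
        using ideal_colon[OF step(1)] ab idealD(3)[OF step(1)] by blast+
      \<comment> \<open>The trace of the chain on the multiples of \<open>a\<close>, read in
        \<open>R/(J : a)\<close>. The colon ideal is larger than \<open>J\<close> because it
        contains \<open>b\<close>.\<close>
      have "\<exists>k. \<forall>n\<ge>k. {x. a * x \<in> L n} = {x. a * x \<in> L k}"
      proof (rule step(3)[OF col])
        show "P = q" if "is_prime P" "{x. a * x \<in> J} \<subseteq> P" "P \<subseteq> q" for P
          using step(4) that col by blast
        show "is_ideal {x. a * x \<in> L n}" for n using ideal_colon[OF step(5)] .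
        show "{x. a * x \<in> J} \<subseteq> {x. a * x \<in> L n}" "{x. a * x \<in> L (Suc n)} \<subseteq> {x. a * x \<in> L n}" for n
          using step(6,7) by blast+
        show "x \<in> {x. a * x \<in> L n}" if "s \<notin> q" "s * x \<in> {x. a * x \<in> L n}" for n s x
          using step(8)[OF that(1), of "a * x" n] that(2) by (simp add: mult.left_commute)
      qed
      then obtain k1 where k1: "\<And>n. n \<ge> k1 \<Longrightarrow> {x. a * x \<in> L n} = {x. a * x \<in> L k1}" by blast
      \<comment> \<open>The image of the chain in \<open>R/(J + (a))\<close>. It is saturated anew,
        since adding \<open>a\<close> can destroy saturation.\<close>
      let ?S = "\<lambda>n. {x. \<exists>s. s \<notin> q \<and> s * x \<in> adj (L n) a}"
      have "\<exists>k. \<forall>n\<ge>k. ?S n = ?S k"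
      proof (rule step(3)[OF adj])
        show "P = q" if "is_prime P" "adj J a \<subseteq> P" "P \<subseteq> q" for P
          using step(4) that adj by blast
        show "is_ideal (?S n)" for n by (rule ideal_sat[OF ideal_adj[OF step(5)] \<open>is_prime q\<close>])
        show "adj J a \<subseteq> ?S n" for n
          using adj_mono[OF step(6)[of n], of a] primeD(2)[OF assms(3)] by (auto intro!: exI[of _ 1])
        show "?S (Suc n) \<subseteq> ?S n" for n using adj_mono[OF step(7)[of n], of a] by blast
        show "x \<in> ?S n" if "s \<notin> q" "s * x \<in> ?S n" for n s x
        proof -
          obtain t where "t \<notin> q" "t * (s * x) \<in> adj (L n) a" using \<open>s * x \<in> ?S n\<close> by blast
          then have "t * s \<notin> q" "(t * s) * x \<in> adj (L n) a"
            using primeD(3)[OF assms(3)] \<open>s \<notin> q\<close> by (auto simp: mult.assoc)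
          then show ?thesis by blast
        qed
      qed
      then obtain k2 where k2: "\<And>n. n \<ge> k2 \<Longrightarrow> ?S n = ?S k2" by blast
      let ?k = "max k1 k2"
      have "L n = L ?k" if n: "n \<ge> ?k" for n
      proof
        show "L n \<subseteq> L ?k" using mono n by blast
        show "L ?k \<subseteq> L n"
        proof
          fix c assume c: "c \<in> L ?k"
          then have "c \<in> ?S ?k" using adj_sub[of "L ?k" a] primeD(2)[OF assms(3)] by (auto intro!: exI[of _ 1])
          moreover have "?S ?k = ?S n" using k2[of n] k2[of ?k] n by simp
          ultimately obtain s where s: "s \<notin> q" "s * c \<in> adj (L n) a" by blast
          then obtain u r where u: "u \<in> L n" "s * c = u + r * a" by (auto elim: adjE)
          have "r * a \<in> L ?k"
            using u c mono[OF n] idealD(3)[OF step(5), of c ?k s] ideal_add_cancel[OF step(5), of u ?k "r * a"] by auto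
          then have "r \<in> {x. a * x \<in> L ?k}" by (simp add: mult.commute)
          then have "r \<in> {x. a * x \<in> L n}" using k1[of n] k1[of ?k] n by simp
          then have "s * c \<in> L n" using u idealD(2)[OF step(5)] by (simp add: mult.commute)
          then show "c \<in> L n" using step(8)[OF s(1)] by blast
        qed
      qed
      then show ?thesis by blast
    qed
  qed
qed

text \<open>A local form of Krull's intersection theorem for a principal ideal; it replaces Nakayama's lemma.\<close>

lemma krull_sat:
  assumes J: "is_ideal J" "I0 \<subseteq> J" and q: "is_prime q" "z \<in> q"
    and a: "\<And>k. \<exists>s. s \<notin> q \<and> s * a \<in> adj J (z ^ k)"
  shows "\<exists>s. s \<notin> q \<and> s * a \<in> J"
proof -
  let ?L = "\<lambda>k. {b. z ^ k * b \<in> adj J a}"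
  have "\<exists>k. \<forall>n\<ge>k. ?L n = ?L k"
  proof (rule acc_seq)
    show "is_ideal (?L n)" for n by (rule ideal_colon[OF ideal_adj[OF J(1)]])
    show "I0 \<subseteq> ?L 0" using J(2) adj_sub[of J a] by auto
    show "?L n \<subseteq> ?L (Suc n)" for n
      using idealD(3)[OF ideal_adj[OF J(1), of a]] by (auto simp: mult.assoc)
  qed
  then obtain k where k: "?L (Suc k) = ?L k" by (meson le_SucI order_refl)
  obtain s where s: "s \<notin> q" "s * a \<in> adj J (z ^ Suc k)" using a by blast
  then obtain j r where j: "j \<in> J" "s * a = j + r * z ^ Suc k" by (auto elim: adjE)
  have "z ^ Suc k * r = s * a - j" using j by (simp add: algebra_simps)
  then have "r \<in> ?L (Suc k)"
    using adj_multI[OF J(1)] adj_sub[of J a] j(1) idealD(6)[OF ideal_adj[OF J(1)]] by auto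
  then have "r \<in> ?L k" using k by blast
  then obtain j' c where j': "j' \<in> J" "z ^ k * r = j' + c * a" by (auto elim: adjE)
  \<comment> \<open>Stationarity at \<open>k\<close> rewrites \<open>z ^ k * r\<close> as a multiple
    of \<open>a\<close> modulo \<open>J\<close>, so \<open>s * a\<close> becomes
    \<open>z * c * a\<close> modulo \<open>J\<close>. As \<open>z\<close> lies in \<open>q\<close>,
    the factor \<open>s - z * c\<close> stays outside \<open>q\<close>.\<close>
  have "(s - z * c) * a = s * a - z * (c * a)" by (simp add: algebra_simps)
  also have "c * a = z ^ k * r - j'" using j' by simp
  also have "s * a - z * (z ^ k * r - j') = j + z * j'" using j by (simp add: algebra_simps)
  finally have "(s - z * c) * a \<in> J" using j j' idealD[OF J(1)] by simp
  moreover have "s - z * c \<notin> q"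
    using s(1) q idealD(4)[OF primeD(1)[OF q(1)], of z c] ideal_diff_cancel[OF primeD(1)[OF q(1)]]
    by (metis add_diff_cancel_right' diff_add_cancel idealD(2)[OF primeD(1)[OF q(1)]])
  ultimately show ?thesis by blast
qed

text \<open>Krull's theorem in the domain modulo \<open>p\<close>, localized at \<open>q\<close>.
  The usual symbolic powers of \<open>r\<close> are replaced by the contractions of
  \<open>p + (c ^ n)\<close> from the localization at \<open>r\<close>, for a single
  \<open>c\<close> in \<open>r\<close> outside \<open>p\<close>.\<close>

theorem principal_ideal_theorem:
  assumes p: "is_prime p" "I0 \<subseteq> p" and q: "min_prime (adj p x) q"
    and r: "is_prime r" "p \<subset> r" "r \<subset> q"
  shows False
proof -
  have qp: "is_prime q" "p \<subseteq> q" "x \<in> q" using q adj_le[OF primeD(1)[OF p(1)]] primeD(1)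
    by (auto simp: min_prime_def)
  have xr: "x \<notin> r"
  proof
    assume "x \<in> r"
    then have "adj p x \<subseteq> r" using adj_le[OF primeD(1)[OF p(1)] primeD(1)[OF r(1)]] r(2) by blast
    then show False using q r unfolding min_prime_def by blast
  qed
  obtain c where c: "c \<in> r" "c \<notin> p" using r(2) by blast
  let ?J = "\<lambda>n. {a. \<exists>s. s \<notin> r \<and> s * a \<in> adj p (c ^ n)}"
  \<comment> \<open>Adding \<open>x\<close> lifts the ideals above \<open>p + (x)\<close>, over
    which \<open>q\<close> is minimal, so their saturations at \<open>q\<close> become
    stationary.\<close>
  let ?L = "\<lambda>n. {a. \<exists>s. s \<notin> q \<and> s * a \<in> adj (?J n) x}"
  note idp = primeD(1)[OF p(1)]
  have idJ: "is_ideal (?J n)" for n by (rule ideal_sat[OF ideal_adj[OF idp] r(1)])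
  have pJ: "p \<subseteq> ?J n" for n
    using adj_sub[of p "c ^ n"] primeD(2)[OF r(1)] by (auto intro!: exI[of _ 1])
  have Jdec: "?J (Suc n) \<subseteq> ?J n" for n
  proof -
    have "adj p (c ^ Suc n) \<subseteq> adj p (c ^ n)"
      using adj_le[OF idp ideal_adj[OF idp]] adj_sub adj_multI[OF idp] by auto
    then show ?thesis by blast
  qed
  have "\<exists>k. \<forall>n\<ge>k. ?L n = ?L k"
  proof (rule dcc_saturated[OF ideal_adj[OF idp, of x] _ qp(1)])
    show "I0 \<subseteq> adj p x" using p(2) adj_sub by blast
    show "P = q" if "is_prime P" "adj p x \<subseteq> P" "P \<subseteq> q" for P using q that by (auto simp: min_prime_def)
    show "is_ideal (?L n)" for n by (rule ideal_sat[OF ideal_adj[OF idJ] qp(1)])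
    show "adj p x \<subseteq> ?L n" for n
      using adj_mono[OF pJ[of n], of x] primeD(2)[OF qp(1)] by (auto intro!: exI[of _ 1])
    show "?L (Suc n) \<subseteq> ?L n" for n using adj_mono[OF Jdec[of n], of x] by blast
    show "a \<in> ?L n" if "s \<notin> q" "s * a \<in> ?L n" for n s a
    proof -
      obtain t where "t \<notin> q" "t * (s * a) \<in> adj (?J n) x" using \<open>s * a \<in> ?L n\<close> by blast
      then have "t * s \<notin> q" "(t * s) * a \<in> adj (?J n) x"
        using primeD(3)[OF qp(1)] \<open>s \<notin> q\<close> by (auto simp: mult.assoc)
      then show ?thesis by blast
    qed
  qed
  then obtain n where n: "?L (Suc n) = ?L n" by (meson le_SucI order_refl)
  \<comment> \<open>As \<open>x\<close> is outside \<open>r\<close> and \<open>?J n\<close> is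
    saturated at \<open>r\<close>, the coefficient of \<open>x\<close> lies in \<open>?J n\<close>
    too: locally at \<open>q\<close>, \<open>?J n = ?J (Suc n) + x * ?J n\<close>.\<close>
  have step: "\<exists>s b. s \<notin> q \<and> b \<in> ?J n \<and> s * a - x * b \<in> ?J (Suc n)" if a: "a \<in> ?J n" for a
  proof -
    have "a \<in> ?L n" using a adj_sub[of "?J n" x] primeD(2)[OF qp(1)] by (intro CollectI exI[of _ 1]) auto
    then have "a \<in> ?L (Suc n)" using n by simp
    then obtain s where s: "s \<notin> q" "s * a \<in> adj (?J (Suc n)) x" by blast
    obtain j b where j: "j \<in> ?J (Suc n)" "s * a = j + b * x" by (rule adjE[OF s(2)])
    have "b * x = s * a - j" using j by simp
    then have "b * x \<in> ?J n" using idealD(3,6)[OF idJ[of n]] a j(1) Jdec[of n]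
      by (metis (no_types, lifting) subsetD)
    then obtain t where t: "t \<notin> r" "t * (b * x) \<in> adj p (c ^ n)" by blast
    then have "t * x \<notin> r" "(t * x) * b \<in> adj p (c ^ n)"
      using xr primeD(3)[OF r(1)] by (auto simp: algebra_simps)
    then have "b \<in> ?J n" by blast
    moreover have "s * a - x * b = j" using j by (simp add: algebra_simps)
    ultimately show ?thesis using s(1) j(1) by blast
  qed
  have iter: "\<exists>s b. s \<notin> q \<and> b \<in> ?J n \<and> s * c ^ n - x ^ k * b \<in> ?J (Suc n)" for k
  proof (induction k)
    case 0
    have "c ^ n \<in> ?J n" using adj_mem[OF idp] primeD(2)[OF r(1)] by (auto intro!: exI[of _ 1])
    then have "1 \<notin> q \<and> c ^ n \<in> ?J n \<and> 1 * c ^ n - x ^ 0 * c ^ n \<in> ?J (Suc n)"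
      using primeD(2)[OF qp(1)] idealD(1)[OF idJ[of "Suc n"]] by simp
    then show ?case by blast
  next
    case (Suc k)
    then obtain s b where sb: "s \<notin> q" "b \<in> ?J n" "s * c ^ n - x ^ k * b \<in> ?J (Suc n)" by blast
    obtain t b' where tb: "t \<notin> q" "b' \<in> ?J n" "t * b - x * b' \<in> ?J (Suc n)" using step[OF sb(2)] by blast
    have "t * s * c ^ n - x ^ Suc k * b' = t * (s * c ^ n - x ^ k * b) + x ^ k * (t * b - x * b')"
      by (simp add: algebra_simps)
    moreover have "t * (s * c ^ n - x ^ k * b) + x ^ k * (t * b - x * b') \<in> ?J (Suc n)"
      by (rule idealD(2)[OF idJ idealD(3)[OF idJ sb(3)] idealD(3)[OF idJ tb(3)]])
    ultimately have "t * s * c ^ n - x ^ Suc k * b' \<in> ?J (Suc n)" by simp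
    moreover have "t * s \<notin> q" using sb tb primeD(3)[OF qp(1)] by blast
    ultimately show ?case using tb(2) by blast
  qed
  \<comment> \<open>\<open>krull_sat\<close> removes the powers of \<open>x\<close> collected by
    iteration. Cancelling \<open>c ^ n\<close> modulo the prime \<open>p\<close> afterwards forces a
    product of elements outside \<open>r\<close> into \<open>r\<close>.\<close>
  have "\<exists>s. s \<notin> q \<and> s * c ^ n \<in> ?J (Suc n)"
  proof (rule krull_sat[OF idJ _ qp(1,3)])
    show "I0 \<subseteq> ?J (Suc n)" using p(2) pJ by blast
    fix k
    obtain s b where sb: "s \<notin> q" "b \<in> ?J n" "s * c ^ n - x ^ k * b \<in> ?J (Suc n)" using iter by blast
    have "s * c ^ n = (s * c ^ n - x ^ k * b) + b * x ^ k" by (simp add: algebra_simps)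
    then show "\<exists>s. s \<notin> q \<and> s * c ^ n \<in> adj (?J (Suc n)) (x ^ k)"
      using sb unfolding adj_def by blast
  qed
  then obtain s t where s: "s \<notin> q" "t \<notin> r" "t * (s * c ^ n) \<in> adj p (c ^ Suc n)" by blast
  obtain j b where j: "j \<in> p" "t * (s * c ^ n) = j + b * c ^ Suc n" by (rule adjE[OF s(3)])
  have "(t * s - b * c) * c ^ n = j" using j(2) by (simp add: algebra_simps)
  then have "t * s - b * c \<in> p \<or> c ^ n \<in> p" using j primeD(3)[OF p(1)] by metis
  then have "t * s - b * c \<in> r" using prime_power[OF p(1)] c r(2) by blast
  then have "t * s \<in> r" using c(1) idealD(3)[OF primeD(1)[OF r(1)]] ideal_diff_cancel[OF primeD(1)[OF r(1)]] by blast
  then show False using s r primeD(3)[OF r(1)] by blast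
qed

end

section \<open>The basis theorem and heights\<close>

definition prime_cover :: "'f::comm_ring_1 set \<Rightarrow> 'f set \<Rightarrow> bool" where
  "prime_cover p q \<longleftrightarrow> is_prime p \<and> is_prime q \<and> p \<subset> q \<and> (\<forall>r. is_prime r \<longrightarrow> p \<subset> r \<longrightarrow> \<not> r \<subset> q)"

text \<open>The extension of \<open>J\<close> to polynomials; modulo \<open>coeff_ideal I0\<close>
  one has the polynomial ring over the quotient by \<open>I0\<close>.\<close>

definition coeff_ideal :: "'f::comm_ring_1 set \<Rightarrow> 'f poly set" where
  "coeff_ideal J = {f. \<forall>i. coeff f i \<in> J}"

text \<open>The degree is bounded by \<open>n\<close> rather than equal to it, so that zero belongs
  to the set and sums stay in it.\<close>

definition lead_ideal :: "nat \<Rightarrow> 'f::comm_ring_1 poly set \<Rightarrow> 'f set" where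
  "lead_ideal n J = {coeff f n | f. f \<in> J \<and> degree f \<le> n}"

lemma ideal_coeff_ideal: assumes "is_ideal J" shows "is_ideal (coeff_ideal J)"
  unfolding is_ideal_def coeff_ideal_def
proof (intro conjI allI ballI CollectI)
  fix f g :: "'a poly" and i assume "f \<in> {f. \<forall>i. coeff f i \<in> J}" 
  then have f: "coeff f i \<in> J" for i by blast
  have "(\<Sum>i\<in>A. coeff g (k i) * coeff f (l i)) \<in> J" if "finite A" for A :: "nat set" and k l
    using that by (induction A rule: finite_induct) (simp_all add: idealD[OF assms] f)
  then show "coeff (g * f) i \<in> J" by (simp add: coeff_mult)
qed (use idealD[OF assms] in auto)

lemma ideal_lead_ideal: assumes J: "is_ideal J" shows "is_ideal (lead_ideal n J)"
proof -
  have "0 \<in> lead_ideal n J"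
    unfolding lead_ideal_def using idealD(1)[OF J] by (intro CollectI exI[of _ 0]) simp
  moreover have "a + b \<in> lead_ideal n J" if ab: "a \<in> lead_ideal n J" "b \<in> lead_ideal n J" for a b
  proof -
    obtain f g where "a = coeff f n" "b = coeff g n" "f \<in> J" "g \<in> J" "degree f \<le> n" "degree g \<le> n"
      using ab unfolding lead_ideal_def by blast
    then show ?thesis unfolding lead_ideal_def using idealD(2)[OF J]
      by (intro CollectI exI[of _ "f + g"]) (simp add: degree_add_le)
  qed
  moreover have "r * a \<in> lead_ideal n J" if a: "a \<in> lead_ideal n J" for a r
  proof -
    obtain f where "a = coeff f n" "f \<in> J" "degree f \<le> n"
      using a unfolding lead_ideal_def by blast
    then show ?thesis unfolding lead_ideal_def using idealD(3)[OF J, of f "[:r:]"] degree_smult_le[of r f]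
      by (intro CollectI exI[of _ "smult r f"]) simp
  qed
  ultimately show ?thesis unfolding is_ideal_def by blast
qed

lemma lead_ideal_mono: "J \<subseteq> K \<Longrightarrow> lead_ideal n J \<subseteq> lead_ideal n K"
  unfolding lead_ideal_def by blast

lemma lead_ideal_Suc: assumes J: "is_ideal J" shows "lead_ideal n J \<subseteq> lead_ideal (Suc n) J"
proof
  fix a assume "a \<in> lead_ideal n J"
  then obtain f where f: "a = coeff f n" "f \<in> J" "degree f \<le> n" unfolding lead_ideal_def by blast
  have "monom 1 1 * f \<in> J" using idealD(3)[OF J f(2)] .
  moreover have "degree (monom 1 1 * f) \<le> Suc n"
    using degree_mult_le[of "monom 1 1" f] f(3) degree_monom_le[of "1::'a" 1] by linarith
  moreover have "coeff (monom 1 1 * f) (Suc n) = a" using f by (simp add: coeff_monom_mult)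
  ultimately show "a \<in> lead_ideal (Suc n) J" unfolding lead_ideal_def by blast
qed

text \<open>Induction on a degree bound: a polynomial of \<open>K\<close> shares its coefficient at
  \<open>n\<close> with some polynomial of \<open>J\<close>, and the difference has smaller
  degree.\<close>

lemma lead_ideal_eq_imp:
  assumes J: "is_ideal J" "is_ideal K" "J \<subseteq> K" and eq: "\<And>n. lead_ideal n J = lead_ideal n K"
  shows "J = K"
proof -
  have "f \<in> J" if "f \<in> K" "degree f < n" for f n
    using that
  proof (induction n arbitrary: f)
    case (Suc n)
    have "coeff f n \<in> lead_ideal n K"
      using Suc.prems unfolding lead_ideal_def by (intro CollectI exI[of _ f]) simp
    then have "coeff f n \<in> lead_ideal n J" by (simp add: eq)
    then obtain g where g: "coeff f n = coeff g n" "g \<in> J" "degree g \<le> n"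
      unfolding lead_ideal_def by blast
    have "f - g \<in> J"
    proof (cases "f - g = 0")
      case True then show ?thesis using idealD(1)[OF J(1)] by simp
    next
      case False
      have "degree (f - g) \<le> n" using Suc.prems(2) g(3) by (simp add: degree_diff_le)
      moreover have "coeff (f - g) n = 0" using g by simp
      ultimately have "degree (f - g) < n \<or> degree (f - g) = 0"
        using False by (metis leading_coeff_0_iff nat_less_le)
      moreover have "degree (f - g) = 0 \<Longrightarrow> 0 < n"
        using \<open>coeff (f - g) n = 0\<close> False
        by (metis degree_0 gr0I leading_coeff_0_iff)
      ultimately have "degree (f - g) < n" by auto
      moreover have "f - g \<in> K" using idealD(6)[OF J(2) Suc.prems(1)] g(2) J(3) by blast
      ultimately show ?thesis using Suc.IH by blast
    qed
    then have "(f - g) + g \<in> J" using idealD(2)[OF J(1)] g(2) by blast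
    then show ?case by simp
  qed simp
  then show ?thesis using J(3) by blast
qed

context noeth
begin

text \<open>Lets a maximal member be reached in stages: above \<open>J\<close> there is a member of
  \<open>C\<close> at which the invariant \<open>\<phi>\<close> can no longer grow.\<close>

lemma maximal_wrt:
  assumes "J \<in> C" and "\<And>J. J \<in> C \<Longrightarrow> is_ideal (\<phi> J) \<and> I0 \<subseteq> \<phi> J" and "\<And>J K. J \<subseteq> K \<Longrightarrow> \<phi> J \<subseteq> \<phi> K"
  shows "\<exists>J'\<in>C. J \<subseteq> J' \<and> (\<forall>K\<in>C. J' \<subseteq> K \<longrightarrow> \<phi> K = \<phi> J')"
proof -
  have "\<exists>M\<in>\<phi> ` {K\<in>C. J \<subseteq> K}. \<forall>K\<in>\<phi> ` {K\<in>C. J \<subseteq> K}. M \<subseteq> K \<longrightarrow> K = M"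
    by (rule max_ideal_ex) (use assms(1,2) in auto)
  then obtain J' where J': "J' \<in> C" "J \<subseteq> J'" "\<And>K. K \<in> C \<Longrightarrow> J \<subseteq> K \<Longrightarrow> \<phi> J' \<subseteq> \<phi> K \<Longrightarrow> \<phi> K = \<phi> J'"
    by auto
  then show ?thesis using assms(3) by (meson order_trans)
qed

text \<open>A maximal member of \<open>C\<close> is found by making finitely many invariants
  stationary. The union of all leading ideals controls those of degree at least \<open>N\<close>;
  the \<open>N\<close> lower ones are treated in turn, and all of them together determine the
  ideal.\<close>

theorem hilbert_basis: "noeth (coeff_ideal I0)"
proof
  show "is_ideal (coeff_ideal I0)" by (rule ideal_coeff_ideal[OF ideal_I0])
  fix C :: "'f poly set set"
  assume ne: "C \<noteq> {}" and C: "\<And>J. J \<in> C \<Longrightarrow> is_ideal J \<and> coeff_ideal I0 \<subseteq> J"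
  have lead: "is_ideal (lead_ideal n J) \<and> I0 \<subseteq> lead_ideal n J" if "J \<in> C" for J n
  proof
    show "is_ideal (lead_ideal n J)" using ideal_lead_ideal C that by blast
    show "I0 \<subseteq> lead_ideal n J"
    proof
      fix a assume "a \<in> I0"
      then have "monom a n \<in> coeff_ideal I0" unfolding coeff_ideal_def using idealD(1)[OF ideal_I0] by simp
      then show "a \<in> lead_ideal n J" unfolding lead_ideal_def using C[OF that] degree_monom_le[of a n]
        by (intro CollectI exI[of _ "monom a n"]) auto
    qed
  qed
  have lead_mono: "lead_ideal n J \<subseteq> lead_ideal m J" if "n \<le> m" "J \<in> C" for n m J
    using lift_Suc_mono_le[of "\<lambda>n. lead_ideal n J"] lead_ideal_Suc C that by blast
  define U where "U = (\<lambda>J :: 'f poly set. \<Union>n. lead_ideal n J)"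
  have Ui: "is_ideal (U J) \<and> I0 \<subseteq> U J" if "J \<in> C" for J
  proof
    show "is_ideal (U J)"
      unfolding is_ideal_def
    proof (intro conjI ballI allI)
      show "0 \<in> U J" using lead[OF that] idealD(1) unfolding U_def by blast
      fix a b r assume "a \<in> U J"
      then obtain n where n: "a \<in> lead_ideal n J" unfolding U_def by blast
      then show "r * a \<in> U J" using lead[OF that] idealD(3) unfolding U_def by blast
      assume "b \<in> U J"
      then obtain m where m: "b \<in> lead_ideal m J" unfolding U_def by blast
      have "a \<in> lead_ideal (max n m) J" "b \<in> lead_ideal (max n m) J"
        using n m lead_mono[OF _ that] by (meson max.cobounded1 max.cobounded2 subsetD)+
      then show "a + b \<in> U J" using lead[OF that] idealD(2) unfolding U_def by blast
    qed
    show "I0 \<subseteq> U J" using lead[OF that] unfolding U_def by blast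
  qed
  obtain J0 where "J0 \<in> C" using ne by blast
  have "\<exists>J'\<in>C. J0 \<subseteq> J' \<and> (\<forall>K\<in>C. J' \<subseteq> K \<longrightarrow> U K = U J')"
  proof (rule maximal_wrt[OF \<open>J0 \<in> C\<close> Ui])
    show "U J \<subseteq> U K" if "J \<subseteq> K" for J K using lead_ideal_mono[OF that] unfolding U_def by blast
  qed
  then obtain J1 where J1: "J1 \<in> C" "\<And>K. K \<in> C \<Longrightarrow> J1 \<subseteq> K \<Longrightarrow> U K = U J1" by blast
  have "\<exists>k. \<forall>n\<ge>k. lead_ideal n J1 = lead_ideal k J1"
    by (rule acc_seq) (use lead[OF J1(1)] lead_ideal_Suc C[OF J1(1)] in blast)+
  then obtain N where N: "\<And>n. n \<ge> N \<Longrightarrow> lead_ideal n J1 = lead_ideal N J1" by blast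
  have UN: "U J1 = lead_ideal N J1"
  proof -
    have "lead_ideal n J1 \<subseteq> lead_ideal N J1" for n
      using N[of n] lead_mono[of n N J1] J1(1) by (cases "n \<ge> N") auto
    then show ?thesis unfolding U_def by blast
  qed
  have big: "lead_ideal n K = lead_ideal n J1" if "K \<in> C" "J1 \<subseteq> K" "n \<ge> N" for K n
  proof -
    have "lead_ideal n K \<subseteq> U K" unfolding U_def by blast
    then show ?thesis
      using UN J1(2)[OF that(1,2)] N[OF that(3)] lead_ideal_mono[OF that(2), of n] by auto
  qed
  \<comment> \<open>Each stage only enlarges the ideal, so the leading ideals that were made
    stationary before keep their values.\<close>
  have "\<exists>J\<in>C. J1 \<subseteq> J \<and> (\<forall>K\<in>C. J \<subseteq> K \<longrightarrow> (\<forall>n<k. lead_ideal n K = lead_ideal n J))" for k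
  proof (induction k)
    case 0
    then show ?case using J1 by blast
  next
    case (Suc k)
    then obtain J where J0: "J \<in> C" "J1 \<subseteq> J" "\<forall>K\<in>C. J \<subseteq> K \<longrightarrow> (\<forall>n<k. lead_ideal n K = lead_ideal n J)"
      by (elim bexE conjE)
    have J3: "lead_ideal n K = lead_ideal n J" if "K \<in> C" "J \<subseteq> K" "n < k" for K n
      using J0(3) that by blast
    note J = J0(1,2) J3
    have "\<exists>J'\<in>C. J \<subseteq> J' \<and> (\<forall>K\<in>C. J' \<subseteq> K \<longrightarrow> lead_ideal k K = lead_ideal k J')"
      by (rule maximal_wrt[OF J(1)]) (fact lead lead_ideal_mono)+
    then obtain J' where J'0: "J' \<in> C" "J \<subseteq> J'" "\<forall>K\<in>C. J' \<subseteq> K \<longrightarrow> lead_ideal k K = lead_ideal k J'"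
      by (elim bexE conjE)
    have J'3: "lead_ideal k K = lead_ideal k J'" if "K \<in> C" "J' \<subseteq> K" for K
      using J'0(3) that by blast
    note J' = J'0(1,2) J'3
    have *: "lead_ideal n K = lead_ideal n J'" if "K \<in> C" "J' \<subseteq> K" "n < Suc k" for K n
    proof (cases "n = k")
      case True
      then show ?thesis using J'(3) that by blast
    next
      case False
      then have "n < k" using that by simp
      then show ?thesis using J(3)[OF that(1) _ \<open>n < k\<close>] J(3)[OF J'(1,2) \<open>n < k\<close>] J'(2) that(2) by (metis order_trans)
    qed
    have "J1 \<subseteq> J'" using J'(2) J(2) by blast
    show ?case
    proof (intro bexI[of _ J'] conjI ballI impI allI)
      show "lead_ideal n K = lead_ideal n J'" if "K \<in> C" "J' \<subseteq> K" "n < Suc k" for K n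
        using that by (rule *)
    qed fact+
  qed
  from this[of N] obtain J where J0: "J \<in> C" "J1 \<subseteq> J" "\<forall>K\<in>C. J \<subseteq> K \<longrightarrow> (\<forall>n<N. lead_ideal n K = lead_ideal n J)"
    by (elim bexE conjE)
  have J3: "lead_ideal n K = lead_ideal n J" if "K \<in> C" "J \<subseteq> K" "n < N" for K n
    using J0(3) that by blast
  note J = J0(1,2) J3
  have "K = J" if K: "K \<in> C" "J \<subseteq> K" for K
  proof -
    have "lead_ideal n J = lead_ideal n K" for n
      using J(3)[OF K, of n] big[OF K(1), of n] big[OF J(1,2), of n] J(2) K(2) by (cases "n < N") auto
    then show ?thesis using lead_ideal_eq_imp[of J K] C[OF J(1)] C[OF K(1)] K(2) by blast
  qed
  then show "\<exists>M\<in>C. \<forall>J\<in>C. M \<subseteq> J \<longrightarrow> J = M" using J(1) by blast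
qed

text \<open>Finiteness is meant modulo \<open>I0\<close>, which is why \<open>I0\<close> itself is
  part of the generating set.\<close>

lemma finitely_generated:
  assumes "is_ideal J" "I0 \<subseteq> J"
  shows "\<exists>G. finite G \<and> J = gen (I0 \<union> G)"
proof -
  define C where "C = {gen (I0 \<union> G) | G. finite G \<and> G \<subseteq> J}"
  have "\<exists>M\<in>C. \<forall>K\<in>C. M \<subseteq> K \<longrightarrow> K = M"
  proof (rule max_ideal_ex)
    show "C \<noteq> {}" unfolding C_def by blast
    show "is_ideal K \<and> I0 \<subseteq> K" if "K \<in> C" for K using that ideal_gen gen_sub unfolding C_def by blast
  qed
  then obtain M where M: "M \<in> C" "\<And>K. K \<in> C \<Longrightarrow> M \<subseteq> K \<Longrightarrow> K = M" by blast
  obtain G where G1: "finite G" "G \<subseteq> J" "M = gen (I0 \<union> G)" using M(1) unfolding C_def by blast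
  have "gen (I0 \<union> G') = gen (I0 \<union> G)"
    if "finite G'" "G' \<subseteq> J" "gen (I0 \<union> G) \<subseteq> gen (I0 \<union> G')" for G'
    using M(2)[of "gen (I0 \<union> G')"] that G1(3) unfolding C_def by blast
  note G = G1(1,2) this
  have "J \<subseteq> gen (I0 \<union> G)"
  proof
    fix x assume x: "x \<in> J"
    have "gen (I0 \<union> insert x G) = gen (I0 \<union> G)"
      by (rule G(3)) (use G x adj_sub[of "gen (I0 \<union> G)" x] gen_insert[of x "I0 \<union> G"] in auto)
    then show "x \<in> gen (I0 \<union> G)" using gen_sub[of "I0 \<union> insert x G"] by blast
  qed
  moreover have "gen (I0 \<union> G) \<subseteq> J" using gen_le[OF assms(1)] assms(2) G(2) by blast
  ultimately show ?thesis using G(1) by blast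
qed

section \<open>Krull's height theorem\<close>

definition prime_chain_in :: "nat \<Rightarrow> (nat \<Rightarrow> 'f set) \<Rightarrow> bool" where
  "prime_chain_in n P \<longleftrightarrow> (\<forall>i\<le>n. is_prime (P i) \<and> I0 \<subseteq> P i) \<and> (\<forall>i<n. P i \<subset> P (Suc i))"

lemma maximal_prime_below:
  assumes "is_prime r0" "I0 \<subseteq> r0" "r0 \<subset> P" "is_prime P"
  shows "\<exists>r. prime_cover r P \<and> r0 \<subseteq> r"
proof -
  let ?C = "{r. is_prime r \<and> r0 \<subseteq> r \<and> r \<subset> P}"
  have "\<exists>M\<in>?C. \<forall>K\<in>?C. M \<subseteq> K \<longrightarrow> K = M"
    by (rule max_ideal_ex) (use assms primeD(1) in blast)+
  then obtain r where r: "is_prime r" "r0 \<subseteq> r" "r \<subset> P" "\<And>K. is_prime K \<Longrightarrow> r \<subseteq> K \<Longrightarrow> K \<subset> P \<Longrightarrow> K = r"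
    by (smt (verit) mem_Collect_eq order_trans)
  then show ?thesis using assms unfolding prime_cover_def by (metis psubset_eq)
qed

text \<open>Induction on the number of generators. Let \<open>r\<close> be adjacent below
  \<open>P\<close> and \<open>y\<close> a generator outside \<open>r\<close>. Modulo
  \<open>y\<close> and up to factors outside \<open>P\<close>, powers of the other generators fall
  into \<open>r\<close>. This gives one element fewer, and \<open>r\<close> is minimal over these
  elements by \<open>principal_ideal_theorem\<close>.\<close>

theorem krull_height:
  assumes "min_prime (gen (I0 \<union> set xs)) P" "prime_chain_in k C" "C k = P"
  shows "k \<le> length xs"
  using assms
proof (induction "length xs" arbitrary: xs P k C rule: less_induct)
  case less
  show ?case
  proof (cases k)
    case (Suc k')
    have P: "is_prime P" "gen (I0 \<union> set xs) \<subseteq> P" using less.prems by (auto simp: min_prime_def)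
    have Ck: "is_prime (C k')" "I0 \<subseteq> C k'" "C k' \<subset> P"
      using less.prems(2,3) Suc by (auto simp: prime_chain_in_def)
    obtain r where r: "prime_cover r P" "C k' \<subseteq> r" using maximal_prime_below[OF Ck P(1)] by blast
    then have r': "is_prime r" "r \<subset> P" "I0 \<subseteq> r" using Ck(2) by (auto simp: prime_cover_def)
    have "\<not> set xs \<subseteq> r"
    proof
      assume "set xs \<subseteq> r"
      then have "gen (I0 \<union> set xs) \<subseteq> r" using gen_le[OF primeD(1)[OF r'(1)]] r'(3) by blast
      then show False using less.prems(1) r' by (auto simp: min_prime_def)
    qed
    then obtain y where y: "y \<in> set xs" "y \<notin> r" by blast
    have adjr: "min_prime (adj r y) P"
      unfolding min_prime_def
    proof (intro conjI allI impI P(1))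
      show "adj r y \<subseteq> P" using adj_le[OF primeD(1)[OF r'(1)] primeD(1)[OF P(1)]] r'(2) P(2) y(1) gen_sub by blast
      fix Q assume Q: "is_prime Q" "adj r y \<subseteq> Q" "Q \<subseteq> P"
      then have "r \<subset> Q" using adj_le[OF primeD(1)[OF r'(1)] primeD(1)[OF Q(1)]] y(2) by blast
      then show "Q = P" using r(1) Q unfolding prime_cover_def by blast
    qed
    define xs' where "xs' = remove1 y xs"
    have "\<exists>b\<in>r. \<exists>s n c. s \<notin> P \<and> s * x ^ n = b + c * y" if "x \<in> set xs'" for x
    proof -
      have "x \<in> P" using that P(2) gen_sub notin_set_remove1[of x xs y] unfolding xs'_def by blast
      then obtain s n where s: "s \<notin> P" "s * x ^ n \<in> adj r y"
        using min_prime_power[OF ideal_adj[OF primeD(1)[OF r'(1)]] _ adjr] r'(3) adj_sub by blast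
      obtain b c where "b \<in> r" "s * x ^ n = b + c * y" by (rule adjE[OF s(2)])
      then show ?thesis using s(1) by blast
    qed
    then obtain b where b: "\<And>x. x \<in> set xs' \<Longrightarrow> b x \<in> r \<and> (\<exists>s n c. s \<notin> P \<and> s * x ^ n = b x + c * y)"
      by metis
    have minr: "min_prime (gen (I0 \<union> set (map b xs'))) r"
      unfolding min_prime_def
    proof (intro conjI allI impI r'(1))
      show "gen (I0 \<union> set (map b xs')) \<subseteq> r"
        using gen_le[OF primeD(1)[OF r'(1)]] r'(3) b by auto
      fix r2 assume r2: "is_prime r2" "gen (I0 \<union> set (map b xs')) \<subseteq> r2" "r2 \<subseteq> r"
      show "r2 = r"
      proof (rule ccontr)
        assume ne: "r2 \<noteq> r"
        have I2: "I0 \<subseteq> r2" using r2(2) gen_sub by blast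
        \<comment> \<open>If a prime \<open>r2\<close> below \<open>r\<close> contained all
          \<open>b x\<close>, then \<open>P\<close> would be minimal over \<open>r2 + (y)\<close>
          with \<open>r\<close> strictly in between.\<close>
        have "min_prime (adj r2 y) P"
          unfolding min_prime_def
        proof (intro conjI allI impI P(1))
          show "adj r2 y \<subseteq> P" using adjr adj_mono[OF r2(3), of y] by (auto simp: min_prime_def)
          fix Q assume Q: "is_prime Q" "adj r2 y \<subseteq> Q" "Q \<subseteq> P"
          then have Q2: "r2 \<subseteq> Q" "y \<in> Q" using adj_le[OF primeD(1)[OF r2(1)] primeD(1)[OF Q(1)]] by blast+
          have "x \<in> Q" if x: "x \<in> set xs'" for x
          proof -
            obtain s n c where s: "s \<notin> P" "s * x ^ n = b x + c * y" using b[OF x] by blast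
            have "b x \<in> r2" using r2(2) gen_sub x by fastforce
            then have "s * x ^ n \<in> Q" unfolding s(2) using Q2 idealD(2,3)[OF primeD(1)[OF Q(1)]] by blast
            then show ?thesis using s(1) Q(3) primeD(3)[OF Q(1)] prime_power[OF Q(1)] by blast
          qed
          then have "set xs \<subseteq> Q"
            using Q2(2) in_set_remove1[of _ y xs] unfolding xs'_def by (metis subsetI)
          then have "gen (I0 \<union> set xs) \<subseteq> Q" using gen_le[OF primeD(1)[OF Q(1)]] I2 Q2(1) by blast
          then show "Q = P" using less.prems(1) Q by (auto simp: min_prime_def)
        qed
        then show False
          using principal_ideal_theorem[OF r2(1) I2 _ r'(1) _ r'(2)] ne r2(3) by blast
      qed
    qed
    have "k' \<le> length (map b xs')"
    proof (rule less.hyps[OF _ minr])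
      show "length (map b xs') < length xs"
        using y(1) length_pos_if_in_set[OF y(1)] unfolding xs'_def by (simp add: length_remove1)
      \<comment> \<open>The shortened chain has to end at \<open>r\<close>, which need not be its
        member \<open>C k'\<close> but contains it.\<close>
      show "prime_chain_in k' (C(k' := r))"
        unfolding prime_chain_in_def
      proof (intro conjI allI impI)
        fix i
        show "is_prime ((C(k' := r)) i)" "I0 \<subseteq> (C(k' := r)) i" if "i \<le> k'"
          using that less.prems(2) Suc r' by (auto simp: prime_chain_in_def)
        show "(C(k' := r)) i \<subset> (C(k' := r)) (Suc i)" if "i < k'"
        proof -
          have "C i \<subset> C (Suc i)" using that less.prems(2) Suc by (auto simp: prime_chain_in_def)
          then show ?thesis using that r(2) by auto
        qed
      qed
    qed simp
    moreover have "length (map b xs') = length xs - 1"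
      using y(1) unfolding xs'_def by (simp add: length_remove1)
    ultimately show ?thesis using Suc length_pos_if_in_set[OF y(1)] by linarith
  qed simp
qed

end

section \<open>Infinitely many intermediate primes\<close>

lemma prime_coverD:
  assumes "prime_cover p q"
  shows "is_prime p" "is_prime q" "p \<subset> q" "is_prime r \<Longrightarrow> p \<subset> r \<Longrightarrow> r \<subseteq> q \<Longrightarrow> r = q"
  using assms unfolding prime_cover_def by blast+

text \<open>Puts adjacent primes into the form that \<open>min_prime_power\<close> requires.\<close>

lemma prime_cover_min_prime:
  assumes "prime_cover p q" "a \<in> q" "a \<notin> p" shows "min_prime (adj p a) q"
proof -
  note pq = prime_coverD[OF assms(1)]
  show ?thesis
    unfolding min_prime_def
  proof (intro conjI allI impI pq(2))
    show "adj p a \<subseteq> q" using adj_le[OF primeD(1)[OF pq(1)] primeD(1)[OF pq(2)]] pq(3) assms(2) by blast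
    fix Q assume "is_prime Q" "adj p a \<subseteq> Q" "Q \<subseteq> q"
    then show "Q = q" using pq(4) adj_le[OF primeD(1)[OF pq(1)] primeD(1)] assms(3) by blast
  qed
qed

lemma coeff_mult_linear:
  "coeff (G * [:- a, b:]) 0 = - (a * coeff G 0)"
  "coeff (G * [:- a, b:]) (Suc i) = b * coeff G i - a * coeff G (Suc i)" for a b :: "'f::comm_ring_1"
  by (simp_all add: mult.commute[of G] algebra_simps)

text \<open>Modulo \<open>p\<close>, \<open>b\<close> times a coefficient of the cofactor
  \<open>G\<close> equals \<open>a\<close> times the next one. The coefficients vanish beyond the
  degree, so descending from the top, with \<open>b\<close> outside \<open>p\<close>, puts all of
  them into \<open>p\<close>.\<close>

lemma linear_multiple_const:
  fixes \<rho> :: "'f::comm_ring_1"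
  assumes p: "is_prime p" "b \<notin> p" and "[:b ^ n * \<rho>:] \<in> adj (coeff_ideal p) [:- a, b:]"
  shows "\<rho> \<in> p"
proof -
  note idp = primeD(1)[OF p(1)]
  obtain H G where H: "H \<in> coeff_ideal p" "[:b ^ n * \<rho>:] = H + G * [:- a, b:]"
    using assms(3) by (auto elim: adjE)
  have Hc: "coeff H i \<in> p" for i using H(1) by (simp add: coeff_ideal_def)
  have "b * coeff G i - a * coeff G (Suc i) \<in> p" for i
  proof -
    have "coeff [:b ^ n * \<rho>:] (Suc i) = coeff H (Suc i) + (b * coeff G i - a * coeff G (Suc i))"
      unfolding H(2) coeff_add coeff_mult_linear by simp
    then have "coeff H (Suc i) + (b * coeff G i - a * coeff G (Suc i)) = 0" by simp
    then show ?thesis using ideal_add_cancel[OF idp Hc[of "Suc i"]] idealD(1)[OF idp] by metis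
  qed
  note rec = this
  have step: "coeff G i \<in> p" if "coeff G (Suc i) \<in> p" for i
    using ideal_diff_cancel[OF idp rec[of i]] idealD(3)[OF idp that, of a] primeD(3)[OF p(1)] p(2) by blast
  have "coeff G (Suc (degree G) - k) \<in> p" for k
  proof (induction k)
    case 0
    then show ?case using idealD(1)[OF idp] by (simp add: coeff_eq_0)
  next
    case (Suc k)
    then show ?case using step[of "Suc (degree G) - Suc k"]
      by (cases "k \<le> degree G") (auto simp: Suc_diff_le)
  qed
  from this[of "Suc (degree G)"] have "coeff G 0 \<in> p" by simp
  moreover have "coeff [:b ^ n * \<rho>:] 0 = coeff H 0 + - (a * coeff G 0)"
    unfolding H(2) coeff_add coeff_mult_linear by simp
  ultimately have "b ^ n * \<rho> \<in> p" using idealD[OF idp] Hc by simp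
  then show ?thesis using primeD(3)[OF p(1)] prime_power[OF p(1)] p(2) by blast
qed

text \<open>The constant \<open>\<rho>\<close> is the value of \<open>F\<close> at
  \<open>a/b\<close> with the denominators cleared.\<close>

lemma pseudo_division:
  fixes F :: "'f::comm_ring_1 poly"
  assumes "is_ideal p"
  shows "\<exists>n \<rho>. [:b ^ n:] * F - [:\<rho>:] \<in> adj (coeff_ideal p) [:- a, b:]"
proof (induction F)
  case 0
  then show ?case using idealD(1)[OF ideal_adj[OF ideal_coeff_ideal[OF assms]]]
    by (intro exI[of _ 0]) simp
next
  case (pCons c F)
  let ?I = "adj (coeff_ideal p) [:- a, b:]"
  note idI = ideal_adj[OF ideal_coeff_ideal[OF assms], of "[:- a, b:]"]
  obtain n \<rho> where n: "[:b ^ n:] * F - [:\<rho>:] \<in> ?I" using pCons by blast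
  have "[:b ^ Suc n:] * pCons c F - [:b ^ Suc n * c + a * \<rho>:] =
     [:0, b:] * ([:b ^ n:] * F - [:\<rho>:]) + [:\<rho>:] * [:- a, b:]"
    by (simp add: algebra_simps smult_diff_right)
  moreover have "\<dots> \<in> ?I"
    by (intro idealD(2)[OF idI] idealD(3)[OF idI] n adj_mem[OF ideal_coeff_ideal[OF assms]])
  ultimately show ?case by (intro exI[of _ "Suc n"] exI[of _ "b ^ Suc n * c + a * \<rho>"]) simp
qed

text \<open>The kernel of \<open>R[T] \<rightarrow> Frac(R/p)\<close>, \<open>T \<mapsto> a/b\<close>.\<close>

definition fraction_ideal :: "'f::comm_ring_1 set \<Rightarrow> 'f \<Rightarrow> 'f \<Rightarrow> 'f poly set" where
  "fraction_ideal p a b = {F. \<exists>n. [:b ^ n:] * F \<in> adj (coeff_ideal p) [:- a, b:]}"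

text \<open>Pseudo-division replaces both factors by constants, and for constants
  \<open>linear_multiple_const\<close> brings the question down to the prime
  \<open>p\<close>.\<close>

lemma prime_fraction_ideal:
  assumes p: "is_prime p" "b \<notin> p" shows "is_prime (fraction_ideal p a b)"
proof -
  let ?I = "adj (coeff_ideal p) [:- a, b:]"
  note idp = primeD(1)[OF p(1)]
  note idI = ideal_adj[OF ideal_coeff_ideal[OF idp], of "[:- a, b:]"]
  have pow: "[:b ^ (n + m):] = [:b ^ n:] * [:b ^ m:]" for n m by (simp add: power_add)
  have one: "1 \<notin> fraction_ideal p a b"
  proof
    assume "1 \<in> fraction_ideal p a b"
    then obtain n where "[:b ^ n:] * 1 \<in> ?I" unfolding fraction_ideal_def by blast
    then have "[:b ^ n * 1:] \<in> ?I" by simp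
    then show False using linear_multiple_const[OF p] primeD(2)[OF p(1)] by blast
  qed
  have "is_ideal (fraction_ideal p a b)"
  proof -
    have "0 \<in> fraction_ideal p a b" unfolding fraction_ideal_def using idealD(1)[OF idI] by simp
    moreover have "F + G \<in> fraction_ideal p a b" if FG: "F \<in> fraction_ideal p a b" "G \<in> fraction_ideal p a b" for F G
    proof -
      obtain n m where nm: "[:b ^ n:] * F \<in> ?I" "[:b ^ m:] * G \<in> ?I" using FG unfolding fraction_ideal_def by blast
      have "[:b ^ (n + m):] * (F + G) = [:b ^ m:] * ([:b ^ n:] * F) + [:b ^ n:] * ([:b ^ m:] * G)"
        unfolding pow by (simp only: distrib_left distrib_right mult_ac)
      then have "[:b ^ (n + m):] * (F + G) \<in> ?I" using idealD(2,3)[OF idI] nm by metis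
      then show ?thesis unfolding fraction_ideal_def by blast
    qed
    moreover have "G * F \<in> fraction_ideal p a b" if F: "F \<in> fraction_ideal p a b" for F G
    proof -
      obtain n where n: "[:b ^ n:] * F \<in> ?I" using F unfolding fraction_ideal_def by blast
      have "[:b ^ n:] * (G * F) = G * ([:b ^ n:] * F)" by (simp only: mult_ac)
      then have "[:b ^ n:] * (G * F) \<in> ?I" using idealD(3)[OF idI n] by metis
      then show ?thesis unfolding fraction_ideal_def by blast
    qed
    ultimately show ?thesis unfolding is_ideal_def by blast
  qed
  moreover have "F \<in> fraction_ideal p a b \<or> G \<in> fraction_ideal p a b"
    if FG: "F * G \<in> fraction_ideal p a b" for F G
  proof -
    obtain n \<rho> where n: "[:b ^ n:] * F - [:\<rho>:] \<in> ?I" using pseudo_division[OF idp] by blast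
    obtain m \<sigma> where m: "[:b ^ m:] * G - [:\<sigma>:] \<in> ?I" using pseudo_division[OF idp] by blast
    obtain k where k: "[:b ^ k:] * (F * G) \<in> ?I" using FG unfolding fraction_ideal_def by blast
    have "[:b ^ k * (\<rho> * \<sigma>):] = [:b ^ k:] * [:\<rho>:] * [:\<sigma>:]" by simp
    also have "\<dots> = [:b ^ n:] * [:b ^ m:] * ([:b ^ k:] * (F * G))
        - ([:b ^ k:] * [:b ^ m:] * G) * ([:b ^ n:] * F - [:\<rho>:]) - ([:b ^ k:] * [:\<rho>:]) * ([:b ^ m:] * G - [:\<sigma>:])"
      by (simp only: right_diff_distrib mult_ac) simp
    also have "\<dots> \<in> ?I" by (intro idealD(6)[OF idI] idealD(3)[OF idI] n m k)
    finally have "\<rho> * \<sigma> \<in> p" by (rule linear_multiple_const[OF p])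
    then have "\<rho> \<in> p \<or> \<sigma> \<in> p" using primeD(3)[OF p(1)] by blast
    moreover have c: "[:x:] \<in> ?I" if "x \<in> p" for x
    proof -
      have "[:x:] \<in> coeff_ideal p" unfolding coeff_ideal_def using that idealD(1)[OF idp]
        by (auto simp: coeff_pCons split: nat.split)
      then show ?thesis using adj_sub by blast
    qed
    moreover have "[:b ^ n:] * F \<in> ?I" if "[:\<rho>:] \<in> ?I" using ideal_diff_cancel[OF idI n] that by blast
    moreover have "[:b ^ m:] * G \<in> ?I" if "[:\<sigma>:] \<in> ?I" using ideal_diff_cancel[OF idI m] that by blast
    ultimately show ?thesis unfolding fraction_ideal_def by blast
  qed
  ultimately show ?thesis unfolding is_prime_def using one by blast
qed

lemma fraction_ideal_const: "is_prime p \<Longrightarrow> b \<notin> p \<Longrightarrow> [:r:] \<in> fraction_ideal p a b \<longleftrightarrow> r \<in> p"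
proof
  assume p: "is_prime p" "b \<notin> p" and "[:r:] \<in> fraction_ideal p a b"
  then obtain n where "[:b ^ n:] * [:r:] \<in> adj (coeff_ideal p) [:- a, b:]" unfolding fraction_ideal_def by blast
  then have "[:b ^ n * r:] \<in> adj (coeff_ideal p) [:- a, b:]" by (simp add: mult.commute)
  then show "r \<in> p" by (rule linear_multiple_const[OF p])
next
  assume p: "is_prime p" "b \<notin> p" and "r \<in> p"
  then have "[:r:] \<in> coeff_ideal p" unfolding coeff_ideal_def using idealD(1)[OF primeD(1)[OF p(1)]]
    by (auto simp: coeff_pCons split: nat.split)
  then have "[:b ^ 0:] * [:r:] \<in> adj (coeff_ideal p) [:- a, b:]" using adj_sub by auto
  then show "[:r:] \<in> fraction_ideal p a b" unfolding fraction_ideal_def by blast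
qed

lemma fraction_ideal_linear: "is_ideal p \<Longrightarrow> [:- a, b:] \<in> fraction_ideal p a b"
  unfolding fraction_ideal_def using adj_mem[OF ideal_coeff_ideal, of p "[:- a, b:]"]
  by (intro CollectI exI[of _ 0]) simp

text \<open>The fraction \<open>a/b\<close> lies in the maximal ideal of the localization at
  \<open>q\<close>, so modulo \<open>q\<close> the variable may be sent to zero.\<close>

lemma fraction_ideal_coeff_0:
  assumes "is_prime p" "is_prime q" "p \<subseteq> q" "a \<in> q" "b \<notin> q" "F \<in> fraction_ideal p a b"
  shows "coeff F 0 \<in> q"
proof -
  obtain n where "[:b ^ n:] * F \<in> adj (coeff_ideal p) [:- a, b:]" using assms(6) unfolding fraction_ideal_def by blast
  then obtain H G where H: "H \<in> coeff_ideal p" "[:b ^ n:] * F = H + G * [:- a, b:]" by (auto elim: adjE)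
  have "b ^ n * coeff F 0 = coeff H 0 + - (a * coeff G 0)"
    using arg_cong[OF H(2), of "\<lambda>f. coeff f 0"] unfolding coeff_add coeff_mult_linear by simp
  moreover have "coeff H 0 \<in> q" using H(1) assms(3) unfolding coeff_ideal_def by blast
  ultimately have "b ^ n * coeff F 0 \<in> q" using idealD[OF primeD(1)[OF assms(2)]] assms(4) by simp
  then show ?thesis using primeD(3)[OF assms(2)] prime_power[OF assms(2)] assms(5) by blast
qed

text \<open>Modulo \<open>s\<close> the fraction \<open>a/b\<close> is the ring element
  \<open>M\<close>, so evaluation at \<open>M\<close> respects the relation that defines the
  fraction ideal.\<close>

lemma fraction_ideal_poly:
  assumes "is_prime p" "is_prime s" "p \<subseteq> s" "a - b * M \<in> s" "b \<notin> s" "F \<in> fraction_ideal p a b"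
  shows "poly F M \<in> s"
proof -
  note ids = primeD(1)[OF assms(2)]
  obtain n where "[:b ^ n:] * F \<in> adj (coeff_ideal p) [:- a, b:]" using assms(6) unfolding fraction_ideal_def by blast
  then obtain H G where H: "H \<in> coeff_ideal p" "[:b ^ n:] * F = H + G * [:- a, b:]" by (auto elim: adjE)
  have "poly H M \<in> s" if "\<forall>i. coeff H i \<in> s" for H
    using that
  proof (induction H)
    case (pCons c H)
    have "c \<in> s" using pCons.prems[rule_format, of 0] by simp
    moreover have "\<forall>i. coeff H i \<in> s" using pCons.prems by (metis coeff_pCons_Suc)
    ultimately show ?case using pCons.IH idealD[OF ids] by simp
  qed (simp add: idealD[OF ids])
  then have "poly H M \<in> s" using H(1) assms(3) unfolding coeff_ideal_def by blast
  moreover have "b ^ n * poly F M = poly H M - poly G M * (a - b * M)"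
    using arg_cong[OF H(2), of "\<lambda>f. poly f M"] by (simp add: algebra_simps)
  ultimately have "b ^ n * poly F M \<in> s" using idealD[OF ids] assms(4) by simp
  then show ?thesis using primeD(3)[OF assms(2)] prime_power[OF assms(2)] assms(5) by blast
qed

lemma prime_const_coeff: "is_prime q \<Longrightarrow> is_prime {F. coeff F 0 \<in> q}"
  unfolding is_prime_def is_ideal_def by (auto simp: coeff_mult)

lemma prime_eval: "is_prime q \<Longrightarrow> is_prime {F. poly F M \<in> q}"
  unfolding is_prime_def is_ideal_def by auto

lemma prime_const_contract: "is_prime P \<Longrightarrow> is_prime {r. [:r:] \<in> P}"
proof -
  assume P: "is_prime P"
  have *: "[:a + b:] = [:a:] + [:b:]" "[:a * b:] = [:a:] * [:b:]" "[:1::'a:] = 1" "[:0::'a:] = 0" for a b :: 'a by simp_all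
  show "is_prime {r. [:r:] \<in> P}"
    unfolding is_prime_def is_ideal_def mem_Collect_eq *
    using primeD[OF P] idealD[OF primeD(1)[OF P]] by blast
qed

lemma poly_minus_eval: "\<exists>G. F = [:poly F M:] + G * [:- M, 1:]" for F :: "'f::comm_ring_1 poly"
proof (induction F)
  case (pCons c F)
  then obtain G where G: "F = [:poly F M:] + G * [:- M, 1:]" by blast
  have "pCons c F = [:c:] + [:0, 1:] * F" by simp
  also have "\<dots> = [:c:] + [:0, 1:] * ([:poly F M:] + G * [:- M, 1:])" using G by simp
  also have "\<dots> = [:c + M * poly F M:] + ([:0, 1:] * G + [:poly F M:]) * [:- M, 1:]"
    by (simp add: algebra_simps)
  finally show ?case by (metis poly_pCons)
qed (simp add: exI[of _ 0])

context noeth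
begin

text \<open>Geometrically, \<open>q'\<close> comes from the exceptional part of the hypersurface \<open>a = b\<^sup>2c\<^sup>k\<close>: the primes
  \<open>q'\<close> are contractions of components of \<open>T = b c\<^sup>k\<close> in the blow-up chart \<open>T = a/b\<close>.\<close>

lemma weak_existence_step:
  assumes pq: "prime_cover p q" and qQ: "prime_cover q Q" and I0: "I0 \<subseteq> p"
    and a: "a \<in> q" "a \<notin> p" and b: "b \<notin> q" and G: "q = gen (I0 \<union> G)"
      "\<And>g. g \<in> G \<Longrightarrow> \<exists>n. b * g ^ n \<in> adj p a"
    and c: "c \<in> Q" "c \<notin> q" and k: "k > 0"
  shows "\<exists>q'. prime_cover p q' \<and> prime_cover q' Q \<and> a - b * (b * c ^ k) \<in> q' \<and> b \<notin> q' \<and> c \<notin> q'"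
proof -
  interpret P: noeth "coeff_ideal I0" by (rule hilbert_basis)
  note p = prime_coverD(1,3)[OF pq] and q = prime_coverD(2)[OF pq] and Q = prime_coverD(2,3)[OF qQ]
  note idp = primeD(1)[OF p(1)] and idq = primeD(1)[OF q] and idQ = primeD(1)[OF Q(1)]
  have bp: "b \<notin> p" using b p(2) by blast
  define M where "M = b * c ^ k"
  have MQ: "M \<in> Q" unfolding M_def using primeD(3)[OF Q(1)] prime_power[OF Q(1)] c(1) k by blast
  have Mq: "M \<notin> q" unfolding M_def using primeD(3)[OF q] prime_power[OF q] c(2) b by blast
  have bMq: "b * M \<notin> q" using primeD(3)[OF q] Mq b by blast
  define L where "L = fraction_ideal p a b"
  have L: "is_prime L" unfolding L_def by (rule prime_fraction_ideal[OF p(1) bp])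
  have I0L: "coeff_ideal I0 \<subseteq> L"
  proof
    fix F assume "F \<in> coeff_ideal I0"
    then have "F \<in> coeff_ideal p" using I0 unfolding coeff_ideal_def by blast
    then have "[:b ^ 0:] * F \<in> adj (coeff_ideal p) [:- a, b:]" using adj_sub by auto
    then show "F \<in> L" unfolding L_def fraction_ideal_def by blast
  qed
  \<comment> \<open>The primes over \<open>q\<close> and \<open>Q\<close> that contain the variable.
    They put \<open>?QQ\<close> at least two steps above \<open>L\<close>.\<close>
  let ?qq = "{F. coeff F 0 \<in> q}" and ?QQ = "{F. coeff F 0 \<in> Q}"
  have qq: "is_prime ?qq" "is_prime ?QQ" using prime_const_coeff q Q(1) by blast+
  have "?qq \<noteq> ?QQ"
  proof -
    obtain x where "x \<in> Q" "x \<notin> q" using Q(2) by blast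
    then have "[:x:] \<in> ?QQ" "[:x:] \<notin> ?qq" by auto
    then show ?thesis by blast
  qed
  then have qqQQ: "?qq \<subset> ?QQ" using Q(2) by blast
  have "L \<subseteq> ?qq" unfolding L_def using fraction_ideal_coeff_0[OF p(1) q _ a(1) b] p(2) by blast
  moreover have "[:a:] \<in> ?qq" "[:a:] \<notin> L" using a fraction_ideal_const[OF p(1) bp] unfolding L_def by auto
  ultimately have Lqq: "L \<subset> ?qq" by blast
  define X where "X = [:- M, 1:]"
  have "X \<in> ?QQ" unfolding X_def using MQ idealD(5)[OF idQ] by simp
  then have adjQQ: "adj L X \<subseteq> ?QQ"
    using adj_le[OF primeD(1)[OF L] primeD(1)[OF qq(2)]] Lqq qqQQ by blast
  obtain W where W: "min_prime (adj L X) W" "W \<subseteq> ?QQ"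
    using P.min_prime_below[OF ideal_adj[OF primeD(1)[OF L]] _ qq(2) adjQQ] I0L adj_sub[of L X] by blast
  have Wp: "is_prime W" "L \<subseteq> W" "X \<in> W"
    using W(1) adj_le[OF primeD(1)[OF L] primeD(1)] unfolding min_prime_def by blast+
  note idW = primeD(1)[OF Wp(1)]
  \<comment> \<open>With \<open>?qq\<close> strictly between \<open>L\<close> and
    \<open>?QQ\<close>, the latter cannot be minimal over \<open>L + (X)\<close>.\<close>
  have "W \<noteq> ?QQ" using P.principal_ideal_theorem[OF L I0L _ qq(1) Lqq, of X] W(1) qqQQ by blast
  define q' where "q' = {r. [:r:] \<in> W}"
  have q': "is_prime q'" unfolding q'_def by (rule prime_const_contract[OF Wp(1)])
  note idq' = primeD(1)[OF q']
  have pq': "p \<subseteq> q'" unfolding q'_def using Wp(2) fraction_ideal_const[OF p(1) bp] unfolding L_def by blast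
  have q'Q: "q' \<subseteq> Q" unfolding q'_def using W(2) by auto
  have T: "[:0, 1:] - [:M:] \<in> W" using Wp(3) unfolding X_def by simp
  \<comment> \<open>If \<open>q'\<close> were \<open>Q\<close>, then \<open>W\<close> would contain
    \<open>M\<close>, hence the variable, hence all of \<open>?QQ\<close>.\<close>
  have q'neQ: "q' \<noteq> Q"
  proof
    assume "q' = Q"
    then have "[:M:] \<in> W" using MQ unfolding q'_def by blast
    then have T: "[:0, 1:] \<in> W" using ideal_diff_cancel[OF idW T] by blast
    have "F \<in> W" if "coeff F 0 \<in> Q" for F
    proof -
      obtain G where G: "F = [:poly F 0:] + G * [:- 0, 1:]" using poly_minus_eval by blast
      have "[:poly F 0:] \<in> W" using that \<open>q' = Q\<close> unfolding q'_def by (auto simp: poly_0_coeff_0)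
      moreover have "G * [:- 0, 1:] \<in> W" using idealD(3)[OF idW T] by simp
      ultimately show ?thesis using idealD(2)[OF idW] G by metis
    qed
    then show False using W(2) \<open>W \<noteq> ?QQ\<close> by blast
  qed
  have f: "a - b * M \<in> q'"
  proof -
    have "[:- a, b:] \<in> W" using fraction_ideal_linear[OF idp] Wp(2) unfolding L_def by blast
    moreover have "[:a - b * M:] = [:b:] * ([:0, 1:] - [:M:]) - [:- a, b:]" by simp
    ultimately have "[:a - b * M:] \<in> W" using idealD(3,6)[OF idW] T by metis
    then show ?thesis unfolding q'_def by blast
  qed
  \<comment> \<open>By the choice of \<open>b\<close>, a power of \<open>g\<close> is a multiple of
    \<open>a/b\<close>; in \<open>W\<close> the fraction becomes the variable and then
    \<open>M\<close>.\<close>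
  have gen: "\<exists>n r. g ^ n - M * r \<in> q'" if g: "g \<in> G" for g
  proof -
    obtain n where n: "b * g ^ n \<in> adj p a" using G(2)[OF g] by blast
    obtain p' r where p': "p' \<in> p" "b * g ^ n = p' + r * a" by (rule adjE[OF n])
    have "[:b:] * ([:g ^ n:] - [:r:] * [:0, 1:]) = [:p':] - [:r:] * [:- a, b:]"
      using p'(2) by (simp add: algebra_simps)
    also have "\<dots> \<in> L"
      using fraction_ideal_linear[OF idp, of a b] fraction_ideal_const[OF p(1) bp, of p' a] p'(1)
        idealD(3,6)[OF primeD(1)[OF L]] unfolding L_def by blast
    finally have "[:g ^ n:] - [:r:] * [:0, 1:] \<in> L"
      using primeD(3)[OF L] fraction_ideal_const[OF p(1) bp, of b a] bp unfolding L_def by blast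
    then have "([:g ^ n:] - [:r:] * [:0, 1:]) + [:r:] * ([:0, 1:] - [:M:]) \<in> W"
      using Wp(2) T idealD(2,3)[OF idW] by blast
    moreover have "([:g ^ n:] - [:r:] * [:0, 1:]) + [:r:] * ([:0, 1:] - [:M:]) = [:g ^ n - M * r:]"
      by (simp add: algebra_simps)
    ultimately show ?thesis unfolding q'_def by auto
  qed
  \<comment> \<open>Such an \<open>s\<close> contains \<open>b\<close> or \<open>c\<close>, hence
    \<open>M\<close>, hence every generator of \<open>q\<close>. It also contains
    \<open>b * c\<close>, which is outside \<open>q\<close>, and \<open>Q\<close> is adjacent to
    \<open>q\<close>.\<close>
  have over: "s = Q" if s: "is_prime s" "q' \<subseteq> s" "s \<subseteq> Q" "b * c \<in> s" for s
  proof -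
    have "b \<in> s \<or> c \<in> s" using s(4) primeD(3)[OF s(1)] by blast
    then have Ms: "M \<in> s" unfolding M_def using primeD(3)[OF s(1)] prime_power[OF s(1)] k by blast
    have "g \<in> s" if g: "g \<in> G" for g
    proof -
      obtain n r where nr: "g ^ n - M * r \<in> q'" using gen[OF g] by blast
      have "M * r \<in> s" using idealD(4)[OF primeD(1)[OF s(1)] Ms] .
      then have "g ^ n \<in> s" using ideal_diff_cancel[OF primeD(1)[OF s(1)]] nr s(2) by blast
      then show ?thesis using prime_power[OF s(1)] by blast
    qed
    then have "q \<subseteq> s" using G(1) gen_le[OF primeD(1)[OF s(1)]] I0 pq' s(2) by blast
    moreover have "b * c \<notin> q" using primeD(3)[OF q] b c(2) by blast
    ultimately show ?thesis using prime_coverD(4)[OF qQ s(1) _ s(3)] s(4) by blast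
  qed
  have bc: "b \<notin> q'" "c \<notin> q'"
    using over[OF q' order_refl q'Q] q'neQ primeD(3)[OF q', of b c] by blast+
  \<comment> \<open>Evaluation at \<open>M\<close> turns a prime over \<open>p + (a - b * M)\<close>
    inside \<open>q'\<close> into a prime over \<open>L + (X)\<close> inside \<open>W\<close>, so
    the minimality of \<open>W\<close> passes to \<open>q'\<close>.\<close>
  have min: "min_prime (adj p (a - b * M)) q'"
    unfolding min_prime_def
  proof (intro conjI allI impI q')
    show "adj p (a - b * M) \<subseteq> q'" using adj_le[OF idp idq'] pq' f by blast
    fix s assume s: "is_prime s" "adj p (a - b * M) \<subseteq> s" "s \<subseteq> q'"
    have s2: "p \<subseteq> s" "a - b * M \<in> s" using s(2) adj_le[OF idp primeD(1)[OF s(1)]] by blast+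
    have bs: "b \<notin> s" using bc s(3) by blast
    let ?S = "{F. poly F M \<in> s}"
    have "adj L X \<subseteq> ?S"
      using adj_le[OF primeD(1)[OF L] primeD(1)[OF prime_eval[OF s(1)]]]
        fraction_ideal_poly[OF p(1) s(1) s2 bs] idealD(1)[OF primeD(1)[OF s(1)]]
      unfolding L_def X_def by auto
    moreover have "?S \<subseteq> W"
    proof
      fix F assume "F \<in> ?S"
      then have F: "[:poly F M:] \<in> W" using s(3) unfolding q'_def by blast
      obtain G where "F = [:poly F M:] + G * [:- M, 1:]" using poly_minus_eval by blast
      then show "F \<in> W" using F idealD(2,3)[OF idW] Wp(3) unfolding X_def by metis
    qed
    ultimately have "?S = W" using W(1) prime_eval[OF s(1)] unfolding min_prime_def by blast
    then show "s = q'" unfolding q'_def by auto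
  qed
  have fp: "a - b * M \<notin> p"
    using ideal_diff_cancel[OF idq, of a "b * M"] a(1) bMq p(2) by blast
  have "prime_cover p q'"
    unfolding prime_cover_def using p(1) q' pq' f fp principal_ideal_theorem[OF p(1) I0 min] by blast
  moreover have "prime_cover q' Q"
  proof -
    have "min_prime (adj q' (b * c)) Q"
      unfolding min_prime_def
    proof (intro conjI allI impI Q(1))
      show "adj q' (b * c) \<subseteq> Q" using adj_le[OF idq' idQ] q'Q idealD(3)[OF idQ c(1)] by blast
      show "s = Q" if "is_prime s" "adj q' (b * c) \<subseteq> s" "s \<subseteq> Q" for s
        using over[OF that(1)] that adj_le[OF idq' primeD(1)[OF that(1)]] by blast
    qed
    then show ?thesis
      unfolding prime_cover_def using Q(1) q' q'Q q'neQ principal_ideal_theorem[OF q'] I0 pq' by blast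
  qed
  ultimately show ?thesis using f bc unfolding M_def by blast
qed

text \<open>Different exponents of \<open>c\<close> give different primes. Two of the relations in
  one prime that omits \<open>b\<close> and \<open>c\<close> would force
  \<open>1 - c ^ (l - k)\<close> into it, hence into \<open>Q\<close>, although \<open>c\<close>
  lies in \<open>Q\<close>.\<close>

theorem weak_existence:
  assumes pq: "prime_cover p q" and qQ: "prime_cover q Q" and I0: "I0 \<subseteq> p"
  shows "infinite {q'. prime_cover p q' \<and> prime_cover q' Q}"
proof -
  note p = prime_coverD(1,3)[OF pq] and q = prime_coverD(2)[OF pq] and Q = prime_coverD(2,3)[OF qQ]
  obtain a where a: "a \<in> q" "a \<notin> p" using p(2) by blast
  obtain c where c: "c \<in> Q" "c \<notin> q" using Q(2) by blast
  obtain G where G: "finite G" "q = gen (I0 \<union> G)"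
    using finitely_generated[OF primeD(1)[OF q]] I0 p(2) by blast
  have "\<forall>g\<in>G. \<exists>s n. s \<notin> q \<and> s * g ^ n \<in> adj p a"
  proof
    fix g assume "g \<in> G"
    then have "g \<in> q" using G(2) gen_sub by blast
    then show "\<exists>s n. s \<notin> q \<and> s * g ^ n \<in> adj p a"
      using min_prime_power[OF ideal_adj[OF primeD(1)[OF p(1)]] _ prime_cover_min_prime[OF pq a]]
        I0 adj_sub[of p a] by blast
  qed
  then obtain s n where sn: "\<And>g. g \<in> G \<Longrightarrow> s g \<notin> q \<and> s g * g ^ n g \<in> adj p a" by metis
  \<comment> \<open>One denominator that serves all generators of \<open>q\<close> at once.\<close>
  define b where "b = prod s G"
  have b: "b \<notin> q" unfolding b_def using prime_prod[OF q G(1)] sn by blast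
  have bg: "\<exists>n. b * g ^ n \<in> adj p a" if "g \<in> G" for g
  proof -
    have "b * g ^ n g = prod s (G - {g}) * (s g * g ^ n g)"
      unfolding b_def using prod.remove[OF G(1) that, of s] by (simp add: mult_ac)
    then show ?thesis using sn[OF that] idealD(3)[OF ideal_adj[OF primeD(1)[OF p(1)]]] by metis
  qed
  have "\<forall>k. \<exists>q'. prime_cover p q' \<and> prime_cover q' Q \<and> a - b * (b * c ^ Suc k) \<in> q' \<and> b \<notin> q' \<and> c \<notin> q'"
    using weak_existence_step[OF pq qQ I0 a b G(2) bg c] by blast
  then obtain f where f: "\<And>k. prime_cover p (f k) \<and> prime_cover (f k) Q \<and> a - b * (b * c ^ Suc k) \<in> f k \<and> b \<notin> f k \<and> c \<notin> f k"
    by metis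
  have ne: "f k \<noteq> f l" if "k < l" for k l
  proof
    assume eq: "f k = f l"
    have fk: "is_prime (f k)" "f k \<subseteq> Q" using f[of k] prime_coverD by blast+
    have l: "Suc l = Suc k + (l - k)" using that by simp
    have "(a - b * (b * c ^ Suc l)) - (a - b * (b * c ^ Suc k)) = b * b * c ^ Suc k * (1 - c ^ (l - k))"
      unfolding l power_add by (simp add: algebra_simps)
    then have "b * b * c ^ Suc k * (1 - c ^ (l - k)) \<in> f k"
      using f[of k] f[of l] eq idealD(6)[OF primeD(1)[OF fk(1)]] by metis
    then have "b \<in> f k \<or> c \<in> f k \<or> 1 - c ^ (l - k) \<in> f k"
      by (auto simp: primeD(3)[OF fk(1)] prime_power[OF fk(1)])
    then have "1 - c ^ (l - k) \<in> f k" using f[of k] by blast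
    then have "1 - c ^ (l - k) \<in> Q" using fk(2) by blast
    moreover have "c ^ (l - k) \<in> Q" using c(1) prime_power[OF Q(1)] that by simp
    ultimately show False using ideal_diff_cancel[OF primeD(1)[OF Q(1)]] primeD(2)[OF Q(1)] by blast
  qed
  have "inj f" using ne by (metis injI linorder_neqE_nat)
  then have "infinite (range f)" using finite_imageD infinite_UNIV_nat by blast
  moreover have "range f \<subseteq> {q'. prime_cover p q' \<and> prime_cover q' Q}" using f by blast
  ultimately show ?thesis using finite_subset by blast
qed

end

section \<open>Local domains and saturated chains\<close>

context noeth
begin

text \<open>Localized at \<open>q\<close>, a power of \<open>q\<close> lies in \<open>J\<close>: the
  bounds for \<open>J + (a)\<close> and \<open>J + (b)\<close> multiply, and the exponents add.
  Products of \<open>n\<close> elements stand for the \<open>n\<close>-th power of the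
  ideal.\<close>

lemma min_prime_products:
  assumes "is_ideal J" "I0 \<subseteq> J" "is_prime q" and "\<And>P. is_prime P \<Longrightarrow> J \<subseteq> P \<Longrightarrow> P \<subseteq> q \<Longrightarrow> P = q"
  shows "\<exists>t n. t \<notin> q \<and> (\<forall>xs. set xs \<subseteq> q \<longrightarrow> length xs = n \<longrightarrow> t * prod_list xs \<in> J)"
  using assms(1,2,4)
proof (induction rule: noeth_induct)
  case (step J)
  consider "\<not> J \<subseteq> q" | "J = q" | "J \<subset> q" by blast
  then show ?case
  proof cases
    case 1
    then obtain t where "t \<in> J" "t \<notin> q" by blast
    then show ?thesis using idealD(4)[OF step(1)] by blast
  next
    case 2
    have "1 * prod_list xs \<in> J" if xs: "set xs \<subseteq> q" "length xs = 1" for xs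
    proof -
      obtain x where "xs = [x]" using xs(2) by (cases xs) auto
      then show ?thesis using xs(1) 2 by simp
    qed
    then show ?thesis using primeD(2)[OF assms(3)] by blast
  next
    case 3
    then have "\<not> is_prime J" "1 \<notin> J" using step(4)[of J] primeD(2)[OF assms(3)] by blast+
    then obtain a b where ab: "a \<notin> J" "b \<notin> J" "a * b \<in> J"
      using not_prime_split[OF step(1)] by metis
    have adj: "is_ideal (adj J a)" "is_ideal (adj J b)" "J \<subset> adj J a" "J \<subset> adj J b"
      using ideal_adj[OF step(1)] adj_sub[of J] adj_mem[OF step(1)] ab by blast+
    obtain s m where s: "s \<notin> q" "\<And>xs. set xs \<subseteq> q \<Longrightarrow> length xs = m \<Longrightarrow> s * prod_list xs \<in> adj J a"
      using step(3)[OF adj(1,3)] step(4) adj(3) by (meson order_trans psubset_imp_subset)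
    obtain t n where t: "t \<notin> q" "\<And>xs. set xs \<subseteq> q \<Longrightarrow> length xs = n \<Longrightarrow> t * prod_list xs \<in> adj J b"
      using step(3)[OF adj(2,4)] step(4) adj(4) by (meson order_trans psubset_imp_subset)
    have "(s * t) * prod_list xs \<in> J" if xs: "set xs \<subseteq> q" "length xs = m + n" for xs
    proof -
      have "set (take m xs) \<subseteq> q" "set (drop m xs) \<subseteq> q" "length (take m xs) = m" "length (drop m xs) = n"
        using xs set_take_subset[of m xs] set_drop_subset[of m xs] by auto
      then have "(s * prod_list (take m xs)) * (t * prod_list (drop m xs)) \<in> J"
        using colon_prod_adj[OF step(1) s(2) t(2) ab(3)] by blast
      moreover have "prod_list xs = prod_list (take m xs) * prod_list (drop m xs)"
        by (metis append_take_drop_id prod_list.append)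
      ultimately show ?thesis by (simp add: mult_ac)
    qed
    moreover have "s * t \<notin> q" using s(1) t(1) primeD(3)[OF assms(3)] by blast
    ultimately show ?thesis by blast
  qed
qed

end

locale local_noeth_domain = noeth I0 for I0 :: "'f::comm_ring_1 set" +
  fixes \<mm> :: "'f set" and d :: nat
  assumes prime_I0: "is_prime I0" and prime_m: "is_prime \<mm>"
    and local: "\<And>P. is_prime P \<Longrightarrow> I0 \<subseteq> P \<Longrightarrow> P \<subseteq> \<mm>"
    and chain_d: "\<exists>C. prime_chain_in d C" and chain_le: "\<And>n C. prime_chain_in n C \<Longrightarrow> n \<le> d"
begin

section \<open>Height and coheight of primes\<close>

definition spec :: "'f set \<Rightarrow> bool" where "spec P \<longleftrightarrow> is_prime P \<and> I0 \<subseteq> P"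

definition ht :: "'f set \<Rightarrow> nat" where "ht q = (GREATEST n. \<exists>C. prime_chain_in n C \<and> C n = q)"

text \<open>The Krull dimension of the quotient by \<open>q\<close>. Chain lengths are bounded by
  \<open>d\<close>, so for a prime over \<open>I0\<close> the greatest value is attained, here as
  well as in \<open>ht\<close>.\<close>

definition coht :: "'f set \<Rightarrow> nat" where "coht q = (GREATEST n. \<exists>C. prime_chain_in n C \<and> C 0 = q)"

lemma I0_sub_m: "I0 \<subseteq> \<mm>" using local prime_I0 by blast

lemma spec_I0: "spec I0" and spec_m: "spec \<mm>" and spec_le_m: "spec P \<Longrightarrow> P \<subseteq> \<mm>"
  using prime_I0 prime_m I0_sub_m local by (auto simp: spec_def)

lemma specD: "spec P \<Longrightarrow> is_prime P" "spec P \<Longrightarrow> is_ideal P" "spec P \<Longrightarrow> I0 \<subseteq> P"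
  using primeD(1) by (auto simp: spec_def)

lemma chain_spec: "prime_chain_in n C \<Longrightarrow> i \<le> n \<Longrightarrow> spec (C i)"
  by (auto simp: prime_chain_in_def spec_def)

lemma chain_mono: "prime_chain_in n C \<Longrightarrow> i \<le> j \<Longrightarrow> j \<le> n \<Longrightarrow> C i \<subseteq> C j"
proof (induction j)
  case (Suc j)
  then have "C i \<subseteq> C j \<or> i = Suc j" "C j \<subset> C (Suc j)" by (auto simp: prime_chain_in_def)
  then show ?case by blast
qed simp

lemma chain_const: "spec q \<Longrightarrow> prime_chain_in 0 (\<lambda>_. q)"
  by (auto simp: prime_chain_in_def spec_def)

lemma chain_pair: "spec p \<Longrightarrow> spec q \<Longrightarrow> p \<subset> q \<Longrightarrow> prime_chain_in 1 (\<lambda>i. if i = 0 then p else q)"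
  by (auto simp: prime_chain_in_def spec_def)

lemma chain_append:
  assumes "prime_chain_in a C" "prime_chain_in b D" "C a = D 0"
  shows "prime_chain_in (a + b) (\<lambda>i. if i \<le> a then C i else D (i - a))"
  unfolding prime_chain_in_def
proof (intro conjI allI impI)
  fix i
  show "is_prime (if i \<le> a then C i else D (i - a))" "I0 \<subseteq> (if i \<le> a then C i else D (i - a))" if "i \<le> a + b"
    using that assms(1,2) by (auto simp: prime_chain_in_def)
  assume i: "i < a + b"
  show "(if i \<le> a then C i else D (i - a)) \<subset> (if Suc i \<le> a then C (Suc i) else D (Suc i - a))"
  proof (cases "i < a")
    case True
    then show ?thesis using assms(1) by (auto simp: prime_chain_in_def)
  next
    case False
    then have "D (i - a) \<subset> D (Suc (i - a))" using assms(2) i by (auto simp: prime_chain_in_def)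
    moreover have "Suc i - a = Suc (i - a)" using False by simp
    moreover have "i \<le> a \<Longrightarrow> C i = D (i - a)" using False assms(3) by (metis diff_is_0_eq' le_neq_implies_less)
    ultimately show ?thesis using False by auto
  qed
qed

lemma chain_shift: "prime_chain_in n C \<Longrightarrow> i \<le> n \<Longrightarrow> prime_chain_in (n - i) (\<lambda>j. C (i + j))"
  by (auto simp: prime_chain_in_def)

lemma chain_take: "prime_chain_in n C \<Longrightarrow> i \<le> n \<Longrightarrow> prime_chain_in i C"
  by (auto simp: prime_chain_in_def)

lemma ht_ge: "prime_chain_in n C \<Longrightarrow> C n = q \<Longrightarrow> n \<le> ht q"
  unfolding ht_def by (rule Greatest_le_nat[where b = d]) (use chain_le in auto)

lemma coht_ge: "prime_chain_in n C \<Longrightarrow> C 0 = q \<Longrightarrow> n \<le> coht q"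
  unfolding coht_def by (rule Greatest_le_nat[where b = d]) (use chain_le in auto)

lemma ht_chain: "spec q \<Longrightarrow> \<exists>C. prime_chain_in (ht q) C \<and> C (ht q) = q"
  unfolding ht_def by (rule GreatestI_nat[where k = 0 and b = d]) (use chain_le chain_const in auto)

lemma coht_chain: "spec q \<Longrightarrow> \<exists>C. prime_chain_in (coht q) C \<and> C 0 = q"
  unfolding coht_def by (rule GreatestI_nat[where k = 0 and b = d]) (use chain_le chain_const in auto)

lemma ht_coht_le: assumes "spec q" shows "ht q + coht q \<le> d"
proof -
  obtain C D where "prime_chain_in (ht q) C" "C (ht q) = q" "prime_chain_in (coht q) D" "D 0 = q"
    using ht_chain[OF assms] coht_chain[OF assms] by blast
  then show ?thesis using chain_append chain_le by metis
qed

lemma ht_less: assumes "spec p" "spec q" "p \<subset> q" shows "ht p < ht q"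
proof -
  obtain C where C: "prime_chain_in (ht p) C" "C (ht p) = p" using ht_chain[OF assms(1)] by blast
  have "ht p + 1 \<le> ht q"
    by (rule ht_ge[OF chain_append[OF C(1) chain_pair[OF assms]]]) (use C in auto)
  then show ?thesis by simp
qed

lemma coht_less: assumes "spec p" "spec q" "p \<subset> q" shows "coht q < coht p"
proof -
  obtain C where C: "prime_chain_in (coht q) C" "C 0 = q" using coht_chain[OF assms(2)] by blast
  have "1 + coht q \<le> coht p"
    by (rule coht_ge[OF chain_append[OF chain_pair[OF assms] C(1)]]) (use C in auto)
  then show ?thesis by simp
qed

lemma ht_mono: "spec p \<Longrightarrow> spec q \<Longrightarrow> p \<subseteq> q \<Longrightarrow> ht p \<le> ht q"
  using ht_less by (cases "p = q") (auto simp: less_imp_le psubset_eq)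

lemma coht_mono: "spec p \<Longrightarrow> spec q \<Longrightarrow> p \<subseteq> q \<Longrightarrow> coht q \<le> coht p"
  using coht_less by (cases "p = q") (auto simp: less_imp_le psubset_eq)

lemma coht_m: "coht \<mm> = 0"
proof -
  obtain C where C: "prime_chain_in (coht \<mm>) C" "C 0 = \<mm>" using coht_chain[OF spec_m] by blast
  have "\<not> 0 < coht \<mm>"
  proof
    assume "0 < coht \<mm>"
    then have "C 0 \<subset> C (Suc 0)" "spec (C (Suc 0))" using C by (auto simp: prime_chain_in_def spec_def)
    then show False using C(2) spec_le_m by blast
  qed
  then show ?thesis by simp
qed

lemma coht_0_imp: "spec P \<Longrightarrow> coht P = 0 \<Longrightarrow> P = \<mm>"
  using coht_less[OF _ spec_m] spec_le_m by (metis not_less_zero psubset_eq)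

text \<open>The two pieces of the chain at \<open>C i\<close> give \<open>ht (C i) \<ge> i\<close>
  and \<open>coht (C i) \<ge> d - i\<close>, while the sum is at most \<open>d\<close>. So both are
  equalities.\<close>

lemma top_chain:
  assumes "prime_chain_in d C" shows "C 0 = I0" "C d = \<mm>" "i \<le> d \<Longrightarrow> ht (C i) = i"
proof -
  have h: "ht (C i) = i" "coht (C i) = d - i" if "i \<le> d" for i
  proof -
    have "i \<le> ht (C i)" using ht_ge[OF chain_take[OF assms that]] by blast
    moreover have "d - i \<le> coht (C i)" using coht_ge[OF chain_shift[OF assms that]] by simp
    ultimately show "ht (C i) = i" "coht (C i) = d - i"
      using ht_coht_le[OF chain_spec[OF assms that]] that by linarith+
  qed
  show "i \<le> d \<Longrightarrow> ht (C i) = i" by (rule h)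
  show "C d = \<mm>" using coht_0_imp[OF chain_spec[OF assms]] h[of d] by simp
  show "C 0 = I0"
    using ht_less[OF spec_I0 chain_spec[OF assms, of 0]] h(1)[of 0] specD(3)[OF chain_spec[OF assms, of 0]] by auto
qed

section \<open>Partial systems of parameters\<close>

definition params :: "'f list \<Rightarrow> bool" where
  "params xs \<longleftrightarrow> (\<forall>P. spec P \<longrightarrow> set xs \<subseteq> P \<longrightarrow> length xs \<le> ht P)"

text \<open>\<open>params\<close> asks that the elements generate an ideal of the largest possible
  height, \<open>coparams\<close> only that they lower the dimension of the quotient as far as
  possible. The two differ for a prime with \<open>ht p + coht p < d\<close>:
  \<open>bad_prime_params\<close> uses \<open>ht p + 1\<close> elements of \<open>p\<close> that
  satisfy the second condition.\<close>

definition coparams :: "'f list \<Rightarrow> bool" where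
  "coparams xs \<longleftrightarrow> (\<forall>P. spec P \<longrightarrow> set xs \<subseteq> P \<longrightarrow> length xs + coht P \<le> d)"

lemma params_imp_coparams: "params xs \<Longrightarrow> coparams xs"
  unfolding params_def coparams_def using ht_coht_le by (meson add_le_mono1 order_trans)

lemma min_prime_gen_spec:
  assumes "min_prime (gen (I0 \<union> S)) r" shows "spec r" "S \<subseteq> r"
  using assms gen_sub[of "I0 \<union> S"] by (auto simp: min_prime_def spec_def)

lemma min_prime_gen_below: "spec P \<Longrightarrow> S \<subseteq> P \<Longrightarrow> \<exists>r. min_prime (gen (I0 \<union> S)) r \<and> r \<subseteq> P"
proof (rule min_prime_below[OF ideal_gen])
  show "I0 \<subseteq> gen (I0 \<union> S)" using gen_sub by blast
  show "spec P \<Longrightarrow> S \<subseteq> P \<Longrightarrow> gen (I0 \<union> S) \<subseteq> P" by (simp add: gen_le specD)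
qed (simp add: spec_def)

lemma min_prime_gen_avoid:
  assumes "is_ideal q"
  shows "\<exists>y\<in>q. \<forall>r. min_prime (gen (I0 \<union> S)) r \<longrightarrow> \<not> q \<subseteq> r \<longrightarrow> y \<notin> r"
proof -
  let ?R = "{r. min_prime (gen (I0 \<union> S)) r \<and> \<not> q \<subseteq> r}"
  have "I0 \<subseteq> gen (I0 \<union> S)" using gen_sub by blast
  then have "finite ?R" using finite_min_primes[OF ideal_gen] by simp
  then have "\<exists>y\<in>q. \<forall>r\<in>?R. y \<notin> r"
    by (rule prime_avoidance) (use assms in \<open>auto simp: min_prime_def\<close>)
  then show ?thesis by blast
qed

text \<open>The element avoids every minimal prime of \<open>xs\<close> that does not contain
  \<open>q\<close>, so the height grows there. A prime that contains \<open>q\<close> has sufficient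
  height already.\<close>

lemma params_extend:
  assumes "params xs" "spec q" "length xs < ht q"
  shows "\<exists>y\<in>q. params (xs @ [y]) \<and> (\<forall>r. min_prime (gen (I0 \<union> set xs)) r \<longrightarrow> \<not> q \<subseteq> r \<longrightarrow> y \<notin> r)"
proof -
  obtain y where y: "y \<in> q" "\<And>r. min_prime (gen (I0 \<union> set xs)) r \<Longrightarrow> \<not> q \<subseteq> r \<Longrightarrow> y \<notin> r"
    using min_prime_gen_avoid[OF specD(2)[OF assms(2)]] by metis
  have "length (xs @ [y]) \<le> ht P" if P: "spec P" "set (xs @ [y]) \<subseteq> P" for P
  proof -
    obtain r where r: "min_prime (gen (I0 \<union> set xs)) r" "r \<subseteq> P"
      using min_prime_gen_below[OF P(1), of "set xs"] P(2) by auto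
    note rs = min_prime_gen_spec[OF r(1)]
    have r1: "length xs \<le> ht r" using assms(1) rs by (auto simp: params_def)
    show ?thesis
    proof (cases "q \<subseteq> r")
      case True
      then have "ht q \<le> ht P" using ht_mono[OF assms(2) P(1)] r(2) by blast
      then show ?thesis using assms(3) by simp
    next
      case False
      then have "r \<subset> P" using y(2)[OF r(1)] P(2) r(2) by auto
      then show ?thesis using ht_less[OF rs(1) P(1)] r1 by simp
    qed
  qed
  then show ?thesis using y unfolding params_def by blast
qed

lemma params_Nil: "params []" by (simp add: params_def)

lemma params_ex: assumes "spec p" "n \<le> ht p" shows "\<exists>xs. length xs = n \<and> set xs \<subseteq> p \<and> params xs"
  using assms(2)
proof (induction n)
  case 0
  then show ?case using params_Nil by (intro exI[of _ "[]"]) simp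
next
  case (Suc n)
  then obtain xs where xs: "length xs = n" "set xs \<subseteq> p" "params xs" by auto
  obtain y where "y \<in> p" "params (xs @ [y])" using params_extend[OF xs(3) assms(1)] xs(1) Suc.prems by auto
  then show ?case using xs by (intro exI[of _ "xs @ [y]"]) auto
qed

lemma params_min_prime:
  assumes "params xs" "set xs \<subseteq> p" "length xs = ht p" "spec p" shows "min_prime (gen (I0 \<union> set xs)) p"
  unfolding min_prime_def
proof (intro conjI allI impI)
  show "is_prime p" using assms by (simp add: spec_def)
  show "gen (I0 \<union> set xs) \<subseteq> p" using assms(2,4) by (simp add: gen_le specD)
  fix Q assume Q: "is_prime Q" "gen (I0 \<union> set xs) \<subseteq> Q" "Q \<subseteq> p"
  then have "spec Q" "set xs \<subseteq> Q" using gen_sub[of "I0 \<union> set xs"] by (auto simp: spec_def)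
  then have "ht p \<le> ht Q" using assms by (auto simp: params_def)
  then show "Q = p" using ht_less[OF \<open>spec Q\<close> assms(4)] Q(3) by (metis leD psubset_eq)
qed

text \<open>\<open>p\<close> is minimal over \<open>ht p\<close> elements. If it is their only
  minimal prime below \<open>q\<close>, one more element makes \<open>q\<close> minimal over
  \<open>ht p + 1\<close> elements, and Krull's theorem bounds its height. Otherwise
  \<open>q\<close> is minimal over \<open>p\<close> together with another minimal prime
  \<open>r\<close>, which leaves finitely many choices.\<close>

theorem finite_bad_covers:
  assumes "spec p" shows "finite {q. prime_cover p q \<and> ht q > ht p + 1}"
proof -
  obtain xs where xs: "length xs = ht p" "set xs \<subseteq> p" "params xs" using params_ex[OF assms order_refl] by blast
  note pmin = params_min_prime[OF xs(3,2,1) assms]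
  let ?R = "{r. min_prime (gen (I0 \<union> set xs)) r}"
  have I0: "I0 \<subseteq> gen (I0 \<union> S)" for S using gen_sub by blast
  have "{q. prime_cover p q \<and> ht q > ht p + 1} \<subseteq> (\<Union>r\<in>?R. {q. min_prime (gen (I0 \<union> (p \<union> r))) q})"
  proof
    fix q assume "q \<in> {q. prime_cover p q \<and> ht q > ht p + 1}"
    then have q: "prime_cover p q" "ht q > ht p + 1" by auto
    note pq = prime_coverD[OF q(1)]
    have sq: "spec q" using pq specD(3)[OF assms] by (auto simp: spec_def)
    obtain y where y: "y \<in> q" "y \<notin> p" using pq(3) by blast
    have "\<exists>r. min_prime (gen (I0 \<union> set xs)) r \<and> r \<noteq> p \<and> r \<subseteq> q"
    proof (rule ccontr)
      assume *: "\<not> ?thesis"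
      have "min_prime (gen (I0 \<union> set (y # xs))) q"
        unfolding min_prime_def
      proof (intro conjI allI impI pq(2))
        show "gen (I0 \<union> set (y # xs)) \<subseteq> q"
          using gen_le[OF specD(2)[OF sq]] specD(3)[OF sq] y xs(2) pq(3) by auto
        fix Q assume Q: "is_prime Q" "gen (I0 \<union> set (y # xs)) \<subseteq> Q" "Q \<subseteq> q"
        have Q2: "spec Q" "set xs \<subseteq> Q" "y \<in> Q"
          using Q(1,2) gen_sub[of "I0 \<union> set (y # xs)"] by (auto simp: spec_def)
        then obtain r where r: "min_prime (gen (I0 \<union> set xs)) r" "r \<subseteq> Q" using min_prime_gen_below by blast
        then have "r = p" using * Q(3) by blast
        then show "Q = q" using pq(4)[OF Q(1) _ Q(3)] r(2) Q2(3) y(2) by blast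
      qed
      moreover obtain C where "prime_chain_in (ht q) C" "C (ht q) = q" using ht_chain[OF sq] by blast
      ultimately have "ht q \<le> length (y # xs)" using krull_height by blast
      then show False using q(2) xs(1) by simp
    qed
    then obtain r where r: "min_prime (gen (I0 \<union> set xs)) r" "r \<noteq> p" "r \<subseteq> q" by blast
    have rp: "\<not> r \<subseteq> p" using r(1,2) pmin by (auto simp: min_prime_def)
    have "min_prime (gen (I0 \<union> (p \<union> r))) q"
      unfolding min_prime_def
    proof (intro conjI allI impI pq(2))
      show "gen (I0 \<union> (p \<union> r)) \<subseteq> q" using gen_le[OF specD(2)[OF sq]] specD(3)[OF sq] pq(3) r(3) by auto
      fix Q assume Q: "is_prime Q" "gen (I0 \<union> (p \<union> r)) \<subseteq> Q" "Q \<subseteq> q"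
      then have "p \<union> r \<subseteq> Q" using gen_sub[of "I0 \<union> (p \<union> r)"] by blast
      then show "Q = q" using pq(4)[OF Q(1) _ Q(3)] rp by blast
    qed
    then show "q \<in> (\<Union>r\<in>?R. {q. min_prime (gen (I0 \<union> (p \<union> r))) q})" using r(1) by blast
  qed
  moreover have "finite (\<Union>r\<in>?R. {q. min_prime (gen (I0 \<union> (p \<union> r))) q})"
    using finite_min_primes[OF ideal_gen I0] by blast
  ultimately show ?thesis using finite_subset by blast
qed

section \<open>Ratliff's theorem on saturated chains\<close>

definition sat_chain :: "nat \<Rightarrow> (nat \<Rightarrow> 'f set) \<Rightarrow> bool" where
  "sat_chain n C \<longleftrightarrow> prime_chain_in n C \<and> (\<forall>i<n. prime_cover (C i) (C (Suc i)))"

lemma sat_chain_shift: "sat_chain (Suc n) C \<Longrightarrow> sat_chain n (\<lambda>i. C (Suc i))"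
  using chain_shift[of "Suc n" C 1] by (auto simp: sat_chain_def)

text \<open>If \<open>coht (C 0)\<close> exceeded the length, each of the infinitely many primes
  \<open>q\<close> that can replace \<open>C 1\<close> would have coheight \<open>j\<close> by
  induction. Its height \<open>d - j\<close> would then be more than \<open>ht (C 0) + 1\<close>,
  against \<open>finite_bad_covers\<close>.\<close>

theorem ratliff:
  assumes eq: "\<And>q. spec q \<Longrightarrow> ht q + coht q = d"
  shows "sat_chain j C \<Longrightarrow> C j = \<mm> \<Longrightarrow> coht (C 0) = j"
proof (induction j arbitrary: C)
  case 0
  then show ?case using coht_m by simp
next
  case (Suc j)
  have C: "prime_chain_in (Suc j) C" "\<And>i. i < Suc j \<Longrightarrow> prime_cover (C i) (C (Suc i))"
    using Suc.prems by (auto simp: sat_chain_def)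
  have s: "i \<le> Suc j \<Longrightarrow> spec (C i)" for i using chain_spec[OF C(1)] .
  have IH: "coht (C 1) = j" using Suc.IH[OF sat_chain_shift[OF Suc.prems(1)]] Suc.prems(2) by simp
  have ge: "Suc j \<le> coht (C 0)" using coht_ge[OF C(1)] by simp
  show ?case
  proof (rule ccontr)
    assume ne: "coht (C 0) \<noteq> Suc j"
    show False
    proof (cases j)
      \<comment> \<open>A single step leaves no \<open>C 2\<close> under which to interpolate; here
        a longer chain contradicts adjacency directly.\<close>
      case 0
      have cov: "prime_cover (C 0) \<mm>" using C(2)[of 0] Suc.prems(2) 0 by simp
      obtain D where D: "prime_chain_in (coht (C 0)) D" "D 0 = C 0" using coht_chain[OF s[of 0]] by blast
      have "1 < coht (C 0)" using ne ge 0 by simp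
      then have D2: "D 0 \<subset> D (Suc 0)" "D (Suc 0) \<subset> D (Suc (Suc 0))" "is_prime (D (Suc 0))" "spec (D (Suc (Suc 0)))"
        using D(1) by (simp_all add: prime_chain_in_def spec_def)
      have "D (Suc 0) \<subset> \<mm>" using D2(2) spec_le_m[OF D2(4)] by blast
      then show False using cov D2(1,3) D(2) unfolding prime_cover_def by simp
    next
      case (Suc i)
      have "infinite {q'. prime_cover (C 0) q' \<and> prime_cover q' (C 2)}"
        using weak_existence[OF C(2)[of 0] ] C(2)[of 1] Suc specD(3)[OF s[of 0]] by (simp add: numeral_2_eq_2)
      moreover have "{q'. prime_cover (C 0) q' \<and> prime_cover q' (C 2)} \<subseteq> {q. prime_cover (C 0) q \<and> ht q > ht (C 0) + 1}"
      proof
        fix q assume "q \<in> {q'. prime_cover (C 0) q' \<and> prime_cover q' (C 2)}"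
        then have q: "prime_cover (C 0) q" "prime_cover q (C 2)" by auto
        have sq: "spec q" using prime_coverD(2,3)[OF q(1)] specD(3)[OF s[of 0]] by (auto simp: spec_def)
        let ?D = "(\<lambda>k. C (Suc k))(0 := q)"
        have "sat_chain j ?D"
          unfolding sat_chain_def prime_chain_in_def
        proof (intro conjI allI impI)
          fix k
          show "is_prime (?D k)" "I0 \<subseteq> ?D k" if "k \<le> j" using s[of "Suc k"] sq that by (auto simp: spec_def)
          show "prime_cover (?D k) (?D (Suc k))" if "k < j" for k
            using C(2)[of "Suc k"] that q(2) by (cases k) (auto simp: numeral_2_eq_2)
          then show "?D k \<subset> ?D (Suc k)" if "k < j" using prime_coverD(3) that by blast
        qed
        then have "coht (?D 0) = j" by (rule Suc.IH) (use Suc.prems(2) \<open>j = Suc i\<close> in auto)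
        then have "coht q = j" by simp
        then have "ht q > ht (C 0) + 1" using eq[OF sq] eq[OF s[of 0]] ne ge by simp
        then show "q \<in> {q. prime_cover (C 0) q \<and> ht q > ht (C 0) + 1}" using q(1) by blast
      qed
      ultimately show False using finite_bad_covers[OF s[of 0]] finite_subset by blast
    qed
  qed
qed

text \<open>Applied to \<open>ht\<close> and to \<open>d - coht\<close>, which rise by exactly one
  along a longest chain.\<close>

lemma chain_coverI:
  fixes f :: "'f set \<Rightarrow> nat"
  assumes C: "prime_chain_in n C" and f: "\<And>p q. spec p \<Longrightarrow> spec q \<Longrightarrow> p \<subset> q \<Longrightarrow> f p < f q"
    and "i < n" "f (C (Suc i)) = Suc (f (C i))"
  shows "prime_cover (C i) (C (Suc i))"
proof -
  have s: "spec (C i)" "spec (C (Suc i))" "C i \<subset> C (Suc i)"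
    using chain_spec[OF C] \<open>i < n\<close> C by (auto simp: prime_chain_in_def)
  have False if r: "is_prime r" "C i \<subset> r" "r \<subset> C (Suc i)" for r
  proof -
    have "spec r" using r(1,2) specD(3)[OF s(1)] by (auto simp: spec_def)
    then have "f (C i) < f r" "f r < f (C (Suc i))" using f s r by blast+
    then show False using assms(4) by simp
  qed
  then show ?thesis using s unfolding prime_cover_def spec_def by blast
qed

lemma ht_sat_chain: assumes "spec q" shows "\<exists>C. sat_chain (ht q) C \<and> C 0 = I0 \<and> C (ht q) = q"
proof -
  obtain C where C: "prime_chain_in (ht q) C" "C (ht q) = q" using ht_chain[OF assms] by blast
  have step: "ht (C i) < ht (C (Suc i))" if "i < ht q" for i
    using ht_less[OF chain_spec[OF C(1)] chain_spec[OF C(1)]] that C(1) by (auto simp: prime_chain_in_def)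
  have le: "ht (C (ht q - i)) \<le> ht q - i" if "i \<le> ht q" for i
    using that
  proof (induction i)
    case (Suc i)
    then show ?case using step[of "ht q - Suc i"] Suc_diff_Suc[of i "ht q"] by auto
  qed (simp add: C(2))
  have eq: "ht (C i) = i" if "i \<le> ht q" for i
    using le[of "ht q - i"] ht_ge[OF chain_take[OF C(1) that]] that by simp
  have "prime_cover (C i) (C (Suc i))" if "i < ht q" for i
    by (rule chain_coverI[OF C(1), where f = ht]) (use ht_less eq that in auto)
  moreover have "C 0 = I0"
  proof (rule ccontr)
    assume "C 0 \<noteq> I0"
    then have "ht I0 < ht (C 0)"
      using ht_less[OF spec_I0 chain_spec[OF C(1), of 0]] specD(3)[OF chain_spec[OF C(1), of 0]] by blast
    then show False using eq[of 0] by simp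
  qed
  ultimately show ?thesis using C unfolding sat_chain_def by blast
qed

lemma coht_sat_chain: assumes "spec q" shows "\<exists>C. sat_chain (coht q) C \<and> C 0 = q \<and> C (coht q) = \<mm>"
proof -
  obtain C where C: "prime_chain_in (coht q) C" "C 0 = q" using coht_chain[OF assms] by blast
  have step: "coht (C (Suc i)) < coht (C i)" if "i < coht q" for i
    using coht_less[OF chain_spec[OF C(1)] chain_spec[OF C(1)]] that C(1) by (auto simp: prime_chain_in_def)
  have le: "coht (C i) + i \<le> coht q" if "i \<le> coht q" for i
    using that
  proof (induction i)
    case (Suc i)
    then show ?case using step[of i] by auto
  qed (simp add: C(2))
  have eq: "coht (C i) + i = coht q" if "i \<le> coht q" for i
    using le[OF that] coht_ge[OF chain_shift[OF C(1) that]] that by force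
  have "prime_cover (C i) (C (Suc i))" if i: "i < coht q" for i
  proof (rule chain_coverI[OF C(1), where f = "\<lambda>p. d - coht p"])
    show "d - coht p < d - coht q" if "spec p" "spec q" "p \<subset> q" for p q
      using coht_less[OF that] ht_coht_le[OF that(1)] by simp
    show "d - coht (C (Suc i)) = Suc (d - coht (C i))"
      using eq[of i] eq[of "Suc i"] i ht_coht_le[OF assms] by simp
  qed (rule i)
  moreover have "C (coht q) = \<mm>"
    using eq[of "coht q"] coht_0_imp[OF chain_spec[OF C(1) order_refl]] by simp
  ultimately show ?thesis using C unfolding sat_chain_def by blast
qed

lemma sat_chain_append:
  assumes "sat_chain a C" "sat_chain b D" "C a = D 0"
  shows "sat_chain (a + b) (\<lambda>i. if i \<le> a then C i else D (i - a))"
proof -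
  have "prime_cover (if i \<le> a then C i else D (i - a)) (if Suc i \<le> a then C (Suc i) else D (Suc i - a))"
    if "i < a + b" for i
  proof (cases "i < a")
    case True
    then show ?thesis using assms(1) by (simp add: sat_chain_def)
  next
    case False
    then have "prime_cover (D (i - a)) (D (Suc (i - a)))" using assms(2) that by (simp add: sat_chain_def)
    moreover have "i \<le> a \<Longrightarrow> C i = D (i - a)" using False assms(3) by (metis diff_is_0_eq' le_neq_implies_less)
    ultimately show ?thesis using False by (auto simp: Suc_diff_le)
  qed
  then show ?thesis using chain_append assms unfolding sat_chain_def by blast
qed

definition equal_sat_chains :: bool where
  "equal_sat_chains \<longleftrightarrow> (\<forall>m n C D. sat_chain m C \<longrightarrow> sat_chain n D \<longrightarrow> C 0 = D 0 \<longrightarrow> C m = D n \<longrightarrow> m = n)"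

text \<open>Longest chains below and above \<open>q\<close> join to a saturated chain from
  \<open>I0\<close> to \<open>\<mm>\<close>, to be compared with one of length \<open>d\<close>. For
  the converse any saturated chain is prolonged to \<open>\<mm>\<close>, and \<open>ratliff\<close>
  expresses its length as a difference of coheights.\<close>

theorem equal_sat_chains_iff: "equal_sat_chains \<longleftrightarrow> (\<forall>q. spec q \<longrightarrow> ht q + coht q = d)"
proof
  assume eq: equal_sat_chains
  show "\<forall>q. spec q \<longrightarrow> ht q + coht q = d"
  proof (intro allI impI)
    have through: "\<exists>C. sat_chain (ht q + coht q) C \<and> C 0 = I0 \<and> C (ht q + coht q) = \<mm>" if q: "spec q" for q
    proof -
      obtain C D where CD: "sat_chain (ht q) C" "C 0 = I0" "C (ht q) = q" "sat_chain (coht q) D" "D 0 = q" "D (coht q) = \<mm>"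
        using ht_sat_chain[OF q] coht_sat_chain[OF q] by blast
      let ?E = "\<lambda>i. if i \<le> ht q then C i else D (i - ht q)"
      have "sat_chain (ht q + coht q) ?E" using sat_chain_append[OF CD(1,4)] CD(3,5) by simp
      moreover have "?E (ht q + coht q) = \<mm>" using CD(3,5,6) by (cases "coht q = 0") simp_all
      ultimately show ?thesis using CD(2) by (intro exI[of _ ?E]) simp
    qed
    obtain C where C: "prime_chain_in d C" using chain_d by blast
    have "ht \<mm> = d" using top_chain(2,3)[OF C] by auto
    then obtain D where D: "sat_chain d D" "D 0 = I0" "D d = \<mm>" using ht_sat_chain[OF spec_m] by auto
    fix q assume "spec q"
    then show "ht q + coht q = d" using through[of q] D eq unfolding equal_sat_chains_def by metis
  qed
next
  assume eq: "\<forall>q. spec q \<longrightarrow> ht q + coht q = d"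
  have len: "coht (C 0) = m + coht (C m)" if C: "sat_chain m C" for m C
  proof -
    have "spec (C m)" using C chain_spec[of m C m] by (simp add: sat_chain_def)
    then obtain E where E: "sat_chain (coht (C m)) E" "E 0 = C m" "E (coht (C m)) = \<mm>" using coht_sat_chain by blast
    let ?E = "\<lambda>i. if i \<le> m then C i else E (i - m)"
    have "sat_chain (m + coht (C m)) ?E" using sat_chain_append[OF C E(1)] E(2) by simp
    moreover have "?E (m + coht (C m)) = \<mm>" using E(2,3) by (cases "coht (C m) = 0") simp_all
    ultimately have "coht (?E 0) = m + coht (C m)" using ratliff eq by blast
    then show ?thesis by simp
  qed
  show equal_sat_chains
    unfolding equal_sat_chains_def
  proof (intro allI impI)
    fix m n C D assume "sat_chain m C" "sat_chain n D" "C 0 = D 0" "C m = D n"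
    then show "m = n" using len[of m C] len[of n D] by simp
  qed
qed

section \<open>Parameters adapted to a prime and to a chain\<close>

lemma coparams_extend:
  assumes "coparams xs" "length xs \<le> n" "n \<le> d"
  shows "\<exists>ws. length (xs @ ws) = n \<and> set ws \<subseteq> \<mm> \<and> coparams (xs @ ws)"
  using assms(2,3)
proof (induction n)
  case 0
  then show ?case using assms(1) by (intro exI[of _ "[]"]) simp
next
  case (Suc n)
  show ?case
  proof (cases "length xs = Suc n")
    case True
    then show ?thesis using assms(1) by (intro exI[of _ "[]"]) simp
  next
    case False
    then obtain ws where ws: "length (xs @ ws) = n" "set ws \<subseteq> \<mm>" "coparams (xs @ ws)" using Suc by auto
    obtain y where y: "y \<in> \<mm>" "\<And>r. min_prime (gen (I0 \<union> set (xs @ ws))) r \<Longrightarrow> \<not> \<mm> \<subseteq> r \<Longrightarrow> y \<notin> r"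
      using min_prime_gen_avoid[OF specD(2)[OF spec_m]] by metis
    have "coparams ((xs @ ws) @ [y])"
      unfolding coparams_def
    proof (intro allI impI)
      fix P assume P: "spec P" "set ((xs @ ws) @ [y]) \<subseteq> P"
      obtain r where r: "min_prime (gen (I0 \<union> set (xs @ ws))) r" "r \<subseteq> P"
        using min_prime_gen_below[OF P(1), of "set (xs @ ws)"] P(2) by auto
      note rs = min_prime_gen_spec[OF r(1)]
      show "length ((xs @ ws) @ [y]) + coht P \<le> d"
      proof (cases "r = \<mm>")
        case True
        then have "P = \<mm>" using r(2) spec_le_m[OF P(1)] by blast
        then show ?thesis using coht_m Suc.prems ws(1) by simp
      next
        case False
        then have "\<not> \<mm> \<subseteq> r" using spec_le_m[OF rs(1)] by blast
        then have "r \<subset> P" using y(2)[OF r(1)] P(2) r(2) by auto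
        then have "coht P < coht r" by (rule coht_less[OF rs(1) P(1)])
        moreover have "length (xs @ ws) + coht r \<le> d" using ws(3) rs by (auto simp: coparams_def)
        ultimately show ?thesis by simp
      qed
    qed
    then show ?thesis using ws y(1) by (intro exI[of _ "ws @ [y]"]) auto
  qed
qed

text \<open>\<open>xs\<close> consists of \<open>ht p\<close> parameters in \<open>p\<close>. The
  element \<open>u\<close> of \<open>p\<close> avoids the other minimal primes of \<open>xs\<close>
  and lowers the dimension there, while over \<open>p\<close> the deficit
  \<open>ht p + coht p < d\<close> leaves the room for one more element. \<open>t\<close> lies in
  the other minimal primes but not in \<open>p\<close>, so \<open>t * u\<close> lies in all of
  them.\<close>

lemma bad_prime_params:
  assumes p: "spec p" and bad: "ht p + coht p < d"
  shows "\<exists>xs u ws t. set xs \<subseteq> p \<and> t \<notin> p \<and> length (xs @ u # ws) = d \<and> set (xs @ u # ws) \<subseteq> \<mm> \<and>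
     (\<forall>P. spec P \<longrightarrow> set xs \<subseteq> P \<longrightarrow> t * u \<in> P) \<and> (\<forall>P. spec P \<longrightarrow> set (xs @ u # ws) \<subseteq> P \<longrightarrow> P = \<mm>)"
proof -
  obtain xs where xs: "length xs = ht p" "set xs \<subseteq> p" "params xs" using params_ex[OF p order_refl] by blast
  note pmin = params_min_prime[OF xs(3,2,1) p]
  let ?R = "{r. min_prime (gen (I0 \<union> set xs)) r}"
  obtain u where u: "u \<in> p" "\<And>r. min_prime (gen (I0 \<union> set xs)) r \<Longrightarrow> \<not> p \<subseteq> r \<Longrightarrow> u \<notin> r"
    using min_prime_gen_avoid[OF specD(2)[OF p]] by metis
  have "coparams (xs @ [u])"
    unfolding coparams_def
  proof (intro allI impI)
    fix P assume P: "spec P" "set (xs @ [u]) \<subseteq> P"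
    obtain r where r: "min_prime (gen (I0 \<union> set xs)) r" "r \<subseteq> P"
      using min_prime_gen_below[OF P(1), of "set xs"] P(2) by auto
    note rs = min_prime_gen_spec[OF r(1)]
    show "length (xs @ [u]) + coht P \<le> d"
    proof (cases "p \<subseteq> r")
      case True
      then have "coht P \<le> coht p" using coht_mono[OF p P(1)] r(2) by blast
      then show ?thesis using bad xs(1) by simp
    next
      case False
      then have "r \<subset> P" using u(2)[OF r(1)] P(2) r(2) by auto
      then have "coht P < coht r" by (rule coht_less[OF rs(1) P(1)])
      moreover have "length xs + coht r \<le> d"
        using params_imp_coparams[OF xs(3)] rs by (auto simp: coparams_def)
      ultimately show ?thesis by simp
    qed
  qed
  moreover have "length (xs @ [u]) \<le> d" using bad xs(1) by simp
  ultimately obtain ws where ws: "length ((xs @ [u]) @ ws) = d" "set ws \<subseteq> \<mm>" "coparams ((xs @ [u]) @ ws)"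
    using coparams_extend by blast
  have fin: "finite (?R - {p})" using finite_min_primes[OF ideal_gen] gen_sub[of "I0 \<union> set xs"] by auto
  have "\<forall>r\<in>?R - {p}. \<exists>x. x \<in> r \<and> x \<notin> p" using pmin by (auto simp: min_prime_def)
  then obtain f where f: "\<And>r. r \<in> ?R - {p} \<Longrightarrow> f r \<in> r \<and> f r \<notin> p" by metis
  define t where "t = prod f (?R - {p})"
  have t: "t \<notin> p" unfolding t_def using prime_prod[OF specD(1)[OF p] fin] f by blast
  have tr: "t \<in> r" if "r \<in> ?R - {p}" for r
  proof -
    have "is_prime r" using that by (auto simp: min_prime_def)
    then show ?thesis unfolding t_def using prime_prod[OF _ fin] f that by blast
  qed
  have "t * u \<in> P" if P: "spec P" "set xs \<subseteq> P" for P
  proof -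
    obtain r where r: "min_prime (gen (I0 \<union> set xs)) r" "r \<subseteq> P" using min_prime_gen_below[OF P] by blast
    have "t \<in> P \<or> u \<in> P" using r tr[of r] u(1) by (cases "r = p") auto
    then show ?thesis using primeD(3)[OF specD(1)[OF P(1)]] by blast
  qed
  moreover have "P = \<mm>" if "spec P" "set (xs @ u # ws) \<subseteq> P" for P
  proof -
    have "length ((xs @ [u]) @ ws) + coht P \<le> d" using ws(3) that by (auto simp: coparams_def)
    then show ?thesis using ws(1) coht_0_imp[OF that(1)] by simp
  qed
  moreover have "set (xs @ u # ws) \<subseteq> \<mm>" using xs(2) u(1) ws(2) spec_le_m[OF p] by auto
  ultimately show ?thesis using xs(2) t ws(1) by (intro exI[of _ xs] exI[of _ u] exI[of _ ws] exI[of _ t]) auto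
qed

text \<open>Every prefix is kept a partial system of parameters. So \<open>C i\<close>, of height
  \<open>i\<close>, is minimal over the first \<open>i\<close> elements, and the next element,
  chosen off the minimal primes that do not contain \<open>C (Suc i)\<close>, avoids it.\<close>

lemma chain_params:
  assumes C: "prime_chain_in d C"
  shows "\<exists>zs. length zs = d \<and> (\<forall>i<d. zs ! i \<in> C (Suc i) \<and> zs ! i \<notin> C i) \<and> (\<forall>P. spec P \<longrightarrow> set zs \<subseteq> P \<longrightarrow> P = \<mm>) \<and>
    (\<forall>i\<le>d. \<forall>Q. spec Q \<longrightarrow> Q \<subseteq> C i \<longrightarrow> set (take i zs) \<subseteq> Q \<longrightarrow> Q = C i)"
proof -
  have "\<exists>zs. length zs = n \<and> (\<forall>i\<le>n. params (take i zs)) \<and> (\<forall>i<n. zs ! i \<in> C (Suc i) \<and> zs ! i \<notin> C i)" if "n \<le> d" for n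
    using that
  proof (induction n)
    case 0
    then show ?case using params_Nil by (intro exI[of _ "[]"]) simp
  next
    case (Suc n)
    then obtain zs where zs0: "length zs = n" "\<And>i. i \<le> n \<Longrightarrow> params (take i zs)"
      "\<And>i. i < n \<Longrightarrow> zs ! i \<in> C (Suc i) \<and> zs ! i \<notin> C i" by auto
    have zs: "length zs = n" "params zs" "\<And>i. i < n \<Longrightarrow> zs ! i \<in> C (Suc i) \<and> zs ! i \<notin> C i"
      using zs0(1,3) zs0(2)[of n] by auto
    have sC: "spec (C n)" "spec (C (Suc n))" using chain_spec[OF C] Suc.prems by auto
    have hC: "ht (C n) = n" "ht (C (Suc n)) = Suc n" using top_chain(3)[OF C] Suc.prems by auto
    obtain y where y: "y \<in> C (Suc n)" "params (zs @ [y])"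
      "\<And>r. min_prime (gen (I0 \<union> set zs)) r \<Longrightarrow> \<not> C (Suc n) \<subseteq> r \<Longrightarrow> y \<notin> r"
      using params_extend[OF zs(2) sC(2)] zs(1) hC(2) by (metis lessI)
    have "set zs \<subseteq> C n"
    proof
      fix z assume "z \<in> set zs"
      then obtain i where "i < n" "z = zs ! i" using zs(1) by (auto simp: in_set_conv_nth)
      then show "z \<in> C n" using zs(3)[of i] chain_mono[OF C, of "Suc i" n] Suc.prems by auto
    qed
    then have "min_prime (gen (I0 \<union> set zs)) (C n)" using params_min_prime[OF zs(2)] zs(1) hC(1) sC(1) by simp
    moreover have "C n \<subset> C (Suc n)" using C Suc.prems by (simp add: prime_chain_in_def)
    then have "\<not> C (Suc n) \<subseteq> C n" by blast
    ultimately have "y \<notin> C n" using y(3) by blast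
    moreover have "params (take i (zs @ [y]))" if "i \<le> Suc n" for i
      using zs0(1) zs0(2)[of i] y(2) that by (cases "i = Suc n") auto
    ultimately show ?case using zs y(1) by (intro exI[of _ "zs @ [y]"]) (auto simp: nth_append less_Suc_eq)
  qed
  then obtain zs where zs0: "length zs = d" "\<And>i. i \<le> d \<Longrightarrow> params (take i zs)"
    "\<And>i. i < d \<Longrightarrow> zs ! i \<in> C (Suc i) \<and> zs ! i \<notin> C i" by blast
  have zs: "length zs = d" "params zs" using zs0(1) zs0(2)[of d] by auto
  have "P = \<mm>" if "spec P" "set zs \<subseteq> P" for P
  proof -
    have "d \<le> ht P" using zs(1,2) that by (auto simp: params_def)
    then show ?thesis using ht_coht_le[OF that(1)] coht_0_imp[OF that(1)] by simp
  qed
  moreover have "Q = C i" if Q: "i \<le> d" "spec Q" "Q \<subseteq> C i" "set (take i zs) \<subseteq> Q" for i Q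
  proof (rule ccontr)
    assume "Q \<noteq> C i"
    then have "ht Q < ht (C i)" using ht_less[OF Q(2) chain_spec[OF C Q(1)]] Q(3) by blast
    moreover have "i \<le> ht Q" using zs0(2)[OF Q(1)] Q(1,2,4) zs(1) by (auto simp: params_def)
    ultimately show False using top_chain(3)[OF C Q(1)] by simp
  qed
  ultimately show ?thesis using zs(1) zs0(3) by blast
qed

text \<open>The generators are removed from the last to the first by letting one exponent grow.
  \<open>krull_sat\<close> at \<open>C (Suc i)\<close> applies because the rest of the relation,
  including the exponents \<open>\<kappa>\<close>, depends only on the first \<open>i\<close>
  entries of \<open>Ks\<close>. The remaining power of \<open>zs ! i\<close> is then outside
  \<open>C i\<close> and is absorbed into \<open>s\<close>; at \<open>h\<close> the same happens to
  \<open>v\<close>. In the end an element outside \<open>I0\<close> lies in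
  \<open>I0\<close>.\<close>

lemma eliminate_params:
  fixes \<kappa> :: "nat list \<Rightarrow> nat" and v :: "nat list \<Rightarrow> 'f"
  assumes C: "prime_chain_in d C" and h: "h \<le> d" and v: "\<And>L. v L \<notin> C h"
    and zs: "\<And>i. i < d \<Longrightarrow> zs ! i \<in> C (Suc i) \<and> zs ! i \<notin> C i"
    and mem: "\<And>Ks. length Ks = d \<Longrightarrow> v (take h Ks) * (\<Prod>i<d. zs ! i ^ \<kappa> (take i Ks))
        \<in> gen (I0 \<union> (\<lambda>i. zs ! i ^ (Ks ! i)) ` {..<d})"
  shows False
proof -
  define J where "J = (\<lambda>Ks i. gen (I0 \<union> (\<lambda>i. zs ! i ^ (Ks ! i)) ` {..<i}))"
  have J: "is_ideal (J Ks i)" "I0 \<subseteq> J Ks i" for Ks i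
    unfolding J_def using ideal_gen gen_sub[of "I0 \<union> _"] by auto
  have JSuc: "J Ks (Suc i) = adj (J Ks i) (zs ! i ^ (Ks ! i))" for Ks i
    unfolding J_def lessThan_Suc image_insert Un_insert_right gen_insert ..
  have Jcong: "J Ks i = J Ls i" if "\<And>j. j < i \<Longrightarrow> Ks ! j = Ls ! j" for Ks Ls i
    unfolding J_def using that by (metis (no_types, lifting) image_cong lessThan_iff)
  define pr where "pr = (\<lambda>Ks i. \<Prod>j<i. zs ! j ^ \<kappa> (take j Ks))"
  have pr_cong: "pr Ks i = pr Ls i" if "\<And>j. j \<le> i \<Longrightarrow> take j Ks = take j Ls" for Ks Ls i
    unfolding pr_def using that by (intro prod.cong) auto
  have C': "spec (C i)" if "i \<le> d" for i using chain_spec[OF C that] .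
  note Cp = specD(1)[OF C']
  have step: "\<exists>s. s \<notin> C i \<and> s * (r (take i Ks) * pr Ks i) \<in> J Ks i"
    if i: "i < d" "length Ks = d" and IH: "\<And>Ks. length Ks = d \<Longrightarrow> \<exists>s. s \<notin> C (Suc i) \<and> s * (r (take i Ks) * pr Ks (Suc i)) \<in> J Ks (Suc i)"
    for i Ks and r :: "nat list \<Rightarrow> 'f"
  proof -
    have "\<exists>s. s \<notin> C (Suc i) \<and> s * (r (take i Ks) * pr Ks (Suc i)) \<in> J Ks i"
    proof (rule krull_sat[OF J])
      show "is_prime (C (Suc i))" "zs ! i \<in> C (Suc i)" using Cp zs i by auto
      fix k
      \<comment> \<open>Only the entry at \<open>i\<close> varies, so the product, the coefficient
        and the ideal of the earlier powers stay the same.\<close>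
      let ?Ks = "Ks[i := k]"
      have t: "take j ?Ks = take j Ks" if "j \<le> i" for j using that by (simp add: take_update_cancel)
      have "pr ?Ks (Suc i) = pr Ks (Suc i)" unfolding pr_def using t by (intro prod.cong) auto
      moreover have "J ?Ks (Suc i) = adj (J Ks i) (zs ! i ^ k)"
        unfolding JSuc using Jcong[of i ?Ks Ks] i by simp
      ultimately show "\<exists>s. s \<notin> C (Suc i) \<and> s * (r (take i Ks) * pr Ks (Suc i)) \<in> adj (J Ks i) (zs ! i ^ k)"
        using IH[of ?Ks] i(2) t[of i] by simp
    qed
    then obtain s where s: "s \<notin> C (Suc i)" "s * (r (take i Ks) * pr Ks (Suc i)) \<in> J Ks i" by blast
    have "s * (r (take i Ks) * pr Ks (Suc i)) = (s * zs ! i ^ \<kappa> (take i Ks)) * (r (take i Ks) * pr Ks i)"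
      unfolding pr_def by (simp add: mult_ac)
    moreover have "s \<notin> C i" using s(1) chain_mono[OF C, of i "Suc i"] i(1) by auto
    then have "s * zs ! i ^ \<kappa> (take i Ks) \<notin> C i"
      using primeD(3)[OF Cp] prime_power[OF Cp] zs[OF i(1)] i(1) by simp
    ultimately show ?thesis using s(2) by metis
  qed
  have upper: "\<exists>s. s \<notin> C (d - n) \<and> s * (v (take h Ks) * pr Ks (d - n)) \<in> J Ks (d - n)"
    if "n \<le> d - h" "length Ks = d" for n Ks
    using that
  proof (induction n arbitrary: Ks)
    case 0
    have "1 \<notin> C d" using primeD(2)[OF Cp] by simp
    then show ?case using mem[OF 0(2)] unfolding pr_def J_def by (intro exI[of _ 1]) simp
  next
    case (Suc n)
    let ?i = "d - Suc n"
    have i: "?i < d" "Suc ?i = d - n" "h \<le> ?i" using Suc.prems h by auto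
    show ?case
      using step[of ?i Ks "\<lambda>L. v (take h L)"] Suc.IH Suc.prems i by (simp add: min_absorb1)
  qed
  have lower: "\<exists>s. s \<notin> C (h - n) \<and> s * pr Ks (h - n) \<in> J Ks (h - n)" if "n \<le> h" "length Ks = d" for n Ks
    using that
  proof (induction n arbitrary: Ks)
    case 0
    obtain s where s: "s \<notin> C h" "s * (v (take h Ks) * pr Ks h) \<in> J Ks h"
      using upper[of "d - h" Ks] 0 h by auto
    have "s * v (take h Ks) \<notin> C h" using s(1) v primeD(3)[OF Cp] h by simp
    then show ?case using s(2) by (auto simp: mult.assoc[symmetric])
  next
    case (Suc n)
    let ?i = "h - Suc n"
    have i: "?i < d" "Suc ?i = h - n" using Suc.prems h by auto
    show ?case
      using step[of ?i Ks "\<lambda>_. 1"] Suc.IH Suc.prems i by simp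
  qed
  obtain s where "s \<notin> C 0" "s * pr (replicate d 0) 0 \<in> J (replicate d 0) 0" using lower[of h "replicate d 0"] by auto
  then show False unfolding pr_def J_def using gen_ideal[OF ideal_I0] top_chain(1)[OF C] by simp
qed

end

section \<open>Artinian modules\<close>

text \<open>The module is the quotient of the type \<open>'m\<close> by the submodule \<open>NN\<close>, and a subquotient \<open>Z/B\<close> of it is a
  pair of submodules \<open>B \<subseteq> Z\<close> that contain \<open>NN\<close>.\<close>

locale null_module =
  fixes scale :: "'f::comm_ring_1 \<Rightarrow> 'm::ab_group_add \<Rightarrow> 'm" (infixr \<open>\<cdot>\<close> 75)
    and NN :: "'m set"
  assumes scale_right_distrib: "r \<cdot> (a + b) = r \<cdot> a + r \<cdot> b"
    and scale_left_distrib: "(r + t) \<cdot> a = r \<cdot> a + t \<cdot> a"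
    and scale_scale: "r \<cdot> t \<cdot> a = (r * t) \<cdot> a"
    and scale_one [simp]: "1 \<cdot> a = a"
    and NN_zero: "0 \<in> NN" and NN_add: "a \<in> NN \<Longrightarrow> b \<in> NN \<Longrightarrow> a + b \<in> NN" and NN_scale: "a \<in> NN \<Longrightarrow> r \<cdot> a \<in> NN"
begin

lemma scale_zero_right [simp]: "r \<cdot> 0 = 0"
  using scale_right_distrib[of r 0 0] by simp

lemma scale_zero_left [simp]: "0 \<cdot> a = 0"
  using scale_left_distrib[of 0 0 a] by simp

lemma scale_minus_right: "r \<cdot> (- a) = - (r \<cdot> a)"
  using scale_right_distrib[of r a "- a"] by (simp add: add_eq_0_iff)

lemma scale_minus_left: "(- r) \<cdot> a = - (r \<cdot> a)"
  using scale_left_distrib[of r "- r" a] by (simp add: add_eq_0_iff)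

lemma scale_right_diff: "r \<cdot> (a - b) = r \<cdot> a - r \<cdot> b"
  using scale_right_distrib[of r a "- b"] by (simp add: scale_minus_right)

lemma scale_left_diff: "(r - t) \<cdot> a = r \<cdot> a - t \<cdot> a"
  using scale_left_distrib[of r "- t" a] by (simp add: scale_minus_left)

lemmas scale_simps = scale_right_distrib scale_left_distrib scale_right_diff scale_left_diff
  scale_minus_right scale_minus_left scale_scale

definition submod :: "'m set \<Rightarrow> bool" where
  "submod N \<longleftrightarrow> NN \<subseteq> N \<and> (\<forall>a\<in>N. \<forall>b\<in>N. a + b \<in> N) \<and> (\<forall>r. \<forall>a\<in>N. r \<cdot> a \<in> N)"

lemma submodD:
  assumes "submod N"
  shows "NN \<subseteq> N" "0 \<in> N" "a \<in> N \<Longrightarrow> b \<in> N \<Longrightarrow> a + b \<in> N" "a \<in> N \<Longrightarrow> r \<cdot> a \<in> N"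
    "a \<in> N \<Longrightarrow> - a \<in> N" "a \<in> N \<Longrightarrow> b \<in> N \<Longrightarrow> a - b \<in> N"
proof -
  show *: "NN \<subseteq> N" "a \<in> N \<Longrightarrow> b \<in> N \<Longrightarrow> a + b \<in> N" "a \<in> N \<Longrightarrow> r \<cdot> a \<in> N" for a b r
    using assms by (auto simp: submod_def)
  show "0 \<in> N" using * NN_zero by blast
  show **: "a \<in> N \<Longrightarrow> - a \<in> N" for a using *(3)[of a "-1"] by (simp add: scale_minus_left)
  show "a \<in> N \<Longrightarrow> b \<in> N \<Longrightarrow> a - b \<in> N" using *(2)[of a "-b"] **[of b] by simp
qed

lemma submod_NN: "submod NN"
  unfolding submod_def using NN_add NN_scale by blast

lemmas NND = submodD[OF submod_NN]

lemma submod_diff_cancel: "submod N \<Longrightarrow> a - b \<in> N \<Longrightarrow> a \<in> N \<longleftrightarrow> b \<in> N"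
proof
  assume N: "submod N" "a - b \<in> N"
  show "b \<in> N" if "a \<in> N" using submodD(6)[OF N(1) that N(2)] by simp
  show "a \<in> N" if "b \<in> N" using submodD(3)[OF N(1) N(2) that] by simp
qed

text \<open>This is \<open>r Z + B\<close>, the preimage of \<open>r (Z/B)\<close>.\<close>

lemma submod_multiples:
  assumes "submod Z" "submod B" shows "submod {b. \<exists>a\<in>Z. b - r \<cdot> a \<in> B}"
  unfolding submod_def
proof (intro conjI ballI allI subsetI)
  show "x \<in> {b. \<exists>a\<in>Z. b - r \<cdot> a \<in> B}" if "x \<in> NN" for x
    using that submodD(1)[OF assms(2)] submodD(2)[OF assms(1)] by (auto intro!: bexI[of _ 0])
  fix x assume "x \<in> {b. \<exists>a\<in>Z. b - r \<cdot> a \<in> B}"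
  then obtain a where a: "a \<in> Z" "x - r \<cdot> a \<in> B" by blast
  show "t \<cdot> x \<in> {b. \<exists>a\<in>Z. b - r \<cdot> a \<in> B}" for t
  proof -
    have *: "t \<cdot> x - r \<cdot> t \<cdot> a = t \<cdot> (x - r \<cdot> a)" by (simp add: scale_simps mult.commute)
    have "t \<cdot> x - r \<cdot> t \<cdot> a \<in> B" unfolding * by (rule submodD(4)[OF assms(2) a(2)])
    then show ?thesis using submodD(4)[OF assms(1) a(1), of t] by blast
  qed
  fix y assume "y \<in> {b. \<exists>a\<in>Z. b - r \<cdot> a \<in> B}"
  then obtain b where b: "b \<in> Z" "y - r \<cdot> b \<in> B" by blast
  have *: "x + y - r \<cdot> (a + b) = (x - r \<cdot> a) + (y - r \<cdot> b)" by (simp add: scale_simps)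
  have "x + y - r \<cdot> (a + b) \<in> B" unfolding * by (rule submodD(3)[OF assms(2) a(2) b(2)])
  then show "x + y \<in> {b. \<exists>a\<in>Z. b - r \<cdot> a \<in> B}"
    using submodD(3)[OF assms(1) a(1) b(1)] by blast
qed

lemma submod_Int: "submod A \<Longrightarrow> submod B \<Longrightarrow> submod (A \<inter> B)"
  unfolding submod_def by blast

lemma submod_killed: assumes "submod Z" "submod B" shows "submod {a\<in>Z. r \<cdot> a \<in> B}"
  unfolding submod_def
proof (intro conjI ballI allI subsetI)
  show "x \<in> {a\<in>Z. r \<cdot> a \<in> B}" if "x \<in> NN" for x
    using that submodD(1)[OF assms(1)] submodD(1)[OF assms(2)] NN_scale by blast
  fix x assume x: "x \<in> {a\<in>Z. r \<cdot> a \<in> B}"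
  show "t \<cdot> x \<in> {a\<in>Z. r \<cdot> a \<in> B}" for t
    using x submodD(4)[OF assms(1)] submodD(4)[OF assms(2), of "r \<cdot> x" t] by (simp add: scale_scale mult.commute)
  fix y assume "y \<in> {a\<in>Z. r \<cdot> a \<in> B}"
  then show "x + y \<in> {a\<in>Z. r \<cdot> a \<in> B}"
    using x submodD(3)[OF assms(1)] submodD(3)[OF assms(2)] by (simp add: scale_right_distrib)
qed

definition artin :: "'m set \<Rightarrow> 'm set \<Rightarrow> bool" where
  "artin Z B \<longleftrightarrow> (\<forall>N :: nat \<Rightarrow> 'm set. (\<forall>n. submod (N n) \<and> B \<subseteq> N n \<and> N n \<subseteq> Z \<and> N (Suc n) \<subseteq> N n) \<longrightarrow> (\<exists>k. \<forall>n\<ge>k. N n = N k))"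

lemma artinD:
  assumes "artin Z B" "\<And>n::nat. submod (N n)" "\<And>n. B \<subseteq> N n" "\<And>n. N n \<subseteq> Z" "\<And>n. N (Suc n) \<subseteq> N n"
  shows "\<exists>k. \<forall>n\<ge>k. N n = N k"
  using assms unfolding artin_def by blast

text \<open>A chain is tested on the kernel \<open>U\<close> of \<open>z\<close>, through the
  elements of \<open>U\<close> that are \<open>z ^ i\<close> times an element of \<open>N j\<close>.
  Once these families are stationary in \<open>j\<close> from a common \<open>J\<close> on,
  induction on the exponent that kills an element gives \<open>N j = N J\<close>.\<close>

lemma artin_torsion:
  assumes Z: "submod Z" and B: "submod B"
    and tors: "\<And>a. a \<in> Z \<Longrightarrow> \<exists>n. z ^ n \<cdot> a \<in> B"
    and art: "artin {a\<in>Z. z \<cdot> a \<in> B} B"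
  shows "artin Z B"
  unfolding artin_def
proof (intro allI impI)
  fix N :: "nat \<Rightarrow> 'm set"
  assume "\<forall>n. submod (N n) \<and> B \<subseteq> N n \<and> N n \<subseteq> Z \<and> N (Suc n) \<subseteq> N n"
  then have N: "\<And>n. submod (N n)" "\<And>n. B \<subseteq> N n" "\<And>n. N n \<subseteq> Z" "\<And>n. N (Suc n) \<subseteq> N n" by auto
  have Nmono: "m \<le> n \<Longrightarrow> N n \<subseteq> N m" for m n using lift_Suc_antimono_le[of N] N(4) by blast
  define U where "U = {a\<in>Z. z \<cdot> a \<in> B}"
  have U: "submod U" unfolding U_def by (rule submod_killed[OF Z B])
  define S where "S = (\<lambda>i j. U \<inter> {b. \<exists>a\<in>N j. b - z ^ i \<cdot> a \<in> B})"
  have BS: "submod (S i j)" "S i j \<subseteq> U" "B \<subseteq> S i j" for i j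
  proof -
    show "submod (S i j)" unfolding S_def by (intro submod_Int U submod_multiples N B)
    show "S i j \<subseteq> U" unfolding S_def by blast
    show "B \<subseteq> S i j"
    proof
      fix b assume b: "b \<in> B"
      then have "b \<in> Z" using N(2,3) by blast
      then show "b \<in> S i j" unfolding S_def U_def
        using b submodD(4)[OF B b] submodD(2)[OF N(1)[of j]] by (auto intro!: bexI[of _ 0])
    qed
  qed
  have Sj: "S i j' \<subseteq> S i j" if "j \<le> j'" for i j j' using Nmono[OF that] unfolding S_def by blast
  have Si: "S (Suc i) j \<subseteq> S i j" for i j
  proof
    fix b assume "b \<in> S (Suc i) j"
    then obtain a where "b \<in> U" "a \<in> N j" "b - z ^ Suc i \<cdot> a \<in> B" unfolding S_def by blast
    moreover have "z ^ Suc i \<cdot> a = z ^ i \<cdot> z \<cdot> a" by (simp add: scale_scale mult.commute)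
    ultimately show "b \<in> S i j" unfolding S_def using submodD(4)[OF N(1)] by auto
  qed
  have Sij: "S i' j' \<subseteq> S i j" if "i \<le> i'" "j \<le> j'" for i i' j j'
    using lift_Suc_antimono_le[of "\<lambda>i. S i j", OF Si that(1)] Sj[OF that(2)] by blast
  note art' = art[folded U_def]
  \<comment> \<open>From \<open>k0\<close> on the diagonal is constant, and every row beyond
    \<open>k0\<close> is squeezed between diagonal entries. Only the finitely many rows below
    \<open>k0\<close> need their own bounds, so one \<open>J\<close> serves all rows.\<close>
  have "\<exists>k. \<forall>n\<ge>k. S n n = S k k"
  proof (rule artinD[OF art'])
    show "S (Suc n) (Suc n) \<subseteq> S n n" for n by (rule Sij) auto
  qed (rule BS)+
  then obtain k0 where k0: "\<And>n. n \<ge> k0 \<Longrightarrow> S n n = S k0 k0" by blast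
  have "\<forall>i. \<exists>k. \<forall>j\<ge>k. S i j = S i k"
  proof
    fix i show "\<exists>k. \<forall>j\<ge>k. S i j = S i k"
      by (rule artinD[OF art']) (use BS Sj in auto)
  qed
  then obtain f where f: "\<And>i j. j \<ge> f i \<Longrightarrow> S i j = S i (f i)" by metis
  define J where "J = Max (insert k0 (f ` {..<k0}))"
  have J: "k0 \<le> J" "i < k0 \<Longrightarrow> f i \<le> J" for i unfolding J_def by auto
  have stable: "S i j = S i J" if "j \<ge> J" for i j
  proof (cases "i < k0")
    case True
    then show ?thesis using f[of i j] f[of i J] J(2)[OF True] that by simp
  next
    case False
    have "S i j = S k0 k0" if "j \<ge> J" for j
      using Sij[of k0 i k0 j] Sij[of i "max i j" j "max i j"] k0[of "max i j"] False that J(1) by auto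
    then show ?thesis using that by simp
  qed
  have main: "z ^ n \<cdot> a \<in> B \<Longrightarrow> a \<in> N J \<Longrightarrow> j \<ge> J \<Longrightarrow> a \<in> N j" for n a j
  proof (induction n arbitrary: a)
    case 0
    then show ?case using N(2) by auto
  next
    case (Suc n)
    have "z ^ n \<cdot> a \<in> N J" using submodD(4)[OF N(1)] Suc.prems by blast
    moreover have "z \<cdot> z ^ n \<cdot> a \<in> B" using Suc.prems by (simp add: scale_scale)
    ultimately have "z ^ n \<cdot> a \<in> S n J"
      unfolding S_def U_def using N(3) Suc.prems(2) submodD(2)[OF B] by (auto intro!: bexI[of _ a])
    then have "z ^ n \<cdot> a \<in> S n j" using stable[OF Suc.prems(3)] by simp
    \<comment> \<open>Subtracting an element of \<open>N j\<close> with the same multiple by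
      \<open>z ^ n\<close> lowers the exponent that kills \<open>a\<close>.\<close>
    then obtain a' where a': "a' \<in> N j" "z ^ n \<cdot> a - z ^ n \<cdot> a' \<in> B" unfolding S_def by blast
    have "a - a' \<in> N J" using submodD(6)[OF N(1) Suc.prems(2)] a'(1) Nmono[OF Suc.prems(3)] by blast
    moreover have "z ^ n \<cdot> (a - a') \<in> B" using a'(2) by (simp add: scale_right_diff)
    ultimately have "a - a' \<in> N j" using Suc.IH Suc.prems(3) by blast
    then show ?case using submodD(3)[OF N(1) _ a'(1)] by fastforce
  qed
  have "N j = N J" if "j \<ge> J" for j
    using main[OF _ _ that] tors N(3) Nmono[OF that] by blast
  then show "\<exists>k. \<forall>n\<ge>k. N n = N k" by blast
qed

lemma artin_extend:
  assumes A: "submod A" "B \<subseteq> A" and art: "artin A B" "artin Z A" and Z: "submod Z" "A \<subseteq> Z"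
  shows "artin Z B"
  unfolding artin_def
proof (intro allI impI)
  fix N :: "nat \<Rightarrow> 'm set"
  assume "\<forall>n. submod (N n) \<and> B \<subseteq> N n \<and> N n \<subseteq> Z \<and> N (Suc n) \<subseteq> N n"
  then have N: "\<And>n. submod (N n)" "\<And>n. B \<subseteq> N n" "\<And>n. N n \<subseteq> Z" "\<And>n. N (Suc n) \<subseteq> N n" by auto
  have Nmono: "m \<le> n \<Longrightarrow> N n \<subseteq> N m" for m n using lift_Suc_antimono_le[of N] N(4) by blast
  have "\<exists>k. \<forall>n\<ge>k. A \<inter> N n = A \<inter> N k"
    by (rule artinD[OF art(1)]) (use submod_Int[OF A(1) N(1)] A(2) N(2,4) in blast)+
  then obtain k1 where k1: "\<And>n. n \<ge> k1 \<Longrightarrow> A \<inter> N n = A \<inter> N k1" by blast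
  let ?S = "\<lambda>n. {b. \<exists>a\<in>N n. b - 1 \<cdot> a \<in> A}"
  have "\<exists>k. \<forall>n\<ge>k. ?S n = ?S k"
  proof (rule artinD[OF art(2)])
    show "submod (?S n)" for n by (rule submod_multiples[OF N(1) A(1)])
    show "A \<subseteq> ?S n" for n using submodD(2)[OF N(1)] by (auto intro!: bexI[of _ 0])
    show "?S n \<subseteq> Z" for n
    proof
      fix b assume "b \<in> ?S n"
      then obtain a where "a \<in> Z" "b - a \<in> Z" using N(3) Z(2) by auto
      then show "b \<in> Z" using submodD(3)[OF Z(1)] by (metis diff_add_cancel)
    qed
    show "?S (Suc n) \<subseteq> ?S n" for n using N(4) by blast
  qed
  then obtain k2 where k2: "\<And>n. n \<ge> k2 \<Longrightarrow> ?S n = ?S k2" by blast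
  let ?k = "max k1 k2"
  have "N n = N ?k" if n: "n \<ge> ?k" for n
  proof
    show "N n \<subseteq> N ?k" using Nmono n by blast
    show "N ?k \<subseteq> N n"
    proof
      fix c assume c: "c \<in> N ?k"
      then have "c \<in> ?S ?k" using submodD(2)[OF A(1)] by (auto intro!: bexI[of _ c])
      moreover have "?S ?k = ?S n" using k2[of n] k2[of ?k] n by simp
      ultimately obtain a where a: "a \<in> N n" "c - a \<in> A" by auto
      have "c - a \<in> N ?k" using submodD(6)[OF N(1) c] a(1) Nmono[OF n] by blast
      then have "c - a \<in> A \<inter> N n" using a(2) k1[of n] k1[of ?k] n by auto
      then show "c \<in> N n" using submodD(3)[OF N(1) _ a(1)] by fastforce
    qed
  qed
  then show "\<exists>k. \<forall>n\<ge>k. N n = N k" by blast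
qed

definition noeth_mod :: "'m set \<Rightarrow> 'm set \<Rightarrow> bool" where
  "noeth_mod Z B \<longleftrightarrow> (\<forall>C. C \<noteq> {} \<longrightarrow> (\<forall>N\<in>C. submod N \<and> B \<subseteq> N \<and> N \<subseteq> Z) \<longrightarrow> (\<exists>M\<in>C. \<forall>N\<in>C. M \<subseteq> N \<longrightarrow> N = M))"

lemma noeth_modD:
  assumes "noeth_mod Z B" "C \<noteq> {}" "\<And>N. N \<in> C \<Longrightarrow> submod N \<and> B \<subseteq> N \<and> N \<subseteq> Z"
  shows "\<exists>M\<in>C. \<forall>N\<in>C. M \<subseteq> N \<longrightarrow> N = M"
proof -
  have "C \<noteq> {} \<longrightarrow> (\<forall>N\<in>C. submod N \<and> B \<subseteq> N \<and> N \<subseteq> Z) \<longrightarrow> (\<exists>M\<in>C. \<forall>N\<in>C. M \<subseteq> N \<longrightarrow> N = M)"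
    using assms(1) unfolding noeth_mod_def by (rule spec)
  then show ?thesis using assms(2,3) by simp
qed

lemma noeth_mod_trivial: assumes "Z \<subseteq> B" shows "noeth_mod Z B"
  unfolding noeth_mod_def
proof (intro allI impI)
  fix C assume C: "C \<noteq> {}" "\<forall>N\<in>C. submod N \<and> B \<subseteq> N \<and> N \<subseteq> Z"
  then obtain M where "M \<in> C" by blast
  moreover have "N = B" if "N \<in> C" for N
  proof -
    have "B \<subseteq> N" "N \<subseteq> Z" using C(2) that by auto
    then show ?thesis using assms by simp
  qed
  ultimately show "\<exists>M\<in>C. \<forall>N\<in>C. M \<subseteq> N \<longrightarrow> N = M" by metis
qed

end

locale null_module_noeth = null_module scale NN + noeth I0
  for scale :: "'f::comm_ring_1 \<Rightarrow> 'm::ab_group_add \<Rightarrow> 'm" (infixr \<open>\<cdot>\<close> 75) and NN and I0 :: "'f set" +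
  fixes \<mm> :: "'f set"
  assumes I0_null: "r \<in> I0 \<Longrightarrow> r \<cdot> a \<in> NN"
    and prime_m: "is_prime \<mm>" and local: "\<And>P. is_prime P \<Longrightarrow> I0 \<subseteq> P \<Longrightarrow> P \<subseteq> \<mm>"
begin

text \<open>The element is invertible modulo \<open>I0\<close>. The congruence modulo
  \<open>\<mm>\<close> is what acts on a module element whose annihilator is
  \<open>\<mm>\<close>.\<close>

lemma unit_mod_m: assumes "I0 \<subseteq> \<mm>" "r \<notin> \<mm>" shows "\<exists>t. t * r - 1 \<in> \<mm>"
proof -
  have "1 \<in> adj I0 r"
  proof (rule ccontr)
    assume "1 \<notin> adj I0 r"
    then have "\<exists>P. is_prime P \<and> adj I0 r \<subseteq> P \<and> P \<inter> {1} = {}"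
      using prime_disjoint_ex[OF ideal_adj[OF ideal_I0] adj_sub, of "{1}" r] by auto
    then obtain P where P: "is_prime P" "adj I0 r \<subseteq> P" by blast
    then have "P \<subseteq> \<mm>" using local adj_sub by blast
    then show False using P adj_mem[OF ideal_I0, of r] assms(2) by blast
  qed
  then obtain j t where "j \<in> I0" "1 = j + t * r" by (auto elim: adjE)
  then have "t * r - 1 = - j" "- j \<in> \<mm>" using assms(1) idealD(5)[OF primeD(1)[OF prime_m]] by (auto simp: algebra_simps)
  then show ?thesis by metis
qed

text \<open>Let \<open>N\<close> be maximal among the submodules that are Artinian over
  \<open>B\<close>. If \<open>N\<close> is not \<open>Z\<close>, an element with largest annihilator
  modulo \<open>N\<close> has a prime annihilator, which must be \<open>\<mm>\<close>. Adjoining it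
  adds a simple module, contrary to maximality.\<close>

lemma noeth_imp_artin:
  assumes Z: "submod Z" and B: "submod B" "B \<subseteq> Z" and noe: "noeth_mod Z B"
    and m: "\<And>P. is_prime P \<Longrightarrow> {r. \<forall>a\<in>Z. r \<cdot> a \<in> B} \<subseteq> P \<Longrightarrow> P = \<mm>"
  shows "artin Z B"
proof -
  define C where "C = {N. submod N \<and> B \<subseteq> N \<and> N \<subseteq> Z \<and> artin N B}"
  have "artin B B"
    unfolding artin_def
  proof (intro allI impI)
    fix N :: "nat \<Rightarrow> 'm set"
    assume "\<forall>n. submod (N n) \<and> B \<subseteq> N n \<and> N n \<subseteq> B \<and> N (Suc n) \<subseteq> N n"
    then have "N n = B" for n by (simp add: subset_antisym)
    then show "\<exists>k. \<forall>n\<ge>k. N n = N k" by simp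
  qed
  then have "B \<in> C" unfolding C_def using B by simp
  then have "\<exists>M\<in>C. \<forall>N\<in>C. M \<subseteq> N \<longrightarrow> N = M"
    by (intro noeth_modD[OF noe]) (auto simp: C_def)
  then obtain N where NC: "N \<in> C" and Nmax: "\<forall>N'\<in>C. N \<subseteq> N' \<longrightarrow> N' = N" by (elim bexE)
  have N: "submod N" "B \<subseteq> N" "N \<subseteq> Z" "artin N B" using NC unfolding C_def by auto
  have max: "N' = N" if "submod N'" "N \<subseteq> N'" "N' \<subseteq> Z" "artin N' B" for N'
  proof -
    have "N' \<in> C" unfolding C_def using that N(2) by auto
    then show ?thesis using Nmax that(2) by simp
  qed
  show ?thesis
  proof (cases "N = Z")
    case False
    define col where "col = (\<lambda>z. {r. r \<cdot> z \<in> N})"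
    have colI: "is_ideal (col z)" "I0 \<subseteq> col z" for z
    proof -
      show "is_ideal (col z)"
        unfolding is_ideal_def col_def
        using submodD(2,3,4)[OF N(1)] by (auto simp: scale_left_distrib scale_scale[symmetric])
      show "I0 \<subseteq> col z" unfolding col_def using I0_null submodD(1)[OF N(1)] by blast
    qed
    have "\<exists>M\<in>col ` (Z - N). \<forall>K\<in>col ` (Z - N). M \<subseteq> K \<longrightarrow> K = M"
      by (rule max_ideal_ex) (use colI N(3) False in auto)
    then obtain z where z: "z \<in> Z" "z \<notin> N" and zmax0: "\<forall>K\<in>col ` (Z - N). col z \<subseteq> K \<longrightarrow> K = col z"
      by (elim bexE imageE DiffE) simp
    have zmax: "col z' = col z" if "z' \<in> Z" "z' \<notin> N" "col z \<subseteq> col z'" for z'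
      using zmax0 that by blast
    have pr: "is_prime (col z)"
      unfolding is_prime_def
    proof (intro conjI allI impI colI)
      show "1 \<notin> col z" using z(2) by (simp add: col_def)
      fix a b assume ab: "a * b \<in> col z"
      show "a \<in> col z \<or> b \<in> col z"
      proof (rule ccontr)
        assume *: "\<not> ?thesis"
        then have "b \<cdot> z \<notin> N" "b \<cdot> z \<in> Z" using submodD(4)[OF Z z(1)] by (auto simp: col_def)
        moreover have "col z \<subseteq> col (b \<cdot> z)"
        proof
          fix r assume "r \<in> col z"
          then have "b \<cdot> r \<cdot> z \<in> N" unfolding col_def using submodD(4)[OF N(1)] by blast
          then show "r \<in> col (b \<cdot> z)" unfolding col_def by (simp add: scale_scale mult.commute)
        qed
        ultimately have "col (b \<cdot> z) = col z" using zmax by blast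
        moreover have "a \<in> col (b \<cdot> z)" using ab by (simp add: col_def scale_scale)
        ultimately show False using * by blast
      qed
    qed
    have colm: "col z = \<mm>"
    proof (rule m[OF pr])
      show "{r. \<forall>a\<in>Z. r \<cdot> a \<in> B} \<subseteq> col z" unfolding col_def using z(1) N(2) by blast
    qed
    then have I0m: "I0 \<subseteq> \<mm>" using colI by blast
    define N' where "N' = {b. \<exists>r. b - r \<cdot> z \<in> N}"
    have N': "submod N'"
      unfolding submod_def
    proof (intro conjI ballI allI subsetI)
      show "x \<in> N'" if "x \<in> NN" for x
        unfolding N'_def using that submodD(1)[OF N(1)] by (intro CollectI exI[of _ 0]) auto
      fix x assume "x \<in> N'"
      then obtain r where r: "x - r \<cdot> z \<in> N" unfolding N'_def by blast
      show "t \<cdot> x \<in> N'" for t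
      proof -
        have "t \<cdot> x - (t * r) \<cdot> z = t \<cdot> (x - r \<cdot> z)" by (simp add: scale_simps)
        then show ?thesis unfolding N'_def using submodD(4)[OF N(1) r] by (metis mem_Collect_eq)
      qed
      fix y assume "y \<in> N'"
      then obtain t where t: "y - t \<cdot> z \<in> N" unfolding N'_def by blast
      have "x + y - (r + t) \<cdot> z = (x - r \<cdot> z) + (y - t \<cdot> z)" by (simp add: scale_simps)
      then show "x + y \<in> N'" unfolding N'_def using submodD(3)[OF N(1) r t] by (metis mem_Collect_eq)
    qed
    have NN': "N \<subseteq> N'" unfolding N'_def by (auto intro: exI[of _ 0])
    have zN': "z \<in> N'" unfolding N'_def using submodD(2)[OF N(1)] by (auto intro!: exI[of _ 1])
    have N'Z: "N' \<subseteq> Z"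
    proof
      fix b assume "b \<in> N'"
      then obtain r where "b - r \<cdot> z \<in> Z" unfolding N'_def using N(3) by blast
      then show "b \<in> Z" using submodD(3)[OF Z _ submodD(4)[OF Z z(1), of r]] by fastforce
    qed
    have simple: "L = N \<or> L = N'" if L: "submod L" "N \<subseteq> L" "L \<subseteq> N'" for L
    proof (cases "L \<subseteq> N")
      case False
      then obtain b where b: "b \<in> L" "b \<notin> N" by blast
      then obtain r where r: "b - r \<cdot> z \<in> N" using L(3) unfolding N'_def by blast
      have "r \<cdot> z \<in> L" using submodD(6)[OF L(1) b(1), of "b - r \<cdot> z"] r L(2) by auto
      have "r \<notin> \<mm>"
      proof
        assume "r \<in> \<mm>"
        then have "r \<cdot> z \<in> N" using colm unfolding col_def by blast
        then show False using submod_diff_cancel[OF N(1) r] b(2) by blast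
      qed
      then obtain t where "t * r - 1 \<in> col z" using unit_mod_m[OF I0m] colm by blast
      then have "(t * r) \<cdot> z - z \<in> N" unfolding col_def by (simp add: scale_left_diff)
      moreover have "(t * r) \<cdot> z \<in> L" using submodD(4)[OF L(1) \<open>r \<cdot> z \<in> L\<close>, of t] by (simp add: scale_scale)
      ultimately have zL: "z \<in> L" using submod_diff_cancel[OF L(1)] L(2) by blast
      have "N' \<subseteq> L"
      proof
        fix x assume "x \<in> N'"
        then obtain r where "x - r \<cdot> z \<in> L" unfolding N'_def using L(2) by blast
        then show "x \<in> L" using submod_diff_cancel[OF L(1)] submodD(4)[OF L(1) zL] by blast
      qed
      then show ?thesis using L(3) by blast
    qed (use L in blast)
    have "artin N' N"
      unfolding artin_def
    proof (intro allI impI)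
      fix L :: "nat \<Rightarrow> 'm set"
      assume L: "\<forall>n. submod (L n) \<and> N \<subseteq> L n \<and> L n \<subseteq> N' \<and> L (Suc n) \<subseteq> L n"
      have mono: "m \<le> n \<Longrightarrow> L n \<subseteq> L m" for m n using lift_Suc_antimono_le[of L] L by blast
      show "\<exists>k. \<forall>n\<ge>k. L n = L k"
      proof (cases "\<forall>n. L n = N'")
        case False
        then obtain k where "L k = N" using simple L by blast
        then have "\<forall>n\<ge>k. L n = L k" using mono L by blast
        then show ?thesis by blast
      qed auto
    qed
    then have "artin N' B" using artin_extend[OF N(1,2,4) _ N' NN'] by blast
    then show ?thesis using max[OF N' NN' N'Z] zN' z(2) by blast
  qed (use N in simp)
qed

end

section \<open>Koszul complexes over complexes of injectives\<close>

lemma mem_eqI: "x = y \<Longrightarrow> y \<in> N \<Longrightarrow> x \<in> N" by simp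

text \<open>\<open>pr\<close> makes the type closed under pairs, so that Koszul complexes on lists
  of every length live in the same type. \<open>divisible0\<close> is the surjectivity of
  \<open>E\<close> onto its localization at \<open>z\<close>; its annihilator clause keeps the new
  element torsion wherever \<open>e\<close> was torsion. The last two assumptions make the complex a
  resolution of the ring modulo \<open>I0\<close>, with \<open>e1\<close> the image of one.\<close>

locale koszul_complex = null_module_noeth scale NN I0 \<mm>
  for scale :: "'f::comm_ring_1 \<Rightarrow> 'm::ab_group_add \<Rightarrow> 'm" (infixr \<open>\<cdot>\<close> 75) and NN and I0 :: "'f set" and \<mm> +
  fixes pr :: "'m \<Rightarrow> 'm \<Rightarrow> 'm" and ev od :: "'m \<Rightarrow> 'm"
    and D0 :: "int \<Rightarrow> 'm set" and del0 :: "'m \<Rightarrow> 'm" and e1 :: 'm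
  assumes ev_pr [simp]: "ev (pr a b) = a" and od_pr [simp]: "od (pr a b) = b" and pr_ev_od: "pr (ev x) (od x) = x"
    and pr_add: "pr a b + pr a' b' = pr (a + a') (b + b')" and pr_scale: "r \<cdot> pr a b = pr (r \<cdot> a) (r \<cdot> b)"
    and pr_NN: "pr a b \<in> NN \<longleftrightarrow> a \<in> NN \<and> b \<in> NN"
    and D0: "submod (D0 i)" and D0_neg: "i < 0 \<Longrightarrow> D0 i \<subseteq> NN"
    and del0_add: "del0 (a + b) = del0 a + del0 b" and del0_scale: "del0 (r \<cdot> a) = r \<cdot> del0 a"
    and del0_NN: "a \<in> NN \<Longrightarrow> del0 a \<in> NN" and del0_del0: "del0 (del0 a) \<in> NN"
    and del0_D0: "a \<in> D0 i \<Longrightarrow> del0 a \<in> D0 (i + 1)"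
    and divisible0: "e \<in> D0 i \<Longrightarrow> \<exists>e'\<in>D0 i. (\<forall>r. r \<cdot> e \<in> NN \<longrightarrow> r \<cdot> e' \<in> NN) \<and> (\<exists>k. z ^ k \<cdot> (z ^ n \<cdot> e' - e) \<in> NN)"
    and exact0: "i > 0 \<Longrightarrow> a \<in> D0 i \<Longrightarrow> del0 a \<in> NN \<Longrightarrow> \<exists>b\<in>D0 (i - 1). a - del0 b \<in> NN"
    and e1: "e1 \<in> D0 0" "del0 e1 \<in> NN" "a \<in> D0 0 \<Longrightarrow> del0 a \<in> NN \<Longrightarrow> \<exists>r. a - r \<cdot> e1 \<in> NN" "r \<cdot> e1 \<in> NN \<Longrightarrow> r \<in> I0"
begin

definition tors :: "'f \<Rightarrow> 'm \<Rightarrow> bool" where "tors w a \<longleftrightarrow> (\<exists>n. w ^ n \<cdot> a \<in> NN)"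

text \<open>Adjoining \<open>c\<close> forms the shifted cone of multiplication by \<open>c\<close>:
  \<open>ev\<close> keeps its degree, and \<open>od\<close> sits one degree lower in the old
  complex.\<close>

primrec del :: "'f list \<Rightarrow> 'm \<Rightarrow> 'm" where
  "del [] = del0"
| "del (c # cs) = (\<lambda>f. pr (del cs (ev f)) (c \<cdot> ev f - del cs (od f)))"

text \<open>Torsion is imposed on the modules of the complex, not on cohomology. If
  \<open>\<mm>\<close> is the only prime over \<open>I0\<close> and \<open>W\<close>, the list
  \<open>[]\<close> gives the complex of local cohomology; smaller sets \<open>W\<close> are the
  intermediate stages.\<close>

primrec D :: "'f list \<Rightarrow> 'f set \<Rightarrow> int \<Rightarrow> 'm set" where
  "D [] = (\<lambda>W i. {a \<in> D0 i. \<forall>w\<in>W. tors w a})"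
| "D (c # cs) = (\<lambda>W i. {f. ev f \<in> D cs W i \<and> od f \<in> D cs W (i - 1)})"

text \<open>On cohomology this is the comparison map from Koszul cohomology to the cohomology
  without Koszul factors.\<close>

primrec proj :: "'f list \<Rightarrow> 'm \<Rightarrow> 'm" where
  "proj [] a = a"
| "proj (c # cs) a = proj cs (ev a)"

definition cyc :: "'f list \<Rightarrow> 'f set \<Rightarrow> int \<Rightarrow> 'm set" where
  "cyc cs W i = {a \<in> D cs W i. del cs a \<in> NN}"

definition bd :: "'f list \<Rightarrow> 'f set \<Rightarrow> int \<Rightarrow> 'm set" where
  "bd cs W i = {a. \<exists>b\<in>D cs W (i - 1). a - del cs b \<in> NN}"

lemma ev_add: "ev (a + b) = ev a + ev b" and od_add: "od (a + b) = od a + od b"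
  using pr_add[of "ev a" "od a" "ev b" "od b"] by (metis pr_ev_od ev_pr, metis pr_ev_od od_pr)

lemma ev_scale: "ev (r \<cdot> a) = r \<cdot> ev a" and od_scale: "od (r \<cdot> a) = r \<cdot> od a"
  using pr_scale[of r "ev a" "od a"] by (metis pr_ev_od ev_pr, metis pr_ev_od od_pr)

lemma ev_diff: "ev (a - b) = ev a - ev b" and od_diff: "od (a - b) = od a - od b"
  using ev_add[of "a - b" b] od_add[of "a - b" b] by simp_all

lemma NN_ev_od: "a \<in> NN \<longleftrightarrow> ev a \<in> NN \<and> od a \<in> NN"
  using pr_NN[of "ev a" "od a"] by (simp add: pr_ev_od)

lemma ev_od_eqI: "ev a = ev b \<Longrightarrow> od a = od b \<Longrightarrow> a = b"
  by (metis pr_ev_od)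

lemma del_add: "del cs (a + b) = del cs a + del cs b"
  by (induction cs arbitrary: a b)
    (simp_all add: del0_add ev_add od_add pr_add scale_simps algebra_simps)

lemma del_scale: "del cs (r \<cdot> a) = r \<cdot> del cs a"
  by (induction cs arbitrary: a)
    (simp_all add: del0_scale ev_scale od_scale pr_scale scale_simps mult.commute)

lemma del_diff: "del cs (a - b) = del cs a - del cs b"
  using del_add[of cs "a - b" b] by simp

lemma del_zero [simp]: "del cs 0 = 0"
  using del_diff[of cs 0 0] by simp

lemma del_minus: "del cs (- a) = - del cs a"
  using del_diff[of cs 0 a] by simp

lemma del_NN: "a \<in> NN \<Longrightarrow> del cs a \<in> NN"
proof (induction cs arbitrary: a)
  case (Cons c cs)
  then show ?case using NN_ev_od[of a] NND(6) NN_scale by (simp add: pr_NN)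
qed (simp add: del0_NN)

lemma del_del: "del cs (del cs a) \<in> NN"
proof (induction cs arbitrary: a)
  case (Cons c cs)
  have "c \<cdot> del cs (ev a) - del cs (c \<cdot> ev a - del cs (od a)) = del cs (del cs (od a))"
    by (simp add: del_diff del_scale)
  then show ?case using Cons by (simp add: pr_NN)
qed (simp add: del0_del0)

lemma tors_le: "w ^ n \<cdot> a \<in> NN \<Longrightarrow> n \<le> m \<Longrightarrow> w ^ m \<cdot> a \<in> NN"
  using NN_scale[of "w ^ n \<cdot> a" "w ^ (m - n)"] by (simp add: scale_scale power_add[symmetric])

lemma tors_NN: "a \<in> NN \<Longrightarrow> tors w a"
  unfolding tors_def by (intro exI[of _ 0]) simp

lemma tors_add: assumes "tors w a" "tors w b" shows "tors w (a + b)"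
proof -
  obtain n m where "w ^ n \<cdot> a \<in> NN" "w ^ m \<cdot> b \<in> NN" using assms unfolding tors_def by blast
  then have "w ^ max n m \<cdot> a \<in> NN" "w ^ max n m \<cdot> b \<in> NN" using tors_le by simp_all
  then show ?thesis unfolding tors_def by (intro exI[of _ "max n m"]) (simp add: scale_right_distrib NN_add)
qed

lemma tors_scale: assumes "tors w a" shows "tors w (r \<cdot> a)"
proof -
  obtain n where "w ^ n \<cdot> a \<in> NN" using assms unfolding tors_def by blast
  then have "r \<cdot> w ^ n \<cdot> a \<in> NN" by (rule NN_scale)
  then show ?thesis unfolding tors_def by (intro exI[of _ n]) (simp add: scale_scale mult.commute)
qed

lemma tors_ev_od: "tors w a \<longleftrightarrow> tors w (ev a) \<and> tors w (od a)"
proof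
  show "tors w (ev a) \<and> tors w (od a)" if "tors w a"
    using that unfolding tors_def by (auto simp: NN_ev_od[of "_ \<cdot> a"] ev_scale od_scale)
  assume "tors w (ev a) \<and> tors w (od a)"
  then obtain n m where "w ^ n \<cdot> ev a \<in> NN" "w ^ m \<cdot> od a \<in> NN" unfolding tors_def by blast
  then have "w ^ max n m \<cdot> ev a \<in> NN" "w ^ max n m \<cdot> od a \<in> NN" using tors_le by simp_all
  then show "tors w a" unfolding tors_def by (intro exI[of _ "max n m"]) (simp add: NN_ev_od[of "_ \<cdot> a"] ev_scale od_scale)
qed

lemma tors_del: assumes "tors w a" shows "tors w (del cs a)"
proof -
  obtain n where "w ^ n \<cdot> a \<in> NN" using assms unfolding tors_def by blast
  then have "del cs (w ^ n \<cdot> a) \<in> NN" by (rule del_NN)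
  then show ?thesis unfolding tors_def del_scale by blast
qed

lemma submod_D: "submod (D cs W i)"
proof (induction cs arbitrary: i)
  case Nil
  show ?case
    unfolding submod_def D.simps
    using submodD(1,3,4)[OF D0[of i]] tors_NN tors_add tors_scale by (simp add: subset_iff)
next
  case (Cons c cs)
  have "NN \<subseteq> D (c # cs) W i"
    using submodD(1)[OF Cons.IH[of i]] submodD(1)[OF Cons.IH[of "i - 1"]] NN_ev_od by auto
  then show ?case
    unfolding submod_def
    using submodD(3,4)[OF Cons.IH[of i]] submodD(3,4)[OF Cons.IH[of "i - 1"]]
    by (simp add: ev_add od_add ev_scale od_scale)
qed

lemmas D_D = submodD[OF submod_D]

lemma del_D: "a \<in> D cs W i \<Longrightarrow> del cs a \<in> D cs W (i + 1)"
proof (induction cs arbitrary: i a)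
  case Nil
  then show ?case using del0_D0 tors_del[of _ a "[]"] by auto
next
  case (Cons c cs)
  then have "del cs (od a) \<in> D cs W i" using Cons.IH[of "od a" "i - 1"] by simp
  then show ?case using Cons D_D(4,6) by simp
qed

lemma del_D': "a \<in> D cs W (i - 1) \<Longrightarrow> del cs a \<in> D cs W i"
  using del_D[of a cs W "i - 1"] by simp

lemma D_insert: "D cs (insert z W) i = {a \<in> D cs W i. tors z a}"
proof (induction cs arbitrary: i)
  case (Cons c cs)
  show ?case
    unfolding D.simps Cons.IH mem_Collect_eq using tors_ev_od[of z] by blast
qed auto

lemma D_mono: "W \<subseteq> W' \<Longrightarrow> D cs W' i \<subseteq> D cs W i"
  by (induction cs arbitrary: i) auto

lemma D_neg: "i < 0 \<Longrightarrow> D cs W i \<subseteq> NN"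
proof (induction cs arbitrary: i)
  case Nil
  then show ?case using D0_neg[of i] by auto
next
  case (Cons c cs)
  have "D cs W i \<subseteq> NN" "D cs W (i - 1) \<subseteq> NN" using Cons.IH[of i] Cons.IH[of "i - 1"] Cons.prems by auto
  then show ?case using NN_ev_od by auto
qed

lemma submod_cyc: "submod (cyc cs W i)"
  unfolding submod_def cyc_def using D_D(1,3,4) del_NN NN_add NN_scale by (auto simp: del_add del_scale)

lemma submod_bd: "submod (bd cs W i)"
  unfolding submod_def
proof (intro conjI ballI allI subsetI)
  show "x \<in> bd cs W i" if "x \<in> NN" for x
    unfolding bd_def using that D_D(2) by (intro CollectI bexI[of _ 0]) simp_all
  fix x assume "x \<in> bd cs W i"
  then obtain a where a: "a \<in> D cs W (i - 1)" "x - del cs a \<in> NN" unfolding bd_def by blast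
  show "t \<cdot> x \<in> bd cs W i" for t
  proof -
    have "t \<cdot> x - del cs (t \<cdot> a) \<in> NN"
      by (rule mem_eqI[OF _ NN_scale[OF a(2), of t]]) (simp add: del_scale scale_simps)
    then show ?thesis unfolding bd_def using D_D(4)[OF a(1)] by blast
  qed
  fix y assume "y \<in> bd cs W i"
  then obtain b where b: "b \<in> D cs W (i - 1)" "y - del cs b \<in> NN" unfolding bd_def by blast
  have "x + y - del cs (a + b) \<in> NN"
    by (rule mem_eqI[OF _ NN_add[OF a(2) b(2)]]) (simp add: del_add)
  then show "x + y \<in> bd cs W i" unfolding bd_def using D_D(3)[OF a(1) b(1)] by blast
qed

lemmas cycD = submodD[OF submod_cyc]
lemmas bdD = submodD[OF submod_bd]

lemma bd_sub_cyc: "bd cs W i \<subseteq> cyc cs W i"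
proof
  fix x assume "x \<in> bd cs W i"
  then obtain a where a: "a \<in> D cs W (i - 1)" "x - del cs a \<in> NN" unfolding bd_def by blast
  have "x \<in> D cs W i"
    using submod_diff_cancel[OF submod_D, of x "del cs a" cs W i] del_D'[OF a(1)] D_D(1) a(2) by blast
  moreover have "del cs x \<in> NN"
    using submod_diff_cancel[OF submod_NN, of "del cs x" "del cs (del cs a)"] del_NN[OF a(2), of cs] del_del
    by (simp add: del_diff)
  ultimately show "x \<in> cyc cs W i" unfolding cyc_def by blast
qed

lemma del_bd: "a \<in> D cs W (i - 1) \<Longrightarrow> del cs a \<in> bd cs W i"
  unfolding bd_def using NN_zero by (intro CollectI bexI[of _ a]) simp_all

lemma bd_mono: "W \<subseteq> W' \<Longrightarrow> bd cs W' i \<subseteq> bd cs W i"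
  unfolding bd_def using D_mono by blast

lemma cyc_mono: "W \<subseteq> W' \<Longrightarrow> cyc cs W' i \<subseteq> cyc cs W i"
  unfolding cyc_def using D_mono by blast

lemma cyc_Cons: "x \<in> cyc (c # cs) W i \<longleftrightarrow>
    ev x \<in> cyc cs W i \<and> od x \<in> D cs W (i - 1) \<and> c \<cdot> ev x - del cs (od x) \<in> NN"
  unfolding cyc_def by (auto simp: pr_NN)

section \<open>Division of chains and the exact sequence of a Koszul factor\<close>

lemma divisible: "a \<in> D cs W i \<Longrightarrow> \<exists>b\<in>D cs W i. tors z (a - z ^ n \<cdot> b)"
proof (induction cs arbitrary: i a)
  case Nil
  then have a: "a \<in> D0 i" "\<And>w. w \<in> W \<Longrightarrow> tors w a" by auto
  obtain e k where e: "e \<in> D0 i" "\<And>r. r \<cdot> a \<in> NN \<Longrightarrow> r \<cdot> e \<in> NN" "z ^ k \<cdot> (z ^ n \<cdot> e - a) \<in> NN"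
    using divisible0[OF a(1), where z = z and n = n] by auto
  have "z ^ k \<cdot> (a - z ^ n \<cdot> e) \<in> NN"
    by (rule mem_eqI[OF _ NND(5)[OF e(3)]]) (simp add: scale_simps)
  then have "tors z (a - z ^ n \<cdot> e)" unfolding tors_def by blast
  moreover have "tors w e" if "w \<in> W" for w using a(2)[OF that] e(2) unfolding tors_def by blast
  then have "e \<in> D [] W i" using e(1) by simp
  ultimately show ?case by blast
next
  case (Cons c cs)
  obtain b where b: "b \<in> D cs W i" "tors z (ev a - z ^ n \<cdot> b)" using Cons.IH[of "ev a" i] Cons.prems by auto
  obtain b' where b': "b' \<in> D cs W (i - 1)" "tors z (od a - z ^ n \<cdot> b')" using Cons.IH[of "od a" "i - 1"] Cons.prems by auto
  have "tors z (a - z ^ n \<cdot> pr b b')" unfolding tors_ev_od[of z "a - _"] using b b' by (simp add: ev_diff od_diff ev_scale od_scale)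
  then show ?case using b b' by (intro bexI[of _ "pr b b'"]) simp_all
qed

text \<open>The chain \<open>b\<close> that bounds \<open>z ^ M\<close> times \<open>e\<close> is
  divided by \<open>z ^ M\<close>; subtracting the boundary of the quotient makes \<open>e\<close> a
  \<open>z\<close>-torsion element. The comparisons of complexes with and without torsion at
  \<open>z\<close> rest on this correction.\<close>

lemma boundary_torsion:
  assumes "e \<in> D cs W (i + 1)" "b \<in> D cs W i" "z ^ M \<cdot> e - del cs b \<in> NN"
  shows "\<exists>b'\<in>D cs W i. tors z (e - del cs b')"
proof -
  obtain b' where b': "b' \<in> D cs W i" "tors z (b - z ^ M \<cdot> b')" using divisible[OF assms(2)] by blast
  have "z ^ M \<cdot> (e - del cs b') = (z ^ M \<cdot> e - del cs b) + del cs (b - z ^ M \<cdot> b')"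
    by (simp add: del_diff del_scale scale_simps)
  moreover have "tors z ((z ^ M \<cdot> e - del cs b) + del cs (b - z ^ M \<cdot> b'))"
    by (intro tors_add tors_NN[OF assms(3)] tors_del[OF b'(2)])
  ultimately have "tors z (z ^ M \<cdot> (e - del cs b'))" by simp
  then obtain n where "z ^ n \<cdot> z ^ M \<cdot> (e - del cs b') \<in> NN" unfolding tors_def by blast
  then have "z ^ (n + M) \<cdot> (e - del cs b') \<in> NN" by (simp add: scale_scale power_add)
  then have "tors z (e - del cs b')" unfolding tors_def by blast
  then show ?thesis using b'(1) by blast
qed

lemma boundary_torsion':
  assumes "e \<in> D cs W i" "z ^ M \<cdot> e \<in> bd cs W i"
  shows "\<exists>b\<in>D cs W (i - 1). tors z (e - del cs b)"
proof -
  obtain b where b: "b \<in> D cs W (i - 1)" "z ^ M \<cdot> e - del cs b \<in> NN" using assms(2) unfolding bd_def by blast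
  have "\<exists>b'\<in>D cs W (i - 1). tors z (e - del cs b')"
    by (rule boundary_torsion[OF _ b]) (use assms(1) in simp)
  then show ?thesis .
qed

text \<open>On the cone of \<open>c\<close>, multiplication by \<open>c\<close> is null-homotopic
  through the map that moves \<open>od\<close> into \<open>ev\<close>. Each further factor doubles
  the exponent, since \<open>ev\<close> and then \<open>od\<close> has to be corrected.\<close>

lemma koszul_kills: "c \<in> set cs \<Longrightarrow> \<exists>k. \<forall>W i. \<forall>a\<in>cyc cs W i. c ^ k \<cdot> a \<in> bd cs W i"
proof (induction cs)
  case (Cons c' cs)
  show ?case
  proof (cases "c = c'")
    case True
    have "c ^ 1 \<cdot> a \<in> bd (c # cs) W i" if "a \<in> cyc (c # cs) W i" for W i a
    proof -
      note a = that[unfolded cyc_Cons]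
      have "c \<cdot> a - del (c # cs) (pr (od a) 0) = pr (c \<cdot> ev a - del cs (od a)) 0"
        by (rule ev_od_eqI) (simp_all add: ev_diff od_diff ev_scale od_scale)
      then have "c \<cdot> a - del (c # cs) (pr (od a) 0) \<in> NN" using a NN_zero by (simp add: pr_NN)
      moreover have "pr (od a) 0 \<in> D (c # cs) W (i - 1)" using a D_D(2) by simp
      ultimately have "c \<cdot> a \<in> bd (c # cs) W i" unfolding bd_def by blast
      then show ?thesis by simp
    qed
    then show ?thesis using True by blast
  next
    case False
    then obtain k where k: "\<And>W i a. a \<in> cyc cs W i \<Longrightarrow> c ^ k \<cdot> a \<in> bd cs W i" using Cons by auto
    have "c ^ (k + k) \<cdot> a \<in> bd (c' # cs) W i" if "a \<in> cyc (c' # cs) W i" for W i a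
    proof -
      note a = that[unfolded cyc_Cons]
      obtain x where x: "x \<in> D cs W (i - 1)" "c ^ k \<cdot> ev a - del cs x \<in> NN" using k[of "ev a" W i] a unfolding bd_def by blast
      define y where "y = c ^ k \<cdot> od a - c' \<cdot> x"
      have "del cs y = c' \<cdot> (c ^ k \<cdot> ev a - del cs x) - c ^ k \<cdot> (c' \<cdot> ev a - del cs (od a))"
        unfolding y_def by (simp add: del_diff del_scale scale_simps mult.commute)
      moreover have "\<dots> \<in> NN" using a x NND(4,6) by blast
      ultimately have "y \<in> cyc cs W (i - 1)" unfolding cyc_def y_def using a x D_D(4,6) by auto
      then obtain w where w: "w \<in> D cs W (i - 1 - 1)" "c ^ k \<cdot> y - del cs w \<in> NN" using k[of y W "i - 1"] unfolding bd_def by blast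
      have "c ^ (k + k) \<cdot> a - del (c' # cs) (pr (c ^ k \<cdot> x) (- w)) = pr (c ^ k \<cdot> (c ^ k \<cdot> ev a - del cs x)) (c ^ k \<cdot> y - del cs w)"
        unfolding y_def by (rule ev_od_eqI)
          (simp_all add: ev_diff od_diff ev_scale od_scale del_scale del_minus scale_simps power_add mult_ac)
      moreover have "\<dots> \<in> NN" unfolding pr_NN using x w NN_scale by blast
      moreover have "pr (c ^ k \<cdot> x) (- w) \<in> D (c' # cs) W (i - 1)" using x w D_D(4,5) by simp
      ultimately show ?thesis unfolding bd_def by (metis (no_types, lifting) mem_Collect_eq)
    qed
    then show ?thesis by blast
  qed
qed simp

text \<open>With \<open>pr_multiple_bd\<close> and \<open>koszul_lift\<close> this is the part in
  use of the exact sequence of a cone, with \<open>pr 0\<close> as connecting map: up to the image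
  of degree \<open>i - 1\<close>, a class is determined by its image under \<open>ev\<close>, and
  that image is any class killed by \<open>c\<close>.\<close>

lemma koszul_kernel:
  assumes "x \<in> cyc (c # cs) W i" "ev x \<in> bd cs W i"
  shows "\<exists>\<theta>\<in>cyc cs W (i - 1). x - pr 0 \<theta> \<in> bd (c # cs) W i"
proof -
  note x = assms(1)[unfolded cyc_Cons]
  obtain \<alpha> where a: "\<alpha> \<in> D cs W (i - 1)" "ev x - del cs \<alpha> \<in> NN" using assms(2) unfolding bd_def by blast
  define \<theta> where "\<theta> = od x - c \<cdot> \<alpha>"
  have "del cs \<theta> = c \<cdot> (ev x - del cs \<alpha>) - (c \<cdot> ev x - del cs (od x))"
    unfolding \<theta>_def by (simp add: del_diff del_scale scale_simps)
  moreover have "\<dots> \<in> NN" using x a NND(4,6) by blast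
  ultimately have "\<theta> \<in> cyc cs W (i - 1)" unfolding cyc_def \<theta>_def using x a D_D(4,6) by simp
  moreover have "x - pr 0 \<theta> - del (c # cs) (pr \<alpha> 0) = pr (ev x - del cs \<alpha>) 0"
    unfolding \<theta>_def by (rule ev_od_eqI) (simp_all add: ev_diff od_diff)
  then have "x - pr 0 \<theta> - del (c # cs) (pr \<alpha> 0) \<in> NN" using a NN_zero by (simp add: pr_NN)
  moreover have "pr \<alpha> 0 \<in> D (c # cs) W (i - 1)" using a D_D(2) by simp
  ultimately show ?thesis unfolding bd_def by blast
qed

lemma pr_cyc: "\<theta> \<in> cyc cs W (i - 1) \<Longrightarrow> pr 0 \<theta> \<in> cyc (c # cs) W i"
  unfolding cyc_Cons using cycD(2) NND(5) by (simp add: cyc_def)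

lemma pr_bd: "\<theta> \<in> bd cs W (i - 1) \<Longrightarrow> pr 0 \<theta> \<in> bd (c # cs) W i"
proof -
  assume "\<theta> \<in> bd cs W (i - 1)"
  then obtain b where b: "b \<in> D cs W (i - 1 - 1)" "\<theta> - del cs b \<in> NN" unfolding bd_def by blast
  have "pr 0 \<theta> - del (c # cs) (pr 0 (- b)) = pr 0 (\<theta> - del cs b)"
    by (rule ev_od_eqI) (simp_all add: ev_diff od_diff del_minus)
  then have "pr 0 \<theta> - del (c # cs) (pr 0 (- b)) \<in> NN" using b NN_zero by (simp add: pr_NN)
  moreover have "pr 0 (- b) \<in> D (c # cs) W (i - 1)" using b D_D(2,5) by simp
  ultimately show ?thesis unfolding bd_def by blast
qed

lemma pr_multiple_bd: assumes "\<eta> \<in> cyc cs W (i - 1)" shows "pr 0 (c \<cdot> \<eta>) \<in> bd (c # cs) W i"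
proof -
  have "pr 0 (c \<cdot> \<eta>) - del (c # cs) (pr \<eta> 0) = pr (- del cs \<eta>) 0"
    by (rule ev_od_eqI) (simp_all add: ev_diff od_diff)
  then have "pr 0 (c \<cdot> \<eta>) - del (c # cs) (pr \<eta> 0) \<in> NN"
    using assms NN_zero NND(5) by (simp add: pr_NN cyc_def)
  moreover have "pr \<eta> 0 \<in> D (c # cs) W (i - 1)" using assms D_D(2) by (simp add: cyc_def)
  ultimately show ?thesis unfolding bd_def by blast
qed

lemma ev_bd: "x \<in> bd (c # cs) W i \<Longrightarrow> ev x \<in> bd cs W i"
proof -
  assume "x \<in> bd (c # cs) W i"
  then obtain b where b: "b \<in> D (c # cs) W (i - 1)" "x - del (c # cs) b \<in> NN" unfolding bd_def by blast
  then have "ev x - del cs (ev b) \<in> NN" using NN_ev_od[of "x - del (c # cs) b"] by (simp add: ev_diff)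
  then show ?thesis unfolding bd_def using b(1) by auto
qed

lemma koszul_lift:
  assumes "a \<in> cyc cs W i" "c \<cdot> a \<in> bd cs W i" shows "\<exists>x\<in>cyc (c # cs) W i. ev x = a"
proof -
  obtain y where "y \<in> D cs W (i - 1)" "c \<cdot> a - del cs y \<in> NN" using assms(2) unfolding bd_def by blast
  then show ?thesis using assms(1) by (intro bexI[of _ "pr a y"]) (simp_all add: cyc_Cons)
qed

section \<open>Projection to the complex without Koszul factors\<close>

lemma proj_add: "proj cs (a + b) = proj cs a + proj cs b"
  by (induction cs arbitrary: a b) (simp_all add: ev_add)

lemma proj_scale: "proj cs (r \<cdot> a) = r \<cdot> proj cs a"
  by (induction cs arbitrary: a) (simp_all add: ev_scale)

lemma proj_diff: "proj cs (a - b) = proj cs a - proj cs b"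
  using proj_add[of cs "a - b" b] by simp

lemma proj_cyc: "a \<in> cyc cs W i \<Longrightarrow> proj cs a \<in> cyc [] W i"
  by (induction cs arbitrary: a) (auto simp: cyc_Cons)

lemma proj_bd: "a \<in> bd cs W i \<Longrightarrow> proj cs a \<in> bd [] W i"
  by (induction cs arbitrary: a) (auto dest: ev_bd)

lemma proj_killed: "c \<in> set cs \<Longrightarrow> a \<in> cyc cs W i \<Longrightarrow> c \<cdot> proj cs a \<in> bd [] W i"
proof (induction cs arbitrary: a)
  case (Cons c' cs)
  note a = Cons.prems(2)[unfolded cyc_Cons]
  show ?case
  proof (cases "c = c'")
    case True
    have "c \<cdot> ev a \<in> bd cs W i" unfolding bd_def using a True by blast
    then show ?thesis using proj_bd[of "c \<cdot> ev a" cs W i] by (simp add: proj_scale)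
  qed (use Cons a in simp)
qed simp

text \<open>The cycle bounds a chain \<open>e\<close> before the condition at \<open>z\<close> is
  imposed. A power of \<open>z\<close> times \<open>e\<close> is a cycle one degree lower, hence a
  boundary, so \<open>e\<close> can be corrected to a torsion chain. The lower degree is the reason
  for the shift of the bound.\<close>

lemma vanish_insert_torsion:
  assumes "\<And>j. j > n \<Longrightarrow> cyc cs W j \<subseteq> bd cs W j" "i > n + 1"
  shows "cyc cs (insert z W) i \<subseteq> bd cs (insert z W) i"
proof
  fix \<xi> assume xi: "\<xi> \<in> cyc cs (insert z W) i"
  then have "\<xi> \<in> cyc cs W i" using cyc_mono[of W "insert z W"] by blast
  then obtain e where e: "e \<in> D cs W (i - 1)" "\<xi> - del cs e \<in> NN" using assms(1)[of i] assms(2) unfolding bd_def by auto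
  obtain M where M: "z ^ M \<cdot> \<xi> \<in> NN" using xi unfolding cyc_def D_insert tors_def by blast
  have "del cs (z ^ M \<cdot> e) = z ^ M \<cdot> \<xi> - z ^ M \<cdot> (\<xi> - del cs e)" by (simp add: del_scale scale_simps)
  moreover have "\<dots> \<in> NN" using M e NND(4,6) by blast
  ultimately have "z ^ M \<cdot> e \<in> cyc cs W (i - 1)" unfolding cyc_def using D_D(4)[OF e(1)] by simp
  then have "z ^ M \<cdot> e \<in> bd cs W (i - 1)" using assms(1)[of "i - 1"] assms(2) by auto
  then obtain b where b: "b \<in> D cs W (i - 1 - 1)" "tors z (e - del cs b)" using boundary_torsion'[OF e(1)] by blast
  have "e - del cs b \<in> D cs (insert z W) (i - 1)" unfolding D_insert using b D_D(6)[OF e(1) del_D'] by blast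
  moreover have "\<xi> - del cs (e - del cs b) \<in> NN"
    by (rule mem_eqI[OF _ NN_add[OF e(2) del_del[of cs b]]]) (simp add: del_diff)
  ultimately show "\<xi> \<in> bd cs (insert z W) i" unfolding bd_def by blast
qed

lemma vanish_cons:
  assumes "\<And>j. j > n \<Longrightarrow> cyc cs W j \<subseteq> bd cs W j" "i > n + 1"
  shows "cyc (c # cs) W i \<subseteq> bd (c # cs) W i"
proof
  fix x assume x: "x \<in> cyc (c # cs) W i"
  then have "ev x \<in> bd cs W i" using assms(1)[of i] assms(2) unfolding cyc_Cons by auto
  then obtain \<theta> where t: "\<theta> \<in> cyc cs W (i - 1)" "x - pr 0 \<theta> \<in> bd (c # cs) W i" using koszul_kernel[OF x] by blast
  then have "pr 0 \<theta> \<in> bd (c # cs) W i" using assms(1)[of "i - 1"] assms(2) pr_bd by auto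
  then show "x \<in> bd (c # cs) W i" using submod_diff_cancel[OF submod_bd t(2)] by blast
qed

text \<open>Each element, as a Koszul factor or as a torsion condition, raises the cohomological
  dimension by at most one, starting from the exact complex.\<close>

lemma vanish:
  assumes "finite W" "i > int (length cs + card W)" shows "cyc cs W i \<subseteq> bd cs W i"
proof -
  have nil: "cyc [] W i \<subseteq> bd [] W i" if "finite W" "i > int (card W)" for W i
    using that
  proof (induction W arbitrary: i rule: finite_induct)
    case empty
    show ?case
    proof
      fix a assume "a \<in> cyc [] {} i"
      then show "a \<in> bd [] {} i" using exact0[of i a] empty.prems unfolding cyc_def bd_def by auto
    qed
  next
    case (insert z W)
    then show ?case using vanish_insert_torsion[of "int (card W)" "[]" W i z] by simp
  qed
  show ?thesis
    using assms(2)
  proof (induction cs arbitrary: i)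
    case Nil
    then show ?case using nil[OF assms(1)] by simp
  next
    case (Cons c cs)
    then show ?case using vanish_cons[of "int (length cs + card W)" cs W i c] by simp
  qed
qed

text \<open>Where a power of \<open>z\<close> already kills the cohomology, a torsion condition at
  \<open>z\<close> does not change it. The first part corrects cycles and gives surjectivity, the
  second corrects bounding chains and gives injectivity.\<close>

lemma torsion_quasi_iso:
  assumes kill: "\<And>i a. a \<in> cyc cs W i \<Longrightarrow> z ^ M \<cdot> a \<in> bd cs W i"
  shows "a \<in> cyc cs W i \<Longrightarrow> \<exists>a'\<in>cyc cs (insert z W) i. a - a' \<in> bd cs W i"
    and "a \<in> cyc cs (insert z W) i \<Longrightarrow> a \<in> bd cs W i \<Longrightarrow> a \<in> bd cs (insert z W) i"
proof -
  assume a: "a \<in> cyc cs W i"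
  obtain b where b: "b \<in> D cs W (i - 1)" "tors z (a - del cs b)"
    using boundary_torsion'[OF _ kill[OF a]] a unfolding cyc_def by blast
  have "a - del cs b \<in> cyc cs (insert z W) i"
    using a b D_D(6)[OF _ del_D'] NND(6)[OF _ del_del] unfolding cyc_def D_insert by (auto simp: del_diff)
  moreover have "a - (a - del cs b) \<in> bd cs W i" using del_bd[OF b(1)] by simp
  ultimately show "\<exists>a'\<in>cyc cs (insert z W) i. a - a' \<in> bd cs W i" by blast
next
  assume a: "a \<in> cyc cs (insert z W) i" "a \<in> bd cs W i"
  obtain e where e: "e \<in> D cs W (i - 1)" "a - del cs e \<in> NN" using a(2) unfolding bd_def by blast
  obtain N where N: "z ^ N \<cdot> a \<in> NN" using a(1) unfolding cyc_def D_insert tors_def by blast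
  have "del cs (z ^ N \<cdot> e) = z ^ N \<cdot> a - z ^ N \<cdot> (a - del cs e)" by (simp add: del_scale scale_simps)
  moreover have "\<dots> \<in> NN" using N e NND(4,6) by blast
  ultimately have "z ^ N \<cdot> e \<in> cyc cs W (i - 1)" unfolding cyc_def using D_D(4)[OF e(1)] by simp
  then have "z ^ (M + N) \<cdot> e \<in> bd cs W (i - 1)" using kill[of "z ^ N \<cdot> e" "i - 1"] by (simp add: scale_scale power_add)
  then obtain b where b: "b \<in> D cs W (i - 1 - 1)" "tors z (e - del cs b)" using boundary_torsion'[OF e(1)] by blast
  have "e - del cs b \<in> D cs (insert z W) (i - 1)" unfolding D_insert using b D_D(6)[OF e(1) del_D'] by blast
  moreover have "a - del cs (e - del cs b) \<in> NN"
    by (rule mem_eqI[OF _ NN_add[OF e(2) del_del[of cs b]]]) (simp add: del_diff)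
  ultimately show "a \<in> bd cs (insert z W) i" unfolding bd_def by blast
qed

section \<open>Chain conditions on the cohomology\<close>

lemma noeth_nil: "noeth_mod (cyc [] {} i) (bd [] {} i)"
proof -
  consider "i < 0" | "i > 0" | "i = 0" by linarith
  then show ?thesis
  proof cases
    case 1
    then have "cyc [] {} i \<subseteq> bd [] {} i" using D_neg[OF 1, of "[]" "{}"] bdD(1) unfolding cyc_def by blast
    then show ?thesis by (rule noeth_mod_trivial)
  next
    case 2
    then have "cyc [] {} i \<subseteq> bd [] {} i" by (intro vanish) simp_all
    then show ?thesis by (rule noeth_mod_trivial)
  next
    case 3
    show ?thesis
      unfolding noeth_mod_def
    proof (intro allI impI)
      fix C assume C: "C \<noteq> {}" "\<forall>N\<in>C. submod N \<and> bd [] {} i \<subseteq> N \<and> N \<subseteq> cyc [] {} i"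
      \<comment> \<open>Every cycle of degree zero is a multiple of \<open>e1\<close> modulo
        \<open>NN\<close>, so a submodule is recovered from its ideal of coefficients.\<close>
      define \<phi> where "\<phi> = (\<lambda>N. {r. r \<cdot> e1 \<in> N})"
      have "\<exists>M\<in>\<phi> ` C. \<forall>K\<in>\<phi> ` C. M \<subseteq> K \<longrightarrow> K = M"
      proof (rule max_ideal_ex)
        show "\<phi> ` C \<noteq> {}" using C by simp
        fix J assume "J \<in> \<phi> ` C"
        then obtain N where N: "submod N" "J = \<phi> N" using C(2) by blast
        then show "is_ideal J \<and> I0 \<subseteq> J"
          unfolding is_ideal_def \<phi>_def using submodD(1,2,3,4)[OF N(1)] I0_null
          by (auto simp: scale_left_distrib scale_scale[symmetric])
      qed
      then obtain X where X: "X \<in> \<phi> ` C" "\<forall>K\<in>\<phi> ` C. X \<subseteq> K \<longrightarrow> K = X" by (elim bexE)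
  then obtain M where "M \<in> C" "X = \<phi> M" by (elim imageE)
  then have M: "M \<in> C" "\<forall>K\<in>C. \<phi> M \<subseteq> \<phi> K \<longrightarrow> \<phi> K = \<phi> M" using X(2) by simp_all
      have "N \<subseteq> M" if N: "N \<in> C" "M \<subseteq> N" for N
      proof
        fix x assume x: "x \<in> N"
        then have "x \<in> cyc [] {} 0" using C(2) N(1) 3 by blast
        then obtain r where r: "x - r \<cdot> e1 \<in> NN" using e1(3)[of x] unfolding cyc_def by auto
        have sub: "submod M" "submod N" using C(2) M(1) N(1) by auto
        have "r \<cdot> e1 \<in> N" using submod_diff_cancel[OF sub(2), of x "r \<cdot> e1"] x r submodD(1)[OF sub(2)] by blast
        moreover have "\<phi> N = \<phi> M" using M(2) N unfolding \<phi>_def by blast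
        ultimately have "r \<cdot> e1 \<in> M" unfolding \<phi>_def by blast
        then show "x \<in> M" using submod_diff_cancel[OF sub(1), of x "r \<cdot> e1"] r submodD(1)[OF sub(1)] by blast
      qed
      then show "\<exists>M\<in>C. \<forall>N\<in>C. M \<subseteq> N \<longrightarrow> N = M" using M(1) by (intro bexI[of _ M]) auto
    qed
  qed
qed

text \<open>Inside a larger submodule, a submodule is determined by its image under
  \<open>ev\<close> and its trace on the image of \<open>pr 0\<close>; both belong to the cohomology
  of \<open>cs\<close>.\<close>

lemma noeth_cons:
  assumes "noeth_mod (cyc cs W i) (bd cs W i)" "noeth_mod (cyc cs W (i - 1)) (bd cs W (i - 1))"
  shows "noeth_mod (cyc (c # cs) W i) (bd (c # cs) W i)"
  unfolding noeth_mod_def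
proof (intro allI impI)
  fix C assume C: "C \<noteq> {}" "\<forall>N\<in>C. submod N \<and> bd (c # cs) W i \<subseteq> N \<and> N \<subseteq> cyc (c # cs) W i"
  define \<phi> where "\<phi> = (\<lambda>N. ev ` N)"
  define \<psi> where "\<psi> = (\<lambda>N. {y. pr 0 y \<in> N})"
  have phi: "submod (\<phi> N) \<and> bd cs W i \<subseteq> \<phi> N \<and> \<phi> N \<subseteq> cyc cs W i" if "N \<in> C" for N
  proof -
    have N: "submod N" "bd (c # cs) W i \<subseteq> N" "N \<subseteq> cyc (c # cs) W i" using C(2) that by auto
    have nn: "pr a 0 \<in> N" if "a \<in> NN" for a using submodD(1)[OF N(1)] that NN_zero pr_NN by blast
    have "submod (\<phi> N)"
      unfolding submod_def \<phi>_def
    proof (intro conjI ballI allI subsetI)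
      show "a \<in> ev ` N" if "a \<in> NN" for a using nn[OF that] ev_pr by (metis image_eqI)
      fix a assume "a \<in> ev ` N"
      then obtain x where x: "x \<in> N" "a = ev x" by blast
      show "r \<cdot> a \<in> ev ` N" for r using submodD(4)[OF N(1) x(1)] x(2) ev_scale by (metis image_eqI)
      fix b assume "b \<in> ev ` N"
      then obtain y where y: "y \<in> N" "b = ev y" by blast
      show "a + b \<in> ev ` N" using submodD(3)[OF N(1) x(1) y(1)] x(2) y(2) ev_add by (metis image_eqI)
    qed
    moreover have "bd cs W i \<subseteq> \<phi> N"
    proof
      fix a assume "a \<in> bd cs W i"
      then obtain b where b: "b \<in> D cs W (i - 1)" "a - del cs b \<in> NN" unfolding bd_def by blast
      have "pr b 0 \<in> D (c # cs) W (i - 1)" using b(1) D_D(2) by simp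
      then have "del (c # cs) (pr b 0) \<in> N" using del_bd N(2) by blast
      then have "del (c # cs) (pr b 0) + pr (a - del cs b) 0 \<in> N" using submodD(3)[OF N(1)] nn[OF b(2)] by blast
      then show "a \<in> \<phi> N" unfolding \<phi>_def by (rule rev_image_eqI) (simp add: ev_add)
    qed
    moreover have "\<phi> N \<subseteq> cyc cs W i" unfolding \<phi>_def using N(3) cyc_Cons by blast
    ultimately show ?thesis by blast
  qed
  have psi: "submod (\<psi> N) \<and> bd cs W (i - 1) \<subseteq> \<psi> N \<and> \<psi> N \<subseteq> cyc cs W (i - 1)" if "N \<in> C" for N
  proof -
    have N: "submod N" "bd (c # cs) W i \<subseteq> N" "N \<subseteq> cyc (c # cs) W i" using C(2) that by auto
    have "submod (\<psi> N)"
      unfolding submod_def \<psi>_def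
    proof (intro conjI ballI allI subsetI CollectI)
      show "pr 0 a \<in> N" if "a \<in> NN" for a using submodD(1)[OF N(1)] that NN_zero pr_NN by blast
      fix a assume a: "a \<in> {y. pr 0 y \<in> N}"
      show "pr 0 (r \<cdot> a) \<in> N" for r using submodD(4)[OF N(1), of "pr 0 a" r] a by (simp add: pr_scale)
      fix b assume "b \<in> {y. pr 0 y \<in> N}"
      then show "pr 0 (a + b) \<in> N" using submodD(3)[OF N(1), of "pr 0 a" "pr 0 b"] a by (simp add: pr_add)
    qed
    moreover have "bd cs W (i - 1) \<subseteq> \<psi> N" unfolding \<psi>_def using pr_bd N(2) by blast
    moreover have "\<psi> N \<subseteq> cyc cs W (i - 1)"
    proof
      fix y assume "y \<in> \<psi> N"
      then have "pr 0 y \<in> cyc (c # cs) W i" unfolding \<psi>_def using N(3) by blast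
      then have "y \<in> D cs W (i - 1)" "- del cs y \<in> NN" unfolding cyc_Cons by simp_all
      then show "y \<in> cyc cs W (i - 1)" unfolding cyc_def using NND(5)[of "- del cs y"] by simp
    qed
    ultimately show ?thesis by blast
  qed
  have "\<exists>M\<in>\<phi> ` C. \<forall>K\<in>\<phi> ` C. M \<subseteq> K \<longrightarrow> K = M"
    by (rule noeth_modD[OF assms(1)]) (use C(1) phi in auto)
  then obtain X where X: "X \<in> \<phi> ` C" "\<forall>K\<in>\<phi> ` C. X \<subseteq> K \<longrightarrow> K = X" by (elim bexE)
  then obtain M where "M \<in> C" "X = \<phi> M" by (elim imageE)
  then have M: "M \<in> C" "\<forall>K\<in>C. \<phi> M \<subseteq> \<phi> K \<longrightarrow> \<phi> K = \<phi> M" using X(2) by simp_all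
  have "\<exists>L\<in>\<psi> ` {N\<in>C. M \<subseteq> N}. \<forall>K\<in>\<psi> ` {N\<in>C. M \<subseteq> N}. L \<subseteq> K \<longrightarrow> K = L"
    by (rule noeth_modD[OF assms(2)]) (use M(1) psi in auto)
  then obtain Y where Y: "Y \<in> \<psi> ` {N\<in>C. M \<subseteq> N}" "\<forall>K\<in>\<psi> ` {N\<in>C. M \<subseteq> N}. Y \<subseteq> K \<longrightarrow> K = Y"
    by (elim bexE)
  then obtain L where "L \<in> {N\<in>C. M \<subseteq> N}" "Y = \<psi> L" by (elim imageE)
  then have L: "L \<in> C" "M \<subseteq> L" "\<forall>K\<in>C. M \<subseteq> K \<longrightarrow> \<psi> L \<subseteq> \<psi> K \<longrightarrow> \<psi> K = \<psi> L"
    using Y(2) by simp_all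
  have "N \<subseteq> L" if N: "N \<in> C" "L \<subseteq> N" for N
  proof
    fix x assume x: "x \<in> N"
    have subm: "submod N" "submod L" using C(2) N(1) L(1) by auto
    have "\<phi> N = \<phi> M" "\<phi> L = \<phi> M" using M(2) N L(1,2) unfolding \<phi>_def by blast+
    then obtain x' where x': "x' \<in> L" "ev x = ev x'" using x unfolding \<phi>_def by (metis image_eqI imageE)
    have eq: "x - x' = pr 0 (od x - od x')" by (rule ev_od_eqI) (simp_all add: ev_diff od_diff x'(2))
    have "x - x' \<in> N" using submodD(6)[OF subm(1) x] x'(1) N(2) by blast
    then have "od x - od x' \<in> \<psi> N" unfolding \<psi>_def eq by simp
    moreover have "\<psi> N = \<psi> L" using L(2,3) N unfolding \<psi>_def by blast
    ultimately have "x - x' \<in> L" unfolding eq \<psi>_def by blast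
    then show "x \<in> L" using submod_diff_cancel[OF subm(2)] x'(1) by blast
  qed
  then show "\<exists>M\<in>C. \<forall>N\<in>C. M \<subseteq> N \<longrightarrow> N = M" using L(1) by (intro bexI[of _ L]) auto
qed

lemma noeth_koszul: "noeth_mod (cyc cs {} i) (bd cs {} i)"
  by (induction cs arbitrary: i) (auto intro: noeth_nil noeth_cons)

lemma artin_killed_transfer:
  assumes "artin (cyc (z # cs) W i) (bd (z # cs) W i)"
  shows "artin {a \<in> cyc cs (insert z W) i. z \<cdot> a \<in> bd cs (insert z W) i} (bd cs (insert z W) i)"
  unfolding artin_def
proof (intro allI impI)
  let ?W = "insert z W"
  fix N :: "nat \<Rightarrow> 'm set"
  assume "\<forall>n. submod (N n) \<and> bd cs ?W i \<subseteq> N n \<and> N n \<subseteq> {a \<in> cyc cs ?W i. z \<cdot> a \<in> bd cs ?W i} \<and> N (Suc n) \<subseteq> N n"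
  then have N: "\<And>n. submod (N n)" "\<And>n. bd cs ?W i \<subseteq> N n" "\<And>n. N n \<subseteq> {a \<in> cyc cs ?W i. z \<cdot> a \<in> bd cs ?W i}"
    "\<And>n. N (Suc n) \<subseteq> N n" by auto
  have Nmono: "m \<le> n \<Longrightarrow> N n \<subseteq> N m" for m n using lift_Suc_antimono_le[of N] N(4) by blast
  define S where "S = (\<lambda>n. {x. \<exists>g. ev g \<in> N n \<and> g \<in> cyc (z # cs) ?W i \<and> x - g \<in> bd (z # cs) W i})"
  have SI: "x \<in> S n" if "ev g \<in> N n" "g \<in> cyc (z # cs) ?W i" "x - g \<in> bd (z # cs) W i" for x g n
    unfolding S_def using that by blast
  have "\<exists>k. \<forall>n\<ge>k. S n = S k"
  proof (rule artinD[OF assms])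
    fix n
    show "submod (S n)"
      unfolding submod_def
    proof (intro conjI ballI allI subsetI)
      show "x \<in> S n" if "x \<in> NN" for x
      proof (rule SI[of 0])
        have "ev 0 = 0" using ev_diff[of 0 0] by simp
        then show "ev 0 \<in> N n" using submodD(2)[OF N(1)] by simp
        show "x - 0 \<in> bd (z # cs) W i" using bdD(1) that by auto
      qed (rule cycD(2))
      fix x assume "x \<in> S n"
      then obtain g where g: "ev g \<in> N n" "g \<in> cyc (z # cs) ?W i" "x - g \<in> bd (z # cs) W i" unfolding S_def by blast
      show "r \<cdot> x \<in> S n" for r
      proof (rule SI[of "r \<cdot> g"])
        show "ev (r \<cdot> g) \<in> N n" unfolding ev_scale by (rule submodD(4)[OF N(1) g(1)])
        show "r \<cdot> x - r \<cdot> g \<in> bd (z # cs) W i" using bdD(4)[OF g(3), of r] by (simp add: scale_right_diff)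
      qed (rule cycD(4)[OF g(2)])
      fix y assume "y \<in> S n"
      then obtain h where h: "ev h \<in> N n" "h \<in> cyc (z # cs) ?W i" "y - h \<in> bd (z # cs) W i" unfolding S_def by blast
      show "x + y \<in> S n"
      proof (rule SI[of "g + h"])
        show "ev (g + h) \<in> N n" unfolding ev_add by (rule submodD(3)[OF N(1) g(1) h(1)])
        show "x + y - (g + h) \<in> bd (z # cs) W i" by (rule mem_eqI[OF _ bdD(3)[OF g(3) h(3)]]) simp
      qed (rule cycD(3)[OF g(2) h(2)])
    qed
    show "bd (z # cs) W i \<subseteq> S n"
    proof
      fix x assume "x \<in> bd (z # cs) W i"
      moreover have "ev 0 = 0" using ev_diff[of 0 0] by simp
      ultimately show "x \<in> S n" by (intro SI[of 0] cycD(2)) (simp_all add: submodD(2)[OF N(1)])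
    qed
    show "S n \<subseteq> cyc (z # cs) W i"
    proof
      fix x assume "x \<in> S n"
      then obtain g where g: "g \<in> cyc (z # cs) ?W i" "x - g \<in> bd (z # cs) W i" unfolding S_def by blast
      then have "g \<in> cyc (z # cs) W i" "x - g \<in> cyc (z # cs) W i" using cyc_mono[of W ?W] bd_sub_cyc by blast+
      then show "x \<in> cyc (z # cs) W i" using submod_diff_cancel[OF submod_cyc] by blast
    qed
    show "S (Suc n) \<subseteq> S n" unfolding S_def using N(4) by blast
  qed
  then obtain k where k: "\<And>n. n \<ge> k \<Longrightarrow> S n = S k" by blast
  have "N n = N k" if n: "n \<ge> k" for n
  proof
    show "N n \<subseteq> N k" by (rule Nmono[OF n])
    show "N k \<subseteq> N n"
    proof
      fix a assume a: "a \<in> N k"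
      then have "a \<in> cyc cs ?W i" "z \<cdot> a \<in> bd cs ?W i" using N(3) by blast+
      then obtain g where g: "g \<in> cyc (z # cs) ?W i" "ev g = a" using koszul_lift by blast
      have "g \<in> S k" using g a bdD(2) by (intro SI[of g]) simp_all
      then have "g \<in> S n" using k[OF n] by simp
      then obtain h where h: "ev h \<in> N n" "h \<in> cyc (z # cs) ?W i" "g - h \<in> bd (z # cs) W i" unfolding S_def by blast
      obtain b where b: "b \<in> D (z # cs) W (i - 1)" "g - h - del (z # cs) b \<in> NN" using h(3) unfolding bd_def by blast
      have b2: "ev b \<in> D cs W (i - 1)" "od b \<in> D cs W (i - 1 - 1)" using b(1) by simp_all
      have e: "ev g - ev h - del cs (ev b) \<in> NN" "od g - od h - (z \<cdot> ev b - del cs (od b)) \<in> NN"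
        using b(2) NN_ev_od[of "g - h - del (z # cs) b"] by (simp_all add: ev_diff od_diff)
      have gh: "g - h \<in> D (z # cs) ?W i" using g(1) h(2) D_D(6)[of g "z # cs" ?W i h] unfolding cyc_def by blast
      then have t: "tors z (od g - od h)" "od g - od h \<in> D cs W (i - 1)" unfolding D_insert by (auto simp: tors_ev_od[of z "g - h"] od_diff)
      \<comment> \<open>\<open>z\<close> times the bounding chain is a torsion element up to a boundary, so it can be corrected to a torsion chain\<close>
      obtain n1 where n1: "z ^ n1 \<cdot> (od g - od h) \<in> NN" using t(1) unfolding tors_def by blast
      have "z ^ Suc n1 \<cdot> ev b - del cs (z ^ n1 \<cdot> od b) = z ^ n1 \<cdot> (od g - od h) - z ^ n1 \<cdot> (od g - od h - (z \<cdot> ev b - del cs (od b)))"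
        by (simp add: del_scale scale_simps mult.commute)
      moreover have "\<dots> \<in> NN" using n1 e(2) NND(4,6) by blast
      ultimately have "z ^ Suc n1 \<cdot> ev b - del cs (z ^ n1 \<cdot> od b) \<in> NN" by (rule mem_eqI)
      then have "z ^ Suc n1 \<cdot> ev b \<in> bd cs W (i - 1)" unfolding bd_def using D_D(4)[OF b2(2)] by blast
      then obtain b' where b': "b' \<in> D cs W (i - 1 - 1)" "tors z (ev b - del cs b')" using boundary_torsion'[OF b2(1)] by blast
      have "ev b - del cs b' \<in> D cs ?W (i - 1)" unfolding D_insert using b' D_D(6)[OF b2(1) del_D'] by blast
      moreover have "a - ev h - del cs (ev b - del cs b') \<in> NN"
        by (rule mem_eqI[OF _ NN_add[OF e(1) del_del[of cs b']]]) (simp add: del_diff g(2))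
      ultimately have "a - ev h \<in> bd cs ?W i" unfolding bd_def by blast
      then show "a \<in> N n" using submod_diff_cancel[OF N(1)] N(2) h(1) by blast
    qed
  qed
  then show "\<exists>k. \<forall>n\<ge>k. N n = N k" by blast
qed

text \<open>Torsion conditions are traded for Koszul factors: by \<open>artin_torsion\<close> only
  the classes killed by \<open>z\<close> matter, and these come from \<open>z # cs\<close> with one
  condition fewer. Without conditions the cohomology is noetherian and killed by a power of each
  factor, hence of finite length.\<close>

theorem artin_cohomology:
  assumes "finite W" "\<And>P. is_prime P \<Longrightarrow> I0 \<subseteq> P \<Longrightarrow> set cs \<union> W \<subseteq> P \<Longrightarrow> P = \<mm>"
  shows "artin (cyc cs W i) (bd cs W i)"
  using assms
proof (induction W arbitrary: cs i rule: finite_induct)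
  case empty
  show ?case
  proof (rule noeth_imp_artin[OF submod_cyc submod_bd bd_sub_cyc noeth_koszul])
    fix P assume P: "is_prime P" "{r. \<forall>a\<in>cyc cs {} i. r \<cdot> a \<in> bd cs {} i} \<subseteq> P"
    have "c \<in> P" if c: "c \<in> set cs" for c
    proof -
      obtain k where "\<forall>W i. \<forall>a\<in>cyc cs W i. c ^ k \<cdot> a \<in> bd cs W i" using koszul_kills[OF c] by blast
      then have "c ^ k \<in> P" using P(2) by blast
      then show ?thesis using prime_power[OF P(1)] by blast
    qed
    moreover have "I0 \<subseteq> P" using P(2) I0_null bdD(1) by blast
    ultimately show "P = \<mm>" using empty.prems P(1) by auto
  qed
next
  case (insert z W)
  show ?case
  proof (rule artin_torsion[OF submod_cyc submod_bd])
    show "\<exists>n. z ^ n \<cdot> a \<in> bd cs (insert z W) i" if "a \<in> cyc cs (insert z W) i" for a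
      using that bdD(1) unfolding cyc_def D_insert tors_def by blast
    show "artin {a \<in> cyc cs (insert z W) i. z \<cdot> a \<in> bd cs (insert z W) i} (bd cs (insert z W) i)"
      by (rule artin_killed_transfer, rule insert.IH) (use insert.prems in auto)
  qed
qed

end

section \<open>Classes in the top cohomology\<close>

text \<open>The list is reversed so that appending an exponent adjoins the outermost Koszul factor,
  the one to which the exact sequence applies.\<close>

definition koszul_powers :: "'f::comm_ring_1 list \<Rightarrow> nat list \<Rightarrow> 'f list" where
  "koszul_powers zs Ks = rev (map (\<lambda>j. zs ! j ^ (Ks ! j)) [0..<length Ks])"

lemma koszul_powers_Nil [simp]: "koszul_powers zs [] = []"
  by (simp add: koszul_powers_def)

lemma koszul_powers_snoc: "koszul_powers zs (Ks @ [K]) = zs ! length Ks ^ K # koszul_powers zs Ks"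
  by (simp add: koszul_powers_def nth_append)

lemma length_koszul_powers [simp]: "length (koszul_powers zs Ks) = length Ks"
  by (simp add: koszul_powers_def)

lemma set_koszul_powers: "set (koszul_powers zs Ks) = (\<lambda>j. zs ! j ^ (Ks ! j)) ` {..<length Ks}"
  by (auto simp: koszul_powers_def)

context koszul_complex
begin

text \<open>Uniform in the torsion conditions and the degree, so that the same multiplier serves
  while conditions are imposed one after another.\<close>

definition kills :: "'f list \<Rightarrow> 'f \<Rightarrow> bool" where
  "kills cs r \<longleftrightarrow> (\<forall>W i. \<forall>a\<in>cyc cs W i. r \<cdot> a \<in> bd cs W i)"

lemma koszul_powers_kill:
  assumes "j < length Ks" shows "\<exists>M. kills (koszul_powers zs Ks) (zs ! j ^ M)"
proof -
  have "zs ! j ^ (Ks ! j) \<in> set (koszul_powers zs Ks)" using assms by (auto simp: set_koszul_powers)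
  then obtain k where "kills (koszul_powers zs Ks) ((zs ! j ^ (Ks ! j)) ^ k)"
    using koszul_kills unfolding kills_def by blast
  then show ?thesis by (metis power_mult)
qed

lemma torsion_representatives:
  assumes "finite W" "\<And>z. z \<in> W \<Longrightarrow> \<exists>M. kills cs (z ^ M)" "a \<in> cyc cs {} i"
  shows "\<exists>a'\<in>cyc cs W i. a - a' \<in> bd cs {} i"
  using assms(1,2)
proof (induction W rule: finite_induct)
  case empty
  then show ?case using assms(3) bdD(2) by (intro bexI[of _ a]) simp_all
next
  case (insert z W)
  then obtain a' where a': "a' \<in> cyc cs W i" "a - a' \<in> bd cs {} i" by auto
  obtain M where "kills cs (z ^ M)" using insert.prems by blast
  then obtain a'' where a'': "a'' \<in> cyc cs (insert z W) i" "a' - a'' \<in> bd cs W i"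
    using torsion_quasi_iso(1)[OF _ a'(1), of z M] unfolding kills_def by blast
  have "a - a'' \<in> bd cs {} i"
    by (rule mem_eqI[OF _ bdD(3)[OF a'(2)]]) (use a''(2) bd_mono[of "{}" W cs i] in auto)
  then show ?case using a''(1) by blast
qed

lemma vanish_torsion:
  assumes "finite X" "\<And>z. z \<in> X \<Longrightarrow> \<exists>M. kills cs (z ^ M)" "cyc cs W i \<subseteq> bd cs W i"
  shows "cyc cs (X \<union> W) i \<subseteq> bd cs (X \<union> W) i"
  using assms(1,2)
proof (induction X rule: finite_induct)
  case (insert z X)
  obtain M where M: "kills cs (z ^ M)" using insert.prems by blast
  have IH: "cyc cs (X \<union> W) i \<subseteq> bd cs (X \<union> W) i" using insert by auto
  show ?case
  proof
    fix a assume a: "a \<in> cyc cs (insert z X \<union> W) i"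
    then have "a \<in> bd cs (X \<union> W) i" using IH cyc_mono[of "X \<union> W" "insert z X \<union> W"] by blast
    then show "a \<in> bd cs (insert z X \<union> W) i"
      using torsion_quasi_iso(2)[of cs "X \<union> W" z M a i] a M unfolding kills_def by auto
  qed
qed (use assms(3) in simp)

text \<open>The images of the powers of \<open>z\<close> on an Artinian quotient become stationary,
  so \<open>z ^ k\<close> times any element is divisible by every higher power. The exponents
  \<open>\<kappa>\<close> and those of \<open>killed_lift\<close> come from here.\<close>

lemma power_stable:
  assumes art: "artin Z B" and Z: "submod Z" "submod B" "B \<subseteq> Z"
  shows "\<exists>k. \<forall>K. \<forall>\<theta>\<in>Z. \<exists>\<eta>\<in>Z. z ^ k \<cdot> \<theta> - z ^ (k + K) \<cdot> \<eta> \<in> B"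
proof -
  let ?N = "\<lambda>k. {b. \<exists>a\<in>Z. b - z ^ k \<cdot> a \<in> B}"
  have "\<exists>k. \<forall>n\<ge>k. ?N n = ?N k"
  proof (rule artinD[OF art])
    fix n
    show "submod (?N n)" by (rule submod_multiples[OF Z(1,2)])
    show "B \<subseteq> ?N n" using submodD(2)[OF Z(1)] by (auto intro!: bexI[of _ 0])
    show "?N n \<subseteq> Z"
      using submod_diff_cancel[OF Z(1)] submodD(4)[OF Z(1)] Z(3) by blast
    show "?N (Suc n) \<subseteq> ?N n"
    proof
      fix b assume "b \<in> ?N (Suc n)"
      then obtain a where a: "a \<in> Z" "b - z ^ Suc n \<cdot> a \<in> B" by blast
      have "b - z ^ n \<cdot> z \<cdot> a \<in> B"
        by (rule mem_eqI[OF _ a(2)]) (simp add: scale_scale mult.commute)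
      then show "b \<in> ?N n" using submodD(4)[OF Z(1) a(1)] by blast
    qed
  qed
  then obtain k where k: "\<And>n. n \<ge> k \<Longrightarrow> ?N n = ?N k" by blast
  have "\<exists>\<eta>\<in>Z. z ^ k \<cdot> \<theta> - z ^ (k + K) \<cdot> \<eta> \<in> B" if "\<theta> \<in> Z" for K \<theta>
  proof -
    have "z ^ k \<cdot> \<theta> \<in> ?N k" using that submodD(2)[OF Z(2)] by (intro CollectI bexI[of _ \<theta>]) simp_all
    then show ?thesis using k[of "k + K"] by auto
  qed
  then show ?thesis by blast
qed

text \<open>The top Koszul cohomology is the ring modulo \<open>I0\<close> and the factors. A new
  factor moves the generator by \<open>pr 0\<close> and adds \<open>c\<close> to its annihilator;
  vanishing above the top degree shows that nothing else appears.\<close>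

lemma koszul_generator:
  "\<exists>\<gamma>\<in>cyc cs {} (int (length cs)). (\<forall>r. r \<cdot> \<gamma> \<in> bd cs {} (int (length cs)) \<longrightarrow> r \<in> gen (I0 \<union> set cs)) \<and>
     (\<forall>a\<in>cyc cs {} (int (length cs)). \<exists>r. a - r \<cdot> \<gamma> \<in> bd cs {} (int (length cs)))"
proof (induction cs)
  case Nil
  have "e1 \<in> cyc [] {} 0" using e1(1,2) by (simp add: cyc_def)
  moreover have "r \<in> gen I0" if r: "r \<cdot> e1 \<in> bd [] {} 0" for r
  proof -
    obtain b where b: "b \<in> D [] {} (0 - 1)" "r \<cdot> e1 - del [] b \<in> NN" using r unfolding bd_def by blast
    then have "del [] b \<in> NN" using D_neg[of "0 - 1" "[]" "{}"] del_NN[of b "[]"] by auto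
    then have "r \<cdot> e1 \<in> NN" using submod_diff_cancel[OF submod_NN b(2)] by blast
    then show ?thesis using e1(4) gen_sub by blast
  qed
  moreover have "\<exists>r. a - r \<cdot> e1 \<in> bd [] {} 0" if a: "a \<in> cyc [] {} 0" for a
  proof -
    obtain r where "a - r \<cdot> e1 \<in> NN" using a e1(3)[of a] by (auto simp: cyc_def)
    then show ?thesis using bdD(1) by blast
  qed
  ultimately show ?case by (intro bexI[of _ e1]) simp_all
next
  case (Cons c cs)
  let ?n = "int (length cs)"
  obtain \<gamma> where g: "\<gamma> \<in> cyc cs {} ?n" "\<And>r. r \<cdot> \<gamma> \<in> bd cs {} ?n \<Longrightarrow> r \<in> gen (I0 \<union> set cs)"
    "\<And>a. a \<in> cyc cs {} ?n \<Longrightarrow> \<exists>r. a - r \<cdot> \<gamma> \<in> bd cs {} ?n"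
    using Cons by blast
  have n: "int (length (c # cs)) = ?n + 1" by simp
  have g': "pr 0 \<gamma> \<in> cyc (c # cs) {} (?n + 1)" using pr_cyc[of \<gamma> cs "{}" "?n + 1"] g(1) by simp
  have 1: "r \<in> gen (I0 \<union> set (c # cs))" if r: "r \<cdot> pr 0 \<gamma> \<in> bd (c # cs) {} (?n + 1)" for r
  proof -
    obtain b where b: "b \<in> D (c # cs) {} (?n + 1 - 1)" "r \<cdot> pr 0 \<gamma> - del (c # cs) b \<in> NN" using r unfolding bd_def by blast
    have b1: "ev b \<in> D cs {} ?n" "od b \<in> D cs {} (?n - 1)" using b(1) by simp_all
    have b2: "- del cs (ev b) \<in> NN" "r \<cdot> \<gamma> - (c \<cdot> ev b - del cs (od b)) \<in> NN"
      using b(2) NN_ev_od[of "r \<cdot> pr 0 \<gamma> - del (c # cs) b"] by (simp_all add: ev_diff od_diff ev_scale od_scale)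
    have "ev b \<in> cyc cs {} ?n" unfolding cyc_def using b1(1) NND(5)[OF b2(1)] by simp
    \<comment> \<open>In the relation that bounds \<open>r\<close> times
      \<open>pr 0 \<gamma>\<close>, the chain \<open>ev b\<close> is itself a top cycle, hence a
      multiple \<open>t\<close> of \<open>\<gamma>\<close>. So \<open>r - t * c\<close> kills the
      class of \<open>\<gamma>\<close>.\<close>
    then obtain t where t: "ev b - t \<cdot> \<gamma> \<in> bd cs {} ?n" using g(3) by blast
    have "(r - t * c) \<cdot> \<gamma> = (r \<cdot> \<gamma> - (c \<cdot> ev b - del cs (od b))) - del cs (od b) + c \<cdot> (ev b - t \<cdot> \<gamma>)"
      by (simp add: scale_simps mult.commute)
    moreover have "\<dots> \<in> bd cs {} ?n"
      by (rule bdD(3)[OF bdD(6)[OF subsetD[OF bdD(1) b2(2)] del_bd[OF b1(2)]] bdD(4)[OF t]])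
    ultimately have "r - t * c \<in> gen (I0 \<union> set cs)" using g(2) by simp
    then have "(r - t * c) + t * c \<in> adj (gen (I0 \<union> set cs)) c" unfolding adj_def by blast
    then show ?thesis using gen_insert[of c "I0 \<union> set cs"] by simp
  qed
  have 2: "\<exists>r. x - r \<cdot> pr 0 \<gamma> \<in> bd (c # cs) {} (?n + 1)" if x: "x \<in> cyc (c # cs) {} (?n + 1)" for x
  proof -
    have "ev x \<in> bd cs {} (?n + 1)" using x vanish[of "{}" cs "?n + 1"] unfolding cyc_Cons by auto
    then obtain \<theta> where th: "\<theta> \<in> cyc cs {} ?n" "x - pr 0 \<theta> \<in> bd (c # cs) {} (?n + 1)" using koszul_kernel[OF x] by auto
    obtain r where "\<theta> - r \<cdot> \<gamma> \<in> bd cs {} ?n" using g(3)[OF th(1)] by blast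
    then have "pr 0 (\<theta> - r \<cdot> \<gamma>) \<in> bd (c # cs) {} (?n + 1)" using pr_bd[of "\<theta> - r \<cdot> \<gamma>" cs "{}" "?n + 1"] by simp
    moreover have "x - r \<cdot> pr 0 \<gamma> = (x - pr 0 \<theta>) + pr 0 (\<theta> - r \<cdot> \<gamma>)"
      by (rule ev_od_eqI) (simp_all add: ev_diff od_diff ev_scale od_scale ev_add od_add)
    ultimately have "x - r \<cdot> pr 0 \<gamma> \<in> bd (c # cs) {} (?n + 1)" using bdD(3)[OF th(2)] by metis
    then show ?thesis by blast
  qed
  show ?case unfolding n using g' 1 2 by blast
qed

context
  fixes W :: "'f set"
  assumes finW: "finite W" and Wm: "\<And>P. is_prime P \<Longrightarrow> I0 \<subseteq> P \<Longrightarrow> W \<subseteq> P \<Longrightarrow> P = \<mm>"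
begin

lemma artin_W: "artin (cyc cs W i) (bd cs W i)"
  by (rule artin_cohomology[OF finW]) (use Wm in blast)

text \<open>At the last factor \<open>z ^ K\<close> the kernel comes from degree
  \<open>i - 1\<close> modulo multiples of \<open>z ^ K\<close>. The power with exponent
  \<open>\<kappa>\<close> turns each such class into a multiple of \<open>z ^ K\<close>, which dies,
  and this exponent does not depend on \<open>K\<close>.\<close>

lemma projection_kernel:
  assumes \<kappa>: "\<And>Ls K \<theta>. \<theta> \<in> cyc (koszul_powers zs Ls) W (i - 1) \<Longrightarrow> \<exists>\<eta>\<in>cyc (koszul_powers zs Ls) W (i - 1).
      zs ! length Ls ^ \<kappa> Ls \<cdot> \<theta> - zs ! length Ls ^ (\<kappa> Ls + K) \<cdot> \<eta> \<in> bd (koszul_powers zs Ls) W (i - 1)"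
  shows "x \<in> cyc (koszul_powers zs Ks) W i \<Longrightarrow> proj (koszul_powers zs Ks) x \<in> bd [] W i \<Longrightarrow>
     (\<Prod>j<length Ks. zs ! j ^ \<kappa> (take j Ks)) \<cdot> x \<in> bd (koszul_powers zs Ks) W i"
proof (induction Ks arbitrary: x rule: rev_induct)
  case Nil
  then show ?case by simp
next
  case (snoc K Ks)
  let ?cs = "koszul_powers zs Ks" and ?z = "zs ! length Ks"
  define g where "g = (\<Prod>j<length Ks. zs ! j ^ \<kappa> (take j Ks))"
  have x: "x \<in> cyc (?z ^ K # ?cs) W i" using snoc.prems(1) by (simp add: koszul_powers_snoc)
  have "g \<cdot> ev x \<in> bd ?cs W i"
    unfolding g_def by (rule snoc.IH) (use x snoc.prems(2) in \<open>simp_all add: koszul_powers_snoc cyc_Cons\<close>)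
  then have "ev (g \<cdot> x) \<in> bd ?cs W i" by (simp add: ev_scale)
  then obtain \<theta> where th: "\<theta> \<in> cyc ?cs W (i - 1)" "g \<cdot> x - pr 0 \<theta> \<in> bd (?z ^ K # ?cs) W i"
    using koszul_kernel[OF cycD(4)[OF x]] by blast
  obtain \<eta> where eta: "\<eta> \<in> cyc ?cs W (i - 1)" "?z ^ \<kappa> Ks \<cdot> \<theta> - ?z ^ (\<kappa> Ks + K) \<cdot> \<eta> \<in> bd ?cs W (i - 1)"
    using \<kappa>[OF th(1)] by blast
  have "(?z ^ \<kappa> Ks * g) \<cdot> x = ?z ^ \<kappa> Ks \<cdot> (g \<cdot> x - pr 0 \<theta>) +
      (pr 0 (?z ^ \<kappa> Ks \<cdot> \<theta> - ?z ^ (\<kappa> Ks + K) \<cdot> \<eta>) + pr 0 (?z ^ K \<cdot> ?z ^ \<kappa> Ks \<cdot> \<eta>))"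
    by (rule ev_od_eqI) (simp_all add: ev_diff od_diff ev_scale od_scale ev_add od_add scale_simps power_add mult_ac)
  moreover have "\<dots> \<in> bd (?z ^ K # ?cs) W i"
    by (intro bdD(3) bdD(4)[OF th(2)] pr_bd[OF eta(2)] pr_multiple_bd[OF cycD(4)[OF eta(1)]])
  moreover have "(\<Prod>j<length (Ks @ [K]). zs ! j ^ \<kappa> (take j (Ks @ [K]))) = ?z ^ \<kappa> Ks * g"
    unfolding g_def by (simp add: mult.commute)
  ultimately show ?case by (simp add: koszul_powers_snoc)
qed

text \<open>The class \<open>\<alpha>\<close> below is the fraction \<open>1/(z\<^sub>1\<^sup>K\<^sup>1 \<dots> z\<^sub>d\<^sup>K\<^sup>d)\<close> in the description of the top local
  cohomology as a direct limit of the \<open>R/(z\<^sub>1\<^sup>n, \<dots>, z\<^sub>d\<^sup>n)\<close>. The exponents \<open>\<kappa>\<close> bound the kernel of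
  \<open>R/(z\<^sub>1\<^sup>K\<^sup>1, \<dots>, z\<^sub>d\<^sup>K\<^sup>d) \<rightarrow> H\<^sup>d\<close>; the \<open>j\<close>-th one depends only on the exponents before it.\<close>

theorem top_class:
  assumes W: "W = set zs" and d: "length zs = d"
  shows "\<exists>\<kappa>. \<forall>Ks. length Ks = d \<longrightarrow> (\<exists>\<alpha>\<in>cyc [] W (int d). (\<forall>j<d. zs ! j ^ (Ks ! j) \<cdot> \<alpha> \<in> bd [] W (int d)) \<and>
    (\<forall>r. r \<cdot> \<alpha> \<in> bd [] W (int d) \<longrightarrow> r * (\<Prod>j<d. zs ! j ^ \<kappa> (take j Ks)) \<in> gen (I0 \<union> (\<lambda>j. zs ! j ^ (Ks ! j)) ` {..<d})))"
proof -
  let ?i = "int d"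
  have "\<forall>Ls. \<exists>k. \<forall>K. \<forall>\<theta>\<in>cyc (koszul_powers zs Ls) W (?i - 1). \<exists>\<eta>\<in>cyc (koszul_powers zs Ls) W (?i - 1).
      zs ! length Ls ^ k \<cdot> \<theta> - zs ! length Ls ^ (k + K) \<cdot> \<eta> \<in> bd (koszul_powers zs Ls) W (?i - 1)"
    using power_stable[OF artin_W submod_cyc submod_bd bd_sub_cyc] by blast
  then obtain \<kappa> where \<kappa>: "\<And>Ls K \<theta>. \<theta> \<in> cyc (koszul_powers zs Ls) W (?i - 1) \<Longrightarrow> \<exists>\<eta>\<in>cyc (koszul_powers zs Ls) W (?i - 1).
      zs ! length Ls ^ \<kappa> Ls \<cdot> \<theta> - zs ! length Ls ^ (\<kappa> Ls + K) \<cdot> \<eta> \<in> bd (koszul_powers zs Ls) W (?i - 1)"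
    by metis
  show ?thesis
  proof (intro exI[of _ \<kappa>] allI impI)
    fix Ks :: "nat list" assume Ks: "length Ks = d"
    let ?cs = "koszul_powers zs Ks" and ?g = "\<Prod>j<d. zs ! j ^ \<kappa> (take j Ks)"
    \<comment> \<open>\<open>\<gamma>\<close> generates the top Koszul cohomology. Powers of all
      parameters kill that cohomology, so \<open>\<gamma>\<close> has a torsion representative; its
      projection is the class sought.\<close>
    obtain \<gamma> where g: "\<gamma> \<in> cyc ?cs {} ?i" "\<And>r. r \<cdot> \<gamma> \<in> bd ?cs {} ?i \<Longrightarrow> r \<in> gen (I0 \<union> set ?cs)"
      using koszul_generator[of ?cs] Ks by auto
    have "\<exists>M. kills ?cs (z ^ M)" if "z \<in> W" for z
      using that koszul_powers_kill[of _ Ks zs] Ks d W by (auto simp: in_set_conv_nth)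
    then obtain \<gamma>' where g': "\<gamma>' \<in> cyc ?cs W ?i" "\<gamma> - \<gamma>' \<in> bd ?cs {} ?i"
      using torsion_representatives[OF finW _ g(1)] by blast
    have 1: "proj ?cs \<gamma>' \<in> cyc [] W ?i" by (rule proj_cyc[OF g'(1)])
    have 2: "zs ! j ^ (Ks ! j) \<cdot> proj ?cs \<gamma>' \<in> bd [] W ?i" if "j < d" for j
      by (rule proj_killed[OF _ g'(1)]) (use that Ks in \<open>auto simp: set_koszul_powers\<close>)
    have 3: "r * ?g \<in> gen (I0 \<union> (\<lambda>j. zs ! j ^ (Ks ! j)) ` {..<d})" if r: "r \<cdot> proj ?cs \<gamma>' \<in> bd [] W ?i" for r
    proof -
      have "?g \<cdot> r \<cdot> \<gamma>' \<in> bd ?cs W ?i"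
        using projection_kernel[OF \<kappa> cycD(4)[OF g'(1)], of r] r Ks by (simp add: proj_scale)
      then have "(r * ?g) \<cdot> \<gamma>' \<in> bd ?cs {} ?i" using bd_mono[of "{}" W] by (auto simp: scale_scale mult.commute)
      moreover have "(r * ?g) \<cdot> \<gamma> - (r * ?g) \<cdot> \<gamma>' \<in> bd ?cs {} ?i"
        using bdD(4)[OF g'(2), of "r * ?g"] by (simp add: scale_right_diff)
      ultimately have "(r * ?g) \<cdot> \<gamma> \<in> bd ?cs {} ?i" using submod_diff_cancel[OF submod_bd] by blast
      then show ?thesis using g(2) Ks by (auto simp: set_koszul_powers)
    qed
    show "\<exists>\<alpha>\<in>cyc [] W ?i. (\<forall>j<d. zs ! j ^ (Ks ! j) \<cdot> \<alpha> \<in> bd [] W ?i) \<and>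
      (\<forall>r. r \<cdot> \<alpha> \<in> bd [] W ?i \<longrightarrow> r * ?g \<in> gen (I0 \<union> (\<lambda>j. zs ! j ^ (Ks ! j)) ` {..<d}))"
      using 1 2 3 by blast
  qed
qed

text \<open>A one-variable dual Artin--Rees argument at each step: the powers of \<open>z\<close> stabilize on the kernel
  of the projection.\<close>

lemma killed_lift:
  assumes "n \<le> length xs"
  shows "\<exists>Ks. length Ks = n \<and> (\<forall>a\<in>cyc [] W i. (\<forall>j<n. xs ! j \<cdot> a \<in> bd [] W i) \<longrightarrow>
     (\<exists>\<gamma>\<in>cyc (koszul_powers xs Ks) W i. proj (koszul_powers xs Ks) \<gamma> - a \<in> bd [] W i))"
  using assms
proof (induction n)
  case 0
  have "\<exists>\<gamma>\<in>cyc [] W i. \<gamma> - a \<in> bd [] W i" if "a \<in> cyc [] W i" for a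
    using that bdD(2) by (intro bexI[of _ a]) simp_all
  then show ?case by (intro exI[of _ "[]"]) simp
next
  case (Suc n)
  then obtain Ks where Ks: "length Ks = n" "\<And>a. a \<in> cyc [] W i \<Longrightarrow> (\<And>j. j < n \<Longrightarrow> xs ! j \<cdot> a \<in> bd [] W i) \<Longrightarrow>
     \<exists>\<gamma>\<in>cyc (koszul_powers xs Ks) W i. proj (koszul_powers xs Ks) \<gamma> - a \<in> bd [] W i" by auto
  let ?cs = "koszul_powers xs Ks" and ?z = "xs ! n"
  define Z where "Z = {\<nu> \<in> cyc ?cs W i. proj ?cs \<nu> \<in> bd [] W i}"
  have Z: "submod Z"
    unfolding submod_def
  proof (intro conjI ballI allI subsetI)
    show "x \<in> Z" if "x \<in> NN" for x
      unfolding Z_def using that cycD(1) proj_bd[of x ?cs W i] bdD(1)[of ?cs W i] by blast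
    fix x y assume xy: "x \<in> Z" "y \<in> Z"
    show "x + y \<in> Z" using xy cycD(3) bdD(3) unfolding Z_def by (simp add: proj_add)
  next
    fix x r assume "x \<in> Z"
    then show "r \<cdot> x \<in> Z" using cycD(4) bdD(4) unfolding Z_def by (simp add: proj_scale)
  qed
  have BZ: "bd ?cs W i \<subseteq> Z" unfolding Z_def using bd_sub_cyc proj_bd by blast
  have "artin Z (bd ?cs W i)"
    unfolding artin_def
  proof (intro allI impI)
    fix N :: "nat \<Rightarrow> 'm set"
    assume N: "\<forall>n. submod (N n) \<and> bd ?cs W i \<subseteq> N n \<and> N n \<subseteq> Z \<and> N (Suc n) \<subseteq> N n"
    have "Z \<subseteq> cyc ?cs W i" unfolding Z_def by blast
    then show "\<exists>k. \<forall>n\<ge>k. N n = N k" using N by (intro artinD[OF artin_W[of ?cs i]]) blast+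
  qed
  then obtain k where k: "\<And>K \<theta>. \<theta> \<in> Z \<Longrightarrow> \<exists>\<eta>\<in>Z. ?z ^ k \<cdot> \<theta> - ?z ^ (k + K) \<cdot> \<eta> \<in> bd ?cs W i"
    using power_stable[OF _ Z submod_bd BZ] by blast
  have "\<exists>\<gamma>\<in>cyc (koszul_powers xs (Ks @ [Suc k])) W i. proj (koszul_powers xs (Ks @ [Suc k])) \<gamma> - a \<in> bd [] W i"
    if a: "a \<in> cyc [] W i" "\<And>j. j < Suc n \<Longrightarrow> xs ! j \<cdot> a \<in> bd [] W i" for a
  proof -
    obtain \<gamma> where g: "\<gamma> \<in> cyc ?cs W i" "proj ?cs \<gamma> - a \<in> bd [] W i" using Ks(2)[OF a(1)] a(2) by auto
    have "?z \<cdot> proj ?cs \<gamma> - ?z \<cdot> a \<in> bd [] W i" using bdD(4)[OF g(2), of ?z] by (simp add: scale_right_diff)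
    then have "?z \<cdot> proj ?cs \<gamma> \<in> bd [] W i" using submod_diff_cancel[OF submod_bd] a(2)[of n] by blast
    then have "?z \<cdot> \<gamma> \<in> Z" unfolding Z_def using cycD(4)[OF g(1)] by (simp add: proj_scale)
    \<comment> \<open>\<open>?z\<close> times \<open>\<gamma>\<close> lies in the kernel of the
      projection but need not be a boundary. Subtracting \<open>\<eta>\<close>, itself in the
      kernel, keeps the projected class and makes \<open>?z ^ Suc k\<close> kill the difference,
      which therefore lifts through one more factor.\<close>
    then obtain \<eta> where eta: "\<eta> \<in> Z" "?z ^ k \<cdot> ?z \<cdot> \<gamma> - ?z ^ (k + 1) \<cdot> \<eta> \<in> bd ?cs W i" using k by blast
    have "?z ^ Suc k \<cdot> (\<gamma> - \<eta>) \<in> bd ?cs W i"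
      by (rule mem_eqI[OF _ eta(2)]) (simp add: scale_simps mult.commute)
    moreover have "\<gamma> - \<eta> \<in> cyc ?cs W i" using cycD(6)[OF g(1)] eta(1) unfolding Z_def by blast
    ultimately obtain \<gamma>' where g': "\<gamma>' \<in> cyc (?z ^ Suc k # ?cs) W i" "ev \<gamma>' = \<gamma> - \<eta>" using koszul_lift by blast
    have "proj ?cs (\<gamma> - \<eta>) - a \<in> bd [] W i"
      by (rule mem_eqI[of _ "(proj ?cs \<gamma> - a) - proj ?cs \<eta>"], simp add: proj_diff)
        (rule bdD(6)[OF g(2)], use eta(1) in \<open>simp add: Z_def\<close>)
    then show ?thesis using g' Ks(1) by (intro bexI[of _ \<gamma>']) (simp_all add: koszul_powers_snoc del: power_Suc)
  qed
  then show ?case using Ks(1) by (intro exI[of _ "Ks @ [Suc k]"]) simp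
qed

theorem annihilated_by_power:
  assumes W: "W = set (xs @ u # ws)" and d: "length (xs @ u # ws) = d"
    and tu: "\<And>P. is_prime P \<Longrightarrow> I0 \<subseteq> P \<Longrightarrow> set xs \<subseteq> P \<Longrightarrow> t * u \<in> P"
  shows "\<exists>N. \<forall>a\<in>cyc [] W (int d). (\<forall>x\<in>set xs. x \<cdot> a \<in> bd [] W (int d)) \<longrightarrow> t ^ N \<cdot> a \<in> bd [] W (int d)"
proof -
  let ?i = "int d"
  obtain Ks where Ks: "length Ks = length xs" "\<And>a. a \<in> cyc [] W ?i \<Longrightarrow> (\<And>j. j < length xs \<Longrightarrow> xs ! j \<cdot> a \<in> bd [] W ?i) \<Longrightarrow>
     \<exists>\<gamma>\<in>cyc (koszul_powers xs Ks) W ?i. proj (koszul_powers xs Ks) \<gamma> - a \<in> bd [] W ?i"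
    using killed_lift[of "length xs" xs ?i] by blast
  let ?cs = "koszul_powers xs Ks"
  define V where "V = set xs \<union> set ws"
  have WV: "W = insert u V" unfolding W V_def by auto
  have kill: "\<exists>M. kills ?cs (z ^ M)" if "z \<in> set xs" for z
    using that koszul_powers_kill[of _ Ks xs] Ks(1) by (auto simp: in_set_conv_nth)
  \<comment> \<open>The Koszul factors and the conditions at \<open>ws\<close> number at most
    \<open>d - 1\<close>, below the degree. The conditions at \<open>xs\<close> can then be added,
    since powers of these elements kill the cohomology.\<close>
  have "cyc ?cs (set ws) ?i \<subseteq> bd ?cs (set ws) ?i"
    by (rule vanish) (use Ks(1) d card_length[of ws] in auto)
  then have van: "cyc ?cs V ?i \<subseteq> bd ?cs V ?i" unfolding V_def using vanish_torsion[OF _ kill] by simp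
  define J where "J = {r. kills ?cs r}"
  have J: "is_ideal J" "I0 \<subseteq> J"
  proof -
    show "is_ideal J"
      unfolding J_def is_ideal_def kills_def using bdD(2,3,4)
      by (auto simp: scale_left_distrib scale_scale[symmetric])
    show "I0 \<subseteq> J" unfolding J_def kills_def using bdD(1) I0_null by blast
  qed
  have "\<exists>n. (t * u) ^ n \<in> J"
  proof (rule radical_mem[OF J])
    fix P assume P: "is_prime P" "J \<subseteq> P"
    have "x \<in> P" if x: "x \<in> set xs" for x
    proof -
      obtain M where "x ^ M \<in> P" using kill[OF x] P(2) unfolding J_def by blast
      then show ?thesis using prime_power[OF P(1)] by blast
    qed
    then show "t * u \<in> P" using tu[OF P(1)] J(2) P(2) by blast
  qed
  then obtain N where N: "kills ?cs ((t * u) ^ N)" unfolding J_def by blast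
  have top: "t ^ N \<cdot> \<xi> \<in> bd ?cs W ?i" if xi: "\<xi> \<in> cyc ?cs W ?i" for \<xi>
  proof -
    have "\<xi> \<in> cyc ?cs V ?i" using xi cyc_mono[of V W] WV by blast
    then obtain e where e: "e \<in> D ?cs V (?i - 1)" "\<xi> - del ?cs e \<in> NN" using van unfolding bd_def by blast
    obtain M where M: "u ^ M \<cdot> \<xi> \<in> NN" using xi unfolding cyc_def WV D_insert tors_def by blast
    have "del ?cs (u ^ M \<cdot> e) = u ^ M \<cdot> \<xi> - u ^ M \<cdot> (\<xi> - del ?cs e)" by (simp add: del_scale scale_simps)
    moreover have "\<dots> \<in> NN" using M e NND(4,6) by blast
    ultimately have "u ^ M \<cdot> e \<in> cyc ?cs V (?i - 1)" unfolding cyc_def using D_D(4)[OF e(1)] by simp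
    \<comment> \<open>The cycle \<open>u ^ M\<close> times \<open>e\<close> has degree
      \<open>d - 1\<close>, where \<open>(t * u) ^ N\<close> kills the cohomology too. Thus a power
      of \<open>u\<close> takes \<open>t ^ N\<close> times \<open>e\<close> to a boundary, and
      \<open>boundary_torsion'\<close> makes it \<open>u\<close>-torsion.\<close>
    then have "(t * u) ^ N \<cdot> u ^ M \<cdot> e \<in> bd ?cs V (?i - 1)" using N unfolding kills_def by blast
    then have "u ^ (N + M) \<cdot> t ^ N \<cdot> e \<in> bd ?cs V (?i - 1)"
      by (simp add: scale_scale power_add power_mult_distrib mult_ac)
    then obtain b where b: "b \<in> D ?cs V (?i - 1 - 1)" "tors u (t ^ N \<cdot> e - del ?cs b)"
      using boundary_torsion'[OF D_D(4)[OF e(1)]] by blast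
    have "t ^ N \<cdot> e - del ?cs b \<in> D ?cs W (?i - 1)"
      unfolding WV D_insert using b D_D(6)[OF D_D(4)[OF e(1)] del_D'] by blast
    moreover have "t ^ N \<cdot> \<xi> - del ?cs (t ^ N \<cdot> e - del ?cs b) \<in> NN"
      by (rule mem_eqI[OF _ NN_add[OF NN_scale[OF e(2)] del_del[of ?cs b]]]) (simp add: del_diff del_scale scale_simps)
    ultimately show ?thesis unfolding bd_def by blast
  qed
  have "t ^ N \<cdot> a \<in> bd [] W ?i" if a: "a \<in> cyc [] W ?i" "\<And>x. x \<in> set xs \<Longrightarrow> x \<cdot> a \<in> bd [] W ?i" for a
  proof -
    obtain \<gamma> where g: "\<gamma> \<in> cyc ?cs W ?i" "proj ?cs \<gamma> - a \<in> bd [] W ?i" using Ks(2)[OF a(1)] a(2) by auto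
    have "t ^ N \<cdot> proj ?cs \<gamma> \<in> bd [] W ?i" using proj_bd[OF top[OF g(1)]] by (simp add: proj_scale)
    moreover have "t ^ N \<cdot> proj ?cs \<gamma> - t ^ N \<cdot> a \<in> bd [] W ?i"
      using bdD(4)[OF g(2), of "t ^ N"] by (simp add: scale_right_diff)
    ultimately show ?thesis using submod_diff_cancel[OF submod_bd] by blast
  qed
  then show ?thesis by blast
qed

end

end

section \<open>A class-typed model of a ring and of its modules\<close>

text \<open>The preceding results need a ring whose carrier is a type. The
  ring freely generated by the type \<open>'a\<close> is one, and \<open>R\<close> is its quotient by the kernel of \<open>reval R\<close>, so the
  ideals of \<open>R\<close> become the ideals above that kernel. Modules are treated in the same way.\<close>

datatype 'a ring_expr =
    RVar 'a | RZero | ROne | RAdd "'a ring_expr" "'a ring_expr" | RMul "'a ring_expr" "'a ring_expr" | RNeg "'a ring_expr"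

inductive ring_expr_eq :: "'a ring_expr \<Rightarrow> 'a ring_expr \<Rightarrow> bool" where
  equal_refl: "ring_expr_eq x x"
| equal_sym: "ring_expr_eq x y \<Longrightarrow> ring_expr_eq y x"
| equal_trans: "ring_expr_eq x y \<Longrightarrow> ring_expr_eq y z \<Longrightarrow> ring_expr_eq x z"
| add_cong: "ring_expr_eq x x' \<Longrightarrow> ring_expr_eq y y' \<Longrightarrow> ring_expr_eq (RAdd x y) (RAdd x' y')"
| mul_cong: "ring_expr_eq x x' \<Longrightarrow> ring_expr_eq y y' \<Longrightarrow> ring_expr_eq (RMul x y) (RMul x' y')"
| neg_cong: "ring_expr_eq x x' \<Longrightarrow> ring_expr_eq (RNeg x) (RNeg x')"
| add_assoc: "ring_expr_eq (RAdd (RAdd x y) z) (RAdd x (RAdd y z))"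
| add_comm: "ring_expr_eq (RAdd x y) (RAdd y x)"
| add_zero: "ring_expr_eq (RAdd RZero x) x"
| add_neg: "ring_expr_eq (RAdd (RNeg x) x) RZero"
| mul_assoc: "ring_expr_eq (RMul (RMul x y) z) (RMul x (RMul y z))"
| mul_comm: "ring_expr_eq (RMul x y) (RMul y x)"
| mul_one: "ring_expr_eq (RMul ROne x) x"
| distrib: "ring_expr_eq (RMul (RAdd x y) z) (RAdd (RMul x z) (RMul y z))"

quotient_type 'a free_ring = "'a ring_expr" / ring_expr_eq
  by (intro equivpI reflpI sympI transpI) (auto intro: ring_expr_eq.equal_refl ring_expr_eq.equal_sym ring_expr_eq.equal_trans)

text \<open>Evaluation in the integers with all variables zero respects the congruence and separates
  the two constants.\<close>

lemma ring_expr_not_trivial: "\<not> ring_expr_eq RZero ROne"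
proof
  define f :: "'b ring_expr \<Rightarrow> int" where
    "f = rec_ring_expr (\<lambda>_. 0) 0 1 (\<lambda>_ _ a b. a + b) (\<lambda>_ _ a b. a * b) (\<lambda>_ a. - a)"
  have "ring_expr_eq x y \<Longrightarrow> f x = f y" for x y
    by (induction rule: ring_expr_eq.induct) (simp_all add: f_def algebra_simps)
  then show "ring_expr_eq (RZero :: 'b ring_expr) ROne \<Longrightarrow> False"
    by (force simp: f_def)
qed

instantiation free_ring :: (type) comm_ring_1
begin

lift_definition zero_free_ring :: "'a free_ring" is RZero .
lift_definition one_free_ring :: "'a free_ring" is ROne .
lift_definition plus_free_ring :: "'a free_ring \<Rightarrow> 'a free_ring \<Rightarrow> 'a free_ring" is RAdd by (rule add_cong)
lift_definition times_free_ring :: "'a free_ring \<Rightarrow> 'a free_ring \<Rightarrow> 'a free_ring" is RMul by (rule mul_cong)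
lift_definition uminus_free_ring :: "'a free_ring \<Rightarrow> 'a free_ring" is RNeg by (rule neg_cong)
lift_definition minus_free_ring :: "'a free_ring \<Rightarrow> 'a free_ring \<Rightarrow> 'a free_ring" is "\<lambda>x y. RAdd x (RNeg y)"
  by (intro add_cong neg_cong)

instance
proof
  fix a b c :: "'a free_ring"
  show "a + b + c = a + (b + c)" by transfer (rule add_assoc)
  show "a + b = b + a" by transfer (rule add_comm)
  show "0 + a = a" by transfer (rule add_zero)
  show "- a + a = 0" by transfer (rule add_neg)
  show "a - b = a + - b" by transfer (rule ring_expr_eq.equal_refl)
  show "a * b * c = a * (b * c)" by transfer (rule mul_assoc)
  show "a * b = b * a" by transfer (rule mul_comm)
  show "1 * a = a" by transfer (rule mul_one)
  show "(a + b) * c = a * c + b * c" by transfer (rule distrib)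
  show "(0 :: 'a free_ring) \<noteq> 1" by transfer (rule ring_expr_not_trivial)
qed

end

lift_definition ring_var :: "'a \<Rightarrow> 'a free_ring" is RVar .

text \<open>Variables outside the carrier are sent to zero, so that every expression has a value in
  the carrier.\<close>

primrec eval_ring_expr :: "('a, 'r) ring_scheme \<Rightarrow> 'a ring_expr \<Rightarrow> 'a" where
  "eval_ring_expr R (RVar a) = (if a \<in> carrier R then a else \<zero>\<^bsub>R\<^esub>)"
| "eval_ring_expr R RZero = \<zero>\<^bsub>R\<^esub>"
| "eval_ring_expr R ROne = \<one>\<^bsub>R\<^esub>"
| "eval_ring_expr R (RAdd x y) = eval_ring_expr R x \<oplus>\<^bsub>R\<^esub> eval_ring_expr R y"
| "eval_ring_expr R (RMul x y) = eval_ring_expr R x \<otimes>\<^bsub>R\<^esub> eval_ring_expr R y"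
| "eval_ring_expr R (RNeg x) = \<ominus>\<^bsub>R\<^esub> eval_ring_expr R x"

definition reval :: "('a, 'r) ring_scheme \<Rightarrow> 'a free_ring \<Rightarrow> 'a" where
  "reval R x = eval_ring_expr R (rep_free_ring x)"

context cring
begin

lemma eval_ring_expr_closed [simp]: "eval_ring_expr R x \<in> carrier R"
  by (induction x) auto

lemma eval_ring_expr_cong: "ring_expr_eq x y \<Longrightarrow> eval_ring_expr R x = eval_ring_expr R y"
  by (induction rule: ring_expr_eq.induct)
    (simp_all add: a_assoc m_assoc l_neg l_distr, simp_all add: a_comm m_comm)

lemma reval_abs: "reval R (abs_free_ring x) = eval_ring_expr R x"
  unfolding reval_def by (rule eval_ring_expr_cong) (metis Quotient3_free_ring rep_abs_rsp ring_expr_eq.equal_refl ring_expr_eq.equal_sym)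

lemma reval_closed [simp]: "reval R x \<in> carrier R"
  by (simp add: reval_def)

lemma reval_var: "a \<in> carrier R \<Longrightarrow> reval R (ring_var a) = a"
  by (simp add: ring_var.abs_eq reval_abs)

lemma reval_zero [simp]: "reval R 0 = \<zero>" and reval_one [simp]: "reval R 1 = \<one>"
  by (simp_all add: zero_free_ring.abs_eq one_free_ring.abs_eq reval_abs)

lemma reval_add: "reval R (x + y) = reval R x \<oplus> reval R y"
proof -
  have "x + y = abs_free_ring (RAdd (rep_free_ring x) (rep_free_ring y))"
    by (metis Quotient3_abs_rep Quotient3_free_ring plus_free_ring.abs_eq)
  then show ?thesis by (simp add: reval_abs) (simp add: reval_def)
qed

lemma reval_mult: "reval R (x * y) = reval R x \<otimes> reval R y"
proof -
  have "x * y = abs_free_ring (RMul (rep_free_ring x) (rep_free_ring y))"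
    by (metis Quotient3_abs_rep Quotient3_free_ring times_free_ring.abs_eq)
  then show ?thesis by (simp add: reval_abs) (simp add: reval_def)
qed

lemma reval_minus: "reval R (- x) = \<ominus> reval R x"
proof -
  have "- x = abs_free_ring (RNeg (rep_free_ring x))"
    by (metis Quotient3_abs_rep Quotient3_free_ring uminus_free_ring.abs_eq)
  then show ?thesis by (simp add: reval_abs) (simp add: reval_def)
qed

lemma reval_diff: "reval R (x - y) = reval R x \<ominus> reval R y"
  using reval_add[of x "- y"] by (simp add: reval_minus a_minus_def)

lemma reval_power: "reval R (x ^ n) = reval R x [^] n"
  by (induction n) (simp_all add: reval_mult m_comm)

end

datatype ('a, 'b) mod_expr =
    MVar 'b | MZero | MAdd "('a, 'b) mod_expr" "('a, 'b) mod_expr" | MNeg "('a, 'b) mod_expr"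
  | MScale "'a free_ring" "('a, 'b) mod_expr"

inductive mod_expr_eq :: "('a, 'b) mod_expr \<Rightarrow> ('a, 'b) mod_expr \<Rightarrow> bool" where
  equal_refl: "mod_expr_eq x x"
| equal_sym: "mod_expr_eq x y \<Longrightarrow> mod_expr_eq y x"
| equal_trans: "mod_expr_eq x y \<Longrightarrow> mod_expr_eq y z \<Longrightarrow> mod_expr_eq x z"
| add_cong: "mod_expr_eq x x' \<Longrightarrow> mod_expr_eq y y' \<Longrightarrow> mod_expr_eq (MAdd x y) (MAdd x' y')"
| neg_cong: "mod_expr_eq x x' \<Longrightarrow> mod_expr_eq (MNeg x) (MNeg x')"
| scale_cong: "mod_expr_eq x x' \<Longrightarrow> mod_expr_eq (MScale r x) (MScale r x')"
| add_assoc: "mod_expr_eq (MAdd (MAdd x y) z) (MAdd x (MAdd y z))"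
| add_comm: "mod_expr_eq (MAdd x y) (MAdd y x)"
| add_zero: "mod_expr_eq (MAdd MZero x) x"
| add_neg: "mod_expr_eq (MAdd (MNeg x) x) MZero"
| scale_right: "mod_expr_eq (MScale r (MAdd x y)) (MAdd (MScale r x) (MScale r y))"
| scale_left: "mod_expr_eq (MScale (r + t) x) (MAdd (MScale r x) (MScale t x))"
| scale_scale: "mod_expr_eq (MScale r (MScale t x)) (MScale (r * t) x)"
| scale_one: "mod_expr_eq (MScale 1 x) x"

quotient_type ('a, 'b) free_module = "('a, 'b) mod_expr" / mod_expr_eq
  by (intro equivpI reflpI sympI transpI) (auto intro: mod_expr_eq.equal_refl mod_expr_eq.equal_sym mod_expr_eq.equal_trans)

instantiation free_module :: (type, type) ab_group_add
begin

lift_definition zero_free_module :: "('a, 'b) free_module" is MZero .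
lift_definition plus_free_module :: "('a, 'b) free_module \<Rightarrow> ('a, 'b) free_module \<Rightarrow> ('a, 'b) free_module" is MAdd
  by (rule mod_expr_eq.add_cong)
lift_definition uminus_free_module :: "('a, 'b) free_module \<Rightarrow> ('a, 'b) free_module" is MNeg
  by (rule mod_expr_eq.neg_cong)
lift_definition minus_free_module :: "('a, 'b) free_module \<Rightarrow> ('a, 'b) free_module \<Rightarrow> ('a, 'b) free_module"
  is "\<lambda>x y. MAdd x (MNeg y)" by (intro mod_expr_eq.add_cong mod_expr_eq.neg_cong)

instance
proof
  fix a b c :: "('a, 'b) free_module"
  show "a + b + c = a + (b + c)" by transfer (rule mod_expr_eq.add_assoc)
  show "a + b = b + a" by transfer (rule mod_expr_eq.add_comm)
  show "0 + a = a" by transfer (rule mod_expr_eq.add_zero)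
  show "- a + a = 0" by transfer (rule mod_expr_eq.add_neg)
  show "a - b = a + - b" by transfer (rule mod_expr_eq.equal_refl)
qed

end

lift_definition mod_var :: "'b \<Rightarrow> ('a, 'b) free_module" is MVar .
lift_definition mod_scale :: "'a free_ring \<Rightarrow> ('a, 'b) free_module \<Rightarrow> ('a, 'b) free_module" is MScale
  by (rule mod_expr_eq.scale_cong)

lemma mod_scale_simps:
  "mod_scale r (x + y) = mod_scale r x + mod_scale r y"
  "mod_scale (r + t) x = mod_scale r x + mod_scale t x"
  "mod_scale r (mod_scale t x) = mod_scale (r * t) x"
  "mod_scale 1 x = x"
proof -
  show "mod_scale r (x + y) = mod_scale r x + mod_scale r y" by transfer (rule mod_expr_eq.scale_right)
  show "mod_scale (r + t) x = mod_scale r x + mod_scale t x" by transfer (rule mod_expr_eq.scale_left)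
  show "mod_scale r (mod_scale t x) = mod_scale (r * t) x" by transfer (rule mod_expr_eq.scale_scale)
  show "mod_scale 1 x = x" by transfer (rule mod_expr_eq.scale_one)
qed

primrec subst_mod_expr :: "('b \<Rightarrow> 'b) \<Rightarrow> ('a, 'b) mod_expr \<Rightarrow> ('a, 'b) mod_expr" where
  "subst_mod_expr f (MVar b) = MVar (f b)"
| "subst_mod_expr f MZero = MZero"
| "subst_mod_expr f (MAdd x y) = MAdd (subst_mod_expr f x) (subst_mod_expr f y)"
| "subst_mod_expr f (MNeg x) = MNeg (subst_mod_expr f x)"
| "subst_mod_expr f (MScale r x) = MScale r (subst_mod_expr f x)"

lift_definition subst_free_module :: "('b \<Rightarrow> 'b) \<Rightarrow> ('a, 'b) free_module \<Rightarrow> ('a, 'b) free_module" is subst_mod_expr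
proof -
  fix f :: "'b \<Rightarrow> 'b" and x y :: "('a, 'b) mod_expr"
  show "mod_expr_eq x y \<Longrightarrow> mod_expr_eq (subst_mod_expr f x) (subst_mod_expr f y)"
    by (induction rule: mod_expr_eq.induct) (auto intro: mod_expr_eq.intros)
qed

lemma subst_free_module_simps:
  "subst_free_module f (x + y) = subst_free_module f x + subst_free_module f y"
  "subst_free_module f (mod_scale r x) = mod_scale r (subst_free_module f x)"
proof -
  show "subst_free_module f (x + y) = subst_free_module f x + subst_free_module f y"
    by transfer (simp add: mod_expr_eq.equal_refl)
  show "subst_free_module f (mod_scale r x) = mod_scale r (subst_free_module f x)"
    by transfer (simp add: mod_expr_eq.equal_refl)
qed

primrec eval_mod_expr :: "('a, 'r) ring_scheme \<Rightarrow> ('a, 'b, 'c) module_scheme \<Rightarrow> ('a, 'b) mod_expr \<Rightarrow> 'b" where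
  "eval_mod_expr R M (MVar b) = (if b \<in> carrier M then b else \<zero>\<^bsub>M\<^esub>)"
| "eval_mod_expr R M MZero = \<zero>\<^bsub>M\<^esub>"
| "eval_mod_expr R M (MAdd x y) = eval_mod_expr R M x \<oplus>\<^bsub>M\<^esub> eval_mod_expr R M y"
| "eval_mod_expr R M (MNeg x) = \<ominus>\<^bsub>M\<^esub> eval_mod_expr R M x"
| "eval_mod_expr R M (MScale r x) = reval R r \<odot>\<^bsub>M\<^esub> eval_mod_expr R M x"

definition meval :: "('a, 'r) ring_scheme \<Rightarrow> ('a, 'b, 'c) module_scheme \<Rightarrow> ('a, 'b) free_module \<Rightarrow> 'b" where
  "meval R M x = eval_mod_expr R M (rep_free_module x)"

context module
begin

lemma eval_mod_expr_closed [simp]: "eval_mod_expr R M x \<in> carrier M"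
  by (induction x) auto

lemma eval_mod_expr_cong: "mod_expr_eq x y \<Longrightarrow> eval_mod_expr R M x = eval_mod_expr R M y"
proof (induction rule: mod_expr_eq.induct)
  case (add_comm x y)
  then show ?case by (simp add: M.a_comm)
qed (simp_all add: M.a_assoc M.l_neg smult_r_distr smult_l_distr smult_assoc1 reval_add reval_mult)

lemma meval_abs: "meval R M (abs_free_module x) = eval_mod_expr R M x"
  unfolding meval_def by (rule eval_mod_expr_cong) (metis Quotient3_free_module rep_abs_rsp mod_expr_eq.equal_refl mod_expr_eq.equal_sym)

lemma meval_closed [simp]: "meval R M x \<in> carrier M"
  by (simp add: meval_def)

lemma meval_var: "b \<in> carrier M \<Longrightarrow> meval R M (mod_var b) = b"
  by (simp add: mod_var.abs_eq meval_abs)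

lemma meval_zero [simp]: "meval R M 0 = \<zero>\<^bsub>M\<^esub>"
  by (simp add: zero_free_module.abs_eq meval_abs)

lemma meval_add: "meval R M (x + y) = meval R M x \<oplus>\<^bsub>M\<^esub> meval R M y"
proof -
  have "x + y = abs_free_module (MAdd (rep_free_module x) (rep_free_module y))"
    by (metis Quotient3_abs_rep Quotient3_free_module plus_free_module.abs_eq)
  then show ?thesis by (simp add: meval_abs) (simp add: meval_def)
qed

lemma meval_scale: "meval R M (mod_scale r x) = reval R r \<odot>\<^bsub>M\<^esub> meval R M x"
proof -
  have "mod_scale r x = abs_free_module (MScale r (rep_free_module x))"
    by (metis Quotient3_abs_rep Quotient3_free_module mod_scale.abs_eq)
  then show ?thesis by (simp add: meval_abs) (simp add: meval_def)
qed

lemma meval_diff: "meval R M (x - y) = meval R M x \<ominus>\<^bsub>M\<^esub> meval R M y"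
proof -
  have "meval R M (x - y) \<oplus>\<^bsub>M\<^esub> meval R M y = meval R M x" using meval_add[of "x - y" y] by simp
  then show ?thesis by (metis M.add.inv_solve_right' M.minus_eq meval_closed)
qed

end

text \<open>Renaming variables along a linear map commutes with evaluation; the default zero matches
  the value of variables outside the carrier. In this way the differentials of the resolution lift
  to the free module.\<close>

lemma meval_subst:
  assumes "module R M" "module R N" "h \<in> module_hom R M N"
  shows "meval R N (subst_free_module (\<lambda>b. if b \<in> carrier M then h b else \<zero>\<^bsub>N\<^esub>) x) = h (meval R M x)"
proof -
  interpret M: module R M by fact
  interpret N: module R N by fact
  have h: "h y \<in> carrier N" "h (y \<oplus>\<^bsub>M\<^esub> y') = h y \<oplus>\<^bsub>N\<^esub> h y'"
    if "y \<in> carrier M" "y' \<in> carrier M" for y y'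
    using assms(3) that by (auto simp: module_hom_def)
  have hs: "h (reval R r \<odot>\<^bsub>M\<^esub> y) = reval R r \<odot>\<^bsub>N\<^esub> h y" if "y \<in> carrier M" for y r
    using assms(3) that by (simp add: module_hom_def)
  have h0: "h \<zero>\<^bsub>M\<^esub> = \<zero>\<^bsub>N\<^esub>"
    using h(1,2)[of "\<zero>\<^bsub>M\<^esub>" "\<zero>\<^bsub>M\<^esub>"] by (metis M.l_zero M.zero_closed N.add.l_cancel_one')
  have hneg: "h (\<ominus>\<^bsub>M\<^esub> y) = \<ominus>\<^bsub>N\<^esub> h y" if "y \<in> carrier M" for y
    using h(1,2)[of "\<ominus>\<^bsub>M\<^esub> y" y] h(1)[of y y] that h0 by (metis M.a_inv_closed M.l_neg N.minus_equality)
  have "eval_mod_expr R N (subst_mod_expr (\<lambda>b. if b \<in> carrier M then h b else \<zero>\<^bsub>N\<^esub>) e) = h (eval_mod_expr R M e)" for e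
    by (induction e) (simp_all add: h h0 hneg hs)
  moreover have "subst_free_module f x = abs_free_module (subst_mod_expr f (rep_free_module x))" for f
    by (metis Quotient3_abs_rep Quotient3_free_module subst_free_module.abs_eq)
  ultimately show ?thesis by (simp add: N.meval_abs) (simp add: meval_def)
qed

section \<open>Transfer between the ring and its model\<close>

definition pull :: "('a, 'r) ring_scheme \<Rightarrow> 'a set \<Rightarrow> 'a free_ring set" where
  "pull R J = {x. reval R x \<in> J}"

context cring
begin

lemma reval_image: "J \<subseteq> carrier R \<Longrightarrow> reval R ` pull R J = J"
proof
  assume "J \<subseteq> carrier R"
  show "J \<subseteq> reval R ` pull R J"
  proof
    fix a assume "a \<in> J"
    then have "reval R (ring_var a) = a" using reval_var \<open>J \<subseteq> carrier R\<close> by blast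
    then show "a \<in> reval R ` pull R J" using \<open>a \<in> J\<close> unfolding pull_def by (metis (mono_tags) imageI mem_Collect_eq)
  qed
qed (auto simp: pull_def)

lemma pull_subset_iff: "J \<subseteq> carrier R \<Longrightarrow> pull R J \<subseteq> pull R K \<longleftrightarrow> J \<subseteq> K"
proof
  assume J: "J \<subseteq> carrier R" and sub: "pull R J \<subseteq> pull R K"
  show "J \<subseteq> K"
  proof
    fix a assume a: "a \<in> J"
    then have "reval R (ring_var a) = a" using reval_var J by blast
    then show "a \<in> K" using sub a unfolding pull_def by (metis (mono_tags, lifting) mem_Collect_eq subsetD)
  qed
qed (auto simp: pull_def)

lemma ideal_pull: assumes "ideal J R" shows "is_ideal (pull R J)"
proof -
  interpret ideal J R by fact
  show ?thesis unfolding is_ideal_def pull_def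
    by (simp add: reval_add reval_mult I_l_closed)
qed

lemma pull_zero_subset: "ideal J R \<Longrightarrow> pull R {\<zero>} \<subseteq> pull R J"
  unfolding pull_def using additive_subgroup.zero_closed ideal.axioms(1) by fastforce

lemma pull_image:
  assumes "is_ideal K" "pull R {\<zero>} \<subseteq> K" shows "pull R (reval R ` K) = K"
proof
  show "pull R (reval R ` K) \<subseteq> K"
  proof
    fix x assume "x \<in> pull R (reval R ` K)"
    then obtain k where k: "k \<in> K" "reval R x = reval R k" unfolding pull_def by blast
    then have "x - k \<in> pull R {\<zero>}" unfolding pull_def by (simp add: reval_diff a_minus_def r_neg)
    then show "x \<in> K" using k(1) assms(2) ideal_diff_cancel[OF assms(1), of x k] by blast
  qed
qed (auto simp: pull_def)

lemma ideal_image: assumes "is_ideal K" shows "ideal (reval R ` K) R"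
proof (rule idealI)
  show "ring R" by (rule ring_axioms)
  show "subgroup (reval R ` K) (add_monoid R)"
  proof (rule subgroup.intro)
    show "reval R ` K \<subseteq> carrier (add_monoid R)" by auto
    show "\<one>\<^bsub>add_monoid R\<^esub> \<in> reval R ` K" using idealD(1)[OF assms] reval_zero by (metis image_eqI monoid.select_convs(2))
    show "x \<otimes>\<^bsub>add_monoid R\<^esub> y \<in> reval R ` K" if "x \<in> reval R ` K" "y \<in> reval R ` K" for x y
      using that idealD(2)[OF assms] by (auto simp: reval_add[symmetric])
    show "inv\<^bsub>add_monoid R\<^esub> x \<in> reval R ` K" if "x \<in> reval R ` K" for x
      using that idealD(5)[OF assms] by (auto simp: reval_minus[symmetric] a_inv_def[symmetric])
  qed
  fix a x assume a: "a \<in> reval R ` K" and x: "x \<in> carrier R"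
  obtain k where k: "k \<in> K" "a = reval R k" using a by blast
  have "x \<otimes> a = reval R (ring_var x * k)" using k x by (simp add: reval_mult reval_var)
  then show "x \<otimes> a \<in> reval R ` K" using idealD(3)[OF assms k(1)] by blast
  then show "a \<otimes> x \<in> reval R ` K" using k x m_comm[of x a] by simp
qed

lemma prime_pull: assumes "primeideal P R" shows "is_prime (pull R P)"
proof -
  interpret P: primeideal P R by fact
  have "\<one> \<notin> P" using P.one_imp_carrier P.I_notcarr by auto
  then show ?thesis
    unfolding is_prime_def using ideal_pull[OF P.ideal_axioms] P.I_prime
    by (auto simp: pull_def reval_mult)
qed

lemma prime_image:
  assumes K: "is_prime K" "pull R {\<zero>} \<subseteq> K" shows "primeideal (reval R ` K) R"
proof (rule primeidealI)
  note eq = pull_image[OF primeD(1)[OF K(1)] K(2)]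
  have iff: "reval R x \<in> reval R ` K \<longleftrightarrow> x \<in> K" for x using eq unfolding pull_def by blast
  show "ideal (reval R ` K) R" by (rule ideal_image[OF primeD(1)[OF K(1)]])
  show "cring R" by (rule cring_axioms)
  show "carrier R \<noteq> reval R ` K" using iff[of 1] primeD(2)[OF K(1)] by auto
  fix a b assume ab: "a \<in> carrier R" "b \<in> carrier R" "a \<otimes> b \<in> reval R ` K"
  have "a \<otimes> b = reval R (ring_var a * ring_var b)" using ab by (simp add: reval_mult reval_var)
  then have "ring_var a \<in> K \<or> ring_var b \<in> K" using ab(3) iff primeD(3)[OF K(1)] by metis
  then show "a \<in> reval R ` K \<or> b \<in> reval R ` K" using iff reval_var ab(1,2) by metis
qed

lemma primeideal_subset: "primeideal P R \<Longrightarrow> P \<subseteq> carrier R"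
  by (meson additive_subgroup.a_subset ideal.axioms(1) primeideal.axioms(1))

lemma image_psubset_iff:
  assumes "is_ideal K" "pull R {\<zero>} \<subseteq> K" "is_ideal L" "pull R {\<zero>} \<subseteq> L"
  shows "reval R ` K \<subset> reval R ` L \<longleftrightarrow> K \<subset> L"
  using pull_image[OF assms(1,2)] pull_image[OF assms(3,4)] unfolding pull_def by blast

lemma pull_psubset_iff: "J \<subseteq> carrier R \<Longrightarrow> K \<subseteq> carrier R \<Longrightarrow> pull R J \<subset> pull R K \<longleftrightarrow> J \<subset> K"
  using pull_subset_iff by blast

end

lemma (in noetherian_ring) maximal_ideal_ex:
  assumes "C \<noteq> {}" "\<And>J. J \<in> C \<Longrightarrow> ideal J R"
  shows "\<exists>M\<in>C. \<forall>J\<in>C. M \<subseteq> J \<longrightarrow> J = M"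
proof (rule subset_Zorn_nonempty[OF assms(1)])
  fix D assume D: "D \<noteq> {}" "subset.chain C D"
  then have "subset.chain {I. ideal I R} D" using assms(2) by (auto simp: subset_chain_def)
  then have "\<Union>D \<in> D" by (rule ideal_chain_is_trivial[OF D(1)])
  then show "\<Union>D \<in> C" using D(2) by (auto simp: subset_chain_def)
qed

lemma noeth_pull:
  fixes R (structure)
  assumes "cring R" "noetherian_ring R" shows "noeth (pull R {\<zero>\<^bsub>R\<^esub>})"
proof -
  interpret cring R by fact
  interpret noetherian_ring R by fact
  show ?thesis
  proof
    show "is_ideal (pull R {\<zero>})" by (rule ideal_pull[OF zeroideal])
    fix C :: "'a free_ring set set"
    assume C: "C \<noteq> {}" "\<And>J. J \<in> C \<Longrightarrow> is_ideal J \<and> pull R {\<zero>} \<subseteq> J"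
    have "\<exists>M\<in>(`) (reval R) ` C. \<forall>J\<in>(`) (reval R) ` C. M \<subseteq> J \<longrightarrow> J = M"
      by (rule maximal_ideal_ex) (use C ideal_image in auto)
    then obtain M where M: "M \<in> C" "\<And>J. J \<in> C \<Longrightarrow> reval R ` M \<subseteq> reval R ` J \<Longrightarrow> reval R ` J = reval R ` M" by auto
    have "J = M" if J: "J \<in> C" "M \<subseteq> J" for J
    proof -
      have "reval R ` J = reval R ` M" by (rule M(2)[OF J(1) image_mono[OF J(2)]])
      then show ?thesis using pull_image[of J] pull_image[of M] C(2)[OF J(1)] C(2)[OF M(1)] by metis
    qed
    then show "\<exists>M\<in>C. \<forall>J\<in>C. M \<subseteq> J \<longrightarrow> J = M" using M(1) by blast
  qed
qed

text \<open>Turns the Krull dimension, a supremum, into an actual chain of length \<open>d\<close>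
  and a bound for all chains.\<close>

lemma Sup_enat_attained: assumes "A \<noteq> {}" "Sup A = enat d" shows "enat d \<in> A" "a \<in> A \<Longrightarrow> a \<le> enat d"
proof -
  show "a \<in> A \<Longrightarrow> a \<le> enat d" using Sup_upper[of a A] assms(2) by simp
  show "enat d \<in> A"
  proof (rule ccontr)
    assume no: "enat d \<notin> A"
    have less: "a < enat d" if "a \<in> A" for a
      using Sup_upper[OF that] assms(2) no that by (metis order.not_eq_order_implies_strict)
    obtain a where "a \<in> A" using assms(1) by blast
    then have "d > 0" using less[of a] by (cases d) (auto simp: zero_enat_def[symmetric])
    have "a \<le> enat (d - 1)" if "a \<in> A" for a
      using less[OF that] \<open>d > 0\<close> by (cases a) auto
    then have "Sup A \<le> enat (d - 1)" by (rule Sup_least)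
    then show False using assms(2) \<open>d > 0\<close> by simp
  qed
qed

locale local_noetherian_domain = noetherian_domain R for R :: "('a, 'r) ring_scheme" (structure) +
  fixes \<mm> :: "'a set" and d :: nat
  assumes loc: "local_ring R \<mm>" and dim: "krull_dim R = enat d"
begin

lemma max_m: "maximalideal \<mm> R" and max_unique: "maximalideal \<nn> R \<Longrightarrow> \<nn> = \<mm>"
  using loc by (auto simp: local_ring_def)

lemma primeideal_m: "primeideal \<mm> R"
  using maximalideal_prime[OF max_m] .

lemma proper_ideal_le_m: assumes "ideal J R" "J \<noteq> carrier R" shows "J \<subseteq> \<mm>"
proof -
  let ?C = "{K. ideal K R \<and> J \<subseteq> K \<and> K \<noteq> carrier R}"
  have "\<exists>M\<in>?C. \<forall>K\<in>?C. M \<subseteq> K \<longrightarrow> K = M"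
    by (rule maximal_ideal_ex) (use assms in auto)
  then obtain M where MC: "M \<in> ?C" "\<forall>K\<in>?C. M \<subseteq> K \<longrightarrow> K = M" by (elim bexE)
  then have M: "ideal M R" "J \<subseteq> M" "M \<noteq> carrier R" by simp_all
  have "maximalideal M R"
  proof (rule maximalidealI[OF M(1)])
    show "carrier R \<noteq> M" using M(3) by simp
    show "K = M \<or> K = carrier R" if "ideal K R" "M \<subseteq> K" "K \<subseteq> carrier R" for K
    proof (cases "K = carrier R")
      case False
      then have "K \<in> ?C" using that(1,2) M(2) by simp
      then show ?thesis using MC(2) that(2) by simp
    qed simp
  qed
  then show ?thesis using max_unique M(2) by blast
qed

lemma primeideal_le_m: assumes "primeideal P R" shows "P \<subseteq> \<mm>"
  using proper_ideal_le_m[OF primeideal.axioms(1)[OF assms]] primeideal.I_notcarr[OF assms] by blast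

lemma chain_pull:
  assumes "prime_chain R n P" shows "noeth.prime_chain_in (pull R {\<zero>}) n (\<lambda>i. pull R (P i))"
proof -
  interpret N: noeth "pull R {\<zero>}" by (rule noeth_pull[OF cring_axioms noetherian_ring_axioms])
  show ?thesis
    using assms prime_pull pull_zero_subset[OF primeideal.axioms(1)] primeideal_subset
    unfolding N.prime_chain_in_def prime_chain_def by (simp add: pull_psubset_iff)
qed

lemma chain_image:
  assumes "noeth.prime_chain_in (pull R {\<zero>}) n C" shows "prime_chain R n (\<lambda>i. reval R ` C i)"
proof -
  interpret N: noeth "pull R {\<zero>}" by (rule noeth_pull[OF cring_axioms noetherian_ring_axioms])
  have C: "\<And>i. i \<le> n \<Longrightarrow> is_prime (C i) \<and> pull R {\<zero>} \<subseteq> C i" "\<And>i. i < n \<Longrightarrow> C i \<subset> C (Suc i)"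
    using assms unfolding N.prime_chain_in_def by auto
  show ?thesis
    unfolding prime_chain_def
  proof (intro conjI allI impI)
    show "primeideal (reval R ` C i) R" if "i \<le> n" for i using prime_image C(1)[OF that] by blast
    show "reval R ` C i \<subset> reval R ` C (Suc i)" if "i < n" for i
      using C(1)[of i] C(1)[of "Suc i"] C(2)[OF that] that by (simp add: image_psubset_iff primeD(1))
  qed
qed

sublocale L: local_noeth_domain "pull R {\<zero>}" "pull R \<mm>" d
proof (rule local_noeth_domain.intro)
  show N: "noeth (pull R {\<zero>})" by (rule noeth_pull[OF cring_axioms noetherian_ring_axioms])
  have ne: "{enat n | n. \<exists>P. prime_chain R n P} \<noteq> {}"
  proof -
    have "prime_chain R 0 (\<lambda>_. \<mm>)" using primeideal_m by (simp add: prime_chain_def)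
    then show ?thesis by blast
  qed
  note S = Sup_enat_attained[OF ne dim[unfolded krull_dim_def]]
  show "local_noeth_domain_axioms (pull R {\<zero>}) (pull R \<mm>) d"
  proof
    show "is_prime (pull R {\<zero>})" by (rule prime_pull[OF zeroprimeideal])
    show "is_prime (pull R \<mm>)" by (rule prime_pull[OF primeideal_m])
    show "P \<subseteq> pull R \<mm>" if P: "is_prime P" "pull R {\<zero>} \<subseteq> P" for P
      using primeideal_le_m[OF prime_image[OF P]] unfolding pull_def by blast
    show "\<exists>C. noeth.prime_chain_in (pull R {\<zero>}) d C" using S(1) chain_pull by blast
    show "n \<le> d" if "noeth.prime_chain_in (pull R {\<zero>}) n C" for n C
      using S(2)[of "enat n"] chain_image[OF that] by auto
  qed
qed

lemma spec_pull: "primeideal P R \<Longrightarrow> L.spec (pull R P)"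
  unfolding L.spec_def using prime_pull pull_zero_subset[OF primeideal.axioms(1)] by blast

lemma spec_image: "L.spec K \<Longrightarrow> primeideal (reval R ` K) R" and spec_pull_image: "L.spec K \<Longrightarrow> pull R (reval R ` K) = K"
  unfolding L.spec_def using prime_image pull_image primeD(1) by blast+

lemma sat_chain_pull:
  assumes "saturated_prime_chain R \<pp> \<qq> n P" shows "L.sat_chain n (\<lambda>i. pull R (P i))"
proof -
  have P: "prime_chain R n P" "\<And>i. i < n \<Longrightarrow> \<nexists>Q. primeideal Q R \<and> P i \<subset> Q \<and> Q \<subset> P (Suc i)"
    using assms by (auto simp: saturated_prime_chain_def)
  note C = chain_pull[OF P(1)]
  have "prime_cover (pull R (P i)) (pull R (P (Suc i)))" if i: "i < n" for i
    unfolding prime_cover_def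
  proof (intro conjI allI impI)
    show "is_prime (pull R (P i))" "is_prime (pull R (P (Suc i)))" "pull R (P i) \<subset> pull R (P (Suc i))"
      using C i unfolding L.prime_chain_in_def by auto
    fix r assume r: "is_prime r" "pull R (P i) \<subset> r"
    have Pi: "primeideal (P i) R" "primeideal (P (Suc i)) R" using P(1) i by (auto simp: prime_chain_def)
    have r0: "pull R {\<zero>} \<subseteq> r" using r(2) pull_zero_subset[OF primeideal.axioms(1)[OF Pi(1)]] by blast
    note rr = pull_image[OF primeD(1)[OF r(1)] r0] prime_image[OF r(1) r0]
    show "\<not> r \<subset> pull R (P (Suc i))"
    proof
      assume "r \<subset> pull R (P (Suc i))"
      then have "reval R ` r \<subset> P (Suc i)" "P i \<subset> reval R ` r"
        using pull_psubset_iff[OF primeideal_subset primeideal_subset, OF rr(2) Pi(2)]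
          pull_psubset_iff[OF primeideal_subset primeideal_subset, OF Pi(1) rr(2)] rr(1) r(2) by simp_all
      then show False using P(2)[OF i] rr(2) by blast
    qed
  qed
  then show ?thesis unfolding L.sat_chain_def using C by blast
qed

lemma sat_chain_image:
  assumes "L.sat_chain n C" shows "saturated_prime_chain R (reval R ` C 0) (reval R ` C n) n (\<lambda>i. reval R ` C i)"
proof -
  have C: "L.prime_chain_in n C" "\<And>i. i < n \<Longrightarrow> prime_cover (C i) (C (Suc i))"
    using assms by (auto simp: L.sat_chain_def)
  have no: False if i: "i < n" and Q: "primeideal Q R" "reval R ` C i \<subset> Q" "Q \<subset> reval R ` C (Suc i)" for i Q
  proof -
    have s: "L.spec (C i)" "L.spec (C (Suc i))" using L.chain_spec[OF C(1)] i by auto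
    have "C i \<subset> pull R Q" "pull R Q \<subset> C (Suc i)"
      using pull_psubset_iff[OF primeideal_subset primeideal_subset, OF spec_image[OF s(1)] Q(1)]
        pull_psubset_iff[OF primeideal_subset primeideal_subset, OF Q(1) spec_image[OF s(2)]]
        spec_pull_image[OF s(1)] spec_pull_image[OF s(2)] Q(2,3) by simp_all
    then show False using C(2)[OF i] prime_pull[OF Q(1)] unfolding prime_cover_def by blast
  qed
  show ?thesis
    unfolding saturated_prime_chain_def
  proof (intro conjI allI impI notI)
    show "prime_chain R n (\<lambda>i. reval R ` C i)" by (rule chain_image[OF C(1)])
    fix i assume i: "i < n" and "\<exists>Q. primeideal Q R \<and> reval R ` C i \<subset> Q \<and> Q \<subset> reval R ` C (Suc i)"
    then obtain Q where "primeideal Q R" "reval R ` C i \<subset> Q" "Q \<subset> reval R ` C (Suc i)" by (elim exE conjE)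
    then show False by (rule no[OF i])
  qed simp_all
qed

text \<open>\<open>catenary\<close> compares chains between distinct primes, whereas
  \<open>equal_sat_chains\<close> also admits equal ends; there the strict inclusions force length
  zero.\<close>

lemma catenary_iff: "catenary R \<longleftrightarrow> L.equal_sat_chains"
proof
  assume cat: "catenary R"
  show "L.equal_sat_chains"
    unfolding L.equal_sat_chains_def
  proof (intro allI impI)
    fix m n C D assume C: "L.sat_chain m C" and D: "L.sat_chain n D" and eq: "C 0 = D 0" "C m = D n"
    have Cc: "L.prime_chain_in m C" "L.prime_chain_in n D" using C D by (auto simp: L.sat_chain_def)
    have s: "L.spec (C 0)" "L.spec (C m)" using L.chain_spec[OF Cc(1)] by auto
    have pos: "C 0 \<subset> C m" if c: "L.prime_chain_in m C" "m > 0" for m C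
    proof -
      have "C 0 \<subset> C (Suc 0)" using c by (simp add: L.prime_chain_in_def)
      moreover have "C (Suc 0) \<subseteq> C m" using L.chain_mono[OF c(1), of "Suc 0" m] c(2) by simp
      ultimately show ?thesis by blast
    qed
    show "m = n"
    proof (cases "C 0 = C m")
      case True
      then have "\<not> 0 < m" "\<not> 0 < n" using pos[OF Cc(1)] pos[OF Cc(2)] eq by auto
      then show ?thesis by simp
    next
      case False
      then have sub: "reval R ` C 0 \<subset> reval R ` C m"
        using L.chain_mono[OF Cc(1), of 0 m] image_psubset_iff[OF L.specD(2,3)[OF s(1)] L.specD(2,3)[OF s(2)]] by auto
      have "saturated_prime_chain R (reval R ` C 0) (reval R ` C m) n (\<lambda>i. reval R ` D i)"
        using sat_chain_image[OF D] eq by simp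
      then show ?thesis
        using cat[unfolded catenary_def, rule_format, OF spec_image[OF s(1)] spec_image[OF s(2)] sub sat_chain_image[OF C]]
        by blast
    qed
  qed
next
  assume "L.equal_sat_chains"
  show "catenary R"
    unfolding catenary_def
  proof (intro allI impI)
    fix \<pp> \<qq> m n P Q
    assume P: "saturated_prime_chain R \<pp> \<qq> m P" and Q: "saturated_prime_chain R \<pp> \<qq> n Q"
    have "P 0 = Q 0" "P m = Q n" using P Q by (auto simp: saturated_prime_chain_def)
    then show "m = n" using \<open>L.equal_sat_chains\<close> sat_chain_pull[OF P] sat_chain_pull[OF Q]
      unfolding L.equal_sat_chains_def by fastforce
  qed
qed

end

section \<open>Injective modules over a noetherian ring\<close>

lemma (in cring) module_ideal:
  assumes "ideal J R" shows "module R ((regular_module R)\<lparr>carrier := J\<rparr>)"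
proof -
  interpret J: ideal J R by fact
  have J: "a \<in> J \<Longrightarrow> a \<in> carrier R" for a by (rule J.a_Hcarr)
  show ?thesis
  proof (rule moduleI)
    show "cring R" by (rule cring_axioms)
    show "abelian_group ((regular_module R)\<lparr>carrier := J\<rparr>)"
    proof (rule abelian_groupI)
      show "\<exists>y\<in>carrier ((regular_module R)\<lparr>carrier := J\<rparr>).
          y \<oplus>\<^bsub>(regular_module R)\<lparr>carrier := J\<rparr>\<^esub> x = \<zero>\<^bsub>(regular_module R)\<lparr>carrier := J\<rparr>\<^esub>"
        if "x \<in> carrier ((regular_module R)\<lparr>carrier := J\<rparr>)" for x
        using that J by (intro bexI[of _ "\<ominus> x"]) (simp_all add: regular_module_def l_neg)
    qed (auto simp: regular_module_def J a_assoc intro: a_comm)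
  qed (auto simp: regular_module_def J J.I_l_closed l_distr r_distr m_assoc)
qed

text \<open>A map on an ideal extends to the whole ring, where it is multiplication by its value at
  one.\<close>

lemma (in cring) injective_extend_ideal:
  assumes E: "injective_module R E" and J: "ideal J R" and f: "f \<in> J \<rightarrow> carrier E"
    and f_add: "\<And>x y. x \<in> J \<Longrightarrow> y \<in> J \<Longrightarrow> f (x \<oplus> y) = f x \<oplus>\<^bsub>E\<^esub> f y"
    and f_smult: "\<And>r x. r \<in> carrier R \<Longrightarrow> x \<in> J \<Longrightarrow> f (r \<otimes> x) = r \<odot>\<^bsub>E\<^esub> f x"
  shows "\<exists>e\<in>carrier E. \<forall>x\<in>J. f x = x \<odot>\<^bsub>E\<^esub> e"
proof -
  let ?J = "(regular_module R)\<lparr>carrier := J\<rparr>"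
  have R: "module R (regular_module R)"
    using module_ideal[OF oneideal] by (simp add: regular_module_def)
  have sub: "J \<subseteq> carrier R" by (rule ideal.Icarr[OF J, THEN subsetI])
  have "(\<lambda>x. x) \<in> module_hom R ?J (regular_module R)" "inj_on (\<lambda>x. x) (carrier ?J)" "f \<in> module_hom R ?J E"
    using sub f f_add f_smult by (auto simp: module_hom_def regular_module_def)
  then obtain g where g: "g \<in> module_hom R (regular_module R) E" "\<forall>x\<in>J. g x = f x"
    using E module_ideal[OF J] R unfolding injective_module_def by fastforce
  have "g x = x \<odot>\<^bsub>E\<^esub> g \<one>" if x: "x \<in> carrier R" for x
  proof -
    have "g (x \<otimes> \<one>) = x \<odot>\<^bsub>E\<^esub> g \<one>"
      using g(1) x one_closed by (simp add: module_hom_def regular_module_def del: r_one)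
    then show ?thesis using x by simp
  qed
  moreover have "g \<one> \<in> carrier E" using g(1) by (auto simp: module_hom_def regular_module_def)
  ultimately show ?thesis using g(2) sub by (metis subsetD)
qed

lemma (in module) smult_diff:
  "a \<in> carrier R \<Longrightarrow> x \<in> carrier M \<Longrightarrow> y \<in> carrier M \<Longrightarrow> a \<odot>\<^bsub>M\<^esub> (x \<ominus>\<^bsub>M\<^esub> y) = a \<odot>\<^bsub>M\<^esub> x \<ominus>\<^bsub>M\<^esub> a \<odot>\<^bsub>M\<^esub> y"
  by (simp add: M.minus_eq smult_r_distr smult_r_minus)

lemma (in module) smult_diff_left:
  "a \<in> carrier R \<Longrightarrow> b \<in> carrier R \<Longrightarrow> x \<in> carrier M \<Longrightarrow> (a \<ominus> b) \<odot>\<^bsub>M\<^esub> x = a \<odot>\<^bsub>M\<^esub> x \<ominus>\<^bsub>M\<^esub> b \<odot>\<^bsub>M\<^esub> x"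
  by (simp add: M.minus_eq R.minus_eq smult_l_distr smult_l_minus)

lemma (in module) diff_zero_iff:
  "x \<in> carrier M \<Longrightarrow> y \<in> carrier M \<Longrightarrow> x \<ominus>\<^bsub>M\<^esub> y = \<zero>\<^bsub>M\<^esub> \<longleftrightarrow> x = y"
  by (metis M.minus_eq M.r_neg M.add.inv_closed M.minus_equality M.minus_minus)

lemma (in module) ideal_preimage:
  assumes B: "\<zero>\<^bsub>M\<^esub> \<in> B" "\<And>x y. x \<in> B \<Longrightarrow> y \<in> B \<Longrightarrow> x \<oplus>\<^bsub>M\<^esub> y \<in> B" "\<And>a x. a \<in> carrier R \<Longrightarrow> x \<in> B \<Longrightarrow> a \<odot>\<^bsub>M\<^esub> x \<in> B"
    and e: "e \<in> carrier M" 
  shows "ideal {r \<in> carrier R. r \<odot>\<^bsub>M\<^esub> e \<in> B} R"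
proof (rule idealI)
  let ?J = "{r \<in> carrier R. r \<odot>\<^bsub>M\<^esub> e \<in> B}"
  show "ring R" by (rule R.ring_axioms)
  show "subgroup ?J (add_monoid R)"
  proof (rule subgroup.intro)
    show "inv\<^bsub>add_monoid R\<^esub> x \<in> ?J" if x: "x \<in> ?J" for x
    proof -
      have "(\<ominus> x) \<odot>\<^bsub>M\<^esub> e = (\<ominus> \<one>) \<odot>\<^bsub>M\<^esub> (x \<odot>\<^bsub>M\<^esub> e)" using x e by (simp add: smult_l_minus)
      then show ?thesis using x B(3)[of "\<ominus> \<one>" "x \<odot>\<^bsub>M\<^esub> e"] by (simp add: a_inv_def[symmetric])
    qed
  qed (use B e in \<open>auto simp: smult_l_distr\<close>)
  fix a x assume a: "a \<in> ?J" and x: "x \<in> carrier R"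
  then show "x \<otimes> a \<in> ?J" using B(3) e by (simp add: smult_assoc1)
  then show "a \<otimes> x \<in> ?J" using a x by (simp add: R.m_comm)
qed

text \<open>Let the annihilators of \<open>z ^ k e\<close> be stationary from \<open>k\<close> on.
  The map on the multiples of \<open>z ^ (k + n) e\<close> that sends this element to
  \<open>z ^ k e\<close> is then well defined. Extended to the multiples of \<open>e\<close>, it
  sends \<open>e\<close> to the desired \<open>e'\<close>, which is killed by whatever kills
  \<open>e\<close>.\<close>

lemma injective_divisible:
  fixes R (structure)
  assumes noeth: "noetherian_ring R" and E: "injective_module R E" and e: "e \<in> carrier E" and z: "z \<in> carrier R"
  shows "\<exists>e'\<in>carrier E. (\<forall>r\<in>carrier R. r \<odot>\<^bsub>E\<^esub> e = \<zero>\<^bsub>E\<^esub> \<longrightarrow> r \<odot>\<^bsub>E\<^esub> e' = \<zero>\<^bsub>E\<^esub>) \<and>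
    (\<exists>k. z [^] (k::nat) \<odot>\<^bsub>E\<^esub> (z [^] (n::nat) \<odot>\<^bsub>E\<^esub> e' \<ominus>\<^bsub>E\<^esub> e) = \<zero>\<^bsub>E\<^esub>)"
proof -
  interpret N: noetherian_ring R by fact
  interpret module R E using E by (simp add: injective_module_def)
  define A where "A = (\<lambda>k::nat. {r \<in> carrier R. r \<odot>\<^bsub>E\<^esub> (z [^] k \<odot>\<^bsub>E\<^esub> e) \<in> {\<zero>\<^bsub>E\<^esub>}})"
  have zk [simp]: "z [^] (k::nat) \<in> carrier R" for k using z by simp
  have A_ideal: "ideal (A k) R" for k unfolding A_def by (rule ideal_preimage) (use e in simp_all)
  have pow: "z [^] (k + l :: nat) \<odot>\<^bsub>E\<^esub> x = z [^] l \<odot>\<^bsub>E\<^esub> (z [^] k \<odot>\<^bsub>E\<^esub> x)" if "x \<in> carrier E" for k l x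
    using that z by (simp add: smult_assoc1[symmetric] N.nat_pow_mult add.commute)
  have comm: "a \<odot>\<^bsub>E\<^esub> (b \<odot>\<^bsub>E\<^esub> x) = b \<odot>\<^bsub>E\<^esub> (a \<odot>\<^bsub>E\<^esub> x)" if "a \<in> carrier R" "b \<in> carrier R" "x \<in> carrier E" for a b x
    using that by (simp add: smult_assoc1[symmetric] R.m_comm)
  have A_mono: "A k \<subseteq> A (k + l)" for k l
    unfolding A_def using e by (auto simp: pow comm[of _ "z [^] l"])
  have "\<exists>M\<in>range A. \<forall>J\<in>range A. M \<subseteq> J \<longrightarrow> J = M"
    by (rule N.maximal_ideal_ex) (use A_ideal in auto)
  then obtain k where k: "\<And>l. A k \<subseteq> A l \<Longrightarrow> A l = A k" by auto
  have stable: "x \<odot>\<^bsub>E\<^esub> (z [^] k \<odot>\<^bsub>E\<^esub> e) = \<zero>\<^bsub>E\<^esub>" if "x \<in> carrier R" "x \<odot>\<^bsub>E\<^esub> (z [^] (k + n) \<odot>\<^bsub>E\<^esub> e) = \<zero>\<^bsub>E\<^esub>" for x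
    using k[OF A_mono[of k n]] that unfolding A_def by auto
  define B where "B = {r \<odot>\<^bsub>E\<^esub> (z [^] (k + n) \<odot>\<^bsub>E\<^esub> e) | r. r \<in> carrier R}"
  \<comment> \<open>The ideal of coefficients that bring \<open>e\<close> into \<open>B\<close>;
    through it the extension becomes one from an ideal to the ring.\<close>
  define J where "J = {r \<in> carrier R. r \<odot>\<^bsub>E\<^esub> e \<in> B}"
  have BI: "r \<in> carrier R \<Longrightarrow> r \<odot>\<^bsub>E\<^esub> (z [^] (k + n) \<odot>\<^bsub>E\<^esub> e) \<in> B" for r
    unfolding B_def by blast
  have "ideal J R" unfolding J_def
  proof (rule ideal_preimage[OF _ _ _ e])
    show "\<zero>\<^bsub>E\<^esub> \<in> B" using BI[of \<zero>] e by simp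
    show "x \<oplus>\<^bsub>E\<^esub> y \<in> B" if xy: "x \<in> B" "y \<in> B" for x y
    proof -
      obtain r s where "r \<in> carrier R" "s \<in> carrier R" "x = r \<odot>\<^bsub>E\<^esub> (z [^] (k + n) \<odot>\<^bsub>E\<^esub> e)" "y = s \<odot>\<^bsub>E\<^esub> (z [^] (k + n) \<odot>\<^bsub>E\<^esub> e)"
        using xy unfolding B_def by blast
      then show ?thesis using BI[of "r \<oplus> s"] e by (simp add: smult_l_distr)
    qed
    show "a \<odot>\<^bsub>E\<^esub> x \<in> B" if ax: "a \<in> carrier R" "x \<in> B" for a x
    proof -
      obtain r where "r \<in> carrier R" "x = r \<odot>\<^bsub>E\<^esub> (z [^] (k + n) \<odot>\<^bsub>E\<^esub> e)"
        using ax unfolding B_def by blast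
      then show ?thesis using BI[of "a \<otimes> r"] ax(1) e by (simp add: smult_assoc1)
    qed
  qed
  define c where "c = (\<lambda>x. SOME r. r \<in> carrier R \<and> x \<odot>\<^bsub>E\<^esub> e = r \<odot>\<^bsub>E\<^esub> (z [^] (k + n) \<odot>\<^bsub>E\<^esub> e))"
  have c: "c x \<in> carrier R" "x \<odot>\<^bsub>E\<^esub> e = c x \<odot>\<^bsub>E\<^esub> (z [^] (k + n) \<odot>\<^bsub>E\<^esub> e)" if "x \<in> J" for x
  proof -
    have "\<exists>r. r \<in> carrier R \<and> x \<odot>\<^bsub>E\<^esub> e = r \<odot>\<^bsub>E\<^esub> (z [^] (k + n) \<odot>\<^bsub>E\<^esub> e)" using that unfolding J_def B_def by blast
    from someI_ex[OF this] show "c x \<in> carrier R" "x \<odot>\<^bsub>E\<^esub> e = c x \<odot>\<^bsub>E\<^esub> (z [^] (k + n) \<odot>\<^bsub>E\<^esub> e)"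
      unfolding c_def by blast+
  qed
  define f where "f = (\<lambda>x. c x \<odot>\<^bsub>E\<^esub> (z [^] k \<odot>\<^bsub>E\<^esub> e))"
  have f: "f x = r \<odot>\<^bsub>E\<^esub> (z [^] k \<odot>\<^bsub>E\<^esub> e)" if x: "x \<in> J" "r \<in> carrier R" "x \<odot>\<^bsub>E\<^esub> e = r \<odot>\<^bsub>E\<^esub> (z [^] (k + n) \<odot>\<^bsub>E\<^esub> e)" for x r
  proof -
    have "(c x \<ominus> r) \<odot>\<^bsub>E\<^esub> (z [^] (k + n) \<odot>\<^bsub>E\<^esub> e) = \<zero>\<^bsub>E\<^esub>"
      using x c[OF x(1)] e by (simp add: smult_diff_left diff_zero_iff)
    then have "(c x \<ominus> r) \<odot>\<^bsub>E\<^esub> (z [^] k \<odot>\<^bsub>E\<^esub> e) = \<zero>\<^bsub>E\<^esub>" using stable x(2) c(1)[OF x(1)] by simp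
    then show ?thesis unfolding f_def using x(2) c(1)[OF x(1)] e by (simp add: smult_diff_left diff_zero_iff)
  qed
  interpret J: ideal J R by fact
  obtain e' where e': "e' \<in> carrier E" "\<And>x. x \<in> J \<Longrightarrow> f x = x \<odot>\<^bsub>E\<^esub> e'"
  proof (rule bexE[OF R.injective_extend_ideal[OF E \<open>ideal J R\<close>]])
    show "f \<in> J \<rightarrow> carrier E" using c(1) e by (auto simp: f_def)
    show "f (x \<oplus> y) = f x \<oplus>\<^bsub>E\<^esub> f y" if "x \<in> J" "y \<in> J" for x y
    proof -
      have "f (x \<oplus> y) = (c x \<oplus> c y) \<odot>\<^bsub>E\<^esub> (z [^] k \<odot>\<^bsub>E\<^esub> e)"
        by (rule f) (use that c(1) c(2)[OF that(1)] c(2)[OF that(2)] e J.Icarr in \<open>simp_all add: smult_l_distr\<close>)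
      then show ?thesis using c(1) that e by (simp add: f_def smult_l_distr)
    qed
    show "f (r \<otimes> x) = r \<odot>\<^bsub>E\<^esub> f x" if "r \<in> carrier R" "x \<in> J" for r x
    proof -
      have "f (r \<otimes> x) = (r \<otimes> c x) \<odot>\<^bsub>E\<^esub> (z [^] k \<odot>\<^bsub>E\<^esub> e)"
        by (rule f) (use that c[OF that(2)] e J.Icarr J.I_l_closed in \<open>simp_all add: smult_assoc1\<close>)
      then show ?thesis using c(1) that e by (simp add: f_def smult_assoc1)
    qed
  qed blast
  have "r \<odot>\<^bsub>E\<^esub> e' = \<zero>\<^bsub>E\<^esub>" if r: "r \<in> carrier R" "r \<odot>\<^bsub>E\<^esub> e = \<zero>\<^bsub>E\<^esub>" for r
  proof -
    have "\<zero>\<^bsub>E\<^esub> \<in> B" using BI[OF N.zero_closed] e by simp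
    then have rJ: "r \<in> J" unfolding J_def using r by simp
    then have "f r = \<zero> \<odot>\<^bsub>E\<^esub> (z [^] k \<odot>\<^bsub>E\<^esub> e)" by (rule f) (use r e in simp_all)
    then show ?thesis using e'(2)[OF rJ] e by simp
  qed
  moreover have "z [^] k \<odot>\<^bsub>E\<^esub> (z [^] n \<odot>\<^bsub>E\<^esub> e' \<ominus>\<^bsub>E\<^esub> e) = \<zero>\<^bsub>E\<^esub>"
  proof -
    have "z [^] (k + n) \<odot>\<^bsub>E\<^esub> e \<in> B" using BI[OF N.one_closed] e by simp
    then have zJ: "z [^] (k + n) \<in> J" unfolding J_def by simp
    then have "f (z [^] (k + n)) = \<one> \<odot>\<^bsub>E\<^esub> (z [^] k \<odot>\<^bsub>E\<^esub> e)" by (rule f) (use e in simp_all)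
    then have "z [^] (k + n) \<odot>\<^bsub>E\<^esub> e' = z [^] k \<odot>\<^bsub>E\<^esub> e" using e'(2)[OF zJ] e by simp
    then show ?thesis using e e'(1) pow[OF e'(1)] comm[of "z [^] k" "z [^] n"] by (simp add: smult_diff diff_zero_iff)
  qed
  ultimately show ?thesis using e'(1) by blast
qed

section \<open>Torsion and quotient modules\<close>

context module
begin

text \<open>Representatives of a coset differ by elements of \<open>N\<close>, and \<open>N\<close>
  is stable under scalars, so a single representative decides the union that defines scalar
  multiplication.\<close>

lemma quotient_smult_eq_zero_iff:
  assumes N: "N \<subseteq> carrier M" "\<zero>\<^bsub>M\<^esub> \<in> N" "\<And>x y. x \<in> N \<Longrightarrow> y \<in> N \<Longrightarrow> x \<oplus>\<^bsub>M\<^esub> y \<in> N" "\<And>a x. a \<in> carrier R \<Longrightarrow> x \<in> N \<Longrightarrow> a \<odot>\<^bsub>M\<^esub> x \<in> N"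
    and r: "r \<in> carrier R" and x: "x \<in> carrier M"
  shows "(\<Union>y\<in>N +>\<^bsub>M\<^esub> x. N +>\<^bsub>M\<^esub> (r \<odot>\<^bsub>M\<^esub> y)) = N \<longleftrightarrow> r \<odot>\<^bsub>M\<^esub> x \<in> N"
proof -
  have coset: "N +>\<^bsub>M\<^esub> y = {n \<oplus>\<^bsub>M\<^esub> y | n. n \<in> N}" for y by (auto simp: a_r_coset_def r_coset_def)
  have neg: "\<ominus>\<^bsub>M\<^esub> n \<in> N" if "n \<in> N" for n
  proof -
    have "n \<in> carrier M" using that N(1) by blast
    then have "(\<ominus> \<one>) \<odot>\<^bsub>M\<^esub> n = \<ominus>\<^bsub>M\<^esub> n" by (simp add: smult_l_minus)
    then show ?thesis using N(4)[OF _ that, of "\<ominus> \<one>"] by simp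
  qed
  have cancel: "y \<in> N" if "n \<in> N" "n \<oplus>\<^bsub>M\<^esub> y \<in> N" "y \<in> carrier M" for n y
  proof -
    have "n \<in> carrier M" using that N(1) by blast
    then have "y = \<ominus>\<^bsub>M\<^esub> n \<oplus>\<^bsub>M\<^esub> (n \<oplus>\<^bsub>M\<^esub> y)" using that(3) by (simp add: M.r_neg1)
    then show ?thesis using N(3)[OF neg[OF that(1)] that(2)] by simp
  qed
  show ?thesis
  proof
    assume eq: "(\<Union>y\<in>N +>\<^bsub>M\<^esub> x. N +>\<^bsub>M\<^esub> (r \<odot>\<^bsub>M\<^esub> y)) = N"
    have "\<zero>\<^bsub>M\<^esub> \<oplus>\<^bsub>M\<^esub> x \<in> N +>\<^bsub>M\<^esub> x" "\<zero>\<^bsub>M\<^esub> \<oplus>\<^bsub>M\<^esub> (r \<odot>\<^bsub>M\<^esub> x) \<in> N +>\<^bsub>M\<^esub> (r \<odot>\<^bsub>M\<^esub> x)"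
      unfolding coset using N(2) by blast+
    then have "r \<odot>\<^bsub>M\<^esub> x \<in> (\<Union>y\<in>N +>\<^bsub>M\<^esub> x. N +>\<^bsub>M\<^esub> (r \<odot>\<^bsub>M\<^esub> y))" using x r by auto
    then show "r \<odot>\<^bsub>M\<^esub> x \<in> N" using eq by simp
  next
    assume rx: "r \<odot>\<^bsub>M\<^esub> x \<in> N"
    have "N +>\<^bsub>M\<^esub> (r \<odot>\<^bsub>M\<^esub> y) = N" if y: "y \<in> N +>\<^bsub>M\<^esub> x" for y
    proof -
      obtain n where n: "n \<in> N" "y = n \<oplus>\<^bsub>M\<^esub> x" using y unfolding coset by blast
      have nc: "n \<in> carrier M" using n(1) N(1) by blast
      have ry: "r \<odot>\<^bsub>M\<^esub> y \<in> N" unfolding n(2) smult_r_distr[OF r nc x] by (rule N(3)[OF N(4)[OF r n(1)] rx])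
      show ?thesis
      proof
        show "N +>\<^bsub>M\<^esub> (r \<odot>\<^bsub>M\<^esub> y) \<subseteq> N" unfolding coset using N(3) ry by blast
        show "N \<subseteq> N +>\<^bsub>M\<^esub> (r \<odot>\<^bsub>M\<^esub> y)"
        proof
          fix a assume a: "a \<in> N"
          have c: "a \<in> carrier M" "r \<odot>\<^bsub>M\<^esub> y \<in> carrier M" using a ry N(1) by blast+
          have "a = (a \<oplus>\<^bsub>M\<^esub> \<ominus>\<^bsub>M\<^esub> (r \<odot>\<^bsub>M\<^esub> y)) \<oplus>\<^bsub>M\<^esub> r \<odot>\<^bsub>M\<^esub> y" using c by (simp add: M.a_assoc M.l_neg)
          then show "a \<in> N +>\<^bsub>M\<^esub> (r \<odot>\<^bsub>M\<^esub> y)" unfolding coset using N(3)[OF a neg[OF ry]] by blast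
        qed
      qed
    qed
    moreover have "N +>\<^bsub>M\<^esub> x \<noteq> {}" unfolding coset using N(2) by blast
    ultimately show "(\<Union>y\<in>N +>\<^bsub>M\<^esub> x. N +>\<^bsub>M\<^esub> (r \<odot>\<^bsub>M\<^esub> y)) = N" by auto
  qed
qed

end

section \<open>The model of an injective resolution\<close>

type_synonym ('x, 'y) cochain = "nat \<Rightarrow> nat \<Rightarrow> ('x, 'y) free_module"

locale injectively_resolved = local_noetherian_domain R \<mm> d
  for R :: "('a, 'r) ring_scheme" (structure) and \<mm> d +
  fixes I :: "nat \<Rightarrow> ('a, 'b) module" and \<delta> :: "nat \<Rightarrow> 'b \<Rightarrow> 'b" and \<epsilon> :: "'a \<Rightarrow> 'b"
  assumes res: "injective_resolution R (regular_module R) \<epsilon> I \<delta>"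
begin

lemma I_injective: "injective_module R (I j)"
  using res by (simp add: injective_resolution_def)

sublocale I: module R "I j" for j
  using I_injective by (simp add: injective_module_def)

lemma delta_hom: "\<delta> j \<in> module_hom R (I j) (I (Suc j))"
  using res by (simp add: injective_resolution_def)

lemma delta_closed [simp]: "x \<in> carrier (I j) \<Longrightarrow> \<delta> j x \<in> carrier (I (Suc j))"
  and delta_smult: "r \<in> carrier R \<Longrightarrow> x \<in> carrier (I j) \<Longrightarrow> \<delta> j (r \<odot>\<^bsub>I j\<^esub> x) = r \<odot>\<^bsub>I (Suc j)\<^esub> \<delta> j x"
  using delta_hom[of j] by (auto simp: module_hom_def)

lemma delta_zero [simp]: "\<delta> j \<zero>\<^bsub>I j\<^esub> = \<zero>\<^bsub>I (Suc j)\<^esub>"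
  using delta_smult[of \<zero> "\<zero>\<^bsub>I j\<^esub>" j] by simp

lemma exact_Suc: "x \<in> carrier (I (Suc j)) \<Longrightarrow> \<delta> (Suc j) x = \<zero>\<^bsub>I (Suc (Suc j))\<^esub> \<longleftrightarrow> x \<in> \<delta> j ` carrier (I j)"
  and exact_zero: "x \<in> carrier (I 0) \<Longrightarrow> \<delta> 0 x = \<zero>\<^bsub>I (Suc 0)\<^esub> \<longleftrightarrow> x \<in> \<epsilon> ` carrier R"
proof -
  have "a_kernel (I (Suc j)) (I (Suc (Suc j))) (\<delta> (Suc j)) = \<delta> j ` carrier (I j)"
    "a_kernel (I 0) (I 1) (\<delta> 0) = \<epsilon> ` carrier R"
    using res by (simp_all add: injective_resolution_def regular_module_def)
  then show "x \<in> carrier (I (Suc j)) \<Longrightarrow> \<delta> (Suc j) x = \<zero>\<^bsub>I (Suc (Suc j))\<^esub> \<longleftrightarrow> x \<in> \<delta> j ` carrier (I j)"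
    "x \<in> carrier (I 0) \<Longrightarrow> \<delta> 0 x = \<zero>\<^bsub>I (Suc 0)\<^esub> \<longleftrightarrow> x \<in> \<epsilon> ` carrier R"
    by (auto simp: a_kernel_def' set_eq_iff)
qed

lemma delta_delta [simp]: "x \<in> carrier (I j) \<Longrightarrow> \<delta> (Suc j) (\<delta> j x) = \<zero>\<^bsub>I (Suc (Suc j))\<^esub>"
  by (simp add: exact_Suc)

lemma eps_closed [simp]: "r \<in> carrier R \<Longrightarrow> \<epsilon> r \<in> carrier (I 0)"
  and eps_smult: "r \<in> carrier R \<Longrightarrow> s \<in> carrier R \<Longrightarrow> \<epsilon> (r \<otimes> s) = r \<odot>\<^bsub>I 0\<^esub> \<epsilon> s"
  and eps_inj: "inj_on \<epsilon> (carrier R)"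
  using res by (auto simp: injective_resolution_def module_hom_def regular_module_def)

lemma eps_one: "r \<in> carrier R \<Longrightarrow> r \<odot>\<^bsub>I 0\<^esub> \<epsilon> \<one> = \<epsilon> r"
  using eps_smult[of r \<one>] by simp

lemma eps_zero_iff: "r \<in> carrier R \<Longrightarrow> \<epsilon> r = \<zero>\<^bsub>I 0\<^esub> \<longleftrightarrow> r = \<zero>"
  using eps_one[of \<zero>] inj_onD[OF eps_inj, of r \<zero>] by auto

text \<open>One class-typed module carries the whole complex: the component \<open>f j 0\<close> denotes an element
  of \<open>I j\<close>, and the second index makes room for the pairs that occur in Koszul complexes.
  Equality in the resolution is congruence modulo \<open>nullC\<close>.\<close>

definition val :: "nat \<Rightarrow> ('a, 'b) free_module \<Rightarrow> 'b" where "val j x = meval R (I j) x"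

definition scaleC :: "'a free_ring \<Rightarrow> ('a, 'b) cochain \<Rightarrow> ('a, 'b) cochain" where
  "scaleC r f = (\<lambda>j n. mod_scale r (f j n))"

definition nullC :: "('a, 'b) cochain set" where
  "nullC = {f. \<forall>j n. val j (f j n) = \<zero>\<^bsub>I j\<^esub>}"

definition pairC :: "('a, 'b) cochain \<Rightarrow> ('a, 'b) cochain \<Rightarrow> ('a, 'b) cochain" where
  "pairC f g = (\<lambda>j n. if even n then f j (n div 2) else g j (n div 2))"

definition evC :: "('a, 'b) cochain \<Rightarrow> ('a, 'b) cochain" where "evC f = (\<lambda>j n. f j (2 * n))"

definition odC :: "('a, 'b) cochain \<Rightarrow> ('a, 'b) cochain" where "odC f = (\<lambda>j n. f j (2 * n + 1))"

text \<open>The second index \<open>0\<close> holds the resolution itself. A negative degree forces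
  all components to vanish, so degree shifts below zero are harmless.\<close>

definition degC :: "int \<Rightarrow> ('a, 'b) cochain set" where
  "degC i = {f. \<forall>j n. int j \<noteq> i \<or> n \<noteq> 0 \<longrightarrow> val j (f j n) = \<zero>\<^bsub>I j\<^esub>}"

definition deltaC :: "('a, 'b) cochain \<Rightarrow> ('a, 'b) cochain" where
  "deltaC f = (\<lambda>j n. case j of 0 \<Rightarrow> 0 | Suc k \<Rightarrow>
    subst_free_module (\<lambda>b. if b \<in> carrier (I k) then \<delta> k b else \<zero>\<^bsub>I (Suc k)\<^esub>) (f k n))"

definition singleC :: "nat \<Rightarrow> 'b \<Rightarrow> ('a, 'b) cochain" where
  "singleC j x = (\<lambda>k n. if k = j \<and> n = 0 then mod_var x else 0)"

lemma val_closed [simp]: "val j x \<in> carrier (I j)"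
  and val_zero [simp]: "val j 0 = \<zero>\<^bsub>I j\<^esub>"
  and val_add: "val j (x + y) = val j x \<oplus>\<^bsub>I j\<^esub> val j y"
  and val_diff: "val j (x - y) = val j x \<ominus>\<^bsub>I j\<^esub> val j y"
  and val_scale: "val j (mod_scale r x) = reval R r \<odot>\<^bsub>I j\<^esub> val j x"
  and val_var: "b \<in> carrier (I j) \<Longrightarrow> val j (mod_var b) = b"
  by (simp_all add: val_def I.meval_add I.meval_diff I.meval_scale I.meval_var)

lemma val_delta: "val j (deltaC f j n) = (case j of 0 \<Rightarrow> \<zero>\<^bsub>I 0\<^esub> | Suc k \<Rightarrow> \<delta> k (val k (f k n)))"
  using meval_subst[OF I.module_axioms I.module_axioms delta_hom]
  by (simp add: deltaC_def val_def split: nat.split)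

lemma val_single: "x \<in> carrier (I j) \<Longrightarrow> val k (singleC j x k n) = (if k = j \<and> n = 0 then x else \<zero>\<^bsub>I k\<^esub>)"
  by (auto simp: singleC_def val_var)

lemma single_deg: "x \<in> carrier (I j) \<Longrightarrow> singleC j x \<in> degC (int j)"
  by (auto simp: degC_def val_single)

lemma nullC_deg: "f \<in> degC (int j) \<Longrightarrow> f \<in> nullC \<longleftrightarrow> val j (f j 0) = \<zero>\<^bsub>I j\<^esub>"
proof -
  assume "f \<in> degC (int j)"
  then have "k \<noteq> j \<or> n \<noteq> 0 \<Longrightarrow> val k (f k n) = \<zero>\<^bsub>I k\<^esub>" for k n by (auto simp: degC_def)
  then have "val j (f j 0) = \<zero>\<^bsub>I j\<^esub> \<Longrightarrow> val k (f k n) = \<zero>\<^bsub>I k\<^esub>" for k n by (cases "k = j \<and> n = 0") auto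
  then show ?thesis by (auto simp: nullC_def)
qed

lemma degC_neg: "i < 0 \<Longrightarrow> degC i \<subseteq> nullC"
  by (auto simp: degC_def nullC_def)

lemma val_scaleC: "val j (scaleC r f j n) = reval R r \<odot>\<^bsub>I j\<^esub> val j (f j n)"
  by (simp add: scaleC_def val_scale)

lemma degC_closed: "f \<in> degC i \<Longrightarrow> g \<in> degC i \<Longrightarrow> f - g \<in> degC i" "f \<in> degC i \<Longrightarrow> scaleC r f \<in> degC i"
  by (auto simp: degC_def val_diff val_scaleC I.diff_zero_iff)

lemma null_module_C: "null_module scaleC nullC"
proof
  show "scaleC r (a + b) = scaleC r a + scaleC r b" "scaleC (r + t) a = scaleC r a + scaleC t a"
    "scaleC r (scaleC t a) = scaleC (r * t) a" "scaleC 1 a = a" for r t a b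
    by (simp_all add: scaleC_def mod_scale_simps fun_eq_iff)
qed (auto simp: nullC_def val_scaleC val_add)

lemma exactC:
  assumes "i > 0" and f: "f \<in> degC i" "deltaC f \<in> nullC"
  shows "\<exists>g\<in>degC (i - 1). f - deltaC g \<in> nullC"
proof -
  obtain k where i: "i = int (Suc k)" using \<open>i > 0\<close> by (metis Suc_pred' nat_0_le order_less_imp_le zero_less_nat_eq)
  have "\<delta> (Suc k) (val (Suc k) (f (Suc k) 0)) = \<zero>\<^bsub>I (Suc (Suc k))\<^esub>"
    using f(2) val_delta[of "Suc (Suc k)" f 0] by (auto simp: nullC_def)
  then obtain y where y: "y \<in> carrier (I k)" "val (Suc k) (f (Suc k) 0) = \<delta> k y"
    by (auto simp: exact_Suc)
  have "f - deltaC (singleC k y) \<in> nullC"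
    unfolding nullC_def using f(1) y
    by (auto simp: val_diff val_delta val_single degC_def i I.diff_zero_iff split: nat.split)
  moreover have "singleC k y \<in> degC (i - 1)" using single_deg[OF y(1)] i by simp
  ultimately show ?thesis by blast
qed

lemma divisibleC:
  assumes f: "f \<in> degC i"
  shows "\<exists>g\<in>degC i. (\<forall>r. scaleC r f \<in> nullC \<longrightarrow> scaleC r g \<in> nullC) \<and>
    (\<exists>k. scaleC (z ^ k) (scaleC (z ^ n) g - f) \<in> nullC)"
proof -
  interpret C: null_module scaleC nullC by (rule null_module_C)
  show ?thesis
  proof (cases "i < 0")
    case True
    have "0 \<in> degC i" "f \<in> nullC" using f degC_neg[OF True] by (auto simp: degC_def)
    then show ?thesis
      by (intro bexI[of _ 0]) (simp_all add: C.NN_zero C.scale_minus_right C.scale_right_diff, metis C.NN_scale C.scale_minus_left C.scale_one)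
  next
    case False
    then obtain j where i: "i = int j" by (metis not_less nonneg_int_cases)
    have fj: "f \<in> degC (int j)" using f i by simp
    obtain e' k where e': "e' \<in> carrier (I j)"
      "\<And>r. r \<in> carrier R \<Longrightarrow> r \<odot>\<^bsub>I j\<^esub> val j (f j 0) = \<zero>\<^bsub>I j\<^esub> \<Longrightarrow> r \<odot>\<^bsub>I j\<^esub> e' = \<zero>\<^bsub>I j\<^esub>"
      "reval R z [^] (k::nat) \<odot>\<^bsub>I j\<^esub> (reval R z [^] n \<odot>\<^bsub>I j\<^esub> e' \<ominus>\<^bsub>I j\<^esub> val j (f j 0)) = \<zero>\<^bsub>I j\<^esub>"
      using injective_divisible[OF noetherian_ring_axioms I_injective val_closed reval_closed, of j "f j 0" z n] by blast
    note g = single_deg[OF e'(1)]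
    have "scaleC r (singleC j e') \<in> nullC" if "scaleC r f \<in> nullC" for r
      using that e'(1) e'(2)[of "reval R r"] nullC_deg[OF degC_closed(2)[OF g]] nullC_deg[OF degC_closed(2)[OF fj]]
      by (simp add: val_scaleC val_single)
    moreover have "scaleC (z ^ k) (scaleC (z ^ n) (singleC j e') - f) \<in> nullC"
      using e'(1,3) nullC_deg[OF degC_closed(2)[OF degC_closed(1)[OF degC_closed(2)[OF g] fj]]]
      by (simp add: val_scaleC val_single val_diff reval_power)
    ultimately show ?thesis using g i by blast
  qed
qed

sublocale K: koszul_complex scaleC nullC "pull R {\<zero>}" "pull R \<mm>" pairC evC odC degC deltaC "singleC 0 (\<epsilon> \<one>)"
proof (rule koszul_complex.intro)
  interpret C: null_module scaleC nullC by (rule null_module_C)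
  show "null_module_noeth scaleC nullC (pull R {\<zero>}) (pull R \<mm>)"
  proof (rule null_module_noeth.intro[OF null_module_C L.noeth_axioms], unfold_locales)
    show "scaleC r f \<in> nullC" if "r \<in> pull R {\<zero>}" for r f
      using that by (simp add: nullC_def val_scaleC pull_def)
    show "is_prime (pull R \<mm>)" by (rule L.prime_m)
    show "P \<subseteq> pull R \<mm>" if "is_prime P" "pull R {\<zero>} \<subseteq> P" for P by (rule L.local[OF that])
  qed
  show "koszul_complex_axioms scaleC nullC (pull R {\<zero>}) pairC evC odC degC deltaC (singleC 0 (\<epsilon> \<one>))"
  proof
    fix a b a' b' :: "('a, 'b) cochain" and r z :: "'a free_ring" and i :: int and n :: nat
    show "evC (pairC a b) = a" "odC (pairC a b) = b" by (simp_all add: evC_def odC_def pairC_def)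
    show "pairC (evC a) (odC a) = a" by (auto simp: evC_def odC_def pairC_def fun_eq_iff odd_two_times_div_two_succ)
    show "pairC a b + pairC a' b' = pairC (a + a') (b + b')" by (auto simp: pairC_def fun_eq_iff)
    show "scaleC r (pairC a b) = pairC (scaleC r a) (scaleC r b)" by (auto simp: pairC_def scaleC_def fun_eq_iff)
    show "pairC a b \<in> nullC \<longleftrightarrow> a \<in> nullC \<and> b \<in> nullC"
    proof
      assume *: "pairC a b \<in> nullC"
      have "val j (a j n) = \<zero>\<^bsub>I j\<^esub>" "val j (b j n) = \<zero>\<^bsub>I j\<^esub>" for j n
        using *[unfolded nullC_def mem_Collect_eq, rule_format, of j "2 * n"]
          *[unfolded nullC_def mem_Collect_eq, rule_format, of j "2 * n + 1"] by (simp_all add: pairC_def)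
      then show "a \<in> nullC \<and> b \<in> nullC" by (simp add: nullC_def)
    qed (simp add: nullC_def pairC_def)
    show "C.submod (degC i)"
      unfolding C.submod_def by (auto simp: degC_def nullC_def val_add val_scaleC)
    show "degC i \<subseteq> nullC" if "i < 0" by (rule degC_neg[OF that])
    show "deltaC (a + b) = deltaC a + deltaC b"
      by (auto simp: deltaC_def fun_eq_iff subst_free_module_simps split: nat.split)
    show "deltaC (scaleC r a) = scaleC r (deltaC a)"
      using C.scale_zero_right[of r]
      by (auto simp: deltaC_def scaleC_def fun_eq_iff subst_free_module_simps split: nat.split)
    show "deltaC a \<in> nullC" if "a \<in> nullC" using that by (simp add: nullC_def val_delta split: nat.split)
    show "deltaC (deltaC a) \<in> nullC" by (simp add: nullC_def val_delta split: nat.split)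
    show "deltaC a \<in> degC (i + 1)" if "a \<in> degC i"
      using that by (auto simp: degC_def val_delta split: nat.split)
    show "\<exists>e'\<in>degC i. (\<forall>r. scaleC r e \<in> nullC \<longrightarrow> scaleC r e' \<in> nullC) \<and>
        (\<exists>k. scaleC (z ^ k) (scaleC (z ^ n) e' - e) \<in> nullC)" if "e \<in> degC i" for e
      by (rule divisibleC[OF that])
    show "\<exists>b\<in>degC (i - 1). a - deltaC b \<in> nullC" if "0 < i" "a \<in> degC i" "deltaC a \<in> nullC"
      by (rule exactC[OF that])
    show e1: "singleC 0 (\<epsilon> \<one>) \<in> degC 0" using single_deg[of "\<epsilon> \<one>" 0] by simp
    have "\<delta> 0 (\<epsilon> \<one>) = \<zero>\<^bsub>I (Suc 0)\<^esub>" by (simp add: exact_zero)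
    then show "deltaC (singleC 0 (\<epsilon> \<one>)) \<in> nullC"
      by (auto simp: nullC_def val_delta val_single split: nat.split)
    show "\<exists>r. a - scaleC r (singleC 0 (\<epsilon> \<one>)) \<in> nullC" if a: "a \<in> degC 0" "deltaC a \<in> nullC"
    proof -
      have "\<delta> 0 (val 0 (a 0 0)) = \<zero>\<^bsub>I (Suc 0)\<^esub>"
        using a(2) val_delta[of "Suc 0" a 0] by (auto simp: nullC_def)
      then obtain s where s: "s \<in> carrier R" "val 0 (a 0 0) = \<epsilon> s" by (auto simp: exact_zero)
      have deg: "a - scaleC (ring_var s) (singleC 0 (\<epsilon> \<one>)) \<in> degC (int 0)"
        using degC_closed a(1) e1 by simp
      have "a - scaleC (ring_var s) (singleC 0 (\<epsilon> \<one>)) \<in> nullC"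
        unfolding nullC_deg[OF deg]
        using s by (simp add: val_diff val_scaleC val_single reval_var eps_one I.diff_zero_iff)
      then show ?thesis by blast
    qed
    show "r \<in> pull R {\<zero>}" if "scaleC r (singleC 0 (\<epsilon> \<one>)) \<in> nullC"
    proof -
      have "scaleC r (singleC 0 (\<epsilon> \<one>)) \<in> degC (int 0)" using degC_closed(2) e1 by simp
      then show ?thesis
        using that nullC_deg[of "scaleC r (singleC 0 (\<epsilon> \<one>))" 0] by (simp add: val_scaleC val_single eps_one eps_zero_iff pull_def)
    qed
  qed
qed

end

section \<open>Local cohomology in the model\<close>

text \<open>For each \<open>a\<close> in \<open>P\<close>, the multiple of the class by
  \<open>a\<close> is killed by shorter products, hence by a smaller power of \<open>u\<close>. So
  \<open>P\<close> kills that power of \<open>u\<close> times the class, and the assumption on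
  \<open>u\<close> yields one more factor.\<close>

lemma (in null_module) killed_by_power:
  assumes Z: "submod Z" and B: "submod B"
    and u: "\<And>\<alpha>. \<alpha> \<in> Z \<Longrightarrow> (\<And>a. a \<in> P \<Longrightarrow> a \<cdot> \<alpha> \<in> B) \<Longrightarrow> u \<cdot> \<alpha> \<in> B"
    and \<alpha>: "\<alpha> \<in> Z" and prods: "\<And>as. set as \<subseteq> P \<Longrightarrow> length as = n \<Longrightarrow> prod_list as \<cdot> \<alpha> \<in> B"
  shows "u ^ n \<cdot> \<alpha> \<in> B"
  using \<alpha> prods
proof (induction n arbitrary: \<alpha>)
  case 0
  then show ?case using "0"(2)[of "[]"] by simp
next
  case (Suc n)
  have "u \<cdot> (u ^ n \<cdot> \<alpha>) \<in> B"
  proof (rule u)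
    show "u ^ n \<cdot> \<alpha> \<in> Z" using submodD(4)[OF Z] Suc.prems(1) .
    fix a assume a: "a \<in> P"
    have "u ^ n \<cdot> a \<cdot> \<alpha> \<in> B"
    proof (rule Suc.IH)
      show "a \<cdot> \<alpha> \<in> Z" using submodD(4)[OF Z] Suc.prems(1) .
      show "prod_list as \<cdot> a \<cdot> \<alpha> \<in> B" if "set as \<subseteq> P" "length as = n" for as
        using Suc.prems(2)[of "a # as"] that a by (simp add: scale_scale mult.commute)
    qed
    then show "a \<cdot> u ^ n \<cdot> \<alpha> \<in> B" by (simp add: scale_scale mult.commute)
  qed
  then show ?case by (simp add: scale_scale)
qed

context local_noetherian_domain
begin

lemma unit_outside_m: assumes "t \<in> carrier R" "t \<notin> \<mm>" shows "\<exists>s\<in>carrier R. s \<otimes> t = \<one>"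
proof -
  have "t \<in> PIdl t" using cgenideal_self assms(1) .
  then have "PIdl t = carrier R" using proper_ideal_le_m[OF cgenideal_ideal[OF assms(1)]] assms(2) by blast
  then have "\<one> \<in> PIdl t" by simp
  then show ?thesis unfolding cgenideal_def by auto
qed

lemma ideal_power_ideal: "ideal (ideal_power R \<mm> n) R"
  by (induction n) (use oneideal ideal_prod_is_ideal maximalideal.axioms(1)[OF max_m] in auto)

lemma power_in_ideal_power: "a \<in> \<mm> \<Longrightarrow> a [^] n \<in> ideal_power R \<mm> n"
proof (induction n)
  case (Suc n)
  have "a \<in> carrier R" using Suc.prems primeideal_subset[OF primeideal_m] by blast
  then show ?case using ideal_prod.prod[OF Suc.prems Suc.IH[OF Suc.prems], where R = R] by (simp add: m_comm)
qed simp

lemma ideal_power_kills: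
  assumes E: "module R E" and x: "x \<in> carrier E"
    and prods: "\<And>as. set as \<subseteq> pull R \<mm> \<Longrightarrow> length as = n \<Longrightarrow> reval R (prod_list as) \<odot>\<^bsub>E\<^esub> x = \<zero>\<^bsub>E\<^esub>"
    and y: "y \<in> ideal_power R \<mm> n"
  shows "y \<odot>\<^bsub>E\<^esub> x = \<zero>\<^bsub>E\<^esub>"
proof -
  interpret E: module R E by fact
  show ?thesis
    using x prods y
  proof (induction n arbitrary: x y)
    case 0
    then show ?case using "0"(2)[of "[]"] E.smult_assoc1[of y \<one> x] by simp
  next
    case (Suc n)
    have carr: "a \<in> \<mm> \<Longrightarrow> a \<in> carrier R" "b \<in> ideal_power R \<mm> n \<Longrightarrow> b \<in> carrier R" for a b
      using primeideal_subset[OF primeideal_m] ideal.Icarr[OF ideal_power_ideal] by blast+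
    have "y \<in> ideal_prod R \<mm> (ideal_power R \<mm> n)" using Suc.prems(3) by simp
    then have "y \<in> carrier R \<and> y \<odot>\<^bsub>E\<^esub> x = \<zero>\<^bsub>E\<^esub>"
    proof (induction rule: ideal_prod.induct)
      case (prod a b)
      note ab = carr(1)[OF prod(1)] carr(2)[OF prod(2)]
      have "b \<odot>\<^bsub>E\<^esub> (a \<odot>\<^bsub>E\<^esub> x) = \<zero>\<^bsub>E\<^esub>"
      proof (rule Suc.IH[OF _ _ prod(2)])
        show "a \<odot>\<^bsub>E\<^esub> x \<in> carrier E" using ab Suc.prems(1) by simp
        fix as assume as: "set as \<subseteq> pull R \<mm>" "length as = n"
        have "ring_var a \<in> pull R \<mm>" using ab(1) prod(1) by (simp add: pull_def reval_var)
        then have "reval R (prod_list (ring_var a # as)) \<odot>\<^bsub>E\<^esub> x = \<zero>\<^bsub>E\<^esub>" using as by (intro Suc.prems(2)) auto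
        then show "reval R (prod_list as) \<odot>\<^bsub>E\<^esub> (a \<odot>\<^bsub>E\<^esub> x) = \<zero>\<^bsub>E\<^esub>"
          using ab Suc.prems(1) by (simp add: reval_mult reval_var E.smult_assoc1[symmetric] m_comm)
      qed
      then show ?case using ab Suc.prems(1) by (simp add: m_comm[of a b] E.smult_assoc1)
    next
      case (sum a b)
      then show ?case using Suc.prems(1) by (simp add: E.smult_l_distr)
    qed
    then show ?case by simp
  qed
qed

text \<open>If powers of all \<open>w\<close> in \<open>W\<close> kill \<open>x\<close>, no prime
  other than the maximal ideal lies over the annihilator of \<open>x\<close>. That annihilator then
  contains a power of the maximal ideal times some \<open>t\<close> outside it, and \<open>t\<close>
  is a unit.\<close>

lemma torsion_iff:
  assumes E: "module R E" and W: "W \<subseteq> pull R \<mm>"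
    and Wm: "\<And>P. is_prime P \<Longrightarrow> pull R {\<zero>} \<subseteq> P \<Longrightarrow> W \<subseteq> P \<Longrightarrow> P = pull R \<mm>"
  shows "x \<in> carrier (torsion_module R \<mm> E) \<longleftrightarrow>
    x \<in> carrier E \<and> (\<forall>w\<in>W. \<exists>n::nat. reval R w [^] n \<odot>\<^bsub>E\<^esub> x = \<zero>\<^bsub>E\<^esub>)"
proof -
  interpret E: module R E by fact
  have tm: "x \<in> carrier (torsion_module R \<mm> E) \<longleftrightarrow> x \<in> carrier E \<and> (\<exists>n. \<forall>a\<in>ideal_power R \<mm> n. a \<odot>\<^bsub>E\<^esub> x = \<zero>\<^bsub>E\<^esub>)"
    by (auto simp: torsion_module_def zero_colon_def)
  have "\<exists>n. \<forall>a\<in>ideal_power R \<mm> n. a \<odot>\<^bsub>E\<^esub> x = \<zero>\<^bsub>E\<^esub>"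
    if x: "x \<in> carrier E" and tors: "\<And>w. w \<in> W \<Longrightarrow> \<exists>n::nat. reval R w [^] n \<odot>\<^bsub>E\<^esub> x = \<zero>\<^bsub>E\<^esub>"
  proof -
    let ?A = "{r. reval R r \<odot>\<^bsub>E\<^esub> x = \<zero>\<^bsub>E\<^esub>}"
    have A: "is_ideal ?A" "pull R {\<zero>} \<subseteq> ?A"
      using x by (auto simp: is_ideal_def reval_add reval_mult E.smult_l_distr E.smult_assoc1 pull_def)
    have "P = pull R \<mm>" if P: "is_prime P" "?A \<subseteq> P" for P
    proof (rule Wm[OF P(1)])
      show "pull R {\<zero>} \<subseteq> P" using A(2) P(2) by blast
      show "W \<subseteq> P"
      proof
        fix w assume "w \<in> W"
        then obtain n :: nat where "reval R w [^] n \<odot>\<^bsub>E\<^esub> x = \<zero>\<^bsub>E\<^esub>" using tors by blast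
        then have "w ^ n \<in> P" using P(2) by (auto simp: reval_power)
        then show "w \<in> P" by (simp add: prime_power[OF P(1)])
      qed
    qed
    then obtain t n where t: "t \<notin> pull R \<mm>" "\<And>as. set as \<subseteq> pull R \<mm> \<Longrightarrow> length as = n \<Longrightarrow> t * prod_list as \<in> ?A"
      using L.min_prime_products[OF A L.prime_m] by blast
    obtain s where s: "s \<in> carrier R" "s \<otimes> reval R t = \<one>"
      using unit_outside_m[of "reval R t"] t(1) by (auto simp: pull_def)
    define y where "y = reval R t \<odot>\<^bsub>E\<^esub> x"
    have y: "y \<in> carrier E" "x = s \<odot>\<^bsub>E\<^esub> y" using s x by (simp_all add: y_def E.smult_assoc1[symmetric])
    have "a \<odot>\<^bsub>E\<^esub> x = \<zero>\<^bsub>E\<^esub>" if a: "a \<in> ideal_power R \<mm> n" for a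
    proof -
      have "a \<odot>\<^bsub>E\<^esub> y = \<zero>\<^bsub>E\<^esub>"
        unfolding y_def by (rule ideal_power_kills[OF E _ _ a])
          (use t(2) x in \<open>auto simp: E.smult_assoc1[symmetric] reval_mult[symmetric] mult.commute\<close>)
      moreover have "a \<in> carrier R" using ideal.Icarr[OF ideal_power_ideal a] .
      moreover from this have "a \<odot>\<^bsub>E\<^esub> x = s \<odot>\<^bsub>E\<^esub> (a \<odot>\<^bsub>E\<^esub> y)"
        unfolding y(2) using s(1) y(1) by (simp add: E.smult_assoc1[symmetric] m_comm)
      ultimately show ?thesis using s(1) by simp
    qed
    then show ?thesis by blast
  qed
  moreover have "\<exists>n::nat. reval R w [^] n \<odot>\<^bsub>E\<^esub> x = \<zero>\<^bsub>E\<^esub>"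
    if "w \<in> W" "\<forall>a\<in>ideal_power R \<mm> n. a \<odot>\<^bsub>E\<^esub> x = \<zero>\<^bsub>E\<^esub>" for w n
    using power_in_ideal_power[of "reval R w" n] that W by (auto simp: pull_def)
  ultimately show ?thesis unfolding tm by blast
qed

end

context injectively_resolved
begin

abbreviation top_cohomology :: "('a, 'b set) module" (\<open>\<H>\<close>)
  where "\<H> \<equiv> local_cohomology R \<mm> I \<delta> d"

definition top_cycles :: "'b set" where
  "top_cycles = {x \<in> carrier (torsion_module R \<mm> (I d)). \<delta> d x = \<zero>\<^bsub>I (Suc d)\<^esub>}"

definition top_boundaries :: "'b set" where
  "top_boundaries = (case d of 0 \<Rightarrow> {\<zero>\<^bsub>I 0\<^esub>} | Suc j \<Rightarrow> \<delta> j ` carrier (torsion_module R \<mm> (I j)))"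

lemma top_cohomology_simps:
  "carrier \<H> = {top_boundaries +>\<^bsub>I d\<^esub> x | x. x \<in> top_cycles}"
  "r \<odot>\<^bsub>\<H>\<^esub> X = (\<Union>x\<in>X. top_boundaries +>\<^bsub>I d\<^esub> (r \<odot>\<^bsub>I d\<^esub> x))"
  "\<zero>\<^bsub>\<H>\<^esub> = top_boundaries"
  by (auto simp: local_cohomology_def cohomology_module_def quotient_module_def torsion_module_def a_kernel_def'
      top_cycles_def top_boundaries_def A_RCOSETS_def RCOSETS_def a_r_coset_def r_coset_def
      split: nat.split)

context
  fixes W :: "'a free_ring set"
  assumes fin: "finite W" and W: "W \<subseteq> pull R \<mm>"
    and Wm: "\<And>P. is_prime P \<Longrightarrow> pull R {\<zero>} \<subseteq> P \<Longrightarrow> W \<subseteq> P \<Longrightarrow> P = pull R \<mm>"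
begin

lemma torsion_W: "x \<in> carrier (torsion_module R \<mm> (I j)) \<longleftrightarrow>
    x \<in> carrier (I j) \<and> (\<forall>w\<in>W. \<exists>n::nat. reval R w [^] n \<odot>\<^bsub>I j\<^esub> x = \<zero>\<^bsub>I j\<^esub>)"
  by (rule torsion_iff[OF I.module_axioms W]) (rule Wm)

lemma torsion_iff_tors:
  assumes "f \<in> degC (int j)"
  shows "val j (f j 0) \<in> carrier (torsion_module R \<mm> (I j)) \<longleftrightarrow> (\<forall>w\<in>W. K.tors w f)"
  unfolding torsion_W K.tors_def nullC_deg[OF degC_closed(2)[OF assms]]
  by (simp add: val_scaleC reval_power)

lemma D_iff: "f \<in> K.D [] W (int j) \<longleftrightarrow> f \<in> degC (int j) \<and> val j (f j 0) \<in> carrier (torsion_module R \<mm> (I j))"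
  using torsion_iff_tors by auto

lemma cyc_iff: "f \<in> K.cyc [] W (int d) \<longleftrightarrow> f \<in> degC (int d) \<and> val d (f d 0) \<in> top_cycles"
proof -
  have "deltaC f \<in> nullC \<longleftrightarrow> \<delta> d (val d (f d 0)) = \<zero>\<^bsub>I (Suc d)\<^esub>" if f: "f \<in> degC (int d)"
  proof -
    have "deltaC f \<in> degC (int (Suc d))" using K.del0_D0[OF f] by (simp add: add.commute)
    from nullC_deg[OF this] show ?thesis by (simp add: val_delta)
  qed
  then show ?thesis unfolding K.cyc_def using D_iff[of f d] by (auto simp: top_cycles_def)
qed

lemma bd_iff:
  assumes f: "f \<in> degC (int d)"
  shows "f \<in> K.bd [] W (int d) \<longleftrightarrow> val d (f d 0) \<in> top_boundaries"
proof (cases d)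
  case 0
  have D: "g \<in> K.D [] W (- 1) \<Longrightarrow> deltaC g \<in> nullC" for g
    using degC_neg[of "- 1"] K.del0_NN by auto
  have "f \<in> K.bd [] W (int d) \<longleftrightarrow> f \<in> nullC"
  proof
    assume "f \<in> K.bd [] W (int d)"
    then obtain g where "g \<in> K.D [] W (- 1)" "f - deltaC g \<in> nullC" by (auto simp: K.bd_def 0)
    then show "f \<in> nullC" using D K.NN_add by (metis diff_add_cancel)
  qed (use K.submodD(1)[OF K.submod_bd] in blast)
  then show ?thesis unfolding top_boundaries_def using nullC_deg[OF f] 0 by simp
next
  case (Suc k)
  have mem: "f - deltaC g \<in> nullC \<longleftrightarrow> val d (f d 0) = \<delta> k (val k (g k 0))" if g: "g \<in> degC (int k)" for g
  proof -
    have "deltaC g \<in> degC (int d)" using K.del0_D0[OF g] Suc by (simp add: add.commute)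
    then have "f - deltaC g \<in> degC (int d)" by (rule degC_closed(1)[OF f])
    from nullC_deg[OF this] show ?thesis by (simp add: Suc val_diff val_delta I.diff_zero_iff)
  qed
  have "f \<in> K.bd [] W (int d) \<longleftrightarrow> (\<exists>g\<in>K.D [] W (int k). f - deltaC g \<in> nullC)"
    by (simp add: K.bd_def Suc)
  also have "\<dots> \<longleftrightarrow> (\<exists>g. g \<in> degC (int k) \<and> val k (g k 0) \<in> carrier (torsion_module R \<mm> (I k)) \<and> val d (f d 0) = \<delta> k (val k (g k 0)))"
    unfolding Bex_def D_iff using mem by blast
  also have "\<dots> \<longleftrightarrow> (\<exists>y\<in>carrier (torsion_module R \<mm> (I k)). val d (f d 0) = \<delta> k y)"
  proof
    assume "\<exists>y\<in>carrier (torsion_module R \<mm> (I k)). val d (f d 0) = \<delta> k y"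
    then obtain y where y: "y \<in> carrier (torsion_module R \<mm> (I k))" "val d (f d 0) = \<delta> k y" by blast
    have yc: "y \<in> carrier (I k)" using y(1) torsion_W by blast
    show "\<exists>g. g \<in> degC (int k) \<and> val k (g k 0) \<in> carrier (torsion_module R \<mm> (I k)) \<and> val d (f d 0) = \<delta> k (val k (g k 0))"
      using single_deg[OF yc] y by (intro exI[of _ "singleC k y"]) (simp add: val_single[OF yc])
  qed blast
  finally show ?thesis unfolding top_boundaries_def by (auto simp: Suc)
qed

lemma top_cycles_closed: "x \<in> top_cycles \<Longrightarrow> x \<in> carrier (I d)"
  by (simp add: torsion_W top_cycles_def)

lemma top_boundaries_closed: "x \<in> top_boundaries \<Longrightarrow> x \<in> carrier (I d)"
  unfolding top_boundaries_def by (auto simp: torsion_W split: nat.splits)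

lemma single_bd_iff: "x \<in> carrier (I d) \<Longrightarrow> singleC d x \<in> K.bd [] W (int d) \<longleftrightarrow> x \<in> top_boundaries"
  using bd_iff[OF single_deg] val_single by simp

lemma top_smult_eq_zero_iff:
  assumes r: "r \<in> carrier R" and x: "x \<in> top_cycles"
  shows "r \<odot>\<^bsub>\<H>\<^esub> (top_boundaries +>\<^bsub>I d\<^esub> x) = \<zero>\<^bsub>\<H>\<^esub> \<longleftrightarrow> r \<odot>\<^bsub>I d\<^esub> x \<in> top_boundaries"
  unfolding top_cohomology_simps
proof (rule I.quotient_smult_eq_zero_iff[OF _ _ _ _ r top_cycles_closed[OF x]])
  note bdD = K.submodD[OF K.submod_bd[of "[]" W "int d"]]
  show "top_boundaries \<subseteq> carrier (I d)" using top_boundaries_closed by blast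
  show "\<zero>\<^bsub>I d\<^esub> \<in> top_boundaries"
    using single_bd_iff[of "\<zero>\<^bsub>I d\<^esub>"] bdD(1) nullC_deg[OF single_deg[of "\<zero>\<^bsub>I d\<^esub>" d]] by (auto simp: val_single)
  show "y \<oplus>\<^bsub>I d\<^esub> z \<in> top_boundaries" if yz: "y \<in> top_boundaries" "z \<in> top_boundaries" for y z
  proof -
    note c = top_boundaries_closed[OF yz(1)] top_boundaries_closed[OF yz(2)]
    have "singleC d y + singleC d z \<in> K.bd [] W (int d)" using yz c bdD(3) by (simp add: single_bd_iff)
    moreover have "singleC d y + singleC d z \<in> degC (int d)"
      using K.submodD(3)[OF K.D0] single_deg c by blast
    ultimately show ?thesis using bd_iff c by (simp add: val_add val_single)
  qed
  show "a \<odot>\<^bsub>I d\<^esub> y \<in> top_boundaries" if ay: "a \<in> carrier R" "y \<in> top_boundaries" for a y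
  proof -
    note c = top_boundaries_closed[OF ay(2)]
    have "scaleC (ring_var a) (singleC d y) \<in> K.bd [] W (int d)" using ay c bdD(4) by (simp add: single_bd_iff)
    moreover have "scaleC (ring_var a) (singleC d y) \<in> degC (int d)"
      using K.submodD(4)[OF K.D0] single_deg c by blast
    ultimately show ?thesis using bd_iff c ay(1) by (simp add: val_scaleC val_single reval_var)
  qed
qed

lemma scale_bd_iff:
  assumes "f \<in> degC (int d)"
  shows "scaleC r f \<in> K.bd [] W (int d) \<longleftrightarrow> reval R r \<odot>\<^bsub>I d\<^esub> val d (f d 0) \<in> top_boundaries"
  using bd_iff[OF degC_closed(2)[OF assms]] by (simp add: val_scaleC)

text \<open>Passes from cosets in the given resolution to cocycles of the model. The set
  \<open>W\<close> is free up to its radical, and each direction of the equivalence brings its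
  own.\<close>

lemma annihilator_zero_colon_iff:
  assumes p: "p \<subseteq> carrier R"
  shows "reval R u \<in> annihilator R \<H> (zero_colon \<H> p) \<longleftrightarrow>
    (\<forall>\<alpha>\<in>K.cyc [] W (int d). (\<forall>a\<in>pull R p. scaleC a \<alpha> \<in> K.bd [] W (int d)) \<longrightarrow> scaleC u \<alpha> \<in> K.bd [] W (int d))"
proof -
  have killed: "(\<forall>a\<in>p. a \<odot>\<^bsub>\<H>\<^esub> (top_boundaries +>\<^bsub>I d\<^esub> x) = \<zero>\<^bsub>\<H>\<^esub>) \<longleftrightarrow>
      (\<forall>a\<in>pull R p. reval R a \<odot>\<^bsub>I d\<^esub> x \<in> top_boundaries)" if x: "x \<in> top_cycles" for x
  proof -
    have "(\<forall>a\<in>p. a \<odot>\<^bsub>\<H>\<^esub> (top_boundaries +>\<^bsub>I d\<^esub> x) = \<zero>\<^bsub>\<H>\<^esub>) \<longleftrightarrow> (\<forall>a\<in>p. a \<odot>\<^bsub>I d\<^esub> x \<in> top_boundaries)"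
      using top_smult_eq_zero_iff[OF _ x] p by blast
    also have "\<dots> \<longleftrightarrow> (\<forall>a\<in>reval R ` pull R p. a \<odot>\<^bsub>I d\<^esub> x \<in> top_boundaries)" by (simp only: reval_image[OF p])
    finally show ?thesis by simp
  qed
  have "reval R u \<in> annihilator R \<H> (zero_colon \<H> p) \<longleftrightarrow>
      (\<forall>X\<in>carrier \<H>. (\<forall>a\<in>p. a \<odot>\<^bsub>\<H>\<^esub> X = \<zero>\<^bsub>\<H>\<^esub>) \<longrightarrow> reval R u \<odot>\<^bsub>\<H>\<^esub> X = \<zero>\<^bsub>\<H>\<^esub>)"
    by (auto simp: annihilator_def zero_colon_def)
  also have "\<dots> \<longleftrightarrow> (\<forall>x\<in>top_cycles. (\<forall>a\<in>p. a \<odot>\<^bsub>\<H>\<^esub> (top_boundaries +>\<^bsub>I d\<^esub> x) = \<zero>\<^bsub>\<H>\<^esub>) \<longrightarrow>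
      reval R u \<odot>\<^bsub>\<H>\<^esub> (top_boundaries +>\<^bsub>I d\<^esub> x) = \<zero>\<^bsub>\<H>\<^esub>)"
    unfolding top_cohomology_simps(1) by blast
  also have "\<dots> \<longleftrightarrow> (\<forall>x\<in>top_cycles. (\<forall>a\<in>pull R p. reval R a \<odot>\<^bsub>I d\<^esub> x \<in> top_boundaries) \<longrightarrow> reval R u \<odot>\<^bsub>I d\<^esub> x \<in> top_boundaries)"
    by (intro ball_cong refl arg_cong2[of _ _ _ _ "(\<longrightarrow>)"] killed top_smult_eq_zero_iff[OF reval_closed])
  also have "\<dots> \<longleftrightarrow> (\<forall>\<alpha>\<in>K.cyc [] W (int d). (\<forall>a\<in>pull R p. scaleC a \<alpha> \<in> K.bd [] W (int d)) \<longrightarrow> scaleC u \<alpha> \<in> K.bd [] W (int d))"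
  proof
    assume *: "\<forall>x\<in>top_cycles. (\<forall>a\<in>pull R p. reval R a \<odot>\<^bsub>I d\<^esub> x \<in> top_boundaries) \<longrightarrow> reval R u \<odot>\<^bsub>I d\<^esub> x \<in> top_boundaries"
    show "\<forall>\<alpha>\<in>K.cyc [] W (int d). (\<forall>a\<in>pull R p. scaleC a \<alpha> \<in> K.bd [] W (int d)) \<longrightarrow> scaleC u \<alpha> \<in> K.bd [] W (int d)"
      using * scale_bd_iff unfolding Ball_def cyc_iff by blast
  next
    assume *: "\<forall>\<alpha>\<in>K.cyc [] W (int d). (\<forall>a\<in>pull R p. scaleC a \<alpha> \<in> K.bd [] W (int d)) \<longrightarrow> scaleC u \<alpha> \<in> K.bd [] W (int d)"
    show "\<forall>x\<in>top_cycles. (\<forall>a\<in>pull R p. reval R a \<odot>\<^bsub>I d\<^esub> x \<in> top_boundaries) \<longrightarrow> reval R u \<odot>\<^bsub>I d\<^esub> x \<in> top_boundaries"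
    proof (intro ballI impI)
      fix x assume x: "x \<in> top_cycles" "\<forall>a\<in>pull R p. reval R a \<odot>\<^bsub>I d\<^esub> x \<in> top_boundaries"
      note c = top_cycles_closed[OF x(1)]
      have "singleC d x \<in> K.cyc [] W (int d)" using cyc_iff single_deg[OF c] x(1) by (simp add: val_single[OF c])
      moreover note iff = scale_bd_iff[OF single_deg[OF c], unfolded val_single[OF c], simplified]
      ultimately show "reval R u \<odot>\<^bsub>I d\<^esub> x \<in> top_boundaries" using * x(2) iff by blast
    qed
  qed
  finally show ?thesis .
qed

end

end

section \<open>Annihilators in the top local cohomology\<close>

context injectively_resolved
begin

text \<open>\<open>C h\<close> is minimal over the powers of the first \<open>h\<close> parameters,
  so some \<open>t\<close> outside it, times products of \<open>n\<close> of its elements, kills the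
  class of \<open>top_class\<close>. If \<open>u\<close> were outside \<open>C h\<close>, then
  \<open>u ^ n * t\<close> would be an element outside \<open>C h\<close> that kills the class, by
  \<open>killed_by_power\<close>, and \<open>eliminate_params\<close> excludes this.\<close>

lemma annihilator_zero_colon_chain:
  assumes C: "L.prime_chain_in d C" and h: "h \<le> d"
    and u: "reval R u \<in> annihilator R \<H> (zero_colon \<H> (reval R ` C h))"
  shows "u \<in> C h"
proof (rule ccontr)
  assume uC: "u \<notin> C h"
  from L.chain_params[OF C] obtain zs where zs0: "length zs = d" "\<forall>i<d. zs ! i \<in> C (Suc i) \<and> zs ! i \<notin> C i"
    "\<forall>P. L.spec P \<longrightarrow> set zs \<subseteq> P \<longrightarrow> P = pull R \<mm>"
    "\<forall>i\<le>d. \<forall>Q. L.spec Q \<longrightarrow> Q \<subseteq> C i \<longrightarrow> set (take i zs) \<subseteq> Q \<longrightarrow> Q = C i"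
    by (elim exE conjE)
  note zs = zs0(1) zs0(2)[rule_format] zs0(3)[rule_format] zs0(4)[rule_format]
  define W where "W = set zs"
  have W: "finite W" "W \<subseteq> pull R \<mm>"
  proof -
    show "W \<subseteq> pull R \<mm>"
    proof
      fix w assume "w \<in> W"
      then obtain i where "i < d" "w = zs ! i" unfolding W_def zs(1)[symmetric] by (auto simp: in_set_conv_nth)
      then have "w \<in> C (Suc i)" "L.spec (C (Suc i))" using zs(2) L.chain_spec[OF C] by auto
      then show "w \<in> pull R \<mm>" using L.spec_le_m by blast
    qed
  qed (simp add: W_def)
  have Wm: "P = pull R \<mm>" if "is_prime P" "pull R {\<zero>} \<subseteq> P" "W \<subseteq> P" for P
    using zs(3) that unfolding W_def L.spec_def by blast
  have specC: "L.spec (C h)" by (rule L.chain_spec[OF C h])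
  note prC = L.specD(1)[OF specC]
  have sub: "reval R ` C h \<subseteq> carrier R" by auto
  define Z B where "Z = K.cyc [] W (int d)" and "B = K.bd [] W (int d)"
  have ZB: "K.submod Z" "K.submod B" unfolding Z_def B_def by (rule K.submod_cyc K.submod_bd)+
  have "\<forall>\<alpha>\<in>Z. (\<forall>a\<in>C h. scaleC a \<alpha> \<in> B) \<longrightarrow> scaleC u \<alpha> \<in> B"
    unfolding Z_def B_def
    by (rule annihilator_zero_colon_iff[OF W(1) W(2) _ sub, of u, unfolded spec_pull_image[OF specC], THEN iffD1]) (rule Wm, use u in auto)
  then have kill: "scaleC u \<alpha> \<in> B" if "\<alpha> \<in> Z" "\<And>a. a \<in> C h \<Longrightarrow> scaleC a \<alpha> \<in> B" for \<alpha>
    using that by simp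
  \<comment> \<open>Only the first \<open>h\<close> exponents occur, so the \<open>t\<close> and
    \<open>n\<close> chosen for this ideal cannot react to the later ones, as
    \<open>eliminate_params\<close> demands.\<close>
  define \<bb> where "\<bb> = (\<lambda>Ls. gen (pull R {\<zero>} \<union> (\<lambda>j. zs ! j ^ (Ls ! j)) ` {..<h}))"
  have "\<exists>t n. t \<notin> C h \<and> (\<forall>as. set as \<subseteq> C h \<longrightarrow> length as = n \<longrightarrow> t * prod_list as \<in> \<bb> Ls)" for Ls
  proof (rule L.min_prime_products[OF _ _ prC])
    show "is_ideal (\<bb> Ls)" "pull R {\<zero>} \<subseteq> \<bb> Ls"
      unfolding \<bb>_def using ideal_gen gen_sub[of "pull R {\<zero>} \<union> _"] by auto
    fix P assume P: "is_prime P" "\<bb> Ls \<subseteq> P" "P \<subseteq> C h"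
    have gens: "pull R {\<zero>} \<union> (\<lambda>j. zs ! j ^ (Ls ! j)) ` {..<h} \<subseteq> P"
      by (rule order_trans[OF gen_sub P(2)[unfolded \<bb>_def]])
    have "zs ! j \<in> P" if "j < h" for j
    proof -
      have "zs ! j ^ (Ls ! j) \<in> P" using gens that by blast
      then show ?thesis by (simp add: prime_power[OF P(1)])
    qed
    then have "set (take h zs) \<subseteq> P" by (auto simp: in_set_conv_nth)
    moreover have "L.spec P" using P(1) gens by (simp add: L.spec_def)
    ultimately show "P = C h" using zs(4)[OF h _ P(3)] by blast
  qed
  then obtain t n where t: "\<And>Ls. t Ls \<notin> C h"
    "\<And>Ls as. set as \<subseteq> C h \<Longrightarrow> length as = n Ls \<Longrightarrow> t Ls * prod_list as \<in> \<bb> Ls"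
    by metis
  define v where "v = (\<lambda>Ls. u ^ n Ls * t Ls)"
  have v: "v Ls \<notin> C h" for Ls
    using uC t(1) by (simp add: v_def primeD(3)[OF prC] prime_power[OF prC])
  obtain \<kappa> where \<kappa>: "\<And>Ks. length Ks = d \<Longrightarrow> \<exists>\<alpha>\<in>Z. (\<forall>j<d. scaleC (zs ! j ^ (Ks ! j)) \<alpha> \<in> B) \<and>
    (\<forall>r. scaleC r \<alpha> \<in> B \<longrightarrow> r * (\<Prod>j<d. zs ! j ^ \<kappa> (take j Ks)) \<in> gen (pull R {\<zero>} \<union> (\<lambda>j. zs ! j ^ (Ks ! j)) ` {..<d}))"
    using K.top_class[OF W(1) Wm W_def zs(1)] unfolding Z_def B_def by blast
  show False
  proof (rule L.eliminate_params[OF C h v zs(2)])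
    fix Ks :: "nat list" assume Ks: "length Ks = d"
    obtain \<alpha> where \<alpha>: "\<alpha> \<in> Z" "\<And>j. j < d \<Longrightarrow> scaleC (zs ! j ^ (Ks ! j)) \<alpha> \<in> B"
      "\<And>r. scaleC r \<alpha> \<in> B \<Longrightarrow> r * (\<Prod>j<d. zs ! j ^ \<kappa> (take j Ks)) \<in> gen (pull R {\<zero>} \<union> (\<lambda>j. zs ! j ^ (Ks ! j)) ` {..<d})"
      using \<kappa>[OF Ks] by blast
    let ?L = "take h Ks"
    have "is_ideal {r. scaleC r \<alpha> \<in> B}"
      using K.submodD[OF ZB(2)] by (auto simp: is_ideal_def K.scale_left_distrib K.scale_scale[symmetric])
    moreover have "pull R {\<zero>} \<union> (\<lambda>j. zs ! j ^ (?L ! j)) ` {..<h} \<subseteq> {r. scaleC r \<alpha> \<in> B}"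
      using K.I0_null K.submodD(1)[OF ZB(2)] \<alpha>(2) h by auto
    ultimately have \<bb>: "\<bb> ?L \<subseteq> {r. scaleC r \<alpha> \<in> B}" unfolding \<bb>_def by (simp only: gen_le)
    have "scaleC (u ^ n ?L) (scaleC (t ?L) \<alpha>) \<in> B"
    proof (rule K.killed_by_power[OF ZB kill])
      show "scaleC (t ?L) \<alpha> \<in> Z" using K.submodD(4)[OF ZB(1) \<alpha>(1)] .
      show "scaleC (prod_list as) (scaleC (t ?L) \<alpha>) \<in> B" if "set as \<subseteq> C h" "length as = n ?L" for as
        using t(2)[OF that] \<bb> by (auto simp: K.scale_scale mult.commute)
    qed
    then show "v ?L * (\<Prod>j<d. zs ! j ^ \<kappa> (take j Ks)) \<in> gen (pull R {\<zero>} \<union> (\<lambda>j. zs ! j ^ (Ks ! j)) ` {..<d})"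
      by (intro \<alpha>(3)) (simp add: v_def K.scale_scale)
  qed
qed

text \<open>The case \<open>h = 0\<close> of \<open>annihilator_zero_colon_chain\<close>: a longest
  chain starts at the zero ideal, which annihilates all of \<open>\<H>\<close>.\<close>

lemma annihilator_top: "primeideal \<pp> R \<Longrightarrow> annihilator R \<H> (carrier \<H>) \<subseteq> \<pp>"
proof
  fix r assume p: "primeideal \<pp> R" and r: "r \<in> annihilator R \<H> (carrier \<H>)"
  obtain C where C: "L.prime_chain_in d C" using L.chain_d by blast
  have rR: "r \<in> carrier R" using r by (simp add: annihilator_def)
  have "r \<in> annihilator R \<H> (zero_colon \<H> (reval R ` C 0))"
    using r by (simp add: annihilator_def zero_colon_def)
  then have "ring_var r \<in> C 0"
    using annihilator_zero_colon_chain[OF C, of 0 "ring_var r"] reval_var[OF rR] by simp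
  then have "r = \<zero>" using L.top_chain(1)[OF C] reval_var[OF rR] by (simp add: pull_def)
  then show "r \<in> \<pp>" using additive_subgroup.zero_closed ideal.axioms(1) primeideal.axioms(1)[OF p] by blast
qed

lemma annihilator_zero_colon_sup: "\<pp> \<subseteq> carrier R \<Longrightarrow> \<pp> \<subseteq> annihilator R \<H> (zero_colon \<H> \<pp>)"
  by (auto simp: annihilator_def zero_colon_def)

text \<open>Longest chains below and above \<open>P\<close> join to a chain of length
  \<open>d\<close> with \<open>P\<close> at position \<open>ht P\<close>.\<close>

lemma annihilator_zero_colon_sub:
  assumes P: "L.spec P" "L.ht P + L.coht P = d"
  shows "annihilator R \<H> (zero_colon \<H> (reval R ` P)) \<subseteq> reval R ` P"
proof
  fix r assume r: "r \<in> annihilator R \<H> (zero_colon \<H> (reval R ` P))"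
  obtain C1 where C1: "L.sat_chain (L.ht P) C1" "C1 (L.ht P) = P" using L.ht_sat_chain[OF P(1)] by blast
  obtain C2 where C2: "L.sat_chain (L.coht P) C2" "C2 0 = P" using L.coht_sat_chain[OF P(1)] by blast
  let ?C = "\<lambda>i. if i \<le> L.ht P then C1 i else C2 (i - L.ht P)"
  have C: "L.prime_chain_in d ?C"
    using L.sat_chain_append[OF C1(1) C2(1)] C1(2) C2(2) P(2) by (simp add: L.sat_chain_def)
  have rR: "r \<in> carrier R" using r by (simp add: annihilator_def)
  have "ring_var r \<in> ?C (L.ht P)"
    by (rule annihilator_zero_colon_chain[OF C]) (use P(2) r rR C1(2) in \<open>simp_all add: reval_var\<close>)
  then show "r \<in> reval R ` P" using C1(2) reval_var[OF rR] by (metis image_eqI order_refl)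
qed

text \<open>A class killed by \<open>P\<close> is killed by \<open>xs\<close>, so
  \<open>annihilated_by_power\<close> applies to the sequence of \<open>bad_prime_params\<close>; a
  power of \<open>t\<close> stays outside the prime \<open>P\<close>.\<close>

lemma annihilator_zero_colon_bad:
  assumes P: "L.spec P" "L.ht P + L.coht P < d"
  shows "\<exists>t. t \<notin> P \<and> reval R t \<in> annihilator R \<H> (zero_colon \<H> (reval R ` P))"
proof -
  obtain xs u ws t where xs: "set xs \<subseteq> P" "t \<notin> P" "length (xs @ u # ws) = d" "set (xs @ u # ws) \<subseteq> pull R \<mm>"
    "\<And>Q. L.spec Q \<Longrightarrow> set xs \<subseteq> Q \<Longrightarrow> t * u \<in> Q" "\<And>Q. L.spec Q \<Longrightarrow> set (xs @ u # ws) \<subseteq> Q \<Longrightarrow> Q = pull R \<mm>"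
    using L.bad_prime_params[OF P] by metis
  define W where "W = set (xs @ u # ws)"
  have W: "finite W" "W \<subseteq> pull R \<mm>" using xs(4) by (simp_all add: W_def)
  have Wm: "Q = pull R \<mm>" if "is_prime Q" "pull R {\<zero>} \<subseteq> Q" "W \<subseteq> Q" for Q
    using xs(6) that unfolding W_def L.spec_def by blast
  have tu: "t * u \<in> Q" if "is_prime Q" "pull R {\<zero>} \<subseteq> Q" "set xs \<subseteq> Q" for Q
    using xs(5) that unfolding L.spec_def by blast
  obtain N where N: "\<And>\<alpha>. \<alpha> \<in> K.cyc [] W (int d) \<Longrightarrow> (\<And>x. x \<in> set xs \<Longrightarrow> scaleC x \<alpha> \<in> K.bd [] W (int d)) \<Longrightarrow>
      scaleC (t ^ N) \<alpha> \<in> K.bd [] W (int d)"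
    using K.annihilated_by_power[OF W(1) Wm W_def xs(3) tu] by blast
  have sub: "reval R ` P \<subseteq> carrier R" by auto
  have kill: "\<forall>\<alpha>\<in>K.cyc [] W (int d). (\<forall>a\<in>P. scaleC a \<alpha> \<in> K.bd [] W (int d)) \<longrightarrow> scaleC (t ^ N) \<alpha> \<in> K.bd [] W (int d)"
  proof (intro ballI impI N)
    show "scaleC x \<alpha> \<in> K.bd [] W (int d)" if "\<forall>a\<in>P. scaleC a \<alpha> \<in> K.bd [] W (int d)" "x \<in> set xs" for x \<alpha>
      using that xs(1) by auto
  qed
  have "reval R (t ^ N) \<in> annihilator R \<H> (zero_colon \<H> (reval R ` P))"
    by (rule annihilator_zero_colon_iff[OF W(1) W(2) _ sub, unfolded spec_pull_image[OF P(1)], THEN iffD2])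
      (rule Wm, use kill in auto)
  moreover have "t ^ N \<notin> P" using xs(2) by (simp add: prime_power[OF L.specD(1)[OF P(1)]])
  ultimately show ?thesis by blast
qed

theorem catenary_iff_annihilators:
  "catenary R \<longleftrightarrow> (\<forall>\<pp>. primeideal \<pp> R \<longrightarrow> annihilator R \<H> (carrier \<H>) \<subseteq> \<pp> \<longrightarrow> annihilator R \<H> (zero_colon \<H> \<pp>) = \<pp>)"
  unfolding catenary_iff L.equal_sat_chains_iff
proof (intro iffI allI impI)
  fix \<pp> assume dims: "\<forall>q. L.spec q \<longrightarrow> L.ht q + L.coht q = d" and p: "primeideal \<pp> R"
  have sub: "\<pp> \<subseteq> carrier R" by (rule primeideal_subset[OF p])
  show "annihilator R \<H> (zero_colon \<H> \<pp>) = \<pp>"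
  proof
    show "annihilator R \<H> (zero_colon \<H> \<pp>) \<subseteq> \<pp>"
      using annihilator_zero_colon_sub[OF spec_pull[OF p]] dims spec_pull[OF p] reval_image[OF sub] by simp
    show "\<pp> \<subseteq> annihilator R \<H> (zero_colon \<H> \<pp>)" by (rule annihilator_zero_colon_sup[OF sub])
  qed
next
  fix P assume ann: "\<forall>\<pp>. primeideal \<pp> R \<longrightarrow> annihilator R \<H> (carrier \<H>) \<subseteq> \<pp> \<longrightarrow> annihilator R \<H> (zero_colon \<H> \<pp>) = \<pp>"
    and P: "L.spec P"
  show "L.ht P + L.coht P = d"
  proof (rule ccontr)
    assume "L.ht P + L.coht P \<noteq> d"
    then have "L.ht P + L.coht P < d" using L.ht_coht_le[OF P] by simp
    then obtain t where t: "t \<notin> P" "reval R t \<in> annihilator R \<H> (zero_colon \<H> (reval R ` P))"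
      using annihilator_zero_colon_bad[OF P] by blast
    have "reval R t \<in> reval R ` P" using t(2) ann spec_image[OF P] annihilator_top[OF spec_image[OF P]] by simp
    then have "t \<in> pull R (reval R ` P)" by (simp add: pull_def)
    then show False using t(1) spec_pull_image[OF P] by simp
  qed
qed

end

theorem mainTheorem2:
  fixes R :: "('a, 'r) ring_scheme"
    and \<mm> :: "'a set"
    and d :: nat
    and I :: "nat \<Rightarrow> ('a, 'b) module"
    and \<delta> :: "nat \<Rightarrow> 'b \<Rightarrow> 'b"
    and \<epsilon> :: "'a \<Rightarrow> 'b"
  assumes "noetherian_domain R"
    and "local_ring R \<mm>"
    and "krull_dim R = enat d"
    and "injective_resolution R (regular_module R) \<epsilon> I \<delta>"
  shows "let H = local_cohomology R \<mm> I \<delta> d in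
    catenary R \<longleftrightarrow>
      (\<forall>\<pp>. primeideal \<pp> R \<longrightarrow> annihilator R H (carrier H) \<subseteq> \<pp> \<longrightarrow>
        annihilator R H (zero_colon H \<pp>) = \<pp>)"
proof -
  interpret injectively_resolved R \<mm> d I \<delta> \<epsilon>
    using assms by (simp add: injectively_resolved_def injectively_resolved_axioms_def
        local_noetherian_domain_def local_noetherian_domain_axioms_def)
  show ?thesis unfolding Let_def by (rule catenary_iff_annihilators)
qed

end
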